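(* The bi-superalgebra $\mathrm{SPO}_q(2n|2m)=A(R)/J(Q)$ is a Hopf superalgebra. Its antipode $S$ is uniquely fixed by $$S(t_{i,j})=\sigma_i\,\sigma_{i,j}\,((C^q)^{-1})_{i,-i}\;t_{-j,-i}\;C^q_{-j,j}\qquad\text{for all } i,j\in I.$$
   Context: Setting. $\mathbb K$ is a field of characteristic zero, $q\in\mathbb K$ is nonzero and not a root of unity, $n,m\ge 1$ are integers, $r=n+m$, and $I=\{-r,\dots,-1,1,\dots,r\}$. Gradations are over $\mathbb Z_2$, with $\sigma(\alpha,\beta)=(-1)^{\alpha\beta}$. Degrees: $\eta_i=\bar 0$ for $1\le|i|\le n$ and $\eta_i=\bar 1$ for $n+1\le|i|\le r$; $\sigma_{i,j}=\sigma(\eta_i,\eta_j)$, $\sigma_i=\sigma_{i,i}$. $V$ is the $\mathbb Z_2$-graded vector space with basis $(e_i)_{i\in I}$, $e_i$ of degree $\eta_i$; $E_{i,j}(e_k)=\delta_{jk}e_i$. Graded tensor product of linear maps: $(g\,\overline{\otimes}\,g')(x\otimes y)=\sigma(\gamma',\xi)g(x)\otimes g'(y)$ with $\gamma'=\deg g'$, $\xi=\deg x$. Tensor products of superalgebras carry the product $(a\otimes b)(a'\otimes b')=\sigma(\deg b,\deg a')\,aa'\otimes bb'$; bi-superalgebras and Hopf superalgebras are meant with respect to this product, with structure maps of degree zero. The matrix $C^q=(C^q_{i,j})_{i,j\in I}$ has $C^q_{i,j}=0$ for $j\neq -i$, and for $1\le j\le r$ $$C^q_{j,-j}=q^{\sum_{k=1}^{j}\sigma_k},\qquad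 C^q_{-j,j}=-\sigma_j\,q^{-1-\sum_{k=1}^{j-1}\sigma_k}.$$ The operator $R=\sum R_{ij,k\ell}E_{i,k}\,\overline{\otimes}\,E_{j,\ell}$ in $V\otimes V$ is $$R=\sum_i q^{\sigma_i}E_{i,i}\overline{\otimes}E_{i,i}+\sum_i q^{-\sigma_i}E_{i,i}\overline{\otimes}E_{-i,-i}+\sum_{i\ne j,-j}E_{i,i}\overline{\otimes}E_{j,j}+(q-q^{-1})\sum_{i<j}\sigma_iE_{j,i}\overline{\otimes}E_{i,j}-(q-q^{-1})\sum_{i<j}\sigma_i\sigma_j\sigma_{i,j}((C^q)^{-1})_{-j,j}C^q_{i,-i}\,E_{j,i}\overline{\otimes}E_{-j,-i}.$$ $A(R)$ is the bi-superalgebra given as the universal associative unital superalgebra generated by elements $t_{i,j}$ ($i,j\in I$) of degree $\eta_j-\eta_i$ with relations $$\sum_{a,b\in I}\sigma(\eta_j-\eta_\ell,\eta_a-\eta_k)R_{ij,ab}\,t_{a,k}t_{b,\ell}=\sum_{a,b\in I}\sigma(\eta_j-\eta_b,\eta_a-\eta_k)\,t_{j,b}t_{i,a}R_{ab,k\ell}\qquad(i,j,k,\ell\in I)$$ and with $\Delta(t_{i,j})=\sum_{k}\sigma(\eta_k-\eta_i,\eta_k-\eta_j)\,t_{i,k}\otimes t_{k,j}$, $\varepsilon(t_{i,j})=\delta_{i,j}$. The element $Q\in A(R)$ is $$Q=(C^q_{k,-k})^{-1}\sum_{a,b\in I}\sigma_{a,k}\,\sigma_{b,a}\,C^q_{a,b}\,t_{a,k}t_{b,-k},$$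 which does not depend on $k\in I$; it is of degree zero, group-like ($\Delta(Q)=Q\otimes Q$, $\varepsilon(Q)=1$) and central. $J(Q)$ is the two-sided ideal of $A(R)$ generated by $Q-1$; it is a graded biideal, so $A(R)/J(Q)$ is a bi-superalgebra. The canonical images of the $t_{i,j}$ in $\mathrm{SPO}_q(2n|2m)$ are again denoted $t_{i,j}$. *)

theory Defs
  imports
    "HOL-Library.Z2"
    "HOL-Library.Poly_Mapping"
    "HOL-Algebra.QuotRing"
    "HOL-Algebra.Module"
    "HOL-Algebra.Algebraic_Closure_Type"
begin

section \<open>Superalgebras\<close>

text \<open>The sign \<open>\<sigma>(\<alpha>,\<beta>) = (-1)\<^bsup>\<alpha>\<beta>\<^esup>\<close>; polymorphic, because it occurs both as a scalar
  and (over \<^typ>\<open>int\<close>) in exponents of \<open>q\<close>.\<close>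

definition sgn2 :: "bit \<Rightarrow> bit \<Rightarrow> 'r::ring_1"
  where "sgn2 \<alpha> \<beta> = (if \<alpha> * \<beta> = 1 then - 1 else 1)"

record ('k, 'a) superalg = "('k, 'a) module" +
  homog :: "bit \<Rightarrow> 'a set"

locale superalgebra =
  ring A + Mod: module "ring_of_type_algebra :: 'k ring" A
  for A :: "('k::field, 'a, 'x) superalg_scheme" (structure) +
  assumes smult_mult_left:
      "\<lbrakk>x \<in> carrier A; y \<in> carrier A\<rbrakk> \<Longrightarrow> (c \<odot> x) \<otimes> y = c \<odot> (x \<otimes> y)"
    and smult_mult_right:
      "\<lbrakk>x \<in> carrier A; y \<in> carrier A\<rbrakk> \<Longrightarrow> x \<otimes> (c \<odot> y) = c \<odot> (x \<otimes> y)"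
    and homog_submodule: "submodule (homog A \<alpha>) (ring_of_type_algebra :: 'k ring) A"
    and homog_direct_sum:
      "x \<in> carrier A \<Longrightarrow> \<exists>!p. fst p \<in> homog A 0 \<and> snd p \<in> homog A 1 \<and> x = fst p \<oplus> snd p"
    and homog_one: "\<one> \<in> homog A 0"
    and homog_mult: "\<lbrakk>x \<in> homog A \<alpha>; y \<in> homog A \<beta>\<rbrakk> \<Longrightarrow> x \<otimes> y \<in> homog A (\<alpha> + \<beta>)"

definition hpart :: "('k, 'a, 'x) superalg_scheme \<Rightarrow> bit \<Rightarrow> 'a \<Rightarrow> 'a"
  where "hpart A \<alpha> x =
    (THE y. y \<in> homog A \<alpha> \<and> (\<exists>z \<in> homog A (\<alpha> + 1). x = y \<oplus>\<^bsub>A\<^esub> z))"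

definition superlinear :: "('k, 'a, 'x) superalg_scheme \<Rightarrow> ('k, 'b, 'y) superalg_scheme \<Rightarrow> ('a \<Rightarrow> 'b) set"
  where "superlinear A B = {f \<in> carrier A \<rightarrow> carrier B.
    (\<forall>x \<in> carrier A. \<forall>y \<in> carrier A. f (x \<oplus>\<^bsub>A\<^esub> y) = f x \<oplus>\<^bsub>B\<^esub> f y) \<and>
    (\<forall>c. \<forall>x \<in> carrier A. f (c \<odot>\<^bsub>A\<^esub> x) = c \<odot>\<^bsub>B\<^esub> f x) \<and>
    (\<forall>\<alpha>. f ` homog A \<alpha> \<subseteq> homog B \<alpha>)}"

definition superalg_hom :: "('k, 'a, 'x) superalg_scheme \<Rightarrow> ('k, 'b, 'y) superalg_scheme \<Rightarrow> ('a \<Rightarrow> 'b) set"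
  where "superalg_hom A B = superlinear A B \<inter> ring_hom A B"

definition superalg_antihom :: "('k::ring_1, 'a, 'x) superalg_scheme \<Rightarrow> ('k, 'b, 'y) superalg_scheme \<Rightarrow> ('a \<Rightarrow> 'b) set"
  where "superalg_antihom A B = {f \<in> superlinear A B. f \<one>\<^bsub>A\<^esub> = \<one>\<^bsub>B\<^esub> \<and>
    (\<forall>\<alpha> \<beta>. \<forall>x \<in> homog A \<alpha>. \<forall>y \<in> homog A \<beta>.
      f (x \<otimes>\<^bsub>A\<^esub> y) = sgn2 \<alpha> \<beta> \<odot>\<^bsub>B\<^esub> (f y \<otimes>\<^bsub>B\<^esub> f x))}"

definition base_superalg :: "('k::field, 'k) superalg"
  where "base_superalg =
    \<lparr>carrier = UNIV, monoid.mult = (*), one = 1, zero = 0, add = (+), module.smult = (*),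
     homog = (\<lambda>\<alpha>. if \<alpha> = 0 then UNIV else {0})\<rparr>"

definition quot_superalg :: "('k, 'a, 'x) superalg_scheme \<Rightarrow> 'a set \<Rightarrow> ('k, 'a set) superalg"
  where "quot_superalg A J =
    \<lparr>carrier = carrier (A Quot J), monoid.mult = monoid.mult (A Quot J), one = one (A Quot J),
     zero = zero (A Quot J), add = add (A Quot J),
     module.smult = (\<lambda>c U. \<Union>x\<in>U. J +>\<^bsub>A\<^esub> (c \<odot>\<^bsub>A\<^esub> x)),
     homog = (\<lambda>\<alpha>. (\<lambda>x. J +>\<^bsub>A\<^esub> x) ` homog A \<alpha>)\<rparr>"


section \<open>Free superalgebras\<close>

text \<open>Words under concatenation, written additively so that finitely supported functions
  on words carry the library's convolution product and form the free associative algebra.\<close>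

datatype 'g word = Word (letters: "'g list")

instantiation word :: (type) monoid_add
begin

definition zero_word :: "'g word"
  where "zero_word = Word []"

definition plus_word :: "'g word \<Rightarrow> 'g word \<Rightarrow> 'g word"
  where "plus_word v w = Word (letters v @ letters w)"

instance
  by standard (simp_all add: zero_word_def plus_word_def)

end

definition word_degree :: "('g \<Rightarrow> bit) \<Rightarrow> 'g word \<Rightarrow> bit"
  where "word_degree d w = (\<Sum>g\<leftarrow>letters w. d g)"

definition pm_scale :: "'k::semiring_0 \<Rightarrow> ('b \<Rightarrow>\<^sub>0 'k) \<Rightarrow> ('b \<Rightarrow>\<^sub>0 'k)"
  where "pm_scale c p = Poly_Mapping.map ((*) c) p"

text \<open>The free associative unital superalgebra on the set \<open>U\<close> of generators, a generator
  \<open>g\<close> having degree \<open>d g\<close>.\<close>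

definition free_superalg :: "'g set \<Rightarrow> ('g \<Rightarrow> bit) \<Rightarrow> ('k::field, 'g word \<Rightarrow>\<^sub>0 'k) superalg"
  where "free_superalg U d =
    \<lparr>carrier = {p. \<forall>w \<in> Poly_Mapping.keys p. set (letters w) \<subseteq> U},
     monoid.mult = (*), one = 1, zero = 0, add = (+), module.smult = pm_scale,
     homog = (\<lambda>\<alpha>. {p. \<forall>w \<in> Poly_Mapping.keys p. set (letters w) \<subseteq> U \<and> word_degree d w = \<alpha>})\<rparr>"

definition free_gen :: "'g \<Rightarrow> ('g word \<Rightarrow>\<^sub>0 'k::field)"
  where "free_gen g = Poly_Mapping.single (Word [g]) 1"


section \<open>Graded tensor products\<close>

text \<open>\<open>A \<otimes> B\<close> is the vector space freely spanned by \<open>carrier A \<times> carrier B\<close>, modulo the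
  subspace generated by the bilinearity relations.\<close>

inductive_set tensor_rel ::
    "('k::field, 'a, 'x) superalg_scheme \<Rightarrow> ('k, 'b, 'y) superalg_scheme \<Rightarrow> ('a \<times> 'b \<Rightarrow>\<^sub>0 'k) set"
  for A :: "('k, 'a, 'x) superalg_scheme" and B :: "('k, 'b, 'y) superalg_scheme"
  where
    add_left: "\<lbrakk>a \<in> carrier A; a' \<in> carrier A; b \<in> carrier B\<rbrakk> \<Longrightarrow>
      Poly_Mapping.single (a \<oplus>\<^bsub>A\<^esub> a', b) 1
        - Poly_Mapping.single (a, b) 1 - Poly_Mapping.single (a', b) 1 \<in> tensor_rel A B"
  | add_right: "\<lbrakk>a \<in> carrier A; b \<in> carrier B; b' \<in> carrier B\<rbrakk> \<Longrightarrow>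
      Poly_Mapping.single (a, b \<oplus>\<^bsub>B\<^esub> b') 1
        - Poly_Mapping.single (a, b) 1 - Poly_Mapping.single (a, b') 1 \<in> tensor_rel A B"
  | smult_left: "\<lbrakk>a \<in> carrier A; b \<in> carrier B\<rbrakk> \<Longrightarrow>
      Poly_Mapping.single (c \<odot>\<^bsub>A\<^esub> a, b) 1 - Poly_Mapping.single (a, b) c \<in> tensor_rel A B"
  | smult_right: "\<lbrakk>a \<in> carrier A; b \<in> carrier B\<rbrakk> \<Longrightarrow>
      Poly_Mapping.single (a, c \<odot>\<^bsub>B\<^esub> b) 1 - Poly_Mapping.single (a, b) c \<in> tensor_rel A B"
  | zero: "0 \<in> tensor_rel A B"
  | plus: "\<lbrakk>p \<in> tensor_rel A B; p' \<in> tensor_rel A B\<rbrakk> \<Longrightarrow> p + p' \<in> tensor_rel A B"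
  | scale: "p \<in> tensor_rel A B \<Longrightarrow> pm_scale c p \<in> tensor_rel A B"

text \<open>The free vector space, with operations that become the superalgebra structure of
  \<open>A \<otimes> B\<close> only after passing to the quotient. The product extends
  \<open>(a \<otimes> b)(a' \<otimes> b') = \<sigma>(\<beta>,\<alpha>) aa' \<otimes> bb'\<close> (\<open>\<beta> = deg b\<close>, \<open>\<alpha> = deg a'\<close>)
  to inhomogeneous \<open>b\<close>, \<open>a'\<close> through their homogeneous components.\<close>

definition pretensor ::
    "('k::field, 'a, 'x) superalg_scheme \<Rightarrow> ('k, 'b, 'y) superalg_scheme \<Rightarrow> ('k, 'a \<times> 'b \<Rightarrow>\<^sub>0 'k) superalg"
  where "pretensor A B =
    \<lparr>carrier = {p. Poly_Mapping.keys p \<subseteq> carrier A \<times> carrier B},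
     monoid.mult = (\<lambda>p p'. \<Sum>(a, b) \<in> Poly_Mapping.keys p. \<Sum>(a', b') \<in> Poly_Mapping.keys p'.
       \<Sum>\<alpha> \<in> {0, 1}. \<Sum>\<beta> \<in> {0, 1}.
         Poly_Mapping.single (a \<otimes>\<^bsub>A\<^esub> hpart A \<alpha> a', hpart B \<beta> b \<otimes>\<^bsub>B\<^esub> b')
           (sgn2 \<beta> \<alpha> * Poly_Mapping.lookup p (a, b) * Poly_Mapping.lookup p' (a', b'))),
     one = Poly_Mapping.single (\<one>\<^bsub>A\<^esub>, \<one>\<^bsub>B\<^esub>) 1,
     zero = 0, add = (+), module.smult = pm_scale,
     homog = (\<lambda>\<gamma>. {p. Poly_Mapping.keys p \<subseteq> (\<Union>\<alpha>. homog A \<alpha> \<times> homog B (\<gamma> - \<alpha>))})\<rparr>"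

definition tensor ::
    "('k::field, 'a, 'x) superalg_scheme \<Rightarrow> ('k, 'b, 'y) superalg_scheme \<Rightarrow> ('k, ('a \<times> 'b \<Rightarrow>\<^sub>0 'k) set) superalg"
  where "tensor A B = quot_superalg (pretensor A B) (tensor_rel A B)"

definition pure_tensor ::
    "('k::field, 'a, 'x) superalg_scheme \<Rightarrow> ('k, 'b, 'y) superalg_scheme \<Rightarrow> 'a \<Rightarrow> 'b \<Rightarrow> ('a \<times> 'b \<Rightarrow>\<^sub>0 'k) set"
  where "pure_tensor A B a b = tensor_rel A B +>\<^bsub>pretensor A B\<^esub> Poly_Mapping.single (a, b) 1"

text \<open>The linear map on a tensor product induced by a bilinear map \<open>\<phi>\<close> with values in \<open>M\<close>.\<close>

definition tensor_lift ::
    "('k::field, 'c, 'z) superalg_scheme \<Rightarrow> ('a \<Rightarrow> 'b \<Rightarrow> 'c) \<Rightarrow> ('a \<times> 'b \<Rightarrow>\<^sub>0 'k) set \<Rightarrow> 'c"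
  where "tensor_lift M \<phi> U =
    (THE z. \<forall>p \<in> U. z = (\<Oplus>\<^bsub>M\<^esub>ab \<in> Poly_Mapping.keys p.
       Poly_Mapping.lookup p ab \<odot>\<^bsub>M\<^esub> \<phi> (fst ab) (snd ab)))"

text \<open>\<open>f \<otimes> g\<close> for \<open>f\<close>, \<open>g\<close> of degree zero (so that no sign appears), with values in
  \<open>C \<otimes> D\<close>.\<close>

definition tensor_map ::
    "('k::field, 'c, 'x) superalg_scheme \<Rightarrow> ('k, 'd, 'y) superalg_scheme \<Rightarrow> ('a \<Rightarrow> 'c) \<Rightarrow> ('b \<Rightarrow> 'd)
      \<Rightarrow> ('a \<times> 'b \<Rightarrow>\<^sub>0 'k) set \<Rightarrow> ('c \<times> 'd \<Rightarrow>\<^sub>0 'k) set"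
  where "tensor_map C D f g = tensor_lift (tensor C D) (\<lambda>a b. pure_tensor C D (f a) (g b))"

text \<open>The canonical isomorphism \<open>(A \<otimes> B) \<otimes> C \<rightarrow> A \<otimes> (B \<otimes> C)\<close>.\<close>

definition tensor_assoc ::
    "('k::field, 'a, 'x) superalg_scheme \<Rightarrow> ('k, 'b, 'y) superalg_scheme \<Rightarrow> ('k, 'c, 'z) superalg_scheme
      \<Rightarrow> (('a \<times> 'b \<Rightarrow>\<^sub>0 'k) set \<times> 'c \<Rightarrow>\<^sub>0 'k) set \<Rightarrow> ('a \<times> ('b \<times> 'c \<Rightarrow>\<^sub>0 'k) set \<Rightarrow>\<^sub>0 'k) set"
  where "tensor_assoc A B C =
    tensor_lift (tensor A (tensor B C))
      (\<lambda>U c. tensor_lift (tensor A (tensor B C))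
        (\<lambda>a b. pure_tensor A (tensor B C) a (pure_tensor B C b c)) U)"


section \<open>Bi-superalgebras and Hopf superalgebras\<close>

record (overloaded) ('k::zero, 'a) bisuperalg = "('k, 'a) superalg" +
  comult :: "'a \<Rightarrow> ('a \<times> 'a \<Rightarrow>\<^sub>0 'k) set"
  counit :: "'a \<Rightarrow> 'k"

locale bi_superalgebra = superalgebra A
  for A :: "('k::field, 'a, 'x) bisuperalg_scheme" (structure) +
  assumes comult_hom: "comult A \<in> superalg_hom A (tensor A A)"
    and counit_hom: "counit A \<in> superalg_hom A base_superalg"
    and coassoc: "x \<in> carrier A \<Longrightarrow>
      tensor_assoc A A A (tensor_map (tensor A A) A (comult A) (\<lambda>y. y) (comult A x)) =
      tensor_map A (tensor A A) (\<lambda>y. y) (comult A) (comult A x)"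
    and counit_left: "x \<in> carrier A \<Longrightarrow>
      tensor_lift A (\<lambda>c y. c \<odot> y)
        (tensor_map base_superalg A (counit A) (\<lambda>y. y) (comult A x)) = x"
    and counit_right: "x \<in> carrier A \<Longrightarrow>
      tensor_lift A (\<lambda>y c. c \<odot> y)
        (tensor_map A base_superalg (\<lambda>y. y) (counit A) (comult A x)) = x"

definition is_antipode :: "('k::field, 'a, 'x) bisuperalg_scheme \<Rightarrow> ('a \<Rightarrow> 'a) \<Rightarrow> bool"
  where "is_antipode A S \<longleftrightarrow> S \<in> superlinear A A \<and>
    (\<forall>x \<in> carrier A.
      tensor_lift A (monoid.mult A) (tensor_map A A S (\<lambda>y. y) (comult A x)) = counit A x \<odot>\<^bsub>A\<^esub> \<one>\<^bsub>A\<^esub> \<and>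
      tensor_lift A (monoid.mult A) (tensor_map A A (\<lambda>y. y) S (comult A x)) = counit A x \<odot>\<^bsub>A\<^esub> \<one>\<^bsub>A\<^esub>)"

locale hopf_superalgebra = bi_superalgebra A
  for A :: "('k::field, 'a, 'x) bisuperalg_scheme" (structure) +
  assumes ex_antipode: "\<exists>S. is_antipode A S"

definition quot_bisuperalg :: "('k::field, 'a, 'x) bisuperalg_scheme \<Rightarrow> 'a set \<Rightarrow> ('k, 'a set) bisuperalg"
  where "quot_bisuperalg A J = superalg.extend (quot_superalg A J)
    (bisuperalg.fields
      (\<lambda>U. THE z. \<forall>x \<in> U. z = tensor_map (quot_superalg A J) (quot_superalg A J)
         (\<lambda>y. J +>\<^bsub>A\<^esub> y) (\<lambda>y. J +>\<^bsub>A\<^esub> y) (comult A x))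
      (\<lambda>U. THE c. \<forall>x \<in> U. c = counit A x))"


section \<open>The matrices \<open>C\<^sup>q\<close> and \<open>R\<close>\<close>

definition idx :: "nat \<Rightarrow> nat \<Rightarrow> int set"
  where "idx n m = {i. i \<noteq> 0 \<and> \<bar>i\<bar> \<le> int (n + m)}"

definition eta :: "nat \<Rightarrow> int \<Rightarrow> bit"
  where "eta n i = (if \<bar>i\<bar> \<le> int n then 0 else 1)"

definition sg2 :: "nat \<Rightarrow> int \<Rightarrow> int \<Rightarrow> 'r::ring_1"
  where "sg2 n i j = sgn2 (eta n i) (eta n j)"

abbreviation sg :: "nat \<Rightarrow> int \<Rightarrow> 'r::ring_1"
  where "sg n i \<equiv> sg2 n i i"

definition Cq :: "nat \<Rightarrow> 'k::field \<Rightarrow> int \<Rightarrow> int \<Rightarrow> 'k"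
  where "Cq n q i j =
    (if j \<noteq> - i then 0
     else if i > 0 then q powi (\<Sum>k = 1..i. sg n k)
     else - sg n j * q powi (- 1 - (\<Sum>k = 1..j - 1. sg n k)))"

definition inv_matrix :: "'i set \<Rightarrow> ('i \<Rightarrow> 'i \<Rightarrow> 'k::field) \<Rightarrow> 'i \<Rightarrow> 'i \<Rightarrow> 'k"
  where "inv_matrix I M = (THE N.
    (\<forall>i j. i \<notin> I \<or> j \<notin> I \<longrightarrow> N i j = 0) \<and>
    (\<forall>i \<in> I. \<forall>j \<in> I. (\<Sum>k \<in> I. M i k * N k j) = of_bool (i = j) \<and>
                      (\<Sum>k \<in> I. N i k * M k j) = of_bool (i = j)))"

definition Cq_inv :: "nat \<Rightarrow> nat \<Rightarrow> 'k::field \<Rightarrow> int \<Rightarrow> int \<Rightarrow> 'k"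
  where "Cq_inv n m q = inv_matrix (idx n m) (Cq n q)"

lemma inv_matrixI:
  assumes "finite I"
    and "\<forall>i j. i \<notin> I \<or> j \<notin> I \<longrightarrow> N i j = 0"
    and "\<And>i j. i \<in> I \<Longrightarrow> j \<in> I \<Longrightarrow> (\<Sum>k \<in> I. M i k * N k j) = of_bool (i = j)"
    and "\<And>i j. i \<in> I \<Longrightarrow> j \<in> I \<Longrightarrow> (\<Sum>k \<in> I. N i k * M k j) = of_bool (i = j)"
  shows "inv_matrix I M = N"
  unfolding inv_matrix_def
proof (rule the_equality)
  fix P assume P: "(\<forall>i j. i \<notin> I \<or> j \<notin> I \<longrightarrow> P i j = 0) \<and>
    (\<forall>i \<in> I. \<forall>j \<in> I. (\<Sum>k \<in> I. M i k * P k j) = of_bool (i = j) \<and>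
                      (\<Sum>k \<in> I. P i k * M k j) = of_bool (i = j))"
  have "P i j = N i j" if ij: "i \<in> I" "j \<in> I" for i j
  proof -
    have "P i j = (\<Sum>k\<in>I. P i k * of_bool (k = j))"
      using ij assms(1) by (simp add: of_bool_def sum.delta if_distrib cong: if_cong)
    also have "\<dots> = (\<Sum>k\<in>I. P i k * (\<Sum>l\<in>I. M k l * N l j))"
      using ij assms(3) by simp
    also have "\<dots> = (\<Sum>l\<in>I. (\<Sum>k\<in>I. P i k * M k l) * N l j)"
      by (simp add: sum_distrib_left sum_distrib_right mult.assoc) (rule sum.swap)
    also have "\<dots> = (\<Sum>l\<in>I. of_bool (i = l) * N l j)"
      using ij P by simp
    also have "\<dots> = N i j"
      using ij assms(1) by (simp add: of_bool_def sum.delta if_distrib[of "\<lambda>x. x * _"] cong: if_cong)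
    finally show ?thesis .
  qed
  then show "P = N"
    using P assms(2) by (intro ext) metis
qed (use assms in auto)

lemma finite_idx: "finite (idx n m)"
  by (rule finite_subset[of _ "{- int (n + m)..int (n + m)}"]) (auto simp: idx_def)

lemma Cq_inv_eq:
  assumes "q \<noteq> 0" "i \<in> idx n m" "j \<in> idx n m"
  shows "Cq_inv n m q i j = (if j = - i then inverse (Cq n q (- i) i) else 0)"
proof -
  define N where "N i j = (if i \<in> idx n m \<and> j = - i then inverse (Cq n q (- i) i) else 0)" for i j
  have sg: "(sg n i :: 'a) \<noteq> 0" for i by (simp add: sg2_def sgn2_def)
  have nz: "Cq n q k (- k) \<noteq> 0" for k using assms(1) sg[of "-k"] by (simp add: Cq_def)
  have minus: "- k \<in> idx n m \<longleftrightarrow> k \<in> idx n m" for k by (auto simp: idx_def)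
  have off: "Cq n q a b = 0" if "b \<noteq> - a" for a b using that by (simp add: Cq_def)
  have "inv_matrix (idx n m) (Cq n q) = N"
  proof (rule inv_matrixI[OF finite_idx])
    show "\<forall>i j. i \<notin> idx n m \<or> j \<notin> idx n m \<longrightarrow> N i j = 0"
      by (auto simp: N_def minus)
  next
    fix i j assume ij: "i \<in> idx n m" "j \<in> idx n m"
    have "(\<Sum>k\<in>idx n m. Cq n q i k * N k j) = (\<Sum>k\<in>{- i}. Cq n q i k * N k j)"
      using ij by (intro sum.mono_neutral_right) (auto simp: finite_idx minus off)
    then show "(\<Sum>k\<in>idx n m. Cq n q i k * N k j) = of_bool (i = j)"
      using ij nz[of i] by (auto simp: N_def minus)
    have "(\<Sum>k\<in>idx n m. N i k * Cq n q k j) = (\<Sum>k\<in>{- i}. N i k * Cq n q k j)"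
      using ij by (intro sum.mono_neutral_right) (auto simp: finite_idx minus N_def)
    then show "(\<Sum>k\<in>idx n m. N i k * Cq n q k j) = of_bool (i = j)"
      using ij nz[of "- i"] off[of j "- i"] by (auto simp: N_def minus)
  qed
  then show ?thesis using assms by (simp add: Cq_inv_def N_def)
qed

text \<open>\<open>EE (a,c) (b,d)\<close> is the family of coefficients of \<open>E\<^sub>a\<^sub>,\<^sub>c \<otimes> E\<^sub>b\<^sub>,\<^sub>d\<close>: its value at
  \<open>i j k l\<close> is the coefficient at \<open>E\<^sub>i\<^sub>,\<^sub>k \<otimes> E\<^sub>j\<^sub>,\<^sub>l\<close>.\<close>

definition EE :: "int \<times> int \<Rightarrow> int \<times> int \<Rightarrow> int \<Rightarrow> int \<Rightarrow> int \<Rightarrow> int \<Rightarrow> 'k::field"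
  where "EE ac bd i j k l = of_bool ((i, k) = ac \<and> (j, l) = bd)"

definition Rmat :: "nat \<Rightarrow> nat \<Rightarrow> 'k::field \<Rightarrow> int \<Rightarrow> int \<Rightarrow> int \<Rightarrow> int \<Rightarrow> 'k"
  where "Rmat n m q i j k l =
    (\<Sum>a \<in> idx n m. q powi sg n a * EE (a, a) (a, a) i j k l)
    + (\<Sum>a \<in> idx n m. q powi (- sg n a) * EE (a, a) (- a, - a) i j k l)
    + (\<Sum>a \<in> idx n m. \<Sum>b \<in> idx n m - {a, - a}. EE (a, a) (b, b) i j k l)
    + (q - inverse q) *
      (\<Sum>b \<in> idx n m. \<Sum>a \<in> {a \<in> idx n m. a < b}. sg n a * EE (b, a) (a, b) i j k l)
    - (q - inverse q) *
      (\<Sum>b \<in> idx n m. \<Sum>a \<in> {a \<in> idx n m. a < b}.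
         sg n a * sg n b * sg2 n a b * Cq_inv n m q (- b) b * Cq n q a (- a)
           * EE (b, a) (- b, - a) i j k l)"


section \<open>The bi-superalgebras \<open>A(R)\<close> and \<open>SPO\<^sub>q(2n|2m)\<close>\<close>

definition gens :: "nat \<Rightarrow> nat \<Rightarrow> (int \<times> int) set"
  where "gens n m = idx n m \<times> idx n m"

definition gdeg :: "nat \<Rightarrow> int \<times> int \<Rightarrow> bit"
  where "gdeg n g = eta n (snd g) - eta n (fst g)"

abbreviation free_t :: "int \<Rightarrow> int \<Rightarrow> ((int \<times> int) word \<Rightarrow>\<^sub>0 'k::field)"
  where "free_t i j \<equiv> free_gen (i, j)"

definition rtt_rel ::
    "nat \<Rightarrow> nat \<Rightarrow> 'k::field \<Rightarrow> int \<Rightarrow> int \<Rightarrow> int \<Rightarrow> int \<Rightarrow> ((int \<times> int) word \<Rightarrow>\<^sub>0 'k)"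
  where "rtt_rel n m q i j k l =
    (\<Sum>a \<in> idx n m. \<Sum>b \<in> idx n m.
       pm_scale (sgn2 (eta n j - eta n l) (eta n a - eta n k) * Rmat n m q i j a b)
         (free_t a k * free_t b l))
    - (\<Sum>a \<in> idx n m. \<Sum>b \<in> idx n m.
       pm_scale (sgn2 (eta n j - eta n b) (eta n a - eta n k) * Rmat n m q a b k l)
         (free_t j b * free_t i a))"

definition rtt_free :: "nat \<Rightarrow> nat \<Rightarrow> ('k::field, (int \<times> int) word \<Rightarrow>\<^sub>0 'k) superalg"
  where "rtt_free n m = free_superalg (gens n m) (gdeg n)"

definition rtt_ideal :: "nat \<Rightarrow> nat \<Rightarrow> 'k::field \<Rightarrow> ((int \<times> int) word \<Rightarrow>\<^sub>0 'k) set"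
  where "rtt_ideal n m q = genideal (rtt_free n m)
    {rtt_rel n m q i j k l | i j k l.
       i \<in> idx n m \<and> j \<in> idx n m \<and> k \<in> idx n m \<and> l \<in> idx n m}"

type_synonym 'k rtt = "((int \<times> int) word \<Rightarrow>\<^sub>0 'k) set"

definition AR_alg :: "nat \<Rightarrow> nat \<Rightarrow> 'k::field \<Rightarrow> ('k, 'k rtt) superalg"
  where "AR_alg n m q = quot_superalg (rtt_free n m) (rtt_ideal n m q)"

definition AR_t :: "nat \<Rightarrow> nat \<Rightarrow> 'k::field \<Rightarrow> int \<Rightarrow> int \<Rightarrow> 'k rtt"
  where "AR_t n m q i j = rtt_ideal n m q +>\<^bsub>rtt_free n m\<^esub> free_t i j"

definition AR_comult :: "nat \<Rightarrow> nat \<Rightarrow> 'k::field \<Rightarrow> 'k rtt \<Rightarrow> ('k rtt \<times> 'k rtt \<Rightarrow>\<^sub>0 'k) set"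
  where "AR_comult n m q = (let A = AR_alg n m q; t = AR_t n m q in
    THE D. D \<in> superalg_hom A (tensor A A) \<inter> extensional (carrier A) \<and>
      (\<forall>i \<in> idx n m. \<forall>j \<in> idx n m. D (t i j) =
        (\<Oplus>\<^bsub>tensor A A\<^esub>k \<in> idx n m.
           sgn2 (eta n k - eta n i) (eta n k - eta n j)
             \<odot>\<^bsub>tensor A A\<^esub> pure_tensor A A (t i k) (t k j))))"

definition AR_counit :: "nat \<Rightarrow> nat \<Rightarrow> 'k::field \<Rightarrow> 'k rtt \<Rightarrow> 'k"
  where "AR_counit n m q = (let A = AR_alg n m q in
    THE e. e \<in> superalg_hom A base_superalg \<inter> extensional (carrier A) \<and>
      (\<forall>i \<in> idx n m. \<forall>j \<in> idx n m. e (AR_t n m q i j) = of_bool (i = j)))"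

definition AR :: "nat \<Rightarrow> nat \<Rightarrow> 'k::field \<Rightarrow> ('k, 'k rtt) bisuperalg"
  where "AR n m q = superalg.extend (AR_alg n m q)
    (bisuperalg.fields (AR_comult n m q) (AR_counit n m q))"

text \<open>The value does not depend on \<open>k\<close> as long as \<open>k \<in> idx n m\<close>; the parameter is kept
  because the formula is written with it.\<close>

definition Q_elem :: "nat \<Rightarrow> nat \<Rightarrow> 'k::field \<Rightarrow> int \<Rightarrow> 'k rtt"
  where "Q_elem n m q k = (let A = AR n m q; t = AR_t n m q in
    inverse (Cq n q k (- k)) \<odot>\<^bsub>A\<^esub>
      (\<Oplus>\<^bsub>A\<^esub>a \<in> idx n m. \<Oplus>\<^bsub>A\<^esub>b \<in> idx n m.
         (sg2 n a k * sg2 n b a * Cq n q a b) \<odot>\<^bsub>A\<^esub> (t a k \<otimes>\<^bsub>A\<^esub> t b (- k))))"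

definition J_Q :: "nat \<Rightarrow> nat \<Rightarrow> 'k::field \<Rightarrow> int \<Rightarrow> 'k rtt set"
  where "J_Q n m q k = genideal (AR n m q) {Q_elem n m q k \<ominus>\<^bsub>AR n m q\<^esub> \<one>\<^bsub>AR n m q\<^esub>}"

definition SPO :: "nat \<Rightarrow> nat \<Rightarrow> 'k::field \<Rightarrow> int \<Rightarrow> ('k, 'k rtt set) bisuperalg"
  where "SPO n m q k = quot_bisuperalg (AR n m q) (J_Q n m q k)"

definition SPO_t :: "nat \<Rightarrow> nat \<Rightarrow> 'k::field \<Rightarrow> int \<Rightarrow> int \<Rightarrow> int \<Rightarrow> 'k rtt set"
  where "SPO_t n m q k i j = J_Q n m q k +>\<^bsub>AR n m q\<^esub> AR_t n m q i j"

end

theory Submission imports Defs begin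

text \<open>The relations of \<open>A(R)\<close> say that \<open>P R\<close>, with \<open>P\<close> the graded flip, intertwines the tensor square
  \<open>W\<close> of the generating matrix. With \<open>\<lambda> = q - q\<^sup>-\<^sup>1\<close> one computes \<open>(P R)\<^sup>2 = \<lambda> P R + 1 + \<lambda> \<mu> e f\<close>, where \<open>\<mu> \<noteq> 0\<close>
  and the vector \<open>e\<close> and the linear form \<open>f\<close> on \<open>V \<otimes> V\<close> come from \<open>C\<^sup>q\<close>. So the rank-one matrix \<open>e f\<close>
  intertwines \<open>W\<close> too, which means \<open>f W = Q f\<close> and \<open>W e = Q e\<close>. Modulo \<open>Q - 1\<close> these two
  identities say that the matrix in the formula for the antipode is a left and a right inverse of the generating
  matrix. The induced inverse of \<open>W\<close> is intertwined by \<open>P R\<close> as well and fixes \<open>f\<close>; hence the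
  antihomomorphism of the free superalgebra given by the formula descends to the quotient. Since inverse
  matrices are unique, every antipode agrees with it.\<close>

text \<open>The formula for \<open>(P R)^2\<close> is the skein relation
  \<open>P R - (P R)^(-1) = \<lambda> (1 - e f)\<close> multiplied by \<open>P R\<close>; in this
  form no inverse is required. The constant \<mu> enters because \<open>e\<close> is an eigenvector
  of \<open>P R\<close> for the eigenvalue \<open>-\<mu>\<close>, which rests on a telescoping sum
  of ratios of entries of the form. Entrywise, \<open>e f W = W e f\<close> reads
  \<open>e_P (f W)_K = f_K (W e)_P\<close>; as P and K vary separately, \<open>f W\<close> and
  \<open>W e\<close> are multiples of \<open>f\<close> and \<open>e\<close> by the same element, and
  this is Q. The obstacle is that all structure maps live on quotients, mostly through descriptions
  \<open>THE\<close>, and that an antipode is by definition merely linear. Each superalgebra is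
  therefore handled through a spanning family \<open>w J K\<close>, with J and K multi-indices of
  equal length. On the free superalgebra a linear map may be prescribed on this family, and whether
  it is a homomorphism or an antihomomorphism is read off from its values. The antipode axioms then
  say that for each length the matrices \<open>S (w J K)\<close> and \<open>w J K\<close> are
  inverse to each other.\<close>

lemma ring_of_type_algebra_simps [simp]:
  "carrier ring_of_type_algebra = UNIV"
  "monoid.mult ring_of_type_algebra = (*)"
  "one ring_of_type_algebra = 1"
  "zero ring_of_type_algebra = 0"
  "add ring_of_type_algebra = (+)"
  by (auto simp: ring_of_type_algebra_def)

section \<open>Finite sums in abelian monoids\<close>

lemma (in abelian_monoid) finsum_cartesian:
  assumes "finite S" "finite T" "\<And>i j. i \<in> S \<Longrightarrow> j \<in> T \<Longrightarrow> f i j \<in> carrier G"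
  shows "(\<Oplus>p\<in>S \<times> T. f (fst p) (snd p)) = (\<Oplus>i\<in>S. \<Oplus>j\<in>T. f i j)"
  using assms(1,3)
proof (induction S)
  case (insert x F)
  have "(\<Oplus>p\<in>insert x F \<times> T. f (fst p) (snd p))
      = (\<Oplus>p\<in>Pair x ` T \<union> F \<times> T. f (fst p) (snd p))"
    by (rule arg_cong[where f = "finsum G _"]) auto
  also have "\<dots> = (\<Oplus>p\<in>Pair x ` T. f (fst p) (snd p)) \<oplus> (\<Oplus>p\<in>F \<times> T. f (fst p) (snd p))"
    using insert assms(2) by (intro finsum_Un_disjoint) auto
  also have "(\<Oplus>p\<in>Pair x ` T. f (fst p) (snd p)) = (\<Oplus>j\<in>T. f x j)"
    using insert by (subst finsum_reindex) (auto simp: inj_on_def)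
  finally show ?case
    using insert assms(2) by (subst finsum_insert) auto
qed simp

lemma (in abelian_monoid) finsum_swap:
  assumes "finite S" "finite T" "\<And>i j. i \<in> S \<Longrightarrow> j \<in> T \<Longrightarrow> f i j \<in> carrier G"
  shows "(\<Oplus>i\<in>S. \<Oplus>j\<in>T. f i j) = (\<Oplus>j\<in>T. \<Oplus>i\<in>S. f i j)"
  using assms(1,3)
proof (induction S)
  case (insert x F)
  then have "(\<Oplus>i\<in>insert x F. \<Oplus>j\<in>T. f i j) = (\<Oplus>j\<in>T. f x j) \<oplus> (\<Oplus>j\<in>T. \<Oplus>i\<in>F. f i j)"
    using assms(2) by (subst finsum_insert) (auto simp: Pi_def)
  also have "\<dots> = (\<Oplus>j\<in>T. f x j \<oplus> (\<Oplus>i\<in>F. f i j))"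
    using insert by (intro finsum_addf[symmetric]) auto
  also have "\<dots> = (\<Oplus>j\<in>T. \<Oplus>i\<in>insert x F. f i j)"
    using insert by (intro finsum_cong') (auto simp: finsum_insert Pi_def)
  finally show ?case .
next
  case empty
  then show ?case by simp
qed

lemma (in abelian_monoid) finsum_delta:
  assumes "finite S" "i \<in> S" "f i \<in> carrier G" "\<And>j. j \<in> S \<Longrightarrow> j \<noteq> i \<Longrightarrow> f j = \<zero>"
  shows "(\<Oplus>j\<in>S. f j) = f i"
proof -
  have "(\<Oplus>j\<in>S. f j) = (\<Oplus>j\<in>insert i (S - {i}). f j)"
    using assms by (simp add: insert_absorb)
  also have "\<dots> = f i \<oplus> (\<Oplus>j\<in>S - {i}. f j)"
    using assms by (subst finsum_insert) (auto simp: Pi_def)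
  also have "(\<Oplus>j\<in>S - {i}. f j) = (\<Oplus>j\<in>S - {i}. \<zero>)"
    using assms by (intro finsum_cong') auto
  finally show ?thesis using assms by simp
qed

section \<open>Vector spaces and linear maps\<close>

text \<open>Only vector space axioms are imposed on a record of superalgebra type. The free space
  under a tensor product is such a record without being known as a superalgebra, and it needs the
  same linear algebra.\<close>

locale kspace = abelian_group A + Mod: module "ring_of_type_algebra :: 'k ring" A
  for A :: "('k::field, 'a, 'x) superalg_scheme" (structure)
begin

lemma smult_closed' [simp, intro]: "x \<in> carrier A \<Longrightarrow> c \<odot> x \<in> carrier A"
  by (rule Mod.smult_closed) auto

lemma smult_add_left: "x \<in> carrier A \<Longrightarrow> (c + d) \<odot> x = c \<odot> x \<oplus> d \<odot> x"
  using Mod.smult_l_distr[of c d x] by simp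

lemma smult_add_right: "x \<in> carrier A \<Longrightarrow> y \<in> carrier A \<Longrightarrow> c \<odot> (x \<oplus> y) = c \<odot> x \<oplus> c \<odot> y"
  using Mod.smult_r_distr[of c x y] by simp

lemma smult_smult [simp]: "x \<in> carrier A \<Longrightarrow> c \<odot> (d \<odot> x) = (c * d) \<odot> x"
  using Mod.smult_assoc1[of c d x] by simp

lemma one_smult [simp]: "x \<in> carrier A \<Longrightarrow> 1 \<odot> x = x"
  using Mod.smult_one[of x] by simp

lemma zero_smult [simp]: "x \<in> carrier A \<Longrightarrow> 0 \<odot> x = \<zero>"
  using Mod.smult_l_null[of x] by simp

lemma smult_zero [simp]: "c \<odot> \<zero> = \<zero>"
  using Mod.smult_r_null[of c] by simp

lemma minus_one_smult: "x \<in> carrier A \<Longrightarrow> (- 1) \<odot> x = \<ominus> x"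
  using smult_add_left[of x "-1" 1] by (simp add: minus_equality[symmetric])

lemma smult_finsum: "finite S \<Longrightarrow> f \<in> S \<rightarrow> carrier A \<Longrightarrow> c \<odot> (\<Oplus>i\<in>S. f i) = (\<Oplus>i\<in>S. c \<odot> f i)"
  by (rule Mod.finsum_smult_ldistr) auto

lemma finsum_sum_smult:
  "finite S \<Longrightarrow> x \<in> carrier A \<Longrightarrow> (\<Sum>i\<in>S. f i) \<odot> x = (\<Oplus>i\<in>S. f i \<odot> x)"
  by (induction S rule: finite_induct) (simp_all add: smult_add_left Pi_def)

lemma submoduleD:
  assumes "submodule H (ring_of_type_algebra :: 'k ring) A"
  shows "H \<subseteq> carrier A" "\<zero> \<in> H"
    "\<And>x y. x \<in> H \<Longrightarrow> y \<in> H \<Longrightarrow> x \<oplus> y \<in> H"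
    "\<And>c x. x \<in> H \<Longrightarrow> c \<odot> x \<in> H"
    "\<And>x. x \<in> H \<Longrightarrow> \<ominus> x \<in> H"
    "\<And>x y. x \<in> H \<Longrightarrow> y \<in> H \<Longrightarrow> x \<ominus> y \<in> H"
  using Mod.submoduleE[OF assms] subgroup.one_closed[OF submodule.axioms(1)[OF assms]]
  by (auto simp: a_minus_def)

lemma submoduleI':
  assumes "H \<subseteq> carrier A" "\<zero> \<in> H" "\<And>x y. x \<in> H \<Longrightarrow> y \<in> H \<Longrightarrow> x \<oplus> y \<in> H"
    "\<And>c x. x \<in> H \<Longrightarrow> c \<odot> x \<in> H"
  shows "submodule H (ring_of_type_algebra :: 'k ring) A"
proof (rule Mod.submoduleI)
  show "\<ominus> a \<in> H" if "a \<in> H" for a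
    using assms(4)[OF that, of "-1"] minus_one_smult[of a] assms(1) that by auto
qed (use assms in auto)

lemma finsum_in_submodule:
  assumes "submodule H (ring_of_type_algebra :: 'k ring) A" "\<And>i. i \<in> S \<Longrightarrow> f i \<in> H"
  shows "(\<Oplus>i\<in>S. f i) \<in> H"
  using assms(2)
proof (induction S rule: infinite_finite_induct)
  case (insert x F)
  then have "(\<Oplus>i\<in>insert x F. f i) = f x \<oplus> (\<Oplus>i\<in>F. f i)"
    using submoduleD(1)[OF assms(1)] by (subst finsum_insert) auto
  then show ?case using insert submoduleD(3)[OF assms(1)] by auto
qed (use submoduleD(2)[OF assms(1)] in auto)

end

lemma kspaceI:
  fixes A :: "('k::field, 'a, 'x) superalg_scheme" (structure)
  assumes "abelian_group A"
    and "\<And>c x. x \<in> carrier A \<Longrightarrow> c \<odot> x \<in> carrier A"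
    and "\<And>c d x. x \<in> carrier A \<Longrightarrow> (c + d) \<odot> x = c \<odot> x \<oplus> d \<odot> x"
    and "\<And>c x y. x \<in> carrier A \<Longrightarrow> y \<in> carrier A \<Longrightarrow> c \<odot> (x \<oplus> y) = c \<odot> x \<oplus> c \<odot> y"
    and "\<And>c d x. x \<in> carrier A \<Longrightarrow> (c * d) \<odot> x = c \<odot> (d \<odot> x)"
    and "\<And>x. x \<in> carrier A \<Longrightarrow> 1 \<odot> x = x"
  shows "kspace A"
  unfolding kspace_def
proof
  show "module (ring_of_type_algebra :: 'k ring) A"
    by (rule moduleI) (use assms cring_from_type_algebra in auto)
qed (rule assms)

text \<open>Linear maps without the degree condition of \<open>superlinear\<close>. Maps out of
  quotients and tensor products are obtained as linear maps first; their behaviour on degrees is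
  checked afterwards on a spanning set.\<close>

definition klin :: "('k::field, 'a, 'x) superalg_scheme \<Rightarrow> ('k, 'b, 'y) superalg_scheme \<Rightarrow> ('a \<Rightarrow> 'b) set"
  where "klin A B = {f \<in> carrier A \<rightarrow> carrier B.
    (\<forall>x \<in> carrier A. \<forall>y \<in> carrier A. f (x \<oplus>\<^bsub>A\<^esub> y) = f x \<oplus>\<^bsub>B\<^esub> f y) \<and>
    (\<forall>c. \<forall>x \<in> carrier A. f (c \<odot>\<^bsub>A\<^esub> x) = c \<odot>\<^bsub>B\<^esub> f x)}"

lemma superlinear_iff:
  "f \<in> superlinear A B \<longleftrightarrow> f \<in> klin A B \<and> (\<forall>\<alpha>. \<forall>x \<in> homog A \<alpha>. f x \<in> homog B \<alpha>)"
  unfolding superlinear_def klin_def image_subset_iff by blast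

lemma klinI:
  assumes "\<And>x. x \<in> carrier A \<Longrightarrow> f x \<in> carrier B"
    "\<And>x y. x \<in> carrier A \<Longrightarrow> y \<in> carrier A \<Longrightarrow> f (x \<oplus>\<^bsub>A\<^esub> y) = f x \<oplus>\<^bsub>B\<^esub> f y"
    "\<And>c x. x \<in> carrier A \<Longrightarrow> f (c \<odot>\<^bsub>A\<^esub> x) = c \<odot>\<^bsub>B\<^esub> f x"
  shows "f \<in> klin A B"
  using assms by (auto simp: klin_def)

lemma klinD:
  assumes "f \<in> klin A B"
  shows "x \<in> carrier A \<Longrightarrow> f x \<in> carrier B"
    "x \<in> carrier A \<Longrightarrow> y \<in> carrier A \<Longrightarrow> f (x \<oplus>\<^bsub>A\<^esub> y) = f x \<oplus>\<^bsub>B\<^esub> f y"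
    "x \<in> carrier A \<Longrightarrow> f (c \<odot>\<^bsub>A\<^esub> x) = c \<odot>\<^bsub>B\<^esub> f x"
  using assms by (auto simp: klin_def)

lemma klin_id: "(\<lambda>x. x) \<in> klin A A"
  by (auto simp: klin_def)

lemma klin_comp: "f \<in> klin A B \<Longrightarrow> g \<in> klin B C \<Longrightarrow> (\<lambda>x. g (f x)) \<in> klin A C"
  by (auto simp: klin_def Pi_def)

lemma kspace_abelian: "kspace A \<Longrightarrow> abelian_group A" "kspace A \<Longrightarrow> abelian_monoid A"
  by (simp_all add: kspace.axioms abelian_group.axioms)

lemma klin_cong:
  assumes "f \<in> klin A B" "kspace A" "\<And>x. x \<in> carrier A \<Longrightarrow> g x = f x"
  shows "g \<in> klin A B"
proof -
  interpret A: kspace A by fact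
  show ?thesis by (rule klinI) (auto simp: klinD[OF assms(1)] assms(3))
qed

lemma klin_zero: assumes "kspace A" "kspace B" "f \<in> klin A B" shows "f \<zero>\<^bsub>A\<^esub> = \<zero>\<^bsub>B\<^esub>"
proof -
  interpret A: kspace A by fact
  interpret B: kspace B by fact
  have "f (0 \<odot>\<^bsub>A\<^esub> \<zero>\<^bsub>A\<^esub>) = 0 \<odot>\<^bsub>B\<^esub> f \<zero>\<^bsub>A\<^esub>"
    using klinD[OF assms(3)] by blast
  then show ?thesis using klinD(1)[OF assms(3) A.zero_closed] by simp
qed

lemma klin_minus:
  assumes "kspace A" "kspace B" "f \<in> klin A B" "x \<in> carrier A" "y \<in> carrier A"
  shows "f (x \<ominus>\<^bsub>A\<^esub> y) = f x \<ominus>\<^bsub>B\<^esub> f y"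
proof -
  interpret A: kspace A by fact
  interpret B: kspace B by fact
  show ?thesis
    using klinD[OF assms(3)] assms(4,5)
    by (simp add: a_minus_def A.minus_one_smult[symmetric] B.minus_one_smult[symmetric])
qed

lemma klin_finsum:
  assumes "kspace A" "kspace B" "f \<in> klin A B" "\<And>i. i \<in> S \<Longrightarrow> g i \<in> carrier A"
  shows "f (finsum A g S) = (\<Oplus>\<^bsub>B\<^esub>i\<in>S. f (g i))"
proof -
  interpret A: kspace A by fact
  interpret B: kspace B by fact
  note f = klinD[OF assms(3)]
  show ?thesis using assms(4)
  proof (induction S rule: infinite_finite_induct)
    case (insert x F)
    then have "f (finsum A g (insert x F)) = f (g x) \<oplus>\<^bsub>B\<^esub> f (finsum A g F)"
      by (subst A.finsum_insert) (auto simp: f)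
    then show ?case using insert by (subst B.finsum_insert) (auto simp: f)
  qed (use klin_zero[OF assms(1-3)] in auto)
qed

inductive_set lspan :: "('k::field, 'a, 'x) superalg_scheme \<Rightarrow> 'a set \<Rightarrow> 'a set"
  for A :: "('k::field, 'a, 'x) superalg_scheme" (structure) and V :: "'a set" where
  base: "x \<in> V \<Longrightarrow> x \<in> lspan A V"
| zero: "\<zero> \<in> lspan A V"
| add: "x \<in> lspan A V \<Longrightarrow> y \<in> lspan A V \<Longrightarrow> x \<oplus> y \<in> lspan A V"
| smult: "x \<in> lspan A V \<Longrightarrow> c \<odot> x \<in> lspan A V"

lemma (in kspace) lspan_closed: "V \<subseteq> carrier A \<Longrightarrow> lspan A V \<subseteq> carrier A"
proof
  fix x assume "V \<subseteq> carrier A" "x \<in> lspan A V"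
  from this(2,1) show "x \<in> carrier A" by (induction) auto
qed

lemma klin_eq_on_span:
  assumes "kspace A" "kspace B" "f \<in> klin A B" "g \<in> klin A B" "V \<subseteq> carrier A"
    and "\<And>x. x \<in> V \<Longrightarrow> f x = g x" "x \<in> lspan A V"
  shows "f x = g x"
proof -
  interpret A: kspace A by fact
  have "x \<in> carrier A \<and> f x = g x"
    using assms(7)
  proof induction
    case (base x) then show ?case using assms by auto
  next
    case zero then show ?case using assms by (simp add: klin_zero)
  qed (use assms(3,4) in \<open>auto simp: klinD\<close>)
  then show ?thesis ..
qed

lemma klin_span_image:
  assumes "kspace A" "kspace B" "f \<in> klin A B" "V \<subseteq> carrier A" "x \<in> lspan A V"
    and "\<And>x. x \<in> V \<Longrightarrow> f x \<in> lspan B Y"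
  shows "f x \<in> lspan B Y"
proof -
  interpret A: kspace A by fact
  have "x \<in> carrier A \<and> f x \<in> lspan B Y"
    using assms(5)
  proof induction
    case (base x) then show ?case using assms by auto
  next
    case zero then show ?case using assms by (simp add: klin_zero lspan.zero)
  qed (use assms(3) in \<open>auto simp: klinD intro: lspan.intros\<close>)
  then show ?thesis ..
qed

subsection \<open>Linear extension\<close>

text \<open>The sum that \<open>tensor_lift\<close> evaluates on a representative. Separated from
  the \<open>THE\<close>, it can be shown to be linear before anything is known about
  well-definedness.\<close>

definition linext :: "('k::field, 'c, 'z) superalg_scheme \<Rightarrow> ('b \<Rightarrow> 'c) \<Rightarrow> ('b \<Rightarrow>\<^sub>0 'k) \<Rightarrow> 'c"
  where "linext M \<phi> p = (\<Oplus>\<^bsub>M\<^esub>b \<in> Poly_Mapping.keys p. Poly_Mapping.lookup p b \<odot>\<^bsub>M\<^esub> \<phi> b)"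

lemma lookup_pm_scale [simp]: "Poly_Mapping.lookup (pm_scale c p) b = c * Poly_Mapping.lookup p b"
  by (simp add: pm_scale_def Poly_Mapping.map.rep_eq when_def)

lemma keys_pm_scale: "Poly_Mapping.keys (pm_scale c p) \<subseteq> Poly_Mapping.keys p"
  by (auto simp: in_keys_iff)

lemma pm_scale_single [simp]: "pm_scale c (Poly_Mapping.single b d) = Poly_Mapping.single b (c * d)"
  by (rule poly_mapping_eqI) (simp add: lookup_single when_def)

lemma pm_scale_simps [simp]:
  "pm_scale c (p + p') = pm_scale c p + pm_scale c p'"
  "pm_scale c (pm_scale d p) = pm_scale (c * d) p"
  "pm_scale 1 p = p" "pm_scale 0 p = 0" "pm_scale c 0 = 0"
  for c :: "'k::field"
  by (rule poly_mapping_eqI; simp add: lookup_add algebra_simps)+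

lemma pm_scale_diff: "pm_scale c (p - p') = pm_scale c p - pm_scale c p'" 
  and pm_scale_minus: "pm_scale c (- p) = - pm_scale c p"
  and pm_scale_add_left: "pm_scale (c + d) p = pm_scale c p + pm_scale d p"
  and pm_scale_neg: "pm_scale (- c) p = - pm_scale c p"
  for c :: "'k::field"
  by (rule poly_mapping_eqI; simp add: lookup_add lookup_minus algebra_simps)+

lemma pm_scale_sum: "pm_scale c (\<Sum>i\<in>S. f i) = (\<Sum>i\<in>S. pm_scale c (f i))" for c :: "'k::field"
  by (induction S rule: infinite_finite_induct) auto

lemma pm_induct [consumes 1, case_names zero single add]:
  fixes p :: "'b \<Rightarrow>\<^sub>0 'k::field"
  assumes "Poly_Mapping.keys p \<subseteq> V" "P 0" "\<And>b c. b \<in> V \<Longrightarrow> P (Poly_Mapping.single b c)"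
    "\<And>p p'. Poly_Mapping.keys p \<subseteq> V \<Longrightarrow> Poly_Mapping.keys p' \<subseteq> V \<Longrightarrow> P p \<Longrightarrow> P p' \<Longrightarrow> P (p + p')"
  shows "P p"
proof -
  have eq: "p = (\<Sum>b\<in>Poly_Mapping.keys p. Poly_Mapping.single b (Poly_Mapping.lookup p b))"
    by (rule poly_mapping_eqI)
      (simp add: lookup_sum lookup_single when_def in_keys_iff sum.delta' if_distrib cong: if_cong)
  have "Poly_Mapping.keys (\<Sum>b\<in>S. Poly_Mapping.single b (Poly_Mapping.lookup p b)) \<subseteq> V \<and>
        P (\<Sum>b\<in>S. Poly_Mapping.single b (Poly_Mapping.lookup p b))" if "finite S" "S \<subseteq> V" for S
    using that
  proof (induction S)
    case (insert x F)
    have "Poly_Mapping.keys (Poly_Mapping.single x (Poly_Mapping.lookup p x)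
        + (\<Sum>b\<in>F. Poly_Mapping.single b (Poly_Mapping.lookup p b))) \<subseteq> V"
      using insert by (intro order.trans[OF Poly_Mapping.keys_add]) auto
    then show ?case using insert assms(3)[of x] assms(4)[of "Poly_Mapping.single x (Poly_Mapping.lookup p x)"]
      by auto
  qed (use assms(2) in auto)
  then show ?thesis using eq assms(1) by (metis finite_keys)
qed

context kspace
begin

lemma linext_superset:
  assumes "finite S" "Poly_Mapping.keys p \<subseteq> S" "\<And>b. b \<in> S \<Longrightarrow> \<phi> b \<in> carrier A"
  shows "linext A \<phi> p = (\<Oplus>b\<in>S. Poly_Mapping.lookup p b \<odot> \<phi> b)"
  unfolding linext_def
  by (rule add.finprod_mono_neutral_cong_left) (use assms in \<open>auto simp: in_keys_iff\<close>)

lemma linext_closed: "(\<And>b. b \<in> Poly_Mapping.keys p \<Longrightarrow> \<phi> b \<in> carrier A) \<Longrightarrow> linext A \<phi> p \<in> carrier A"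
  unfolding linext_def by (rule finsum_closed) auto

lemma linext_zero [simp]: "linext A \<phi> 0 = \<zero>"
  by (simp add: linext_def)

lemma linext_single: "\<phi> b \<in> carrier A \<Longrightarrow> linext A \<phi> (Poly_Mapping.single b c) = c \<odot> \<phi> b"
  by (subst linext_superset[of "{b}"]) auto

lemma linext_add:
  assumes "Poly_Mapping.keys p \<subseteq> V" "Poly_Mapping.keys p' \<subseteq> V" "\<And>b. b \<in> V \<Longrightarrow> \<phi> b \<in> carrier A"
  shows "linext A \<phi> (p + p') = linext A \<phi> p \<oplus> linext A \<phi> p'"
proof -
  let ?S = "Poly_Mapping.keys p \<union> Poly_Mapping.keys p'"
  have c: "\<And>b. b \<in> ?S \<Longrightarrow> \<phi> b \<in> carrier A" using assms by auto
  have "linext A \<phi> (p + p') = (\<Oplus>b\<in>?S. Poly_Mapping.lookup (p + p') b \<odot> \<phi> b)"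
    using c by (intro linext_superset) (auto simp: Poly_Mapping.keys_add)
  also have "\<dots> = (\<Oplus>b\<in>?S. Poly_Mapping.lookup p b \<odot> \<phi> b \<oplus> Poly_Mapping.lookup p' b \<odot> \<phi> b)"
    using c by (intro finsum_cong') (auto simp: lookup_add smult_add_left)
  also have "\<dots> = (\<Oplus>b\<in>?S. Poly_Mapping.lookup p b \<odot> \<phi> b) \<oplus> (\<Oplus>b\<in>?S. Poly_Mapping.lookup p' b \<odot> \<phi> b)"
    using c by (intro finsum_addf) auto
  also have "\<dots> = linext A \<phi> p \<oplus> linext A \<phi> p'"
    by (simp only: linext_superset[of ?S, OF _ Un_upper1 c] linext_superset[of ?S, OF _ Un_upper2 c] finite_Un finite_keys simp_thms)
  finally show ?thesis .
qed

lemma linext_scale: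
  assumes "Poly_Mapping.keys p \<subseteq> V" "\<And>b. b \<in> V \<Longrightarrow> \<phi> b \<in> carrier A"
  shows "linext A \<phi> (pm_scale c p) = c \<odot> linext A \<phi> p"
proof -
  let ?S = "Poly_Mapping.keys p"
  have c: "\<And>b. b \<in> ?S \<Longrightarrow> \<phi> b \<in> carrier A" using assms by auto
  have "linext A \<phi> (pm_scale c p) = (\<Oplus>b\<in>?S. Poly_Mapping.lookup (pm_scale c p) b \<odot> \<phi> b)"
    using c by (intro linext_superset) (auto simp: keys_pm_scale)
  also have "\<dots> = (\<Oplus>b\<in>?S. c \<odot> (Poly_Mapping.lookup p b \<odot> \<phi> b))"
    using c by (intro finsum_cong') auto
  also have "\<dots> = c \<odot> linext A \<phi> p"
    unfolding linext_def using c by (intro smult_finsum[symmetric]) auto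
  finally show ?thesis .
qed

end

section \<open>Quotients\<close>

locale kquot = kspace A for A :: "('k::field, 'a, 'x) superalg_scheme" (structure) +
  fixes J :: "'a set"
  assumes J_submodule: "submodule J (ring_of_type_algebra :: 'k ring) A"
begin

lemmas J_sub = submoduleD[OF J_submodule]

sublocale abelian_subgroup J A
  by (rule abelian_subgroupI3)
    (auto intro!: additive_subgroup.intro submodule.axioms(1)[OF J_submodule] abelian_group_axioms)

lemma mem_coset: "x \<in> carrier A \<Longrightarrow> y \<in> J +> x \<longleftrightarrow> y \<in> carrier A \<and> y \<ominus> x \<in> J"
  using a_rcos_module[of x y] a_elemrcos_carrier[of x y]
  by (auto simp: a_minus_def)

lemma coset_eq_iff:
  assumes "x \<in> carrier A" "y \<in> carrier A"
  shows "J +> x = J +> y \<longleftrightarrow> x \<ominus> y \<in> J"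
  using mem_coset[OF assms(2), of x] assms a_repr_independenceD[OF _ , of y x] a_repr_independence'[of x y]
    a_rcos_self[of x]
  by auto

lemma quot_carrier: "carrier (quot_superalg A J) = (\<lambda>x. J +> x) ` carrier A"
  by (auto simp: quot_superalg_def FactRing_def A_RCOSETS_def' )

lemma quot_add: "x \<in> carrier A \<Longrightarrow> y \<in> carrier A \<Longrightarrow>
    (J +> x) \<oplus>\<^bsub>quot_superalg A J\<^esub> (J +> y) = J +> (x \<oplus> y)"
  by (simp add: quot_superalg_def FactRing_def a_rcos_sum)

lemma quot_zero: "\<zero>\<^bsub>quot_superalg A J\<^esub> = J +> \<zero>"
  by (simp add: quot_superalg_def FactRing_def a_coset_add_zero[OF J_sub(1)])

lemma quot_one: "\<one>\<^bsub>quot_superalg A J\<^esub> = J +> \<one>"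
  by (simp add: quot_superalg_def FactRing_def)

lemma quot_smult: "x \<in> carrier A \<Longrightarrow>
    c \<odot>\<^bsub>quot_superalg A J\<^esub> (J +> x) = J +> (c \<odot> x)"
proof -
  assume x: "x \<in> carrier A"
  have "J +> (c \<odot> y) = J +> (c \<odot> x)" if "y \<in> J +> x" for y
  proof -
    have y: "y \<in> carrier A" "y \<ominus> x \<in> J" using that mem_coset[OF x] by auto
    have "c \<odot> y \<ominus> c \<odot> x = c \<odot> (y \<ominus> x)"
      using x y Mod.smult_r_minus[of c x] by (simp add: a_minus_def smult_add_right)
    then show ?thesis using x y J_sub(4) by (subst coset_eq_iff) auto
  qed
  then have "(\<Union>y\<in>J +> x. J +> (c \<odot> y)) = J +> (c \<odot> x)"
    using a_rcos_self[OF x] by blast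
  then show ?thesis by (simp add: quot_superalg_def)
qed

lemma quot_coset_closed [simp]: "x \<in> carrier A \<Longrightarrow> J +> x \<in> carrier (quot_superalg A J)"
  by (simp add: quot_carrier)

lemma quot_cases:
  assumes "U \<in> carrier (quot_superalg A J)"
  obtains x where "x \<in> carrier A" "U = J +> x"
  using assms by (auto simp: quot_carrier)

lemma quot_kspace: "kspace (quot_superalg A J)"
proof (rule kspaceI)
  let ?Q = "quot_superalg A J"
  show "abelian_group ?Q"
  proof (rule abelian_groupI)
    fix x y assume "x \<in> carrier ?Q" "y \<in> carrier ?Q"
    then show "x \<oplus>\<^bsub>?Q\<^esub> y \<in> carrier ?Q" "x \<oplus>\<^bsub>?Q\<^esub> y = y \<oplus>\<^bsub>?Q\<^esub> x"
      by (auto simp: quot_add a_comm elim!: quot_cases)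
  next
    fix x y z assume "x \<in> carrier ?Q" "y \<in> carrier ?Q" "z \<in> carrier ?Q"
    then show "x \<oplus>\<^bsub>?Q\<^esub> y \<oplus>\<^bsub>?Q\<^esub> z = x \<oplus>\<^bsub>?Q\<^esub> (y \<oplus>\<^bsub>?Q\<^esub> z)"
      by (auto simp: quot_add a_assoc elim!: quot_cases)
  next
    fix x assume x: "x \<in> carrier ?Q"
    then show "\<zero>\<^bsub>?Q\<^esub> \<oplus>\<^bsub>?Q\<^esub> x = x"
      by (auto simp: quot_add quot_zero elim!: quot_cases)
    from x obtain a where "a \<in> carrier A" "x = J +> a" by (rule quot_cases)
    then show "\<exists>y\<in>carrier ?Q. y \<oplus>\<^bsub>?Q\<^esub> x = \<zero>\<^bsub>?Q\<^esub>"
      by (intro bexI[of _ "J +> (\<ominus> a)"]) (auto simp: quot_add quot_zero l_neg)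
  qed (simp add: quot_zero)
qed (auto simp: quot_smult quot_add smult_add_left smult_add_right elim!: quot_cases)

lemma coset_klin: "(\<lambda>x. J +> x) \<in> klin A (quot_superalg A J)"
  by (rule klinI) (auto simp: quot_add quot_smult)

lemma coset_eq_zero_iff: "x \<in> carrier A \<Longrightarrow> J +> x = \<zero>\<^bsub>quot_superalg A J\<^esub> \<longleftrightarrow> x \<in> J"
  using coset_eq_iff[of x \<zero>] add.inv_one by (simp add: quot_zero a_minus_def a_inv_def)

text \<open>Maps out of quotients (\<open>tensor_lift\<close>, the structure maps of
  \<open>quot_bisuperalg\<close>) are written as descriptions over all elements of a coset. A linear
  map that kills \<open>J\<close> is constant on cosets, and a coset is nonempty, so the description
  denotes the value at any representative.\<close>

lemma the_coset:
  assumes "kspace B" "f \<in> klin A B" "\<And>x. x \<in> J \<Longrightarrow> f x = \<zero>\<^bsub>B\<^esub>" "x \<in> carrier A"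
  shows "(THE z. \<forall>y\<in>J +> x. z = f y) = f x"
proof -
  interpret B: kspace B by fact
  have "f y = f x" if "y \<in> J +> x" for y
  proof -
    have y: "y \<in> carrier A" "y \<ominus> x \<in> J" using that mem_coset assms(4) by auto
    have "f y \<ominus>\<^bsub>B\<^esub> f x = \<zero>\<^bsub>B\<^esub>"
      using klin_minus[OF kspace_axioms assms(1,2) y(1) assms(4)] assms(3)[OF y(2)] by simp
    then show ?thesis using y assms(4) klinD(1)[OF assms(2)] B.minus_equality[of "f y" "\<ominus>\<^bsub>B\<^esub> f x"]
      by (simp add: a_minus_def B.minus_minus)
  qed
  then have "\<forall>y\<in>J +> x. f x = f y" by (metis (full_types))
  then show ?thesis
  proof (rule the_equality)
    show "z = f x" if "\<forall>y\<in>J +> x. z = f y" for z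
      using bspec[OF that a_rcos_self[OF assms(4)]] .
  qed
qed

lemma the_coset_klin:
  assumes "kspace B" "f \<in> klin A B" "\<And>x. x \<in> J \<Longrightarrow> f x = \<zero>\<^bsub>B\<^esub>"
  shows "(\<lambda>U. THE z. \<forall>y\<in>U. z = f y) \<in> klin (quot_superalg A J) B"
proof -
  define g where "g U = (THE z. \<forall>y\<in>U. z = f y)" for U
  have g: "g (J +> x) = f x" if "x \<in> carrier A" for x
    unfolding g_def by (rule the_coset[OF assms that])
  have "g \<in> klin (quot_superalg A J) B"
    by (rule klinI) (auto elim!: quot_cases simp: quot_add quot_smult g klinD[OF assms(2)])
  then show ?thesis by (simp add: g_def[abs_def])
qed

lemma lspan_quot:
  assumes "carrier A = lspan A V"
  shows "carrier (quot_superalg A J) = lspan (quot_superalg A J) ((\<lambda>x. J +> x) ` V)"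
proof
  have V: "V \<subseteq> carrier A" using assms lspan.base by auto
  show "carrier (quot_superalg A J) \<subseteq> lspan (quot_superalg A J) ((\<lambda>x. J +> x) ` V)"
    unfolding quot_carrier assms
    by (rule image_subsetI)
      (erule klin_span_image[OF kspace_axioms quot_kspace coset_klin V], blast intro: lspan.base)
  show "lspan (quot_superalg A J) ((\<lambda>x. J +> x) ` V) \<subseteq> carrier (quot_superalg A J)"
    using V by (intro kspace.lspan_closed[OF quot_kspace]) auto
qed

end

section \<open>Algebras without associativity\<close>

text \<open>The product on the free vector space underlying a tensor product is only bilinear.\<close>

locale kalg = kspace A for A :: "('k::field, 'a, 'x) superalg_scheme" (structure) +
  assumes mult_closed: "x \<in> carrier A \<Longrightarrow> y \<in> carrier A \<Longrightarrow> x \<otimes> y \<in> carrier A"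
    and distr_left: "x \<in> carrier A \<Longrightarrow> y \<in> carrier A \<Longrightarrow> z \<in> carrier A \<Longrightarrow> (x \<oplus> y) \<otimes> z = x \<otimes> z \<oplus> y \<otimes> z"
    and distr_right: "x \<in> carrier A \<Longrightarrow> y \<in> carrier A \<Longrightarrow> z \<in> carrier A \<Longrightarrow> z \<otimes> (x \<oplus> y) = z \<otimes> x \<oplus> z \<otimes> y"
    and smult_left: "x \<in> carrier A \<Longrightarrow> y \<in> carrier A \<Longrightarrow> (c \<odot> x) \<otimes> y = c \<odot> (x \<otimes> y)"
    and smult_right: "x \<in> carrier A \<Longrightarrow> y \<in> carrier A \<Longrightarrow> x \<otimes> (c \<odot> y) = c \<odot> (x \<otimes> y)"
begin

lemma klin_mult_left: "y \<in> carrier A \<Longrightarrow> (\<lambda>x. x \<otimes> y) \<in> klin A A"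
  by (rule klinI) (auto simp: mult_closed distr_left smult_left)

lemma klin_mult_right: "y \<in> carrier A \<Longrightarrow> (\<lambda>x. y \<otimes> x) \<in> klin A A"
  by (rule klinI) (auto simp: mult_closed distr_right smult_right)

lemma finsum_mult_left:
  "(\<And>i. i \<in> S \<Longrightarrow> f i \<in> carrier A) \<Longrightarrow> y \<in> carrier A \<Longrightarrow> (\<Oplus>i\<in>S. f i) \<otimes> y = (\<Oplus>i\<in>S. f i \<otimes> y)"
  using klin_finsum[OF kspace_axioms kspace_axioms klin_mult_left] by blast

lemma finsum_mult_right:
  "(\<And>i. i \<in> S \<Longrightarrow> f i \<in> carrier A) \<Longrightarrow> y \<in> carrier A \<Longrightarrow> y \<otimes> (\<Oplus>i\<in>S. f i) = (\<Oplus>i\<in>S. y \<otimes> f i)"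
  using klin_finsum[OF kspace_axioms kspace_axioms klin_mult_right] by blast

lemma mult_zero: "x \<in> carrier A \<Longrightarrow> \<zero> \<otimes> x = \<zero>" "x \<in> carrier A \<Longrightarrow> x \<otimes> \<zero> = \<zero>"
  using klin_zero[OF kspace_axioms kspace_axioms klin_mult_left]
    klin_zero[OF kspace_axioms kspace_axioms klin_mult_right] by blast+

end

lemma bilinear_eq_on_span:
  assumes "kspace A" "kspace B" "kspace M" "carrier A = lspan A V" "carrier B = lspan B W"
    and f: "\<And>y. y \<in> carrier B \<Longrightarrow> (\<lambda>x. f x y) \<in> klin A M" "\<And>x. x \<in> carrier A \<Longrightarrow> f x \<in> klin B M"
    and g: "\<And>y. y \<in> carrier B \<Longrightarrow> (\<lambda>x. g x y) \<in> klin A M" "\<And>x. x \<in> carrier A \<Longrightarrow> g x \<in> klin B M"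
    and eq: "\<And>x y. x \<in> V \<Longrightarrow> y \<in> W \<Longrightarrow> f x y = g x y"
    and "x \<in> carrier A" "y \<in> carrier B"
  shows "f x y = g x y"
proof -
  have V: "V \<subseteq> carrier A" "W \<subseteq> carrier B" using assms(4,5) lspan.base by auto
  have "f x' y = g x' y" if "x' \<in> V" for x'
  proof (rule klin_eq_on_span[OF assms(2,3) f(2) g(2) V(2)])
    show "x' \<in> carrier A" "x' \<in> carrier A" using that V by auto
    show "f x' z = g x' z" if "z \<in> W" for z using eq that \<open>x' \<in> V\<close> by blast
    show "y \<in> lspan B W" using assms(5,12) by simp
  qed
  then show ?thesis
    using assms(4,11,12) klin_eq_on_span[OF assms(1,3) f(1) g(1) V(1), of y y x] by simp
qed

locale kalg_quot = kalg A + kquot A J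
  for A :: "('k::field, 'a, 'x) superalg_scheme" (structure) and J +
  assumes absorb_left: "x \<in> J \<Longrightarrow> y \<in> carrier A \<Longrightarrow> x \<otimes> y \<in> J"
    and absorb_right: "x \<in> J \<Longrightarrow> y \<in> carrier A \<Longrightarrow> y \<otimes> x \<in> J"
begin

lemma quot_mult:
  assumes x: "x \<in> carrier A" and y: "y \<in> carrier A"
  shows "(J +> x) \<otimes>\<^bsub>quot_superalg A J\<^esub> (J +> y) = J +> (x \<otimes> y)"
proof -
  have "J +> (a \<otimes> b) = J +> (x \<otimes> y)" if "a \<in> J +> x" "b \<in> J +> y" for a b
  proof -
    have a: "a \<in> carrier A" "a \<ominus> x \<in> J" and b: "b \<in> carrier A" "b \<ominus> y \<in> J"
      using that mem_coset x y by auto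
    have 1: "(a \<ominus> x) \<otimes> b = a \<otimes> b \<ominus> x \<otimes> b"
      using klin_minus[OF kspace_axioms kspace_axioms klin_mult_left[OF b(1)] a(1) x] .
    have 2: "x \<otimes> (b \<ominus> y) = x \<otimes> b \<ominus> x \<otimes> y"
      using klin_minus[OF kspace_axioms kspace_axioms klin_mult_right[OF x] b(1) y] .
    have "J +> (a \<otimes> b) = J +> (x \<otimes> b)"
      using absorb_left[OF a(2) b(1)] 1 a(1) b(1) x by (subst coset_eq_iff) (auto simp: mult_closed)
    also have "\<dots> = J +> (x \<otimes> y)"
      using absorb_right[OF b(2) x] 2 b(1) x y by (subst coset_eq_iff) (auto simp: mult_closed)
    finally show ?thesis .
  qed
  then have "(\<Union>a\<in>J +> x. \<Union>b\<in>J +> y. J +> (a \<otimes> b)) = J +> (x \<otimes> y)"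
    using a_rcos_self[OF x] a_rcos_self[OF y] by blast
  then show ?thesis
    by (simp add: quot_superalg_def FactRing_def rcoset_mult_def)
qed

lemma quot_kalg: "kalg (quot_superalg A J)"
  by (intro kalg.intro kalg_axioms.intro quot_kspace)
    (auto elim!: quot_cases simp: quot_mult quot_add quot_smult mult_closed
      distr_left distr_right smult_left smult_right)

end

section \<open>Homogeneous components\<close>

lemma sgn2_mult_self [simp]: "sgn2 a b * sgn2 a b = (1 :: 'r::ring_1)"
  by (simp add: sgn2_def)

context superalgebra
begin

sublocale kspace A
  by (intro kspace.intro abelian_group_axioms Mod.module_axioms)

sublocale kalg A
  by unfold_locales (auto simp: l_distr r_distr smult_mult_left smult_mult_right)

lemmas homog_sub = submoduleD[OF homog_submodule]

lemma homog_carrier: "x \<in> homog A \<alpha> \<Longrightarrow> x \<in> carrier A"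
  using homog_sub(1) by auto

lemma homog_decomp:
  assumes "x \<in> carrier A"
  obtains u v where "u \<in> homog A \<alpha>" "v \<in> homog A (\<alpha> + 1)" "x = u \<oplus> v"
proof -
  obtain p where p: "fst p \<in> homog A 0" "snd p \<in> homog A 1" "x = fst p \<oplus> snd p"
    using homog_direct_sum[OF assms] by blast
  show thesis
  proof (cases "\<alpha> = 0")
    case True then show thesis using p that by auto
  next
    case False
    then have "\<alpha> = 1" by (simp add: bit_not_zero_iff)
    then show thesis using p that[of "snd p" "fst p"] a_comm homog_carrier by auto
  qed
qed

lemma homog_unique:
  assumes "u \<in> homog A \<alpha>" "v \<in> homog A (\<alpha> + 1)" "u' \<in> homog A \<alpha>" "v' \<in> homog A (\<alpha> + 1)"
    "u \<oplus> v = u' \<oplus> v'"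
  shows "u = u'" "v = v'"
proof -
  have c: "u \<in> carrier A" "v \<in> carrier A" "u' \<in> carrier A" "v' \<in> carrier A"
    using assms homog_carrier by auto
  have "u = u' \<and> v = v'"
  proof (cases "\<alpha> = 0")
    case True
    then have "(u, v) = (u', v')"
      using homog_direct_sum[of "u \<oplus> v"] assms c
      by (metis add_0 a_closed fst_conv snd_conv)
    then show ?thesis by simp
  next
    case False
    then have [simp]: "\<alpha> = 1" by (simp add: bit_not_zero_iff)
    have "(v, u) = (v', u')"
      using homog_direct_sum[of "v \<oplus> u"] assms c
      by simp (metis a_comm a_closed fst_conv snd_conv)
    then show ?thesis by simp
  qed
  then show "u = u'" "v = v'" by auto
qed

lemma hpart_eqI:
  assumes "u \<in> homog A \<alpha>" "v \<in> homog A (\<alpha> + 1)"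
  shows "hpart A \<alpha> (u \<oplus> v) = u"
  unfolding hpart_def
  using assms homog_unique by (intro the_equality) blast+

lemma hpart_homog [simp]: assumes "x \<in> carrier A" shows "hpart A \<alpha> x \<in> homog A \<alpha>"
  using homog_decomp[OF assms, of \<alpha>] hpart_eqI by metis

lemma hpart_closed [simp]: "x \<in> carrier A \<Longrightarrow> hpart A \<alpha> x \<in> carrier A"
  using hpart_homog homog_carrier by blast

lemma hpart_decomp: assumes "x \<in> carrier A" shows "x = hpart A \<alpha> x \<oplus> hpart A (\<alpha> + 1) x"
proof -
  obtain u v where uv: "u \<in> homog A \<alpha>" "v \<in> homog A (\<alpha> + 1)" "x = u \<oplus> v"
    using homog_decomp[OF assms] .
  have "hpart A (\<alpha> + 1) (v \<oplus> u) = v"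
    using uv by (intro hpart_eqI) (auto simp: add.assoc)
  then show ?thesis using hpart_eqI[OF uv(1,2)] uv a_comm homog_carrier by auto
qed

lemma hpart_same [simp]: "x \<in> homog A \<alpha> \<Longrightarrow> hpart A \<alpha> x = x"
  using hpart_eqI[of x \<alpha> \<zero>] homog_sub(2) homog_carrier by auto

lemma hpart_other: "x \<in> homog A \<beta> \<Longrightarrow> \<beta> \<noteq> \<alpha> \<Longrightarrow> hpart A \<alpha> x = \<zero>"
proof -
  assume x: "x \<in> homog A \<beta>" "\<beta> \<noteq> \<alpha>"
  then have "\<beta> = \<alpha> + 1" by (cases \<alpha>; cases \<beta>) auto
  then show ?thesis using hpart_eqI[of \<zero> \<alpha> x] homog_sub(2) homog_carrier x by auto
qed

lemma hpart_klin: "hpart A \<alpha> \<in> klin A A"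
proof (rule klinI)
  fix x y assume x: "x \<in> carrier A" and y: "y \<in> carrier A"
  have "x \<oplus> y = (hpart A \<alpha> x \<oplus> hpart A \<alpha> y) \<oplus> (hpart A (\<alpha> + 1) x \<oplus> hpart A (\<alpha> + 1) y)"
    using x y hpart_decomp[OF x, of \<alpha>] hpart_decomp[OF y, of \<alpha>] 
    by (metis a_assoc a_lcomm a_closed hpart_closed)
  then show "hpart A \<alpha> (x \<oplus> y) = hpart A \<alpha> x \<oplus> hpart A \<alpha> y"
    using hpart_eqI[of "hpart A \<alpha> x \<oplus> hpart A \<alpha> y" \<alpha>] homog_sub(3) x y by simp
next
  fix c x assume x: "x \<in> carrier A"
  have "c \<odot> x = c \<odot> hpart A \<alpha> x \<oplus> c \<odot> hpart A (\<alpha> + 1) x"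
    using x hpart_decomp[OF x, of \<alpha>] by (metis smult_add_right hpart_closed)
  then show "hpart A \<alpha> (c \<odot> x) = c \<odot> hpart A \<alpha> x"
    using hpart_eqI[of "c \<odot> hpart A \<alpha> x" \<alpha>] homog_sub(4) x by simp
qed simp

text \<open>Multiplication by an element of degree \<alpha> shifts the homogeneous components by
  \<alpha>; the index \<open>\<beta> + \<alpha>\<close> is \<open>\<beta> - \<alpha>\<close>, since
  degrees are added modulo two.\<close>

lemma hpart_mult_homog:
  assumes "x \<in> homog A \<alpha>" "y \<in> carrier A"
  shows "hpart A \<beta> (x \<otimes> y) = x \<otimes> hpart A (\<beta> + \<alpha>) y" "hpart A \<beta> (y \<otimes> x) = hpart A (\<beta> + \<alpha>) y \<otimes> x"
proof -
  have x: "x \<in> carrier A" using assms homog_carrier by auto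
  have e: "\<alpha> + (\<beta> + \<alpha>) = \<beta>" "\<beta> + \<alpha> + \<alpha> = \<beta>" "\<alpha> + (\<beta> + \<alpha> + 1) = \<beta> + 1" "\<beta> + \<alpha> + 1 + \<alpha> = \<beta> + 1"
    by (cases \<alpha>; cases \<beta>; simp)+
  have "x \<otimes> hpart A (\<beta> + \<alpha>) y \<in> homog A \<beta>" "x \<otimes> hpart A (\<beta> + \<alpha> + 1) y \<in> homog A (\<beta> + 1)"
    using homog_mult[OF assms(1) hpart_homog[OF assms(2)], of "\<beta> + \<alpha>"]
      homog_mult[OF assms(1) hpart_homog[OF assms(2)], of "\<beta> + \<alpha> + 1"] e by auto
  then show "hpart A \<beta> (x \<otimes> y) = x \<otimes> hpart A (\<beta> + \<alpha>) y"
    using hpart_eqI[of "x \<otimes> hpart A (\<beta> + \<alpha>) y"] hpart_decomp[OF assms(2), of "\<beta> + \<alpha>"]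
      r_distr assms(2) x by (metis hpart_closed)
  have "hpart A (\<beta> + \<alpha>) y \<otimes> x \<in> homog A \<beta>" "hpart A (\<beta> + \<alpha> + 1) y \<otimes> x \<in> homog A (\<beta> + 1)"
    using homog_mult[OF hpart_homog[OF assms(2)] assms(1), of "\<beta> + \<alpha>"]
      homog_mult[OF hpart_homog[OF assms(2)] assms(1), of "\<beta> + \<alpha> + 1"] e by auto
  then show "hpart A \<beta> (y \<otimes> x) = hpart A (\<beta> + \<alpha>) y \<otimes> x"
    using hpart_eqI[of "hpart A (\<beta> + \<alpha>) y \<otimes> x"] hpart_decomp[OF assms(2), of "\<beta> + \<alpha>"]
      l_distr assms(2) x by (metis hpart_closed)
qed

lemma ideal_submodule: assumes "ideal I A" shows "submodule I (ring_of_type_algebra :: 'k ring) A"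
proof -
  interpret I: ideal I A by fact
  have "c \<odot> x \<in> I" if "x \<in> I" for c x
    using I.I_l_closed[OF that, of "c \<odot> \<one>"] smult_mult_left[of \<one> x c] I.Icarr[OF that] by simp
  then show ?thesis by (intro submoduleI') auto
qed

lemma idealI':
  assumes "submodule I (ring_of_type_algebra :: 'k ring) A"
    "\<And>x y. x \<in> I \<Longrightarrow> y \<in> carrier A \<Longrightarrow> x \<otimes> y \<in> I"
    "\<And>x y. x \<in> I \<Longrightarrow> y \<in> carrier A \<Longrightarrow> y \<otimes> x \<in> I"
  shows "ideal I A"
  by (rule idealI) (use assms submodule.axioms(1)[OF assms(1)] ring_axioms in auto)

text \<open>The elements all of whose components lie in the generated ideal form an ideal
  \<open>K\<close>: the other factor of a product can be expanded into its components first. As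
  \<open>K\<close> contains the homogeneous set \<open>S\<close>, minimality gives the
  claim.\<close>

lemma genideal_graded:
  assumes S: "S \<subseteq> (\<Union>\<alpha>. homog A \<alpha>)" and x: "x \<in> genideal A S"
  shows "hpart A \<alpha> x \<in> genideal A S"
proof -
  have Sc: "S \<subseteq> carrier A" using S homog_carrier by auto
  interpret I: ideal "genideal A S" A by (rule genideal_ideal[OF Sc])
  note sub = submoduleD[OF ideal_submodule[OF I.ideal_axioms]]
  define K where "K = {x \<in> genideal A S. \<forall>\<alpha>. hpart A \<alpha> x \<in> genideal A S}"
  have K: "submodule K (ring_of_type_algebra :: 'k ring) A"
    using sub by (intro submoduleI') (auto simp: K_def klinD[OF hpart_klin] klin_zero[OF kspace_axioms kspace_axioms hpart_klin])
  have "ideal K A"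
  proof (rule idealI'[OF K])
    fix x y assume x: "x \<in> K" and y: "y \<in> carrier A"
    have xI: "x \<in> genideal A S" "\<And>\<alpha>. hpart A \<alpha> x \<in> genideal A S" and xc: "x \<in> carrier A"
      using x sub(1) by (auto simp: K_def)
    have "hpart A \<alpha> (x \<otimes> y) \<in> genideal A S" for \<alpha>
    proof -
      have "hpart A \<alpha> (x \<otimes> y) = hpart A \<alpha> (x \<otimes> hpart A 0 y \<oplus> x \<otimes> hpart A 1 y)"
        using hpart_decomp[OF y, of 0] r_distr xc y by (metis add_0 hpart_closed)
      also have "\<dots> = hpart A (\<alpha> + 0) x \<otimes> hpart A 0 y \<oplus> hpart A (\<alpha> + 1) x \<otimes> hpart A 1 y"
        using xc y hpart_mult_homog(2)[OF hpart_homog[OF y] xc, of \<alpha>]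
        by (simp only: klinD[OF hpart_klin] mult_closed hpart_closed)
      also have "\<dots> \<in> genideal A S"
        using xI y by (intro I.a_closed I.I_r_closed) auto
      finally show ?thesis .
    qed
    then show "x \<otimes> y \<in> K" using xI y I.I_r_closed by (auto simp: K_def)
    have "hpart A \<alpha> (y \<otimes> x) \<in> genideal A S" for \<alpha>
    proof -
      have "hpart A \<alpha> (y \<otimes> x) = hpart A \<alpha> (hpart A 0 y \<otimes> x \<oplus> hpart A 1 y \<otimes> x)"
        using hpart_decomp[OF y, of 0] l_distr xc y by (metis add_0 hpart_closed)
      also have "\<dots> = hpart A 0 y \<otimes> hpart A (\<alpha> + 0) x \<oplus> hpart A 1 y \<otimes> hpart A (\<alpha> + 1) x"
        using xc y hpart_mult_homog(1)[OF hpart_homog[OF y] xc, of \<alpha>]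
        by (simp only: klinD[OF hpart_klin] mult_closed hpart_closed)
      also have "\<dots> \<in> genideal A S"
        using xI y by (intro I.a_closed I.I_l_closed) auto
      finally show ?thesis .
    qed
    then show "y \<otimes> x \<in> K" using xI y I.I_l_closed by (auto simp: K_def)
  qed
  moreover have "S \<subseteq> K"
  proof
    fix s assume s: "s \<in> S"
    then obtain \<alpha> where a: "s \<in> homog A \<alpha>" using S by auto
    have "hpart A \<beta> s \<in> genideal A S" for \<beta>
      using a hpart_other[of s \<alpha> \<beta>] genideal_self[OF Sc] s sub(2) by (cases "\<alpha> = \<beta>") auto
    then show "s \<in> K" using genideal_self[OF Sc] s by (auto simp: K_def)
  qed
  ultimately have "x \<in> K" using genideal_minimal x by blast
  then show ?thesis by (simp add: K_def)
qed

end

locale graded_quot = superalgebra A + J: ideal J A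
  for A :: "('k::field, 'a, 'x) superalg_scheme" (structure) and J +
  assumes graded: "x \<in> J \<Longrightarrow> hpart A \<alpha> x \<in> J"
begin

sublocale kalg_quot A J
  by (intro kalg_quot.intro kquot.intro kquot_axioms.intro kalg_quot_axioms.intro
      ideal_submodule J.ideal_axioms kspace_axioms kalg_axioms)
    (auto intro: J.I_l_closed J.I_r_closed)

lemma quot_homog: "homog (quot_superalg A J) \<alpha> = (\<lambda>x. J +> x) ` homog A \<alpha>"
  by (simp add: quot_superalg_def)

lemma quot_superalgebra: "superalgebra (quot_superalg A J)"
proof -
  let ?Q = "quot_superalg A J"
  interpret Q: kalg ?Q by (rule quot_kalg)
  have "ring ?Q"
  proof (rule ringI)
    show "abelian_group ?Q" by (rule Q.abelian_group_axioms)
    show "monoid ?Q"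
      by (rule monoidI) (auto elim!: quot_cases simp: quot_mult quot_one m_assoc)
  qed (auto simp: Q.distr_left Q.distr_right)
  moreover have "submodule (homog ?Q \<alpha>) (ring_of_type_algebra :: 'k ring) ?Q" for \<alpha>
    unfolding quot_homog
    by (rule Q.submoduleI')
      (auto simp: quot_zero quot_add quot_smult homog_carrier homog_sub intro!: imageI)
  moreover have "\<exists>!p. fst p \<in> homog ?Q 0 \<and> snd p \<in> homog ?Q 1 \<and> x = fst p \<oplus>\<^bsub>?Q\<^esub> snd p"
    if x: "x \<in> carrier ?Q" for x
  proof -
    obtain a where a: "a \<in> carrier A" "x = J +> a" using quot_cases[OF x] .
    show ?thesis
    proof (rule ex1I[of _ "(J +> hpart A 0 a, J +> hpart A 1 a)"])
      show "fst (J +> hpart A 0 a, J +> hpart A 1 a) \<in> homog ?Q 0 \<and>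
        snd (J +> hpart A 0 a, J +> hpart A 1 a) \<in> homog ?Q 1 \<and>
        x = fst (J +> hpart A 0 a, J +> hpart A 1 a) \<oplus>\<^bsub>?Q\<^esub> snd (J +> hpart A 0 a, J +> hpart A 1 a)"
        using a hpart_decomp[OF a(1), of 0] by (auto simp: quot_homog quot_add)
    next
      fix p assume p: "fst p \<in> homog ?Q 0 \<and> snd p \<in> homog ?Q 1 \<and> x = fst p \<oplus>\<^bsub>?Q\<^esub> snd p"
      then obtain u v where u: "u \<in> homog A 0" "fst p = J +> u" and v: "v \<in> homog A 1" "snd p = J +> v"
        by (auto simp: quot_homog)
      note uv = homog_carrier[OF u(1)] homog_carrier[OF v(1)]
      have "(u \<oplus> v) \<ominus> a \<in> J"
        using p a u(2) v(2) uv by (subst coset_eq_iff[symmetric]) (auto simp: quot_add)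
      \<comment> \<open>Gradedness of \<open>J\<close> gives uniqueness: the two components of
        \<open>(u + v) - a\<close> lie in \<open>J\<close> separately.\<close>
      then have J: "hpart A \<alpha> ((u \<oplus> v) \<ominus> a) \<in> J" for \<alpha> by (rule graded)
      have "hpart A \<alpha> ((u \<oplus> v) \<ominus> a) = hpart A \<alpha> (u \<oplus> v) \<ominus> hpart A \<alpha> a" for \<alpha>
        using klin_minus[OF kspace_axioms kspace_axioms hpart_klin] uv a by auto
      moreover have "hpart A 0 (u \<oplus> v) = u" "hpart A 1 (u \<oplus> v) = v"
        using u v hpart_eqI[of u 0 v] hpart_eqI[of v 1 u] a_comm[OF uv] by auto
      ultimately have "u \<ominus> hpart A 0 a \<in> J" "v \<ominus> hpart A 1 a \<in> J"
        using J[of 0] J[of 1] by auto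
      then show "p = (J +> hpart A 0 a, J +> hpart A 1 a)"
        using u v uv a coset_eq_iff by (intro prod_eqI) auto
    qed
  qed
  moreover have "\<one>\<^bsub>?Q\<^esub> \<in> homog ?Q 0"
    using homog_one by (auto simp: quot_homog quot_one)
  moreover have "x \<otimes>\<^bsub>?Q\<^esub> y \<in> homog ?Q (\<alpha> + \<beta>)" if xy: "x \<in> homog ?Q \<alpha>" "y \<in> homog ?Q \<beta>" for x y \<alpha> \<beta>
  proof -
    obtain u v where "u \<in> homog A \<alpha>" "x = J +> u" "v \<in> homog A \<beta>" "y = J +> v"
      using xy unfolding quot_homog by blast
    then show ?thesis
      using homog_mult[of u \<alpha> v \<beta>] quot_mult[of u v] homog_carrier[of u] homog_carrier[of v]
      unfolding quot_homog by blast
  qed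
  ultimately show ?thesis
    by (intro superalgebra.intro superalgebra_axioms.intro Q.Mod.module_axioms)
      (auto simp: Q.smult_left Q.smult_right)
qed

end

section \<open>Free superalgebras\<close>

lemma free_superalg_simps [simp]:
  "carrier (free_superalg U d) = {p. \<forall>w \<in> Poly_Mapping.keys p. set (letters w) \<subseteq> U}"
  "monoid.mult (free_superalg U d) = (*)"
  "one (free_superalg U d) = 1" "zero (free_superalg U d) = 0" "add (free_superalg U d) = (+)"
  "module.smult (free_superalg U d) = pm_scale"
  "homog (free_superalg U d) \<alpha> =
    {p. \<forall>w \<in> Poly_Mapping.keys p. set (letters w) \<subseteq> U \<and> word_degree d w = \<alpha>}"
  by (simp_all add: free_superalg_def)

lemma pm_scale_mult:
  fixes p p' :: "'b::monoid_add \<Rightarrow>\<^sub>0 'k::field"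
  shows "pm_scale c p * p' = pm_scale c (p * p')" "p * pm_scale c p' = pm_scale c (p * p')"
proof -
  have s: "Poly_Mapping.single b e * pm_scale c p' = pm_scale c (Poly_Mapping.single b e * p')" for b e
    by (rule pm_induct[of p' UNIV]) (auto simp: mult_single algebra_simps)
  have "pm_scale c p = Poly_Mapping.single 0 c * p"
    by (simp add: pm_scale_def mult_map_scale_conv_mult)
  moreover have "pm_scale c (p * p') = Poly_Mapping.single 0 c * (p * p')"
    by (simp add: pm_scale_def mult_map_scale_conv_mult)
  ultimately show "pm_scale c p * p' = pm_scale c (p * p')" by (simp add: mult.assoc)
  show "p * pm_scale c p' = pm_scale c (p * p')"
    by (rule pm_induct[of p UNIV]) (auto simp: s algebra_simps)
qed

lemma letters_add [simp]: "letters (v + w) = letters v @ letters w"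
  by (simp add: plus_word_def)

lemma letters_zero [simp]: "letters 0 = []"
  by (simp add: zero_word_def)

lemma word_degree_add [simp]: "word_degree d (v + w) = word_degree d v + word_degree d w"
  by (simp add: word_degree_def)

lemma free_kspace: "kspace (free_superalg U d :: ('k::field, _) superalg)"
proof (rule kspaceI)
  let ?F = "free_superalg U d :: ('k, _) superalg"
  have add: "x + y \<in> carrier ?F" if "x \<in> carrier ?F" "y \<in> carrier ?F" for x y
    using that Poly_Mapping.keys_add[of x y] by auto
  show "abelian_group ?F"
  proof (rule abelian_groupI)
    show "\<exists>y\<in>carrier ?F. y \<oplus>\<^bsub>?F\<^esub> x = \<zero>\<^bsub>?F\<^esub>" if "x \<in> carrier ?F" for x
      using that by (intro bexI[of _ "- x"]) auto
    show "x \<oplus>\<^bsub>?F\<^esub> y \<in> carrier ?F" if "x \<in> carrier ?F" "y \<in> carrier ?F" for x y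
      using add[OF that] by simp
  qed (simp_all add: add.assoc add.commute)
  show "c \<odot>\<^bsub>?F\<^esub> x \<in> carrier ?F" if "x \<in> carrier ?F" for c x
    using that keys_pm_scale[of c x] by auto
qed (auto simp: pm_scale_add_left)

lemma free_superalgebra: "superalgebra (free_superalg U d :: ('k::field, _) superalg)"
proof -
  let ?F = "free_superalg U d :: ('k, _) superalg"
  interpret kspace ?F by (rule free_kspace)
  have keys_mult: "\<exists>u\<in>Poly_Mapping.keys x. \<exists>v\<in>Poly_Mapping.keys y. w = u + v"
    if "w \<in> Poly_Mapping.keys (x * y)" for x y :: "_ \<Rightarrow>\<^sub>0 'k" and w
    using subsetD[OF Poly_Mapping.keys_mult that] by blast
  have mult: "x * y \<in> carrier ?F" if "x \<in> carrier ?F" "y \<in> carrier ?F" for x y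
    using that by (fastforce dest!: keys_mult)
  have "monoid ?F"
  proof (rule monoidI)
    show "x \<otimes>\<^bsub>?F\<^esub> y \<in> carrier ?F" if "x \<in> carrier ?F" "y \<in> carrier ?F" for x y
      using mult[OF that] by simp
  qed (simp_all add: mult.assoc)
  then have ring: "ring ?F"
    by (intro ringI abelian_group_axioms) (auto simp: algebra_simps)
  have sub0: "submodule (homog ?F \<alpha>) ring_of_type_algebra ?F" for \<alpha>
  proof (rule submoduleI')
    show "x \<oplus>\<^bsub>?F\<^esub> y \<in> homog ?F \<alpha>" if "x \<in> homog ?F \<alpha>" "y \<in> homog ?F \<alpha>" for x y
      using that Poly_Mapping.keys_add[of x y] by auto
    show "c \<odot>\<^bsub>?F\<^esub> x \<in> homog ?F \<alpha>" if "x \<in> homog ?F \<alpha>" for c x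
      using that keys_pm_scale[of c x] by auto
  qed auto
  note sub = submoduleD[OF sub0]
  have ex: "\<exists>u\<in>homog ?F 0. \<exists>v\<in>homog ?F 1. x = u + v" if "x \<in> carrier ?F" for x
  proof -
    have "Poly_Mapping.keys x \<subseteq> {w. set (letters w) \<subseteq> U}" using that by auto
    then show ?thesis
    proof (induction rule: pm_induct)
      case zero
      then show ?case using sub(2) by (intro bexI[of _ 0]) auto
    next
      case (single b c)
      show ?case
      proof (cases "word_degree d b = 0")
        case True
        then show ?thesis using single
          by (intro bexI[of _ "Poly_Mapping.single b c"] bexI[of _ 0]) auto
      next
        case False
        then show ?thesis using single
          by (intro bexI[of _ "Poly_Mapping.single b c"] bexI[of _ 0]) (auto simp: bit_not_zero_iff)
      qed
    next
      case (add p p')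
      then obtain u v u' v' where uv: "u \<in> homog ?F 0" "v \<in> homog ?F 1" "p = u + v"
          "u' \<in> homog ?F 0" "v' \<in> homog ?F 1" "p' = u' + v'"
        by metis
      show ?case
      proof (intro bexI)
        show "p + p' = (u + u') + (v + v')" using uv by (simp add: algebra_simps)
        show "u + u' \<in> homog ?F 0" "v + v' \<in> homog ?F 1"
          using sub(3)[OF uv(1,4)] sub(3)[OF uv(2,5)] unfolding free_superalg_simps(5) .
      qed
    qed
  qed
  have dsum: "\<exists>!p. fst p \<in> homog ?F 0 \<and> snd p \<in> homog ?F 1 \<and> x = fst p \<oplus>\<^bsub>?F\<^esub> snd p"
    if x: "x \<in> carrier ?F" for x
  proof -
    obtain u v where uv: "u \<in> homog ?F 0" "v \<in> homog ?F 1" "x = u + v" using ex[OF x] by auto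
    show ?thesis
    proof (rule ex1I[of _ "(u, v)"])
      fix p assume p: "fst p \<in> homog ?F 0 \<and> snd p \<in> homog ?F 1 \<and> x = fst p \<oplus>\<^bsub>?F\<^esub> snd p"
      have eq: "u + v = fst p + snd p" using p uv by simp
      have "w \<notin> Poly_Mapping.keys (u - fst p)" for w
      proof
        assume w: "w \<in> Poly_Mapping.keys (u - fst p)"
        have "u - fst p = snd p - v" using eq by (simp add: algebra_simps)
        then have w': "w \<in> Poly_Mapping.keys (snd p - v)" using w by simp
        have "word_degree d w = 0"
          using w p uv(1) Poly_Mapping.keys_add[of u "- fst p"] by auto
        moreover have "word_degree d w = 1"
          using w' p uv(2) Poly_Mapping.keys_add[of "snd p" "- v"] by auto
        ultimately show False by simp
      qed
      then have "Poly_Mapping.keys (u - fst p) \<subseteq> {}" by blast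
      \<comment> \<open>With the empty key set the induction has no basis vectors to treat, so it
        shows that an element without support vanishes.\<close>
      then have "u - fst p = 0" using pm_induct[of "u - fst p" "{}" "\<lambda>r. r = 0"] by auto
      then show "p = (u, v)" using eq by (intro prod_eqI) auto
    qed (use uv in simp)
  qed
  have hmult: "x \<otimes>\<^bsub>?F\<^esub> y \<in> homog ?F (\<alpha> + \<beta>)" if "x \<in> homog ?F \<alpha>" "y \<in> homog ?F \<beta>" for x y \<alpha> \<beta>
  proof -
    have "set (letters w) \<subseteq> U \<and> word_degree d w = \<alpha> + \<beta>" if w: "w \<in> Poly_Mapping.keys (x * y)" for w
    proof -
      obtain u v where "u \<in> Poly_Mapping.keys x" "v \<in> Poly_Mapping.keys y" "w = u + v"
        using keys_mult[OF w] by blast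
      then show ?thesis using \<open>x \<in> homog ?F \<alpha>\<close> \<open>y \<in> homog ?F \<beta>\<close> by auto
    qed
    then show ?thesis by simp
  qed
  have hone: "\<one>\<^bsub>?F\<^esub> \<in> homog ?F 0" by (simp add: word_degree_def)
  show ?thesis
  proof (intro superalgebra.intro superalgebra_axioms.intro Mod.module_axioms ring sub0 dsum hmult hone)
  qed (simp_all add: pm_scale_mult)
qed

section \<open>Tensor products\<close>

lemma klin_add:
  assumes "kspace A" "kspace M" "f \<in> klin A M" "g \<in> klin A M"
  shows "(\<lambda>x. f x \<oplus>\<^bsub>M\<^esub> g x) \<in> klin A M"
proof -
  interpret A: kspace A by fact
  interpret M: kspace M by fact
  show ?thesis
    using klinD[OF assms(3)] klinD[OF assms(4)]
    by (intro klinI) (auto simp: M.smult_add_right M.a_ac)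
qed

lemma klin_smult:
  assumes "kspace A" "kspace M" "f \<in> klin A M"
  shows "(\<lambda>x. c \<odot>\<^bsub>M\<^esub> f x) \<in> klin A M"
proof -
  interpret A: kspace A by fact
  interpret M: kspace M by fact
  show ?thesis
    using klinD[OF assms(3)] by (intro klinI) (auto simp: M.smult_add_right mult.commute)
qed

definition bilin :: "('k::field, 'a, 'x) superalg_scheme \<Rightarrow> ('k, 'b, 'y) superalg_scheme
    \<Rightarrow> ('k, 'c, 'z) superalg_scheme \<Rightarrow> ('a \<Rightarrow> 'b \<Rightarrow> 'c) \<Rightarrow> bool"
  where "bilin A B M \<phi> \<longleftrightarrow> (\<forall>b\<in>carrier B. (\<lambda>a. \<phi> a b) \<in> klin A M) \<and> (\<forall>a\<in>carrier A. \<phi> a \<in> klin B M)"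

lemma bilinD:
  assumes "bilin A B M \<phi>"
  shows "b \<in> carrier B \<Longrightarrow> (\<lambda>a. \<phi> a b) \<in> klin A M" "a \<in> carrier A \<Longrightarrow> \<phi> a \<in> klin B M"
  using assms by (auto simp: bilin_def)

lemma pretensor_simps [simp]:
  "carrier (pretensor A B) = {p. Poly_Mapping.keys p \<subseteq> carrier A \<times> carrier B}"
  "one (pretensor A B) = Poly_Mapping.single (\<one>\<^bsub>A\<^esub>, \<one>\<^bsub>B\<^esub>) 1"
  "zero (pretensor A B) = 0" "add (pretensor A B) = (+)" "module.smult (pretensor A B) = pm_scale"
  "homog (pretensor A B) \<gamma> = {p. Poly_Mapping.keys p \<subseteq> (\<Union>\<alpha>. homog A \<alpha> \<times> homog B (\<gamma> - \<alpha>))}"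
  by (simp_all add: pretensor_def)

lemma pretensor_kspace: "kspace (pretensor A B :: ('k::field, _) superalg)"
proof (rule kspaceI)
  let ?F = "pretensor A B :: ('k, _) superalg"
  have add: "x + y \<in> carrier ?F" if "x \<in> carrier ?F" "y \<in> carrier ?F" for x y
    using that Poly_Mapping.keys_add[of x y] by auto
  show "abelian_group ?F"
  proof (rule abelian_groupI)
    show "\<exists>y\<in>carrier ?F. y \<oplus>\<^bsub>?F\<^esub> x = \<zero>\<^bsub>?F\<^esub>" if "x \<in> carrier ?F" for x
      using that by (intro bexI[of _ "- x"]) auto
    show "x \<oplus>\<^bsub>?F\<^esub> y \<in> carrier ?F" if "x \<in> carrier ?F" "y \<in> carrier ?F" for x y
      using add[OF that] by simp
  qed (simp_all add: add.assoc add.commute)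
  show "c \<odot>\<^bsub>?F\<^esub> x \<in> carrier ?F" if "x \<in> carrier ?F" for c x
    using that keys_pm_scale[of c x] by auto
qed (auto simp: pm_scale_add_left)

locale ktensor = A: kspace A + B: kspace B
  for A :: "('k::field, 'a, 'x) superalg_scheme" and B :: "('k, 'b, 'y) superalg_scheme"
begin

sublocale P: kspace "pretensor A B"
  by (rule pretensor_kspace)

lemma tensor_rel_carrier: "p \<in> tensor_rel A B \<Longrightarrow> p \<in> carrier (pretensor A B)"
proof (induction rule: tensor_rel.induct)
  case (plus p p')
  then show ?case using P.a_closed by simp
next
  case (scale p c)
  then show ?case using P.smult_closed'[of p c] by simp
next
  case (add_left a a' b)
  have "Poly_Mapping.single (a \<oplus>\<^bsub>A\<^esub> a', b) 1 \<oplus>\<^bsub>pretensor A B\<^esub> (- 1) \<odot>\<^bsub>pretensor A B\<^esub> Poly_Mapping.single (a, b) 1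
     \<oplus>\<^bsub>pretensor A B\<^esub> (- 1) \<odot>\<^bsub>pretensor A B\<^esub> Poly_Mapping.single (a', b) 1 \<in> carrier (pretensor A B)"
    by (intro P.a_closed P.smult_closed') (use add_left in auto)
  then show ?case by (simp add: single_uminus)
next
  case (add_right a b b')
  have "Poly_Mapping.single (a, b \<oplus>\<^bsub>B\<^esub> b') 1 \<oplus>\<^bsub>pretensor A B\<^esub> (- 1) \<odot>\<^bsub>pretensor A B\<^esub> Poly_Mapping.single (a, b) 1
     \<oplus>\<^bsub>pretensor A B\<^esub> (- 1) \<odot>\<^bsub>pretensor A B\<^esub> Poly_Mapping.single (a, b') 1 \<in> carrier (pretensor A B)"
    by (intro P.a_closed P.smult_closed') (use add_right in auto)
  then show ?case by (simp add: single_uminus)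
next
  case (smult_left a b c)
  have "Poly_Mapping.single (c \<odot>\<^bsub>A\<^esub> a, b) 1 \<oplus>\<^bsub>pretensor A B\<^esub> (- 1) \<odot>\<^bsub>pretensor A B\<^esub> Poly_Mapping.single (a, b) c
      \<in> carrier (pretensor A B)"
    by (intro P.a_closed P.smult_closed') (use smult_left in auto)
  then show ?case by (simp add: single_uminus)
next
  case (smult_right a b c)
  have "Poly_Mapping.single (a, c \<odot>\<^bsub>B\<^esub> b) 1 \<oplus>\<^bsub>pretensor A B\<^esub> (- 1) \<odot>\<^bsub>pretensor A B\<^esub> Poly_Mapping.single (a, b) c
      \<in> carrier (pretensor A B)"
    by (intro P.a_closed P.smult_closed') (use smult_right in auto)
  then show ?case by (simp add: single_uminus)
qed auto

sublocale T: kquot "pretensor A B" "tensor_rel A B"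
proof (intro kquot.intro kquot_axioms.intro P.kspace_axioms)
  show "submodule (tensor_rel A B) ring_of_type_algebra (pretensor A B)"
  proof (rule P.submoduleI')
    show "tensor_rel A B \<subseteq> carrier (pretensor A B)" using tensor_rel_carrier by (rule subsetI)
  qed (simp_all add: tensor_rel.zero tensor_rel.plus tensor_rel.scale)
qed

lemma tensor_kspace: "kspace (tensor A B)"
  unfolding tensor_def by (rule T.quot_kspace)

lemma single_carrier [simp]: "a \<in> carrier A \<Longrightarrow> b \<in> carrier B \<Longrightarrow>
    Poly_Mapping.single (a, b) (c::'k) \<in> carrier (pretensor A B)"
  by simp

lemma pure_closed: "a \<in> carrier A \<Longrightarrow> b \<in> carrier B \<Longrightarrow> pure_tensor A B a b \<in> carrier (tensor A B)"
  unfolding pure_tensor_def tensor_def by (intro T.quot_coset_closed) simp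

lemma coset_single: 
  assumes "a \<in> carrier A" "b \<in> carrier B"
  shows "tensor_rel A B +>\<^bsub>pretensor A B\<^esub> Poly_Mapping.single (a, b) c = c \<odot>\<^bsub>tensor A B\<^esub> pure_tensor A B a b"
  using T.quot_smult[OF single_carrier[OF assms], of c 1] by (simp add: tensor_def pure_tensor_def)

lemma P_minus: "p \<in> carrier (pretensor A B) \<Longrightarrow> q \<in> carrier (pretensor A B) \<Longrightarrow>
    p \<ominus>\<^bsub>pretensor A B\<^esub> q = p - q"
  using P.minus_one_smult[of q] by (simp add: a_minus_def pm_scale_neg)

lemma bilin_pure: "bilin A B (tensor A B) (pure_tensor A B)"
  unfolding bilin_def
proof (intro conjI ballI klinI)
  fix a b b' c assume a: "a \<in> carrier A" and b: "b \<in> carrier B"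
  show "pure_tensor A B a (c \<odot>\<^bsub>B\<^esub> b) = c \<odot>\<^bsub>tensor A B\<^esub> pure_tensor A B a b"
    unfolding coset_single[OF a b, symmetric] unfolding pure_tensor_def
    by (subst T.coset_eq_iff) (use a b in \<open>auto simp: P_minus intro: tensor_rel.intros simp del: pretensor_simps(1)\<close>)
  assume b': "b' \<in> carrier B"
  have "tensor_rel A B +>\<^bsub>pretensor A B\<^esub> Poly_Mapping.single (a, b \<oplus>\<^bsub>B\<^esub> b') 1
      = tensor_rel A B +>\<^bsub>pretensor A B\<^esub> (Poly_Mapping.single (a, b) 1 \<oplus>\<^bsub>pretensor A B\<^esub> Poly_Mapping.single (a, b') 1)"
    using tensor_rel.add_right[OF a b b']
    unfolding T.coset_eq_iff[OF single_carrier[OF a B.a_closed[OF b b']]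
        P.a_closed[OF single_carrier[OF a b] single_carrier[OF a b']]]
      P_minus[OF single_carrier[OF a B.a_closed[OF b b']]
        P.a_closed[OF single_carrier[OF a b] single_carrier[OF a b']]]
    by (simp add: algebra_simps)
  then show "pure_tensor A B a (b \<oplus>\<^bsub>B\<^esub> b') = pure_tensor A B a b \<oplus>\<^bsub>tensor A B\<^esub> pure_tensor A B a b'"
    unfolding pure_tensor_def tensor_def using a b b' by (subst T.quot_add) auto
next
  fix a a' b c assume b: "b \<in> carrier B" and a: "a \<in> carrier A"
  show "pure_tensor A B (c \<odot>\<^bsub>A\<^esub> a) b = c \<odot>\<^bsub>tensor A B\<^esub> pure_tensor A B a b"
    unfolding coset_single[OF a b, symmetric] unfolding pure_tensor_def
    by (subst T.coset_eq_iff) (use a b in \<open>auto simp: P_minus intro: tensor_rel.intros simp del: pretensor_simps(1)\<close>)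
  assume a': "a' \<in> carrier A"
  have "tensor_rel A B +>\<^bsub>pretensor A B\<^esub> Poly_Mapping.single (a \<oplus>\<^bsub>A\<^esub> a', b) 1
      = tensor_rel A B +>\<^bsub>pretensor A B\<^esub> (Poly_Mapping.single (a, b) 1 \<oplus>\<^bsub>pretensor A B\<^esub> Poly_Mapping.single (a', b) 1)"
    using tensor_rel.add_left[OF a a' b]
    unfolding T.coset_eq_iff[OF single_carrier[OF A.a_closed[OF a a'] b]
        P.a_closed[OF single_carrier[OF a b] single_carrier[OF a' b]]]
      P_minus[OF single_carrier[OF A.a_closed[OF a a'] b]
        P.a_closed[OF single_carrier[OF a b] single_carrier[OF a' b]]]
    by (simp add: algebra_simps)
  then show "pure_tensor A B (a \<oplus>\<^bsub>A\<^esub> a') b = pure_tensor A B a b \<oplus>\<^bsub>tensor A B\<^esub> pure_tensor A B a' b"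
    unfolding pure_tensor_def tensor_def using a a' b by (subst T.quot_add) auto
qed (auto simp: pure_closed)

text \<open>The generators of \<open>tensor_rel\<close> measure the failure of bilinearity, so the
  linear extension of a bilinear map vanishes on them and on their span. This is the universal
  property before passing to the quotient.\<close>

lemma bilinear_linext:
  assumes M: "kspace M" and \<phi>: "bilin A B M \<phi>"
  defines "L \<equiv> linext M (\<lambda>ab. \<phi> (fst ab) (snd ab))"
  shows "L \<in> klin (pretensor A B) M"
    and "\<And>a b c. a \<in> carrier A \<Longrightarrow> b \<in> carrier B \<Longrightarrow> L (Poly_Mapping.single (a, b) c) = c \<odot>\<^bsub>M\<^esub> \<phi> a b"
    and "\<And>p. p \<in> tensor_rel A B \<Longrightarrow> L p = \<zero>\<^bsub>M\<^esub>"
proof -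
  interpret M: kspace M by fact
  have cl: "\<phi> (fst ab) (snd ab) \<in> carrier M" if "ab \<in> carrier A \<times> carrier B" for ab
    using that klinD(1)[OF bilinD(2)[OF \<phi>]] by auto
  show L: "L \<in> klin (pretensor A B) M"
    unfolding L_def
    by (rule klinI) (auto intro!: M.linext_closed M.linext_add[of _ "carrier A \<times> carrier B"]
        M.linext_scale[of _ "carrier A \<times> carrier B"] intro: cl)
  show S: "L (Poly_Mapping.single (a, b) c) = c \<odot>\<^bsub>M\<^esub> \<phi> a b"
    if "a \<in> carrier A" "b \<in> carrier B" for a b c
    using cl[of "(a, b)"] that by (simp add: L_def M.linext_single)
  note c1 = klinD[OF bilinD(1)[OF \<phi>]] and c2 = klinD[OF bilinD(2)[OF \<phi>]]
  have D: "L (p - q) = L p \<ominus>\<^bsub>M\<^esub> L q" if "p \<in> carrier (pretensor A B)" "q \<in> carrier (pretensor A B)" for p q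
    using klin_minus[OF P.kspace_axioms M L that] P_minus[OF that] by simp
  have C: "p - q \<in> carrier (pretensor A B)" if "p \<in> carrier (pretensor A B)" "q \<in> carrier (pretensor A B)" for p q
    using P.minus_closed[OF that] P_minus[OF that] by simp
  show "L p = \<zero>\<^bsub>M\<^esub>" if "p \<in> tensor_rel A B" for p
    using that
  proof (induction rule: tensor_rel.induct)
    case (plus p p')
    then show ?case using klinD(2)[OF L] tensor_rel_carrier by fastforce
  next
    case (scale p c)
    then show ?case using klinD(3)[OF L] tensor_rel_carrier by fastforce
  next
    case (add_left a a' b)
    then show ?case
      by (simp add: D C S c1 M.minus_add M.a_ac M.r_neg M.r_neg1 a_minus_def del: pretensor_simps(1))
  next
    case (add_right a b b')
    then show ?case
      by (simp add: D C S c2 M.minus_add M.a_ac M.r_neg M.r_neg1 a_minus_def del: pretensor_simps(1))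
  next
    case (smult_left a b c)
    then show ?case
      by (simp add: D C S c1 M.r_neg a_minus_def del: pretensor_simps(1))
  next
    case (smult_right a b c)
    then show ?case
      by (simp add: D C S c1 c2 M.r_neg a_minus_def del: pretensor_simps(1))
  next
    case zero
    then show ?case by (simp add: L_def)
  qed
qed

lemma tensor_lift_klin:
  assumes M: "kspace M" and \<phi>: "bilin A B M \<phi>"
  shows "tensor_lift M \<phi> \<in> klin (tensor A B) M"
  using T.the_coset_klin[OF M bilinear_linext(1)[OF assms] bilinear_linext(3)[OF assms]]
  by (simp add: tensor_lift_def[abs_def] tensor_def linext_def)

lemma tensor_lift_pure:
  assumes M: "kspace M" and \<phi>: "bilin A B M \<phi>" and ab: "a \<in> carrier A" "b \<in> carrier B"
  shows "tensor_lift M \<phi> (pure_tensor A B a b) = \<phi> a b"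
proof -
  interpret M: kspace M by fact
  have "\<phi> a b \<in> carrier M" using klinD(1)[OF bilinD(2)[OF \<phi>]] ab by auto
  then show ?thesis
    using T.the_coset[OF M bilinear_linext(1)[OF assms(1,2)] bilinear_linext(3)[OF assms(1,2)] single_carrier[OF ab, of 1]]
      bilinear_linext(2)[OF assms]
    by (simp add: tensor_lift_def pure_tensor_def linext_def)
qed

lemma tensor_span:
  "carrier (tensor A B) = lspan (tensor A B) {pure_tensor A B a b | a b. a \<in> carrier A \<and> b \<in> carrier B}"
proof
  interpret T': kspace "tensor A B" by (rule tensor_kspace)
  show "lspan (tensor A B) {pure_tensor A B a b | a b. a \<in> carrier A \<and> b \<in> carrier B} \<subseteq> carrier (tensor A B)"
    by (rule T'.lspan_closed) (auto simp: pure_closed)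
  show "carrier (tensor A B) \<subseteq> lspan (tensor A B) {pure_tensor A B a b | a b. a \<in> carrier A \<and> b \<in> carrier B}"
  proof
    fix U assume "U \<in> carrier (tensor A B)"
    then obtain p where p: "p \<in> carrier (pretensor A B)" "U = tensor_rel A B +>\<^bsub>pretensor A B\<^esub> p"
      unfolding tensor_def by (rule T.quot_cases)
    have "Poly_Mapping.keys p \<subseteq> carrier A \<times> carrier B" using p by simp
    then show "U \<in> lspan (tensor A B) {pure_tensor A B a b | a b. a \<in> carrier A \<and> b \<in> carrier B}"
      unfolding p(2)
    proof (induction rule: pm_induct)
      case zero
      then show ?case using T.quot_zero lspan.zero[of "tensor A B"] by (simp add: tensor_def)
    next
      case (single b c)
      then show ?case
      proof (cases b)
        case (Pair a b')
        then have ab: "a \<in> carrier A" "b' \<in> carrier B" using single by auto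
        show ?thesis
          unfolding Pair coset_single[OF ab] by (rule lspan.smult, rule lspan.base) (use ab in blast)
      qed
    next
      case (add p p')
      have "p \<in> carrier (pretensor A B)" "p' \<in> carrier (pretensor A B)" using add(1,2) by simp_all
      from T.quot_add[OF this]
      have eq: "tensor_rel A B +>\<^bsub>pretensor A B\<^esub> (p + p') = (tensor_rel A B +>\<^bsub>pretensor A B\<^esub> p)
          \<oplus>\<^bsub>tensor A B\<^esub> (tensor_rel A B +>\<^bsub>pretensor A B\<^esub> p')"
        unfolding tensor_def pretensor_simps by simp
      show ?case unfolding eq by (rule lspan.add[OF add(3,4)])
    qed
  qed
qed

end

lemma tensor_map_props:
  assumes "ktensor A B" "ktensor C D" "f \<in> klin A C" "g \<in> klin B D"
  shows "tensor_map C D f g \<in> klin (tensor A B) (tensor C D)"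
    and "\<And>a b. a \<in> carrier A \<Longrightarrow> b \<in> carrier B \<Longrightarrow>
      tensor_map C D f g (pure_tensor A B a b) = pure_tensor C D (f a) (g b)"
proof -
  interpret AB: ktensor A B by fact
  interpret CD: ktensor C D by fact
  have bil: "bilin A B (tensor C D) (\<lambda>a b. pure_tensor C D (f a) (g b))"
    unfolding bilin_def
    using klin_comp[OF assms(3) bilinD(1)[OF CD.bilin_pure klinD(1)[OF assms(4)]]]
      klin_comp[OF assms(4) bilinD(2)[OF CD.bilin_pure klinD(1)[OF assms(3)]]] by blast
  show "tensor_map C D f g \<in> klin (tensor A B) (tensor C D)"
    unfolding tensor_map_def by (rule AB.tensor_lift_klin[OF CD.tensor_kspace bil])
  show "tensor_map C D f g (pure_tensor A B a b) = pure_tensor C D (f a) (g b)"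
    if "a \<in> carrier A" "b \<in> carrier B" for a b
    unfolding tensor_map_def by (rule AB.tensor_lift_pure[OF CD.tensor_kspace bil that])
qed

section \<open>The product on a graded tensor product\<close>

lemma bit_mem: "(\<beta> :: bit) \<in> {0, 1}"
  by (cases \<beta>) auto

locale graded_tensor = A: superalgebra A + B: superalgebra B
  for A :: "('k::field, 'a, 'x) superalg_scheme" and B :: "('k, 'b, 'y) superalg_scheme"
begin

sublocale ktensor A B
  by (intro ktensor.intro A.kspace_axioms B.kspace_axioms)

text \<open>Product of two basis vectors of the free space; the product of \<open>pretensor\<close>
  is its bilinear extension. \<open>pterm\<close> is not additive in the entries of its pairs, since
  different pairs are independent basis vectors.\<close>

definition pterm :: "'a \<times> 'b \<Rightarrow> 'a \<times> 'b \<Rightarrow> ('a \<times> 'b \<Rightarrow>\<^sub>0 'k)"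
  where "pterm x y = (\<Sum>\<alpha>\<in>{0, 1}. \<Sum>\<beta>\<in>{0, 1}.
    Poly_Mapping.single (fst x \<otimes>\<^bsub>A\<^esub> hpart A \<alpha> (fst y), hpart B \<beta> (snd x) \<otimes>\<^bsub>B\<^esub> snd y) (sgn2 \<beta> \<alpha>))"

lemma P_finsum:
  "(\<And>i. i \<in> S \<Longrightarrow> f i \<in> carrier (pretensor A B)) \<Longrightarrow> finsum (pretensor A B) f S = sum f S"
proof (induction S rule: infinite_finite_induct)
  case (insert x F)
  then show ?case by (subst P.finsum_insert) auto
qed auto

lemma P_sum_closed:
  "(\<And>i. i \<in> S \<Longrightarrow> f i \<in> carrier (pretensor A B)) \<Longrightarrow> sum f S \<in> carrier (pretensor A B)"
  using P_finsum[of S f] P.finsum_closed[of f S] by (simp add: Pi_def del: pretensor_simps)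

lemma pterm_closed:
  assumes "x \<in> carrier A \<times> carrier B" "y \<in> carrier A \<times> carrier B"
  shows "pterm x y \<in> carrier (pretensor A B)"
  unfolding pterm_def
  by (intro P_sum_closed single_carrier A.m_closed B.m_closed A.hpart_closed B.hpart_closed)
    (use assms in auto)

lemma linext_P: 
  assumes "\<And>b. b \<in> Poly_Mapping.keys p \<Longrightarrow> \<phi> b \<in> carrier (pretensor A B)"
  shows "linext (pretensor A B) \<phi> p = (\<Sum>b\<in>Poly_Mapping.keys p. pm_scale (Poly_Mapping.lookup p b) (\<phi> b))"
  unfolding linext_def using P.smult_closed'[OF assms]
  by (subst P_finsum) (auto simp del: pretensor_simps(1))

lemma pretensor_mult:
  assumes p: "p \<in> carrier (pretensor A B)" and p': "p' \<in> carrier (pretensor A B)"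
  shows "p \<otimes>\<^bsub>pretensor A B\<^esub> p' = linext (pretensor A B) (\<lambda>x. linext (pretensor A B) (pterm x) p') p"
proof -
  have kp: "\<And>x. x \<in> Poly_Mapping.keys p \<Longrightarrow> x \<in> carrier A \<times> carrier B"
    and kp': "\<And>x. x \<in> Poly_Mapping.keys p' \<Longrightarrow> x \<in> carrier A \<times> carrier B"
    using p p' by auto
  have "linext (pretensor A B) (\<lambda>x. linext (pretensor A B) (pterm x) p') p
      = (\<Sum>x\<in>Poly_Mapping.keys p. pm_scale (Poly_Mapping.lookup p x) (linext (pretensor A B) (pterm x) p'))"
    by (rule linext_P) (intro P.linext_closed pterm_closed kp kp')
  also have "\<dots> = (\<Sum>x\<in>Poly_Mapping.keys p. pm_scale (Poly_Mapping.lookup p x)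
      (\<Sum>y\<in>Poly_Mapping.keys p'. pm_scale (Poly_Mapping.lookup p' y) (pterm x y)))"
    by (intro sum.cong refl arg_cong[where f = "pm_scale _"] linext_P pterm_closed kp kp')
  finally show ?thesis
    unfolding pretensor_def pterm_def
    by (simp add: pm_scale_sum case_prod_unfold mult_ac)
qed

lemma pretensor_mult_klin:
  shows "\<And>p'. p' \<in> carrier (pretensor A B) \<Longrightarrow> (\<lambda>p. p \<otimes>\<^bsub>pretensor A B\<^esub> p') \<in> klin (pretensor A B) (pretensor A B)"
    and "\<And>p. p \<in> carrier (pretensor A B) \<Longrightarrow> (\<lambda>p'. p \<otimes>\<^bsub>pretensor A B\<^esub> p') \<in> klin (pretensor A B) (pretensor A B)"
proof -
  let ?P = "pretensor A B" and ?K = "carrier A \<times> carrier B"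
  have keys: "p \<in> carrier ?P \<longleftrightarrow> Poly_Mapping.keys p \<subseteq> ?K" for p by simp
  have in1: "linext ?P (pterm x) p' \<in> carrier ?P" if "x \<in> ?K" "p' \<in> carrier ?P" for x p'
    by (rule P.linext_closed, rule pterm_closed) (use that keys in auto)
  show 1: "(\<lambda>p. p \<otimes>\<^bsub>?P\<^esub> p') \<in> klin ?P ?P" if p': "p' \<in> carrier ?P" for p'
  proof (rule klinI)
    fix p q c assume p: "p \<in> carrier ?P"
    show "p \<otimes>\<^bsub>?P\<^esub> p' \<in> carrier ?P"
      unfolding pretensor_mult[OF p p'] using p keys
      by (intro P.linext_closed in1 p') auto
    show "(c \<odot>\<^bsub>?P\<^esub> p) \<otimes>\<^bsub>?P\<^esub> p' = c \<odot>\<^bsub>?P\<^esub> (p \<otimes>\<^bsub>?P\<^esub> p')"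
      unfolding pretensor_mult[OF p p'] pretensor_mult[OF P.smult_closed'[OF p] p']
      unfolding pretensor_simps(5)
      by (subst P.linext_scale[of _ ?K]) (use p p' in1 keys in auto)
    assume q: "q \<in> carrier ?P"
    show "(p \<oplus>\<^bsub>?P\<^esub> q) \<otimes>\<^bsub>?P\<^esub> p' = p \<otimes>\<^bsub>?P\<^esub> p' \<oplus>\<^bsub>?P\<^esub> q \<otimes>\<^bsub>?P\<^esub> p'"
      unfolding pretensor_mult[OF p p'] pretensor_mult[OF q p'] pretensor_mult[OF P.a_closed[OF p q] p']
      unfolding pretensor_simps(4)
      by (subst P.linext_add[of _ ?K]) (use p q p' in1 keys in auto)
  qed
  show "(\<lambda>p'. p \<otimes>\<^bsub>?P\<^esub> p') \<in> klin ?P ?P" if p: "p \<in> carrier ?P" for p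
  proof (rule klinI)
    fix p' q c assume p': "p' \<in> carrier ?P"
    have kp: "\<And>x. x \<in> Poly_Mapping.keys p \<Longrightarrow> x \<in> ?K" using p by auto
    have kl: "Poly_Mapping.keys p' \<subseteq> ?K" using p' by simp
    have e: "linext ?P (\<lambda>x. linext ?P (pterm x) r) p
        = (\<Sum>x\<in>Poly_Mapping.keys p. pm_scale (Poly_Mapping.lookup p x) (linext ?P (pterm x) r))"
      if "r \<in> carrier ?P" for r
      by (rule linext_P) (rule in1[OF kp that])
    show "p \<otimes>\<^bsub>?P\<^esub> p' \<in> carrier ?P" using klinD(1)[OF 1[OF p'] p] .
    have sc: "linext ?P (pterm x) (pm_scale c p') = pm_scale c (linext ?P (pterm x) p')"
      if "x \<in> Poly_Mapping.keys p" for x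
      using P.linext_scale[OF kl pterm_closed[OF kp[OF that]]] by simp
    show "p \<otimes>\<^bsub>?P\<^esub> (c \<odot>\<^bsub>?P\<^esub> p') = c \<odot>\<^bsub>?P\<^esub> (p \<otimes>\<^bsub>?P\<^esub> p')"
      unfolding pretensor_mult[OF p p'] pretensor_mult[OF p P.smult_closed'[OF p']]
        e[OF p'] e[OF P.smult_closed'[OF p']]
      by (simp add: sc pm_scale_sum mult.commute)
    assume q: "q \<in> carrier ?P"
    have kq: "Poly_Mapping.keys q \<subseteq> ?K" using q by simp
    have ad: "linext ?P (pterm x) (p' + q) = linext ?P (pterm x) p' + linext ?P (pterm x) q"
      if "x \<in> Poly_Mapping.keys p" for x
      using P.linext_add[OF kl kq pterm_closed[OF kp[OF that]]] by simp
    show "p \<otimes>\<^bsub>?P\<^esub> (p' \<oplus>\<^bsub>?P\<^esub> q) = p \<otimes>\<^bsub>?P\<^esub> p' \<oplus>\<^bsub>?P\<^esub> p \<otimes>\<^bsub>?P\<^esub> q"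
      unfolding pretensor_mult[OF p p'] pretensor_mult[OF p q] pretensor_mult[OF p P.a_closed[OF p' q]]
        e[OF p'] e[OF q] e[OF P.a_closed[OF p' q]]
      by (simp add: ad sum.distrib)
  qed
qed

sublocale P: kalg "pretensor A B"
proof unfold_locales
  fix x y z c assume xy: "x \<in> carrier (pretensor A B)" "y \<in> carrier (pretensor A B)"
  show "x \<otimes>\<^bsub>pretensor A B\<^esub> y \<in> carrier (pretensor A B)"
    by (rule klinD(1)[OF pretensor_mult_klin(1)[OF xy(2)] xy(1)])
  show "c \<odot>\<^bsub>pretensor A B\<^esub> x \<otimes>\<^bsub>pretensor A B\<^esub> y = c \<odot>\<^bsub>pretensor A B\<^esub> (x \<otimes>\<^bsub>pretensor A B\<^esub> y)"
    by (rule klinD(3)[OF pretensor_mult_klin(1)[OF xy(2)] xy(1)])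
  show "x \<otimes>\<^bsub>pretensor A B\<^esub> (c \<odot>\<^bsub>pretensor A B\<^esub> y) = c \<odot>\<^bsub>pretensor A B\<^esub> (x \<otimes>\<^bsub>pretensor A B\<^esub> y)"
    by (rule klinD(3)[OF pretensor_mult_klin(2)[OF xy(1)] xy(2)])
  assume z: "z \<in> carrier (pretensor A B)"
  show "(x \<oplus>\<^bsub>pretensor A B\<^esub> y) \<otimes>\<^bsub>pretensor A B\<^esub> z
      = x \<otimes>\<^bsub>pretensor A B\<^esub> z \<oplus>\<^bsub>pretensor A B\<^esub> y \<otimes>\<^bsub>pretensor A B\<^esub> z"
    by (rule klinD(2)[OF pretensor_mult_klin(1)[OF z] xy])
  show "z \<otimes>\<^bsub>pretensor A B\<^esub> (x \<oplus>\<^bsub>pretensor A B\<^esub> y)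
      = z \<otimes>\<^bsub>pretensor A B\<^esub> x \<oplus>\<^bsub>pretensor A B\<^esub> z \<otimes>\<^bsub>pretensor A B\<^esub> y"
    by (rule klinD(2)[OF pretensor_mult_klin(2)[OF z] xy])
qed

lemma pretensor_mult_single:
  assumes "x \<in> carrier A \<times> carrier B" "y \<in> carrier A \<times> carrier B"
  shows "Poly_Mapping.single x c \<otimes>\<^bsub>pretensor A B\<^esub> Poly_Mapping.single y d = pm_scale (c * d) (pterm x y)"
proof -
  have c: "Poly_Mapping.single x c \<in> carrier (pretensor A B)" "Poly_Mapping.single y d \<in> carrier (pretensor A B)"
    using assms by auto
  show ?thesis
    unfolding pretensor_mult[OF c]
      P.linext_single[of "\<lambda>x. linext (pretensor A B) (pterm x) (Poly_Mapping.single y d)" x, 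
        unfolded P.linext_single[of "pterm x" y, OF pterm_closed[OF assms]],
        OF P.smult_closed'[OF pterm_closed[OF assms]]]
      P.linext_single[of "pterm x" y, OF pterm_closed[OF assms]]
    by simp
qed

text \<open>The class of \<open>pterm\<close> modulo \<open>tensor_rel\<close>. On classes the
  product does become bilinear in each of the pairs \<open>(a, b)\<close> and
  \<open>(a', b')\<close>.\<close>

definition pure_mult :: "'a \<Rightarrow> 'b \<Rightarrow> 'a \<Rightarrow> 'b \<Rightarrow> ('a \<times> 'b \<Rightarrow>\<^sub>0 'k) set"
  where "pure_mult a b a' b' = (\<Oplus>\<^bsub>tensor A B\<^esub>\<alpha>\<in>{0, 1}. \<Oplus>\<^bsub>tensor A B\<^esub>\<beta>\<in>{0, 1}.
    sgn2 \<beta> \<alpha> \<odot>\<^bsub>tensor A B\<^esub> pure_tensor A B (a \<otimes>\<^bsub>A\<^esub> hpart A \<alpha> a') (hpart B \<beta> b \<otimes>\<^bsub>B\<^esub> b'))"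

lemma coset_pterm:
  assumes "a \<in> carrier A" "b \<in> carrier B" "a' \<in> carrier A" "b' \<in> carrier B"
  shows "tensor_rel A B +>\<^bsub>pretensor A B\<^esub> pterm (a, b) (a', b') = pure_mult a b a' b'"
proof -
  let ?g = "\<lambda>\<alpha> \<beta>. Poly_Mapping.single (a \<otimes>\<^bsub>A\<^esub> hpart A \<alpha> a', hpart B \<beta> b \<otimes>\<^bsub>B\<^esub> b') (sgn2 \<beta> \<alpha> :: 'k)"
  have g: "?g \<alpha> \<beta> \<in> carrier (pretensor A B)" for \<alpha> \<beta>
    using assms by (intro single_carrier) auto
  have "pterm (a, b) (a', b') = (\<Oplus>\<^bsub>pretensor A B\<^esub>\<alpha>\<in>{0, 1}. \<Oplus>\<^bsub>pretensor A B\<^esub>\<beta>\<in>{0, 1}. ?g \<alpha> \<beta>)"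
    unfolding pterm_def fst_conv snd_conv
    by (subst P_finsum, subst P_finsum) (auto simp: P_finsum g P_sum_closed simp del: pretensor_simps(1) sum.insert)
  then have "tensor_rel A B +>\<^bsub>pretensor A B\<^esub> pterm (a, b) (a', b')
      = (\<Oplus>\<^bsub>tensor A B\<^esub>\<alpha>\<in>{0, 1}. tensor_rel A B +>\<^bsub>pretensor A B\<^esub> (\<Oplus>\<^bsub>pretensor A B\<^esub>\<beta>\<in>{0, 1}. ?g \<alpha> \<beta>))"
    unfolding tensor_def
    by (simp only:) (rule klin_finsum[OF P.kspace_axioms T.quot_kspace T.coset_klin],
        rule P.finsum_closed, use g in blast)
  moreover have "tensor_rel A B +>\<^bsub>pretensor A B\<^esub> (\<Oplus>\<^bsub>pretensor A B\<^esub>\<beta>\<in>{0, 1}. ?g \<alpha> \<beta>)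
      = (\<Oplus>\<^bsub>tensor A B\<^esub>\<beta>\<in>{0, 1}. tensor_rel A B +>\<^bsub>pretensor A B\<^esub> ?g \<alpha> \<beta>)" for \<alpha>
    unfolding tensor_def by (rule klin_finsum[OF P.kspace_axioms T.quot_kspace T.coset_klin g])
  ultimately show ?thesis
    unfolding pure_mult_def
    by (simp only: coset_single[OF A.m_closed[OF assms(1) A.hpart_closed[OF assms(3)]]
          B.m_closed[OF B.hpart_closed[OF assms(2)] assms(4)]])
qed

lemma pure_mult_bilin:
  shows "a' \<in> carrier A \<Longrightarrow> b' \<in> carrier B \<Longrightarrow> bilin A B (tensor A B) (\<lambda>a b. pure_mult a b a' b')"
    and "a \<in> carrier A \<Longrightarrow> b \<in> carrier B \<Longrightarrow> bilin A B (tensor A B) (\<lambda>a' b'. pure_mult a b a' b')"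
proof -
  interpret T': kspace "tensor A B" by (rule tensor_kspace)
  note p = bilinD[OF bilin_pure]
  have eq: "pure_mult a b a' b' =
      (sgn2 0 0 \<odot>\<^bsub>tensor A B\<^esub> pure_tensor A B (a \<otimes>\<^bsub>A\<^esub> hpart A 0 a') (hpart B 0 b \<otimes>\<^bsub>B\<^esub> b')
      \<oplus>\<^bsub>tensor A B\<^esub> sgn2 1 0 \<odot>\<^bsub>tensor A B\<^esub> pure_tensor A B (a \<otimes>\<^bsub>A\<^esub> hpart A 0 a') (hpart B 1 b \<otimes>\<^bsub>B\<^esub> b'))
      \<oplus>\<^bsub>tensor A B\<^esub> (sgn2 0 1 \<odot>\<^bsub>tensor A B\<^esub> pure_tensor A B (a \<otimes>\<^bsub>A\<^esub> hpart A 1 a') (hpart B 0 b \<otimes>\<^bsub>B\<^esub> b')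
      \<oplus>\<^bsub>tensor A B\<^esub> sgn2 1 1 \<odot>\<^bsub>tensor A B\<^esub> pure_tensor A B (a \<otimes>\<^bsub>A\<^esub> hpart A 1 a') (hpart B 1 b \<otimes>\<^bsub>B\<^esub> b'))"
    if "a \<in> carrier A" "b \<in> carrier B" "a' \<in> carrier A" "b' \<in> carrier B" for a b a' b'
    unfolding pure_mult_def using that by (simp add: pure_closed Pi_def T'.a_ac)
  have l: "(\<lambda>a. pure_tensor A B (a \<otimes>\<^bsub>A\<^esub> x) y) \<in> klin A (tensor A B)" if "x \<in> carrier A" "y \<in> carrier B" for x y
    using klin_comp[OF A.klin_mult_left[OF that(1)] p(1)[OF that(2)]] .
  have r: "(\<lambda>b. pure_tensor A B x (hpart B \<beta> b \<otimes>\<^bsub>B\<^esub> y)) \<in> klin B (tensor A B)" if "x \<in> carrier A" "y \<in> carrier B" for x y \<beta>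
    using klin_comp[OF klin_comp[OF B.hpart_klin B.klin_mult_left[OF that(2)]] p(2)[OF that(1)]] .
  have l': "(\<lambda>a. pure_tensor A B (x \<otimes>\<^bsub>A\<^esub> hpart A \<beta> a) y) \<in> klin A (tensor A B)" if "x \<in> carrier A" "y \<in> carrier B" for x y \<beta>
    using klin_comp[OF klin_comp[OF A.hpart_klin A.klin_mult_right[OF that(1)]] p(1)[OF that(2)]] .
  have r': "(\<lambda>b. pure_tensor A B x (y \<otimes>\<^bsub>B\<^esub> b)) \<in> klin B (tensor A B)" if "x \<in> carrier A" "y \<in> carrier B" for x y
    using klin_comp[OF B.klin_mult_right[OF that(2)] p(2)[OF that(1)]] .
  show "bilin A B (tensor A B) (\<lambda>a b. pure_mult a b a' b')" if "a' \<in> carrier A" "b' \<in> carrier B"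
    unfolding bilin_def
  proof (intro conjI ballI)
    fix b assume "b \<in> carrier B"
    with that show "(\<lambda>a. pure_mult a b a' b') \<in> klin A (tensor A B)"
      by (intro klin_cong[OF _ A.kspace_axioms eq] klin_add klin_smult A.kspace_axioms tensor_kspace l) auto
  next
    fix a assume "a \<in> carrier A"
    with that show "(\<lambda>b. pure_mult a b a' b') \<in> klin B (tensor A B)"
      by (intro klin_cong[OF _ B.kspace_axioms eq] klin_add klin_smult B.kspace_axioms tensor_kspace r) auto
  qed
  show "bilin A B (tensor A B) (\<lambda>a' b'. pure_mult a b a' b')" if "a \<in> carrier A" "b \<in> carrier B"
    unfolding bilin_def
  proof (intro conjI ballI)
    fix b' assume "b' \<in> carrier B"
    with that show "(\<lambda>a'. pure_mult a b a' b') \<in> klin A (tensor A B)"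
      by (intro klin_cong[OF _ A.kspace_axioms eq] klin_add klin_smult A.kspace_axioms tensor_kspace l') auto
  next
    fix a' assume "a' \<in> carrier A"
    with that show "pure_mult a b a' \<in> klin B (tensor A B)"
      by (intro klin_cong[OF _ B.kspace_axioms eq] klin_add klin_smult B.kspace_axioms tensor_kspace r') auto
  qed
qed

lemma klin_eq_on_pretensor:
  assumes "kspace M" "f \<in> klin (pretensor A B) M" "g \<in> klin (pretensor A B) M"
    "\<And>a b. a \<in> carrier A \<Longrightarrow> b \<in> carrier B \<Longrightarrow> f (Poly_Mapping.single (a, b) 1) = g (Poly_Mapping.single (a, b) 1)"
    "p \<in> carrier (pretensor A B)"
  shows "f p = g p"
proof -
  have "Poly_Mapping.keys p \<subseteq> carrier A \<times> carrier B" using assms(5) by simp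
  then show ?thesis
  proof (induction rule: pm_induct)
    case zero
    then show ?case
      using klin_zero[OF P.kspace_axioms assms(1,2)] klin_zero[OF P.kspace_axioms assms(1,3)] by simp
  next
    case (single b c)
    then obtain a b' where b: "b = (a, b')" "a \<in> carrier A" "b' \<in> carrier B" by auto
    have "h (Poly_Mapping.single b c) = c \<odot>\<^bsub>M\<^esub> h (Poly_Mapping.single b 1)" if "h \<in> klin (pretensor A B) M" for h
      using klinD(3)[OF that single_carrier[OF b(2,3), of 1], of c] b(1) by simp
    then show ?case using assms(2,3,4) b by metis
  next
    case (add p p')
    then have c: "p \<in> carrier (pretensor A B)" "p' \<in> carrier (pretensor A B)" by simp_all
    show ?case
      using klinD(2)[OF assms(2) c] klinD(2)[OF assms(3) c] add(3,4) by simp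
  qed
qed

text \<open>The relations form a two-sided ideal: modulo relations, multiplication by a fixed basis
  vector is the linear extension of the bilinear map given by \<open>pure_mult\<close>, hence sends
  relations to zero. Linearity in the fixed factor then covers every factor.\<close>

sublocale T: kalg_quot "pretensor A B" "tensor_rel A B"
proof (intro kalg_quot.intro kalg_quot_axioms.intro P.kalg_axioms T.kquot_axioms)
  let ?P = "pretensor A B" and ?c = "\<lambda>p. tensor_rel A B +>\<^bsub>pretensor A B\<^esub> p"
  fix x y assume x: "x \<in> tensor_rel A B" and y: "y \<in> carrier ?P"
  have xc: "x \<in> carrier ?P" using x by (rule tensor_rel_carrier)
  note ck = T.coset_klin[folded tensor_def]
  have "?c (x \<otimes>\<^bsub>?P\<^esub> Poly_Mapping.single (a', b') 1) = \<zero>\<^bsub>tensor A B\<^esub>" if ab: "a' \<in> carrier A" "b' \<in> carrier B" for a' b'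
  proof -
    note bl = bilinear_linext[OF tensor_kspace pure_mult_bilin(1)[OF ab]]
    have "?c (x \<otimes>\<^bsub>?P\<^esub> Poly_Mapping.single (a', b') 1)
        = linext (tensor A B) (\<lambda>z. pure_mult (fst z) (snd z) a' b') x"
      by (rule klin_eq_on_pretensor[OF tensor_kspace klin_comp[OF P.klin_mult_left[OF single_carrier[OF ab]] ck] bl(1) _ xc])
        (use ab in \<open>simp add: bl(2) pretensor_mult_single coset_pterm klinD(1)[OF bilinD(2)[OF pure_mult_bilin(1)[OF ab]]]
            kspace.one_smult[OF tensor_kspace]\<close>)
    then show ?thesis using bl(3)[OF x] by simp
  qed
  then have "?c (x \<otimes>\<^bsub>?P\<^esub> y) = (\<lambda>_. \<zero>\<^bsub>tensor A B\<^esub>) y"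
    using kspace_abelian(2)[OF tensor_kspace] kspace.smult_zero[OF tensor_kspace]
    by (intro klin_eq_on_pretensor[OF tensor_kspace klin_comp[OF P.klin_mult_right[OF xc] ck] _ _ y])
      (auto intro!: klinI abelian_monoid.zero_closed simp: abelian_monoid.l_zero abelian_monoid.zero_closed)
  then show "x \<otimes>\<^bsub>?P\<^esub> y \<in> tensor_rel A B"
    using T.coset_eq_zero_iff[OF P.mult_closed[OF xc y]] by (simp add: tensor_def)
  have "?c (Poly_Mapping.single (a, b) 1 \<otimes>\<^bsub>?P\<^esub> x) = \<zero>\<^bsub>tensor A B\<^esub>" if ab: "a \<in> carrier A" "b \<in> carrier B" for a b
  proof -
    note bl = bilinear_linext[OF tensor_kspace pure_mult_bilin(2)[OF ab]]
    have "?c (Poly_Mapping.single (a, b) 1 \<otimes>\<^bsub>?P\<^esub> x)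
        = linext (tensor A B) (\<lambda>z. pure_mult a b (fst z) (snd z)) x"
      by (rule klin_eq_on_pretensor[OF tensor_kspace klin_comp[OF P.klin_mult_right[OF single_carrier[OF ab]] ck] bl(1) _ xc])
        (use ab in \<open>simp add: bl(2) pretensor_mult_single coset_pterm klinD(1)[OF bilinD(2)[OF pure_mult_bilin(2)[OF ab]]]
            kspace.one_smult[OF tensor_kspace]\<close>)
    then show ?thesis using bl(3)[OF x] by simp
  qed
  then have "?c (y \<otimes>\<^bsub>?P\<^esub> x) = (\<lambda>_. \<zero>\<^bsub>tensor A B\<^esub>) y"
    using kspace_abelian(2)[OF tensor_kspace] kspace.smult_zero[OF tensor_kspace]
    by (intro klin_eq_on_pretensor[OF tensor_kspace klin_comp[OF P.klin_mult_left[OF xc] ck] _ _ y])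
      (auto intro!: klinI abelian_monoid.zero_closed simp: abelian_monoid.l_zero abelian_monoid.zero_closed)
  then show "y \<otimes>\<^bsub>?P\<^esub> x \<in> tensor_rel A B"
    using T.coset_eq_zero_iff[OF P.mult_closed[OF y xc]] by (simp add: tensor_def)
qed

lemma tensor_kalg: "kalg (tensor A B)"
  unfolding tensor_def by (rule T.quot_kalg)

lemma tensor_one: "\<one>\<^bsub>tensor A B\<^esub> = pure_tensor A B \<one>\<^bsub>A\<^esub> \<one>\<^bsub>B\<^esub>"
  by (simp add: tensor_def T.quot_one pure_tensor_def)

text \<open>For homogeneous inner factors three of the four terms of \<open>pure_mult\<close>
  vanish, and the familiar sign rule remains.\<close>

lemma pure_mult_homog:
  assumes "a \<in> carrier A" "b \<in> homog B \<beta>" "a' \<in> homog A \<alpha>" "b' \<in> carrier B"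
  shows "pure_tensor A B a b \<otimes>\<^bsub>tensor A B\<^esub> pure_tensor A B a' b'
    = sgn2 \<beta> \<alpha> \<odot>\<^bsub>tensor A B\<^esub> pure_tensor A B (a \<otimes>\<^bsub>A\<^esub> a') (b \<otimes>\<^bsub>B\<^esub> b')"
proof -
  interpret T': kspace "tensor A B" by (rule tensor_kspace)
  have c: "a' \<in> carrier A" "b \<in> carrier B" using assms A.homog_carrier B.homog_carrier by auto
  have z: "pure_tensor A B x \<zero>\<^bsub>B\<^esub> = \<zero>\<^bsub>tensor A B\<^esub>" if "x \<in> carrier A" for x
    by (rule klin_zero[OF B.kspace_axioms tensor_kspace bilinD(2)[OF bilin_pure that]])
  have z': "pure_tensor A B \<zero>\<^bsub>A\<^esub> x = \<zero>\<^bsub>tensor A B\<^esub>" if "x \<in> carrier B" for x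
    using klin_zero[OF A.kspace_axioms tensor_kspace bilinD(1)[OF bilin_pure that]] .
  have "pure_tensor A B a b \<otimes>\<^bsub>tensor A B\<^esub> pure_tensor A B a' b' = pure_mult a b a' b'"
    using T.quot_mult[OF single_carrier[OF assms(1) c(2), of 1] single_carrier[OF c(1) assms(4), of 1]] assms c
    by (simp add: tensor_def[symmetric] pure_tensor_def[symmetric] pretensor_mult_single coset_pterm)
  also have "\<dots> = (\<Oplus>\<^bsub>tensor A B\<^esub>\<beta>'\<in>{0, 1}.
    sgn2 \<beta>' \<alpha> \<odot>\<^bsub>tensor A B\<^esub> pure_tensor A B (a \<otimes>\<^bsub>A\<^esub> a') (hpart B \<beta>' b \<otimes>\<^bsub>B\<^esub> b'))"
  proof -
    have "pure_mult a b a' b' = (\<Oplus>\<^bsub>tensor A B\<^esub>\<beta>'\<in>{0, 1}.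
        sgn2 \<beta>' \<alpha> \<odot>\<^bsub>tensor A B\<^esub> pure_tensor A B (a \<otimes>\<^bsub>A\<^esub> hpart A \<alpha> a') (hpart B \<beta>' b \<otimes>\<^bsub>B\<^esub> b'))"
      unfolding pure_mult_def
    proof (rule T'.finsum_delta)
      fix j assume "j \<in> {0, 1}" "j \<noteq> \<alpha>"
      then have h: "hpart A j a' = \<zero>\<^bsub>A\<^esub>" using A.hpart_other[OF assms(3), of j] by auto
      show "(\<Oplus>\<^bsub>tensor A B\<^esub>\<beta>'\<in>{0, 1}. sgn2 \<beta>' j \<odot>\<^bsub>tensor A B\<^esub>
          pure_tensor A B (a \<otimes>\<^bsub>A\<^esub> hpart A j a') (hpart B \<beta>' b \<otimes>\<^bsub>B\<^esub> b')) = \<zero>\<^bsub>tensor A B\<^esub>"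
        unfolding h using assms c by (simp add: z')
    qed (use assms c pure_closed in \<open>auto simp: bit_mem simp del: insert_iff intro!: T'.finsum_closed\<close>)
    then show ?thesis using assms by simp
  qed
  also have "\<dots> = sgn2 \<beta> \<alpha> \<odot>\<^bsub>tensor A B\<^esub> pure_tensor A B (a \<otimes>\<^bsub>A\<^esub> a') (hpart B \<beta> b \<otimes>\<^bsub>B\<^esub> b')"
  proof (rule T'.finsum_delta)
    fix j assume "j \<in> {0, 1}" "j \<noteq> \<beta>"
    then have h: "hpart B j b = \<zero>\<^bsub>B\<^esub>" using B.hpart_other[OF assms(2), of j] by auto
    show "sgn2 j \<alpha> \<odot>\<^bsub>tensor A B\<^esub> pure_tensor A B (a \<otimes>\<^bsub>A\<^esub> a') (hpart B j b \<otimes>\<^bsub>B\<^esub> b') = \<zero>\<^bsub>tensor A B\<^esub>"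
      unfolding h using assms c by (simp add: z)
  qed (use assms c pure_closed in \<open>auto simp: bit_mem simp del: insert_iff\<close>)
  finally show ?thesis using assms by simp
qed

lemma tensor_homog: "homog (tensor A B) \<gamma> = (\<lambda>p. tensor_rel A B +>\<^bsub>pretensor A B\<^esub> p) ` homog (pretensor A B) \<gamma>"
  by (simp add: tensor_def quot_superalg_def)

lemma tensor_homog_submodule: "submodule (homog (tensor A B) \<gamma>) (ring_of_type_algebra :: 'k ring) (tensor A B)"
proof -
  interpret T': kspace "tensor A B" by (rule tensor_kspace)
  have sub: "p \<in> carrier (pretensor A B)" if "p \<in> homog (pretensor A B) \<gamma>" for p
  proof -
    have "(\<Union>\<alpha>. homog A \<alpha> \<times> homog B (\<gamma> - \<alpha>)) \<subseteq> carrier A \<times> carrier B"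
      by (intro UN_least Sigma_mono A.homog_sub(1) B.homog_sub(1))
    then show ?thesis using that unfolding pretensor_simps by blast
  qed
  show ?thesis
  proof (rule T'.submoduleI')
    show "homog (tensor A B) \<gamma> \<subseteq> carrier (tensor A B)"
      unfolding tensor_homog unfolding tensor_def by (intro image_subsetI T.quot_coset_closed sub)
    have "0 \<in> homog (pretensor A B) \<gamma>" by simp
    then show "\<zero>\<^bsub>tensor A B\<^esub> \<in> homog (tensor A B) \<gamma>"
      unfolding tensor_homog using T.quot_zero by (auto simp: tensor_def)
    fix x y c assume "x \<in> homog (tensor A B) \<gamma>"
    then obtain p where p: "p \<in> homog (pretensor A B) \<gamma>" "x = tensor_rel A B +>\<^bsub>pretensor A B\<^esub> p"
      unfolding tensor_homog by blast
    have "pm_scale c p \<in> homog (pretensor A B) \<gamma>"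
      using p(1) keys_pm_scale[of c p] unfolding pretensor_simps by blast
    moreover have "c \<odot>\<^bsub>tensor A B\<^esub> x = tensor_rel A B +>\<^bsub>pretensor A B\<^esub> (pm_scale c p)"
      using T.quot_smult[OF sub[OF p(1)], of c] p by (simp add: tensor_def)
    ultimately show "c \<odot>\<^bsub>tensor A B\<^esub> x \<in> homog (tensor A B) \<gamma>" unfolding tensor_homog by blast
    assume "y \<in> homog (tensor A B) \<gamma>"
    then obtain p' where p': "p' \<in> homog (pretensor A B) \<gamma>" "y = tensor_rel A B +>\<^bsub>pretensor A B\<^esub> p'"
      unfolding tensor_homog by blast
    have "p + p' \<in> homog (pretensor A B) \<gamma>"
      using p(1) p'(1) Poly_Mapping.keys_add[of p p'] unfolding pretensor_simps by blast
    moreover have "x \<oplus>\<^bsub>tensor A B\<^esub> y = tensor_rel A B +>\<^bsub>pretensor A B\<^esub> (p + p')"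
      using T.quot_add[OF sub[OF p(1)] sub[OF p'(1)]] p p' by (simp add: tensor_def)
    ultimately show "x \<oplus>\<^bsub>tensor A B\<^esub> y \<in> homog (tensor A B) \<gamma>" unfolding tensor_homog by blast
  qed
qed

lemma pure_homog:
  assumes "a \<in> homog A \<alpha>" "b \<in> homog B \<beta>"
  shows "pure_tensor A B a b \<in> homog (tensor A B) (\<alpha> + \<beta>)"
proof -
  have "\<alpha> + \<beta> - \<alpha> = \<beta>" by (cases \<alpha>; cases \<beta>) auto
  then have "(a, b) \<in> homog A \<alpha> \<times> homog B (\<alpha> + \<beta> - \<alpha>)" using assms by simp
  then have "(a, b) \<in> (\<Union>\<alpha>'. homog A \<alpha>' \<times> homog B (\<alpha> + \<beta> - \<alpha>'))" by (rule UN_I[OF UNIV_I])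
  then have "Poly_Mapping.single (a, b) 1 \<in> homog (pretensor A B) (\<alpha> + \<beta>)"
    unfolding pretensor_simps by simp
  then show ?thesis unfolding tensor_homog pure_tensor_def by blast
qed

end

text \<open>Keeps sums and products of degrees in ring notation, in which sign rules such as
  \<open>sgn2_add\<close> are stated.\<close>

declare add_bit_eq_xor [simp del] mult_bit_eq_and [simp del]

section \<open>Double sums, the associator of tensor products, and the ground field\<close>

lemma (in abelian_monoid) finsum_cong2:
  assumes "\<And>i j. i \<in> S \<Longrightarrow> j \<in> T \<Longrightarrow> f i j = g i j"
    "\<And>i j. i \<in> S \<Longrightarrow> j \<in> T \<Longrightarrow> g i j \<in> carrier G"
  shows "(\<Oplus>i\<in>S. \<Oplus>j\<in>T. f i j) = (\<Oplus>i\<in>S. \<Oplus>j\<in>T. g i j)"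
proof (rule finsum_cong'[OF refl])
  show "(\<lambda>i. \<Oplus>j\<in>T. g i j) \<in> S \<rightarrow> carrier G"
    using assms(2) by (intro funcsetI finsum_closed) auto
  show "(\<Oplus>j\<in>T. f i j) = (\<Oplus>j\<in>T. g i j)" if "i \<in> S" for i
    by (rule finsum_cong'[OF refl]) (use that assms in auto)
qed

lemma (in kspace) smult_finsum2:
  assumes "finite S" "finite T" "\<And>i j. i \<in> S \<Longrightarrow> j \<in> T \<Longrightarrow> f i j \<in> carrier A"
  shows "c \<odot> (\<Oplus>i\<in>S. \<Oplus>j\<in>T. f i j) = (\<Oplus>i\<in>S. \<Oplus>j\<in>T. c \<odot> f i j)"
proof -
  have "c \<odot> (\<Oplus>i\<in>S. \<Oplus>j\<in>T. f i j) = (\<Oplus>i\<in>S. c \<odot> (\<Oplus>j\<in>T. f i j))"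
    using assms by (intro smult_finsum funcsetI finsum_closed) auto
  also have "\<dots> = (\<Oplus>i\<in>S. \<Oplus>j\<in>T. c \<odot> f i j)"
  proof (rule finsum_cong'[OF refl])
    show "(\<lambda>i. \<Oplus>j\<in>T. c \<odot> f i j) \<in> S \<rightarrow> carrier A"
      using assms(3) by (intro funcsetI finsum_closed) auto
    show "c \<odot> (\<Oplus>j\<in>T. f i j) = (\<Oplus>j\<in>T. c \<odot> f i j)" if "i \<in> S" for i
      using that assms by (intro smult_finsum) auto
  qed
  finally show ?thesis .
qed

lemma (in kalg) finsum_mult_finsum:
  assumes "\<And>i. i \<in> S \<Longrightarrow> f i \<in> carrier A" "\<And>j. j \<in> T \<Longrightarrow> g j \<in> carrier A"
  shows "(\<Oplus>i\<in>S. f i) \<otimes> (\<Oplus>j\<in>T. g j) = (\<Oplus>i\<in>S. \<Oplus>j\<in>T. f i \<otimes> g j)"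
proof -
  have g: "(\<Oplus>j\<in>T. g j) \<in> carrier A" using assms(2) by (intro finsum_closed) auto
  have "(\<Oplus>i\<in>S. f i) \<otimes> (\<Oplus>j\<in>T. g j) = (\<Oplus>i\<in>S. f i \<otimes> (\<Oplus>j\<in>T. g j))"
    by (rule finsum_mult_left[OF assms(1) g])
  also have "\<dots> = (\<Oplus>i\<in>S. \<Oplus>j\<in>T. f i \<otimes> g j)"
  proof (rule finsum_cong'[OF refl])
    show "(\<lambda>i. \<Oplus>j\<in>T. f i \<otimes> g j) \<in> S \<rightarrow> carrier A"
      using assms by (intro funcsetI finsum_closed mult_closed) auto
    show "f i \<otimes> (\<Oplus>j\<in>T. g j) = (\<Oplus>j\<in>T. f i \<otimes> g j)" if "i \<in> S" for i
      using that assms by (intro finsum_mult_right) auto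
  qed
  finally show ?thesis .
qed

lemma tensor_assoc_props:
  assumes "kspace A" "kspace B" "kspace C"
  shows "tensor_assoc A B C \<in> klin (tensor (tensor A B) C) (tensor A (tensor B C))"
    and "\<And>a b c. a \<in> carrier A \<Longrightarrow> b \<in> carrier B \<Longrightarrow> c \<in> carrier C \<Longrightarrow>
      tensor_assoc A B C (pure_tensor (tensor A B) C (pure_tensor A B a b) c)
        = pure_tensor A (tensor B C) a (pure_tensor B C b c)"
proof -
  interpret AB: ktensor A B by (intro ktensor.intro assms)
  interpret BC: ktensor B C by (intro ktensor.intro assms)
  interpret AB_C: ktensor "tensor A B" C by (intro ktensor.intro assms AB.tensor_kspace)
  interpret A_BC: ktensor A "tensor B C" by (intro ktensor.intro assms BC.tensor_kspace)
  let ?M = "tensor A (tensor B C)"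
  interpret M: kspace ?M by (rule A_BC.tensor_kspace)
  define \<phi> where "\<phi> c a b = pure_tensor A (tensor B C) a (pure_tensor B C b c)" for c a b
  define \<psi> where "\<psi> U c = tensor_lift ?M (\<phi> c) U" for U c
  note p1 = bilinD[OF BC.bilin_pure] and p2 = bilinD[OF A_BC.bilin_pure]
  have \<phi>: "bilin A B ?M (\<phi> c)" if "c \<in> carrier C" for c
    unfolding bilin_def \<phi>_def
    using p2(1)[OF BC.pure_closed[OF _ that]] klin_comp[OF p1(1)[OF that] p2(2)] by blast
  have \<psi>1: "(\<lambda>U. \<psi> U c) \<in> klin (tensor A B) ?M" if "c \<in> carrier C" for c
    unfolding \<psi>_def by (rule AB.tensor_lift_klin[OF M.kspace_axioms \<phi>[OF that]])
  have \<psi>p: "\<psi> (pure_tensor A B a b) c = \<phi> c a b" if "a \<in> carrier A" "b \<in> carrier B" "c \<in> carrier C" for a b c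
    unfolding \<psi>_def by (rule AB.tensor_lift_pure[OF M.kspace_axioms \<phi>[OF that(3)] that(1,2)])
  \<comment> \<open>Linearity in \<open>c\<close> is visible only for pure tensors \<open>U\<close>.
    It carries over to all \<open>U\<close> by induction over the span, because \<psi> is linear in
    \<open>U\<close>.\<close>
  have \<psi>2: "\<psi> U \<in> klin C ?M" if "U \<in> carrier (tensor A B)" for U
  proof -
    have "U \<in> lspan (tensor A B) {pure_tensor A B a b | a b. a \<in> carrier A \<and> b \<in> carrier B}"
      using that AB.tensor_span by simp
    then have "U \<in> carrier (tensor A B) \<and> \<psi> U \<in> klin C ?M"
    proof induction
      case (base U)
      then obtain a b where U: "U = pure_tensor A B a b" "a \<in> carrier A" "b \<in> carrier B" by blast
      have "\<phi> c a b = pure_tensor A (tensor B C) a (pure_tensor B C b c)" for c by (simp add: \<phi>_def)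
      then have "\<psi> U \<in> klin C ?M"
        using klin_cong[OF klin_comp[OF p1(2)[OF U(3)] p2(2)[OF U(2)]] assms(3), of "\<psi> U"] U(1) \<psi>p[OF U(2,3)]
        by simp
      then show ?case using AB.pure_closed[OF U(2,3)] U(1) by simp
    next
      case zero
      have "(\<lambda>c. \<zero>\<^bsub>?M\<^esub>) \<in> klin C ?M" by (rule klinI) auto
      moreover have "\<psi> \<zero>\<^bsub>tensor A B\<^esub> c = \<zero>\<^bsub>?M\<^esub>" if "c \<in> carrier C" for c
        by (rule klin_zero[OF AB.tensor_kspace M.kspace_axioms \<psi>1[OF that]])
      ultimately show ?case by (simp add: AB_C.A.zero_closed klin_cong[OF _ assms(3)])
    next
      case (add U W)
      then show ?case
        using klinD(2)[OF \<psi>1] klin_cong[OF klin_add[OF assms(3) M.kspace_axioms, of "\<psi> U" "\<psi> W"] assms(3), of "\<psi> (U \<oplus>\<^bsub>tensor A B\<^esub> W)"]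
        by (simp add: AB_C.A.a_closed)
    next
      case (smult U r)
      then show ?case
        using klinD(3)[OF \<psi>1] klin_cong[OF klin_smult[OF assms(3) M.kspace_axioms, of "\<psi> U" r] assms(3), of "\<psi> (r \<odot>\<^bsub>tensor A B\<^esub> U)"]
        by (simp add: AB_C.A.smult_closed')
    qed
    then show ?thesis ..
  qed
  have bil: "bilin (tensor A B) C ?M \<psi>" unfolding bilin_def using \<psi>1 \<psi>2 by blast
  have eq: "tensor_assoc A B C = tensor_lift ?M \<psi>"
    by (simp add: tensor_assoc_def \<psi>_def[abs_def] \<phi>_def[abs_def])
  show "tensor_assoc A B C \<in> klin (tensor (tensor A B) C) ?M"
    unfolding eq by (rule AB_C.tensor_lift_klin[OF M.kspace_axioms bil])
  show "tensor_assoc A B C (pure_tensor (tensor A B) C (pure_tensor A B a b) c)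
        = pure_tensor A (tensor B C) a (pure_tensor B C b c)"
    if "a \<in> carrier A" "b \<in> carrier B" "c \<in> carrier C" for a b c
    unfolding eq AB_C.tensor_lift_pure[OF M.kspace_axioms bil AB.pure_closed[OF that(1,2)] that(3)]
      \<psi>p[OF that] \<phi>_def ..
qed

lemma base_superalg_simps [simp]:
  "carrier base_superalg = UNIV" "monoid.mult base_superalg = (*)" "one base_superalg = 1"
  "zero base_superalg = 0" "add base_superalg = (+)" "module.smult base_superalg = (*)"
  "homog base_superalg \<alpha> = (if \<alpha> = 0 then UNIV else {0})"
  by (simp_all add: base_superalg_def)

lemma base_kspace: "kspace (base_superalg :: ('k::field, 'k) superalg)"
proof (rule kspaceI)
  show "abelian_group (base_superalg :: ('k, 'k) superalg)"
    by (rule abelian_groupI) (auto simp: add.assoc add.commute intro: exI[of _ "- _"])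
qed (auto simp: algebra_simps)

section \<open>Superalgebras spanned by a multiplicative matrix coalgebra\<close>

text \<open>After the sign change \<open>u\<^sub>i\<^sub>j = \<sigma>(\<eta>\<^sub>i, \<eta>\<^sub>i + \<eta>\<^sub>j) t\<^sub>i\<^sub>j\<close> the comultiplication becomes \<open>\<Delta>(u\<^sub>i\<^sub>j) = \<Sum>\<^sub>k u\<^sub>i\<^sub>k \<otimes> u\<^sub>k\<^sub>j\<close>.
  The monomials in the \<open>u\<^sub>i\<^sub>j\<close>, indexed by multi-indices \<open>J\<close>, \<open>K\<close> and with suitable signs, are the matrix
  elements \<open>w J K\<close> of the tensor powers of the corresponding comodule: again
  \<open>\<Delta>(w J K) = \<Sum>\<^sub>M w J M \<otimes> w M K\<close>. They span the algebra, so every linear identity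
  involving \<open>\<Delta>\<close>, \<open>\<epsilon>\<close>, \<open>S\<close> has to be checked on them only.\<close>

definition mdeg :: "('i \<Rightarrow> bit) \<Rightarrow> 'i list \<Rightarrow> bit"
  where "mdeg d J = (\<Sum>i\<leftarrow>J. d i)"

lemma mdeg_simps [simp]:
  "mdeg d [] = 0" "mdeg d (i # J) = d i + mdeg d J" "mdeg d (J @ K) = mdeg d J + mdeg d K"
  by (simp_all add: mdeg_def)

definition mwords :: "'i set \<Rightarrow> nat \<Rightarrow> 'i list set"
  where "mwords I l = {J. set J \<subseteq> I \<and> length J = l}"

lemma finite_mwords: "finite I \<Longrightarrow> finite (mwords I l)"
  unfolding mwords_def by (rule finite_lists_length_eq)

lemma mwords_0 [simp]: "mwords I 0 = {[]}"
  by (auto simp: mwords_def)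

lemma mwords_add: "mwords I (l + l') = (\<lambda>p. fst p @ snd p) ` (mwords I l \<times> mwords I l')"
proof (intro equalityI subsetI)
  fix J assume "J \<in> mwords I (l + l')"
  then have "J = take l J @ drop l J" "take l J \<in> mwords I l" "drop l J \<in> mwords I l'"
    using set_take_subset[of l J] set_drop_subset[of l J] by (auto simp: mwords_def)
  then show "J \<in> (\<lambda>p. fst p @ snd p) ` (mwords I l \<times> mwords I l')"
    by (intro image_eqI[of _ _ "(take l J, drop l J)"]) auto
qed (auto simp: mwords_def)

lemma (in abelian_monoid) finsum_mwords_add:
  assumes "finite I" "\<And>J J'. J \<in> mwords I l \<Longrightarrow> J' \<in> mwords I l' \<Longrightarrow> f (J @ J') \<in> carrier G"
  shows "(\<Oplus>J\<in>mwords I (l + l'). f J) = (\<Oplus>J\<in>mwords I l. \<Oplus>J'\<in>mwords I l'. f (J @ J'))"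
proof -
  have "inj_on (\<lambda>p. fst p @ snd p) (mwords I l \<times> mwords I l')"
    by (auto simp: inj_on_def mwords_def)
  then have "(\<Oplus>J\<in>mwords I (l + l'). f J) = (\<Oplus>p\<in>mwords I l \<times> mwords I l'. f (fst p @ snd p))"
    unfolding mwords_add by (subst finsum_reindex) (use assms(2) in auto)
  also have "\<dots> = (\<Oplus>J\<in>mwords I l. \<Oplus>J'\<in>mwords I l'. f (J @ J'))"
    by (rule finsum_cartesian) (use assms finite_mwords in auto)
  finally show ?thesis .
qed

lemma (in abelian_monoid) finsum_mwords_1:
  assumes "\<And>i. i \<in> I \<Longrightarrow> f [i] \<in> carrier G"
  shows "(\<Oplus>J\<in>mwords I 1. f J) = (\<Oplus>i\<in>I. f [i])"
proof -
  have "mwords I 1 = (\<lambda>i. [i]) ` I"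
    by (auto simp: mwords_def length_Suc_conv)
  moreover have "(\<Oplus>J\<in>(\<lambda>i. [i]) ` I. f J) = (\<Oplus>i\<in>I. f [i])"
    by (rule finsum_reindex) (use assms in \<open>auto simp: inj_on_def\<close>)
  ultimately show ?thesis by simp
qed

text \<open>\<open>hpart A \<alpha>\<close> fixes the generators of degree \<alpha> and kills those
  of the other degree. Applied to a linear combination of generators that represents
  \<open>x\<close>, it leaves \<open>x\<close> unchanged and removes the unwanted
  generators.\<close>

lemma (in superalgebra) homog_span:
  assumes "carrier A = lspan A V" "V \<subseteq> (\<Union>\<alpha>. homog A \<alpha>)" "x \<in> homog A \<alpha>"
  shows "x \<in> lspan A (V \<inter> homog A \<alpha>)"
proof -
  have V: "V \<subseteq> carrier A" using assms(1) lspan.base[of _ V A] by auto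
  have "hpart A \<alpha> v \<in> lspan A (V \<inter> homog A \<alpha>)" if v: "v \<in> V" for v
  proof -
    obtain \<beta> where b: "v \<in> homog A \<beta>" using assms(2) v by auto
    show ?thesis
    proof (cases "\<beta> = \<alpha>")
      case True
      then show ?thesis using v b by (intro lspan.base) auto
    qed (use b in \<open>simp add: hpart_other lspan.zero\<close>)
  qed
  then have "hpart A \<alpha> x \<in> lspan A (V \<inter> homog A \<alpha>)"
    by (rule klin_span_image[OF kspace_axioms kspace_axioms hpart_klin V
          homog_carrier[OF assms(3), unfolded assms(1)]])
  then show ?thesis using assms(3) by simp
qed

lemma (in superalgebra) klin_graded:
  assumes "carrier A = lspan A V" "V \<subseteq> (\<Union>\<alpha>. homog A \<alpha>)" "kspace M" "f \<in> klin A M"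
    "submodule H (ring_of_type_algebra :: 'k ring) M"
    "\<And>v. v \<in> V \<Longrightarrow> v \<in> homog A \<alpha> \<Longrightarrow> f v \<in> H" "x \<in> homog A \<alpha>"
  shows "f x \<in> H"
proof -
  note sub = kspace.submoduleD[OF assms(3,5)]
  have V: "V \<subseteq> carrier A" using assms(1) lspan.base[of _ V A] by auto
  have "x \<in> carrier A \<and> f x \<in> H"
    using homog_span[OF assms(1,2,7)]
  proof induction
    case zero
    then show ?case using klin_zero[OF kspace_axioms assms(3,4)] sub(2) by simp
  qed (use V assms(6) sub klinD[OF assms(4)] in auto)
  then show ?thesis ..
qed

locale matalg = superalgebra A
  for A :: "('k::field, 'a, 'x) superalg_scheme" (structure) +
  fixes I :: "'i set" and d :: "'i \<Rightarrow> bit" and w :: "'i list \<Rightarrow> 'i list \<Rightarrow> 'a"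
  assumes finite_I: "finite I"
    and w_homog: "\<lbrakk>J \<in> mwords I l; K \<in> mwords I l\<rbrakk> \<Longrightarrow> w J K \<in> homog A (mdeg d J + mdeg d K)"
    and w_mult: "\<lbrakk>J \<in> mwords I l; K \<in> mwords I l; J' \<in> mwords I l'; K' \<in> mwords I l'\<rbrakk> \<Longrightarrow>
      w J K \<otimes> w J' K' = sgn2 (mdeg d J + mdeg d K) (mdeg d J') \<odot> w (J @ J') (K @ K')"
    and w_Nil: "w [] [] = \<one>"
    and w_span: "carrier A = lspan A {w J K | J K l. J \<in> mwords I l \<and> K \<in> mwords I l}"
begin

abbreviation "wset \<equiv> {w J K | J K l. J \<in> mwords I l \<and> K \<in> mwords I l}"

lemma w_closed: "\<lbrakk>J \<in> mwords I l; K \<in> mwords I l\<rbrakk> \<Longrightarrow> w J K \<in> carrier A"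
  using w_homog homog_carrier by blast

lemma wset_homog: "wset \<subseteq> (\<Union>\<alpha>. homog A \<alpha>)"
  using w_homog by blast

lemma wset_carrier: "wset \<subseteq> carrier A"
  using w_closed by blast

lemma klin_eq_w:
  assumes "kspace M" "f \<in> klin A M" "g \<in> klin A M"
    "\<And>J K l. J \<in> mwords I l \<Longrightarrow> K \<in> mwords I l \<Longrightarrow> f (w J K) = g (w J K)" "x \<in> carrier A"
  shows "f x = g x"
  by (rule klin_eq_on_span[OF kspace_axioms assms(1-3) wset_carrier])
    (use assms(4,5) w_span in auto)

lemma bilinear_eq_w:
  assumes "kspace M"
    and f: "\<And>y. y \<in> carrier A \<Longrightarrow> (\<lambda>x. f x y) \<in> klin A M" "\<And>x. x \<in> carrier A \<Longrightarrow> f x \<in> klin A M"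
    and g: "\<And>y. y \<in> carrier A \<Longrightarrow> (\<lambda>x. g x y) \<in> klin A M" "\<And>x. x \<in> carrier A \<Longrightarrow> g x \<in> klin A M"
    and eq: "\<And>J K l J' K' l'. J \<in> mwords I l \<Longrightarrow> K \<in> mwords I l \<Longrightarrow> J' \<in> mwords I l' \<Longrightarrow> K' \<in> mwords I l' \<Longrightarrow>
      f (w J K) (w J' K') = g (w J K) (w J' K')"
    and "x \<in> carrier A" "y \<in> carrier A"
  shows "f x y = g x y"
  by (rule bilinear_eq_on_span[OF kspace_axioms kspace_axioms assms(1) w_span w_span f g])
    (use eq assms(6-) in auto)

lemma klin_graded_w:
  assumes "kspace M" "f \<in> klin A M" "\<And>\<alpha>. submodule (H \<alpha>) (ring_of_type_algebra :: 'k ring) M"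
    "\<And>J K l. J \<in> mwords I l \<Longrightarrow> K \<in> mwords I l \<Longrightarrow> f (w J K) \<in> H (mdeg d J + mdeg d K)"
    "x \<in> homog A \<alpha>"
  shows "f x \<in> H \<alpha>"
proof (rule klin_graded[OF w_span wset_homog assms(1,2) assms(3) _ assms(5)])
  fix v assume v: "v \<in> wset" "v \<in> homog A \<alpha>"
  then obtain J K l where J: "J \<in> mwords I l" "K \<in> mwords I l" "v = w J K" by blast
  show "f v \<in> H \<alpha>"
  proof (cases "mdeg d J + mdeg d K = \<alpha>")
    case True
    then show ?thesis using assms(4)[OF J(1,2)] J(3) by simp
  next
    case False
    then have "v = \<zero>" using hpart_other[OF w_homog[OF J(1,2)] False] hpart_same[OF v(2)] J(3) by simp
    then show ?thesis
      using klin_zero[OF kspace_axioms assms(1,2)] kspace.submoduleD(2)[OF assms(1,3)] by simp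
  qed
qed

lemma w_Cons:
  assumes "J \<in> mwords I l" "K \<in> mwords I l" "i \<in> I" "k \<in> I"
  shows "w (i # J) (k # K) = sgn2 (d i + d k) (mdeg d J) \<odot> (w [i] [k] \<otimes> w J K)"
proof -
  have s: "[i] \<in> mwords I 1" "[k] \<in> mwords I 1" using assms by (auto simp: mwords_def)
  have "w ([i] @ J) ([k] @ K) \<in> carrier A"
    using assms by (intro w_closed[of _ "Suc l"]) (auto simp: mwords_def)
  then show ?thesis using w_mult[OF s assms(1,2)] by simp
qed

text \<open>The premise on products only asks that agreement on the factors implies agreement on the
  product. It thus covers homomorphisms (\<open>mult_maps_eq_hom\<close>) as well as
  antihomomorphisms (\<open>antihom_unique\<close>).\<close>

lemma mult_maps_eq:
  assumes "kspace M" "f \<in> klin A M" "g \<in> klin A M" "f \<one> = g \<one>"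
    "\<And>i k. i \<in> I \<Longrightarrow> k \<in> I \<Longrightarrow> f (w [i] [k]) = g (w [i] [k])"
    "\<And>i k J K l. \<lbrakk>i \<in> I; k \<in> I; J \<in> mwords I l; K \<in> mwords I l; f (w J K) = g (w J K)\<rbrakk> \<Longrightarrow>
      f (w [i] [k] \<otimes> w J K) = g (w [i] [k] \<otimes> w J K)"
    "x \<in> carrier A"
  shows "f x = g x"
proof -
  have "f (w J K) = g (w J K)" if "J \<in> mwords I l" "K \<in> mwords I l" for J K l
    using that
  proof (induction l arbitrary: J K)
    case 0
    then show ?case using assms(4) by (simp add: w_Nil)
  next
    case (Suc l)
    then obtain i J' k K' where J: "J = i # J'" "K = k # K'" "i \<in> I" "k \<in> I" "J' \<in> mwords I l" "K' \<in> mwords I l"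
      by (auto simp: mwords_def length_Suc_conv)
    have c: "w [i] [k] \<otimes> w J' K' \<in> carrier A"
      using J by (intro mult_closed w_closed[of _ 1] w_closed[of _ l]) (auto simp: mwords_def)
    show ?case
      unfolding J(1,2) w_Cons[OF J(5,6,3,4)]
      using assms(6)[OF J(3-6) Suc.IH[OF J(5,6)]] klinD(3)[OF assms(2) c] klinD(3)[OF assms(3) c] by simp
  qed
  then show ?thesis using klin_eq_w[OF assms(1-3)] assms(7) by blast
qed

end

lemma superalg_homI:
  assumes "f \<in> klin A B" "\<And>x \<alpha>. x \<in> homog A \<alpha> \<Longrightarrow> f x \<in> homog B \<alpha>"
    "\<And>x y. x \<in> carrier A \<Longrightarrow> y \<in> carrier A \<Longrightarrow> f (x \<otimes>\<^bsub>A\<^esub> y) = f x \<otimes>\<^bsub>B\<^esub> f y" "f \<one>\<^bsub>A\<^esub> = \<one>\<^bsub>B\<^esub>"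
  shows "f \<in> superalg_hom A B"
proof -
  have "f \<in> ring_hom A B"
    by (rule ring_hom_memI) (fact klinD(1)[OF assms(1)] klinD(2)[OF assms(1)] assms(3,4))+
  then show ?thesis using assms(1,2) by (simp add: superalg_hom_def superlinear_iff)
qed

lemma superalg_homD:
  assumes "f \<in> superalg_hom A B"
  shows "f \<in> klin A B" "f \<one>\<^bsub>A\<^esub> = \<one>\<^bsub>B\<^esub>"
    "\<And>x y. x \<in> carrier A \<Longrightarrow> y \<in> carrier A \<Longrightarrow> f (x \<otimes>\<^bsub>A\<^esub> y) = f x \<otimes>\<^bsub>B\<^esub> f y"
    "\<And>x \<alpha>. x \<in> homog A \<alpha> \<Longrightarrow> f x \<in> homog B \<alpha>"
  using assms by (auto simp: superalg_hom_def superlinear_iff ring_hom_one ring_hom_mult)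

lemma superalg_antihomD:
  assumes "f \<in> superalg_antihom A B"
  shows "f \<in> klin A B" "f \<one>\<^bsub>A\<^esub> = \<one>\<^bsub>B\<^esub>"
    "\<And>x y \<alpha> \<beta>. x \<in> homog A \<alpha> \<Longrightarrow> y \<in> homog A \<beta> \<Longrightarrow>
      f (x \<otimes>\<^bsub>A\<^esub> y) = sgn2 \<alpha> \<beta> \<odot>\<^bsub>B\<^esub> (f y \<otimes>\<^bsub>B\<^esub> f x)"
    "\<And>x \<alpha>. x \<in> homog A \<alpha> \<Longrightarrow> f x \<in> homog B \<alpha>"
  using assms by (auto simp: superalg_antihom_def superlinear_iff)

text \<open>The matrix \<open>v\<close> multiplied with itself, products of entries being pure
  tensors. For the family \<open>w\<close> of a bi-superalgebra this is the value of the
  comultiplication on \<open>w J K\<close>.\<close>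

definition comat :: "('k::field, 'a, 'x) superalg_scheme \<Rightarrow> 'i set \<Rightarrow> ('i list \<Rightarrow> 'i list \<Rightarrow> 'a)
    \<Rightarrow> 'i list \<Rightarrow> 'i list \<Rightarrow> ('a \<times> 'a \<Rightarrow>\<^sub>0 'k) set"
  where "comat A I v J K = (\<Oplus>\<^bsub>tensor A A\<^esub>M\<in>mwords I (length J). pure_tensor A A (v J M) (v M K))"

lemma sgn2_add: "sgn2 (a + b) c = (sgn2 a c * sgn2 b c :: 'r::ring_1)" "sgn2 c (a + b) = (sgn2 c a * sgn2 c b :: 'r)"
  by (cases a; cases b; cases c; simp add: sgn2_def)+

lemma sgn2_commute: "sgn2 a b = sgn2 b a"
  by (simp add: sgn2_def mult.commute)

text \<open>Write |J| for \<open>mdeg d J\<close>. The product in the tensor square contributes the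
  sign exponent (|M|+|K|)(|J'|+|M'|), and the two uses of \<open>w_mult\<close> contribute
  (|J|+|M|)|J'| and (|M|+|K|)|M'|. Modulo two the total is (|J|+|K|)|J'|, the sign of
  \<open>w_mult\<close>, whatever M and M' are. Source and target may differ: the lemma serves the
  maps from the free superalgebra to the tensor square of \<open>A(R)\<close> and from
  \<open>A(R)\<close> to that of its quotient.\<close>

lemma matalg_comult_hom:
  fixes A :: "('k::field, 'a, 'x) superalg_scheme" and C :: "('k, 'c, 'y) superalg_scheme"
  assumes "matalg A I d w" "matalg C I d v"
    and D: "D \<in> klin A (tensor C C)"
    and Dw: "\<And>J K l. J \<in> mwords I l \<Longrightarrow> K \<in> mwords I l \<Longrightarrow> D (w J K) = comat C I v J K"
  shows "D \<in> superalg_hom A (tensor C C)"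
proof -
  interpret A: matalg A I d w by fact
  interpret C: matalg C I d v by fact
  interpret T: graded_tensor C C
    by (intro graded_tensor.intro C.superalgebra_axioms)
  let ?T = "tensor C C"
  interpret CC: kalg ?T by (rule T.tensor_kalg)
  have pc: "pure_tensor C C (v J M) (v M K) \<in> carrier ?T"
    if "J \<in> mwords I l" "K \<in> mwords I l" "M \<in> mwords I l" for J K M l
    using that C.w_closed by (intro T.pure_closed) auto
  have one: "D \<one>\<^bsub>A\<^esub> = \<one>\<^bsub>?T\<^esub>"
    using Dw[of "[]" 0 "[]"] T.tensor_one pc[of "[]" 0 "[]" "[]"]
    by (simp add: A.w_Nil C.w_Nil comat_def)
  have D2: "D (w J K \<otimes>\<^bsub>A\<^esub> w J' K') = D (w J K) \<otimes>\<^bsub>?T\<^esub> D (w J' K')"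
    if m: "J \<in> mwords I l" "K \<in> mwords I l" "J' \<in> mwords I l'" "K' \<in> mwords I l'" for J K l J' K' l'
  proof -
    have len: "length J = l" "length J' = l'" using m by (auto simp: mwords_def)
    have app: "M @ M' \<in> mwords I (l + l')" if "M \<in> mwords I l" "M' \<in> mwords I l'" for M M'
      using that by (auto simp: mwords_def)
    have pc2: "pure_tensor C C (v (J @ J') (M @ M')) (v (M @ M') (K @ K')) \<in> carrier ?T"
      if "M \<in> mwords I l" "M' \<in> mwords I l'" for M M'
      using that m by (intro pc[of _ "l + l'"] app)
    let ?s = "sgn2 (mdeg d J + mdeg d K) (mdeg d J') :: 'k"
    have pm: "pure_tensor C C (v J M) (v M K) \<otimes>\<^bsub>?T\<^esub> pure_tensor C C (v J' M') (v M' K')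
        = ?s \<odot>\<^bsub>?T\<^esub> pure_tensor C C (v (J @ J') (M @ M')) (v (M @ M') (K @ K'))"
      if M: "M \<in> mwords I l" "M' \<in> mwords I l'" for M M'
    proof -
      note cl = C.w_closed[OF app[OF m(1,3)] app[OF M]] C.w_closed[OF app[OF M] app[OF m(2,4)]]
      note p1 = klinD(3)[OF bilinD(1)[OF T.bilin_pure]] and p2 = klinD(3)[OF bilinD(2)[OF T.bilin_pure]]
      have "pure_tensor C C (v J M) (v M K) \<otimes>\<^bsub>?T\<^esub> pure_tensor C C (v J' M') (v M' K')
        = sgn2 (mdeg d M + mdeg d K) (mdeg d J' + mdeg d M') \<odot>\<^bsub>?T\<^esub>
          pure_tensor C C (v J M \<otimes>\<^bsub>C\<^esub> v J' M') (v M K \<otimes>\<^bsub>C\<^esub> v M' K')"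
        using M m by (intro T.pure_mult_homog C.w_homog[of _ l] C.w_homog[of _ l'] C.w_closed[of _ l] C.w_closed[of _ l'])
      also have "\<dots> = (sgn2 (mdeg d M + mdeg d K) (mdeg d J' + mdeg d M')
          * (sgn2 (mdeg d J + mdeg d M) (mdeg d J') * sgn2 (mdeg d M + mdeg d K) (mdeg d M'))) \<odot>\<^bsub>?T\<^esub>
          pure_tensor C C (v (J @ J') (M @ M')) (v (M @ M') (K @ K'))"
        unfolding C.w_mult[OF m(1) M(1) m(3) M(2)] C.w_mult[OF M(1) m(2) M(2) m(4)]
        using cl pc2[OF M] by (simp add: p1 p2 mult.assoc mult.commute mult.left_commute)
      also have "sgn2 (mdeg d M + mdeg d K) (mdeg d J' + mdeg d M')
          * (sgn2 (mdeg d J + mdeg d M) (mdeg d J') * sgn2 (mdeg d M + mdeg d K) (mdeg d M')) = ?s"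
        by (cases "mdeg d M"; cases "mdeg d K"; cases "mdeg d J'"; cases "mdeg d M'"; cases "mdeg d J";
            simp add: sgn2_def)
      finally show ?thesis .
    qed
    have f: "finite (mwords I l)" "finite (mwords I l')" using C.finite_I finite_mwords by auto
    have "D (w J K \<otimes>\<^bsub>A\<^esub> w J' K') = ?s \<odot>\<^bsub>?T\<^esub> comat C I v (J @ J') (K @ K')"
      unfolding A.w_mult[OF m] using klinD(3)[OF D A.w_closed[OF app[OF m(1,3)] app[OF m(2,4)]]]
        Dw[OF app[OF m(1,3)] app[OF m(2,4)]] by simp
    also have "\<dots> = ?s \<odot>\<^bsub>?T\<^esub> (\<Oplus>\<^bsub>?T\<^esub>M\<in>mwords I l. \<Oplus>\<^bsub>?T\<^esub>M'\<in>mwords I l'.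
        pure_tensor C C (v (J @ J') (M @ M')) (v (M @ M') (K @ K')))"
      unfolding comat_def length_append len by (subst CC.finsum_mwords_add[OF C.finite_I]) (auto intro: pc2)
    also have "\<dots> = (\<Oplus>\<^bsub>?T\<^esub>M\<in>mwords I l. \<Oplus>\<^bsub>?T\<^esub>M'\<in>mwords I l'.
        ?s \<odot>\<^bsub>?T\<^esub> pure_tensor C C (v (J @ J') (M @ M')) (v (M @ M') (K @ K')))"
      by (rule CC.smult_finsum2[OF f pc2])
    also have "\<dots> = (\<Oplus>\<^bsub>?T\<^esub>M\<in>mwords I l. \<Oplus>\<^bsub>?T\<^esub>M'\<in>mwords I l'.
        pure_tensor C C (v J M) (v M K) \<otimes>\<^bsub>?T\<^esub> pure_tensor C C (v J' M') (v M' K'))"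
      by (rule CC.finsum_cong2[OF pm[symmetric] CC.mult_closed[OF pc[OF m(1,2)] pc[OF m(3,4)]]])
    also have "\<dots> = D (w J K) \<otimes>\<^bsub>?T\<^esub> D (w J' K')"
      unfolding Dw[OF m(1,2)] Dw[OF m(3,4)] comat_def len
      by (rule CC.finsum_mult_finsum[OF pc[OF m(1,2)] pc[OF m(3,4)], symmetric])
    finally show ?thesis .
  qed
  have Dc: "D x \<in> carrier ?T" if "x \<in> carrier A" for x using klinD(1)[OF D that] .
  have mult: "D (x \<otimes>\<^bsub>A\<^esub> y) = D x \<otimes>\<^bsub>?T\<^esub> D y" if "x \<in> carrier A" "y \<in> carrier A" for x y
    by (rule A.bilinear_eq_w[OF CC.kspace_axioms klin_comp[OF A.klin_mult_left D] klin_comp[OF A.klin_mult_right D]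
          klin_comp[OF D CC.klin_mult_left[OF Dc]] klin_comp[OF D CC.klin_mult_right[OF Dc]] D2 that])
  have graded: "D x \<in> homog ?T \<alpha>" if "x \<in> homog A \<alpha>" for x \<alpha>
  proof (rule A.klin_graded_w[OF CC.kspace_axioms D T.tensor_homog_submodule _ that])
    fix J K l assume m: "J \<in> mwords I l" "K \<in> mwords I l"
    then have len: "length J = l" by (auto simp: mwords_def)
    have "pure_tensor C C (v J M) (v M K) \<in> homog ?T (mdeg d J + mdeg d K)" if "M \<in> mwords I l" for M
    proof -
      have "mdeg d J + mdeg d M + (mdeg d M + mdeg d K) = mdeg d J + mdeg d K"
        by (cases "mdeg d J"; cases "mdeg d M"; cases "mdeg d K") auto
      then show ?thesis
        using T.pure_homog[OF C.w_homog[OF m(1) that] C.w_homog[OF that m(2)]] by metis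
    qed
    then show "D (w J K) \<in> homog ?T (mdeg d J + mdeg d K)"
      unfolding Dw[OF m] comat_def len by (rule CC.finsum_in_submodule[OF T.tensor_homog_submodule])
  qed
  show ?thesis by (rule superalg_homI[OF D graded mult one])
qed

lemma matalg_counit_hom:
  assumes "matalg A I d w" and e: "e \<in> klin A base_superalg"
    and ew: "\<And>J K l. J \<in> mwords I l \<Longrightarrow> K \<in> mwords I l \<Longrightarrow> e (w J K) = of_bool (J = K)"
  shows "e \<in> superalg_hom A base_superalg"
proof -
  interpret A: matalg A I d w by fact
  interpret B: kspace base_superalg by (rule base_kspace)
  have one: "e \<one>\<^bsub>A\<^esub> = 1" using ew[of "[]" 0 "[]"] by (simp add: A.w_Nil)
  note em = klinD[OF e]
  have "e (x \<otimes>\<^bsub>A\<^esub> y) = e x * e y" if "x \<in> carrier A" "y \<in> carrier A" for x y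
  proof (rule A.bilinear_eq_w[OF B.kspace_axioms klin_comp[OF A.klin_mult_left e] klin_comp[OF A.klin_mult_right e] _ _ _ that])
    fix J K l J' K' l'
    assume m: "J \<in> mwords I l" "K \<in> mwords I l" "J' \<in> mwords I l'" "K' \<in> mwords I l'"
    have app: "J @ J' \<in> mwords I (l + l')" "K @ K' \<in> mwords I (l + l')" using m by (auto simp: mwords_def)
    have "J @ J' = K @ K' \<longleftrightarrow> J = K \<and> J' = K'" using m by (auto simp: mwords_def)
    moreover have "mdeg d K + mdeg d K = 0" by (cases "mdeg d K") auto
    ultimately show "e (w J K \<otimes>\<^bsub>A\<^esub> w J' K') = e (w J K) * e (w J' K')"
      unfolding A.w_mult[OF m] em(3)[OF A.w_closed[OF app]] ew[OF app] ew[OF m(1,2)] ew[OF m(3,4)]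
      by (auto simp: sgn2_def)
  qed (auto intro!: klinI simp: em algebra_simps)
  moreover have "e x \<in> homog base_superalg \<alpha>" if "x \<in> homog A \<alpha>" for x \<alpha>
  proof (rule A.klin_graded_w[OF B.kspace_axioms e _ _ that])
    show "submodule (homog base_superalg \<alpha>) ring_of_type_algebra base_superalg" for \<alpha>
      by (rule B.submoduleI') auto
    fix J K l assume "J \<in> mwords I l" "K \<in> mwords I l"
    moreover have "mdeg d K + mdeg d K = 0" by (cases "mdeg d K") auto
    ultimately show "e (w J K) \<in> homog base_superalg (mdeg d J + mdeg d K)"
      using ew by auto
  qed
  ultimately show ?thesis
    unfolding superalg_hom_def using e one by (auto simp: superlinear_iff em intro!: ring_hom_memI)
qed

text \<open>The sign of \<open>w_mult\<close> involves J' and that of \<open>v_mult\<close> involves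
  K'. Together they give the sign for the full degrees |J|+|K| and |J'|+|K'| that an
  antihomomorphism requires.\<close>

lemma matalg_antihom:
  assumes "matalg A I d w" "superalgebra C" and f: "f \<in> klin A C"
    and fw: "\<And>J K l. J \<in> mwords I l \<Longrightarrow> K \<in> mwords I l \<Longrightarrow> f (w J K) = v J K"
    and v_homog: "\<And>J K l. \<lbrakk>J \<in> mwords I l; K \<in> mwords I l\<rbrakk> \<Longrightarrow> v J K \<in> homog C (mdeg d J + mdeg d K)"
    and v_mult: "\<And>J K l J' K' l'. \<lbrakk>J \<in> mwords I l; K \<in> mwords I l; J' \<in> mwords I l'; K' \<in> mwords I l'\<rbrakk> \<Longrightarrow>
      v (J @ J') (K @ K') = sgn2 (mdeg d J + mdeg d K) (mdeg d K') \<odot>\<^bsub>C\<^esub> (v J' K' \<otimes>\<^bsub>C\<^esub> v J K)"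
    and v_Nil: "v [] [] = \<one>\<^bsub>C\<^esub>"
  shows "f \<in> superalg_antihom A C"
proof -
  interpret A: matalg A I d w by fact
  interpret C: superalgebra C by fact
  note fl = klinD[OF f]
  have one: "f \<one>\<^bsub>A\<^esub> = \<one>\<^bsub>C\<^esub>" using fw[of "[]" 0 "[]"] by (simp add: A.w_Nil v_Nil)
  have graded: "f x \<in> homog C \<alpha>" if "x \<in> homog A \<alpha>" for x \<alpha>
    by (rule A.klin_graded_w[OF C.kspace_axioms f C.homog_submodule _ that]) (simp only: fw v_homog)
  have anti: "f (x \<otimes>\<^bsub>A\<^esub> y) = sgn2 \<alpha> \<beta> \<odot>\<^bsub>C\<^esub> (f y \<otimes>\<^bsub>C\<^esub> f x)"
    if x: "x \<in> homog A \<alpha>" and y: "y \<in> homog A \<beta>" for x y \<alpha> \<beta>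
  proof -
    have 1: "f (x' \<otimes>\<^bsub>A\<^esub> y') = sgn2 \<alpha> \<beta> \<odot>\<^bsub>C\<^esub> (f y' \<otimes>\<^bsub>C\<^esub> f x')"
      if xy: "x' \<in> A.wset \<inter> homog A \<alpha>" "y' \<in> A.wset \<inter> homog A \<beta>" for x' y'
    proof -
      obtain J K l J' K' l' where m: "J \<in> mwords I l" "K \<in> mwords I l" "J' \<in> mwords I l'" "K' \<in> mwords I l'"
        "x' = w J K" "y' = w J' K'" using xy by blast
      have app: "J @ J' \<in> mwords I (l + l')" "K @ K' \<in> mwords I (l + l')" using m by (auto simp: mwords_def)
      have vc: "v J K \<in> carrier C" "v J' K' \<in> carrier C" using v_homog m C.homog_carrier by blast+
      have eq: "f (x' \<otimes>\<^bsub>A\<^esub> y') = sgn2 (mdeg d J + mdeg d K) (mdeg d J' + mdeg d K') \<odot>\<^bsub>C\<^esub> (f y' \<otimes>\<^bsub>C\<^esub> f x')"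
        unfolding m(5,6) A.w_mult[OF m(1-4)] fl(3)[OF A.w_closed[OF app]] fw[OF app] fw[OF m(1,2)] fw[OF m(3,4)]
          v_mult[OF m(1-4)] using vc by (simp add: sgn2_add)
      \<comment> \<open>A spanning element lies in a prescribed homogeneous part either because it
        has this degree or because it is zero; both cases have to be treated.\<close>
      consider "mdeg d J + mdeg d K = \<alpha>" "mdeg d J' + mdeg d K' = \<beta>" | "x' = \<zero>\<^bsub>A\<^esub>" | "y' = \<zero>\<^bsub>A\<^esub>"
        using A.hpart_other[OF A.w_homog[OF m(1,2)], of \<alpha>] A.hpart_other[OF A.w_homog[OF m(3,4)], of \<beta>]
          A.hpart_same[of x' \<alpha>] A.hpart_same[of y' \<beta>] m(5,6) xy by auto
      then show ?thesis
      proof cases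
        case 1
        then show ?thesis using eq by simp
      next
        case 2
        then show ?thesis
          using m klin_zero[OF A.kspace_axioms C.kspace_axioms f] fl(1) A.w_closed[OF m(3,4)]
          by (simp add: A.mult_zero C.mult_zero)
      next
        case 3
        then show ?thesis
          using m klin_zero[OF A.kspace_axioms C.kspace_axioms f] fl(1) A.w_closed[OF m(1,2)]
          by (simp add: A.mult_zero C.mult_zero)
      qed
    qed
    have sub: "A.wset \<inter> homog A \<gamma> \<subseteq> carrier A" for \<gamma> using A.wset_carrier by blast
    have xc: "x' \<in> carrier A" if "x' \<in> A.wset \<inter> homog A \<gamma>" for x' \<gamma> using sub that by blast
    have yc: "y \<in> carrier A" using y A.homog_carrier by blast
    have 2: "f (x' \<otimes>\<^bsub>A\<^esub> y) = sgn2 \<alpha> \<beta> \<odot>\<^bsub>C\<^esub> (f y \<otimes>\<^bsub>C\<^esub> f x')" if x': "x' \<in> A.wset \<inter> homog A \<alpha>" for x'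
      by (rule klin_eq_on_span[OF A.kspace_axioms C.kspace_axioms klin_comp[OF A.klin_mult_right[OF xc[OF x']] f]
            klin_smult[OF A.kspace_axioms C.kspace_axioms klin_comp[OF f C.klin_mult_left[OF fl(1)[OF xc[OF x']]]]]
            sub 1[OF x'] A.homog_span[OF A.w_span A.wset_homog y]])
    show ?thesis
      by (rule klin_eq_on_span[OF A.kspace_axioms C.kspace_axioms klin_comp[OF A.klin_mult_left[OF yc] f]
            klin_smult[OF A.kspace_axioms C.kspace_axioms klin_comp[OF f C.klin_mult_right[OF fl(1)[OF yc]]]]
            sub 2 A.homog_span[OF A.w_span A.wset_homog x]])
  qed
  show ?thesis
    unfolding superalg_antihom_def using f graded anti one by (auto simp: superlinear_iff)
qed

subsection \<open>Coalgebra axioms and antipodes\<close>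

context matalg
begin

lemma w_pure_closed:
  "\<lbrakk>J \<in> mwords I l; K \<in> mwords I l; M \<in> mwords I l\<rbrakk> \<Longrightarrow> pure_tensor A A (w J M) (w M K) \<in> carrier (tensor A A)"
  by (intro ktensor.pure_closed ktensor.intro kspace_axioms w_closed[of _ l])

lemma finite_mw: "finite (mwords I l)"
  by (rule finite_mwords[OF finite_I])

context
  fixes \<Delta> assumes \<Delta>: "\<Delta> \<in> klin A (tensor A A)"
    and \<Delta>w: "\<And>J K l. J \<in> mwords I l \<Longrightarrow> K \<in> mwords I l \<Longrightarrow> \<Delta> (w J K) = comat A I w J K"
begin

lemma klin_comat:
  assumes M: "kspace M" and f: "f \<in> klin (tensor A A) M" and JK: "J \<in> mwords I l" "K \<in> mwords I l"
  shows "f (\<Delta> (w J K)) = (\<Oplus>\<^bsub>M\<^esub>N\<in>mwords I l. f (pure_tensor A A (w J N) (w N K)))"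
proof -
  have "length J = l" using JK by (simp add: mwords_def)
  then show ?thesis
    unfolding \<Delta>w[OF JK] comat_def
    using klin_finsum[OF ktensor.tensor_kspace[OF ktensor.intro[OF kspace_axioms kspace_axioms]] M f
        w_pure_closed[OF JK]] by simp
qed

text \<open>On \<open>w J K\<close> both sides are the double sum of the triple tensors with factors
  \<open>w J N\<close>, \<open>w N M\<close>, \<open>w M K\<close>; only the order of summation
  differs.\<close>

lemma matalg_coassoc:
  assumes "x \<in> carrier A"
  shows "tensor_assoc A A A (tensor_map (tensor A A) A \<Delta> (\<lambda>y. y) (\<Delta> x)) =
    tensor_map A (tensor A A) (\<lambda>y. y) \<Delta> (\<Delta> x)"
proof -
  interpret AA: ktensor A A by (intro ktensor.intro kspace_axioms)
  interpret AA_A: ktensor "tensor A A" A by (intro ktensor.intro kspace_axioms AA.tensor_kspace)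
  interpret A_AA: ktensor A "tensor A A" by (intro ktensor.intro kspace_axioms AA.tensor_kspace)
  interpret T: kspace "tensor A (tensor A A)" by (rule A_AA.tensor_kspace)
  note tm1 = tensor_map_props[OF AA.ktensor_axioms AA_A.ktensor_axioms \<Delta> klin_id]
  note tm2 = tensor_map_props[OF AA.ktensor_axioms A_AA.ktensor_axioms klin_id \<Delta>]
  note as = tensor_assoc_props[OF kspace_axioms kspace_axioms kspace_axioms]
  note f = klin_comp[OF tm1(1) as(1)]
  show ?thesis
  proof (rule klin_eq_w[OF T.kspace_axioms klin_comp[OF \<Delta> f] klin_comp[OF \<Delta> tm2(1)] _ assms])
    fix J K l assume JK: "J \<in> mwords I l" "K \<in> mwords I l"
    let ?t = "\<lambda>M N. pure_tensor A (tensor A A) (w J N) (pure_tensor A A (w N M) (w M K))"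
    have tc: "?t M N \<in> carrier (tensor A (tensor A A))" if "M \<in> mwords I l" "N \<in> mwords I l" for M N
      using that JK by (intro A_AA.pure_closed AA.pure_closed w_closed[of _ l])
    have "tensor_assoc A A A (tensor_map (tensor A A) A \<Delta> (\<lambda>y. y) (\<Delta> (w J K)))
      = (\<Oplus>\<^bsub>tensor A (tensor A A)\<^esub>M\<in>mwords I l. \<Oplus>\<^bsub>tensor A (tensor A A)\<^esub>N\<in>mwords I l. ?t M N)"
      unfolding klin_comat[OF T.kspace_axioms f JK]
    proof (rule T.finsum_cong'[OF refl])
      show "(\<lambda>M. \<Oplus>\<^bsub>tensor A (tensor A A)\<^esub>N\<in>mwords I l. ?t M N) \<in> mwords I l \<rightarrow> carrier (tensor A (tensor A A))"
        using tc by (intro funcsetI T.finsum_closed) auto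
      fix M assume M: "M \<in> mwords I l"
      have g: "(\<lambda>U. tensor_assoc A A A (pure_tensor (tensor A A) A U (w M K))) \<in> klin (tensor A A) (tensor A (tensor A A))"
        by (rule klin_comp[OF bilinD(1)[OF AA_A.bilin_pure w_closed[OF M JK(2)]] as(1)])
      show "tensor_assoc A A A (tensor_map (tensor A A) A \<Delta> (\<lambda>y. y) (pure_tensor A A (w J M) (w M K)))
        = (\<Oplus>\<^bsub>tensor A (tensor A A)\<^esub>N\<in>mwords I l. ?t M N)"
        unfolding tm1(2)[OF w_closed[OF JK(1) M] w_closed[OF M JK(2)]] klin_comat[OF T.kspace_axioms g JK(1) M]
      proof (rule T.finsum_cong'[OF refl])
        show "(\<lambda>N. ?t M N) \<in> mwords I l \<rightarrow> carrier (tensor A (tensor A A))"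
          using tc[OF M] by auto
        show "tensor_assoc A A A (pure_tensor (tensor A A) A (pure_tensor A A (w J N) (w N M)) (w M K)) = ?t M N"
          if "N \<in> mwords I l" for N
          by (rule as(2)[OF w_closed[OF JK(1) that] w_closed[OF that M] w_closed[OF M JK(2)]])
      qed
    qed
    also have "\<dots> = (\<Oplus>\<^bsub>tensor A (tensor A A)\<^esub>N\<in>mwords I l. \<Oplus>\<^bsub>tensor A (tensor A A)\<^esub>M\<in>mwords I l. ?t M N)"
      by (rule T.finsum_swap[OF finite_mw finite_mw tc])
    also have "\<dots> = tensor_map A (tensor A A) (\<lambda>y. y) \<Delta> (\<Delta> (w J K))"
      unfolding klin_comat[OF T.kspace_axioms tm2(1) JK]
    proof (rule T.finsum_cong'[OF refl, symmetric])
      show "(\<lambda>N. \<Oplus>\<^bsub>tensor A (tensor A A)\<^esub>M\<in>mwords I l. ?t M N) \<in> mwords I l \<rightarrow> carrier (tensor A (tensor A A))"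
        using tc by (intro funcsetI T.finsum_closed) auto
      fix N assume N: "N \<in> mwords I l"
      show "tensor_map A (tensor A A) (\<lambda>y. y) \<Delta> (pure_tensor A A (w J N) (w N K))
          = (\<Oplus>\<^bsub>tensor A (tensor A A)\<^esub>M\<in>mwords I l. ?t M N)"
        unfolding tm2(2)[OF w_closed[OF JK(1) N] w_closed[OF N JK(2)]]
          klin_comat[OF T.kspace_axioms bilinD(2)[OF A_AA.bilin_pure w_closed[OF JK(1) N]] N JK(2)] ..
    qed
    finally show "tensor_assoc A A A (tensor_map (tensor A A) A \<Delta> (\<lambda>y. y) (\<Delta> (w J K)))
      = tensor_map A (tensor A A) (\<lambda>y. y) \<Delta> (\<Delta> (w J K))" .
  qed
qed

lemma matalg_counit:
  assumes e: "e \<in> klin A base_superalg"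
    and ew: "\<And>J K l. J \<in> mwords I l \<Longrightarrow> K \<in> mwords I l \<Longrightarrow> e (w J K) = of_bool (J = K)"
    and x: "x \<in> carrier A"
  shows "tensor_lift A (\<lambda>c y. c \<odot> y) (tensor_map base_superalg A e (\<lambda>y. y) (\<Delta> x)) = x"
    and "tensor_lift A (\<lambda>y c. c \<odot> y) (tensor_map A base_superalg (\<lambda>y. y) e (\<Delta> x)) = x"
proof -
  interpret AA: ktensor A A by (intro ktensor.intro kspace_axioms)
  interpret BA: ktensor base_superalg A by (intro ktensor.intro kspace_axioms base_kspace)
  interpret AB: ktensor A base_superalg by (intro ktensor.intro kspace_axioms base_kspace)
  have b1: "bilin base_superalg A A (\<lambda>c y. c \<odot> y)"
    unfolding bilin_def by (auto intro!: klinI simp: smult_add_left smult_add_right mult.commute)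
  have b2: "bilin A base_superalg A (\<lambda>y c. c \<odot> y)"
    unfolding bilin_def by (auto intro!: klinI simp: smult_add_left smult_add_right mult.commute)
  note tm1 = tensor_map_props[OF AA.ktensor_axioms BA.ktensor_axioms e klin_id]
  note tm2 = tensor_map_props[OF AA.ktensor_axioms AB.ktensor_axioms klin_id e]
  note f1 = klin_comp[OF tm1(1) BA.tensor_lift_klin[OF kspace_axioms b1]]
  note f2 = klin_comp[OF tm2(1) AB.tensor_lift_klin[OF kspace_axioms b2]]
  show "tensor_lift A (\<lambda>c y. c \<odot> y) (tensor_map base_superalg A e (\<lambda>y. y) (\<Delta> x)) = x"
  proof (rule klin_eq_w[OF kspace_axioms klin_comp[OF \<Delta> f1] klin_id _ x])
    fix J K l assume JK: "J \<in> mwords I l" "K \<in> mwords I l"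
    have t: "tensor_lift A (\<lambda>c y. c \<odot> y) (tensor_map base_superalg A e (\<lambda>y. y) (pure_tensor A A (w J N) (w N K)))
        = of_bool (J = N) \<odot> w N K" if "N \<in> mwords I l" for N
      unfolding tm1(2)[OF w_closed[OF JK(1) that] w_closed[OF that JK(2)]]
      by (subst BA.tensor_lift_pure[OF kspace_axioms b1]) (use w_closed[OF that JK(2)] ew[OF JK(1) that] in auto)
    show "tensor_lift A (\<lambda>c y. c \<odot> y) (tensor_map base_superalg A e (\<lambda>y. y) (\<Delta> (w J K))) = w J K"
      unfolding klin_comat[OF kspace_axioms f1 JK]
      by (subst finsum_delta[of _ J]) (use JK w_closed finite_mw t in auto)
  qed
  show "tensor_lift A (\<lambda>y c. c \<odot> y) (tensor_map A base_superalg (\<lambda>y. y) e (\<Delta> x)) = x"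
  proof (rule klin_eq_w[OF kspace_axioms klin_comp[OF \<Delta> f2] klin_id _ x])
    fix J K l assume JK: "J \<in> mwords I l" "K \<in> mwords I l"
    have t: "tensor_lift A (\<lambda>y c. c \<odot> y) (tensor_map A base_superalg (\<lambda>y. y) e (pure_tensor A A (w J N) (w N K)))
        = of_bool (N = K) \<odot> w J N" if "N \<in> mwords I l" for N
      unfolding tm2(2)[OF w_closed[OF JK(1) that] w_closed[OF that JK(2)]]
      by (subst AB.tensor_lift_pure[OF kspace_axioms b2]) (use w_closed[OF JK(1) that] ew[OF that JK(2)] in auto)
    show "tensor_lift A (\<lambda>y c. c \<odot> y) (tensor_map A base_superalg (\<lambda>y. y) e (\<Delta> (w J K))) = w J K"
      unfolding klin_comat[OF kspace_axioms f2 JK]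
      by (subst finsum_delta[of _ K]) (use JK w_closed finite_mw t in auto)
  qed
qed

text \<open>Convolution of linear maps becomes multiplication of the matrices of their values on
  \<open>w\<close>. This turns the antipode axioms into a statement on inverse matrices.\<close>

lemma convolution_klin:
  assumes S: "S \<in> klin A A" and T: "T \<in> klin A A"
  shows "(\<lambda>x. tensor_lift A (\<otimes>) (tensor_map A A S T (\<Delta> x))) \<in> klin A A"
    and "\<lbrakk>J \<in> mwords I l; K \<in> mwords I l\<rbrakk> \<Longrightarrow>
      tensor_lift A (\<otimes>) (tensor_map A A S T (\<Delta> (w J K))) = (\<Oplus>M\<in>mwords I l. S (w J M) \<otimes> T (w M K))"
proof -
  interpret AA: ktensor A A by (intro ktensor.intro kspace_axioms)
  have b: "bilin A A A (\<otimes>)"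
    unfolding bilin_def using klin_mult_left klin_mult_right by blast
  note tm = tensor_map_props[OF AA.ktensor_axioms AA.ktensor_axioms S T]
  note f = klin_comp[OF tm(1) AA.tensor_lift_klin[OF kspace_axioms b]]
  show "(\<lambda>x. tensor_lift A (\<otimes>) (tensor_map A A S T (\<Delta> x))) \<in> klin A A"
    by (rule klin_comp[OF \<Delta> f])
  assume JK: "J \<in> mwords I l" "K \<in> mwords I l"
  show "tensor_lift A (\<otimes>) (tensor_map A A S T (\<Delta> (w J K))) = (\<Oplus>M\<in>mwords I l. S (w J M) \<otimes> T (w M K))"
    unfolding klin_comat[OF kspace_axioms f JK]
  proof (rule finsum_cong'[OF refl])
    fix N assume N: "N \<in> mwords I l"
    show "tensor_lift A (\<otimes>) (tensor_map A A S T (pure_tensor A A (w J N) (w N K))) = S (w J N) \<otimes> T (w N K)"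
      unfolding tm(2)[OF w_closed[OF JK(1) N] w_closed[OF N JK(2)]]
      by (rule AA.tensor_lift_pure[OF kspace_axioms b klinD(1)[OF S w_closed[OF JK(1) N]] klinD(1)[OF T w_closed[OF N JK(2)]]])
  qed (use JK klinD(1)[OF S] klinD(1)[OF T] w_closed in \<open>auto intro!: mult_closed\<close>)
qed

end

end

section \<open>Kernels of homomorphisms and antihomomorphisms\<close>

context superalgebra
begin

lemma kernel_submodule:
  assumes "kspace M" "f \<in> klin A M"
  shows "submodule {x \<in> carrier A. f x = \<zero>\<^bsub>M\<^esub>} (ring_of_type_algebra :: 'k ring) A"
proof -
  interpret M: kspace M by fact
  show ?thesis
    by (rule submoduleI') (auto simp: klinD[OF assms(2)] klin_zero[OF kspace_axioms assms])
qed

lemma genideal_kernel: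
  assumes "kalg M" "f \<in> klin A M"
    "\<And>x y. x \<in> carrier A \<Longrightarrow> y \<in> carrier A \<Longrightarrow> f (x \<otimes> y) = f x \<otimes>\<^bsub>M\<^esub> f y"
    "S \<subseteq> carrier A" "\<And>s. s \<in> S \<Longrightarrow> f s = \<zero>\<^bsub>M\<^esub>" "x \<in> genideal A S"
  shows "f x = \<zero>\<^bsub>M\<^esub>"
proof -
  interpret M: kalg M by fact
  have "ideal {x \<in> carrier A. f x = \<zero>\<^bsub>M\<^esub>} A"
    by (rule idealI'[OF kernel_submodule[OF M.kspace_axioms assms(2)]])
      (auto simp: assms(3) M.mult_zero klinD(1)[OF assms(2)])
  then show ?thesis using genideal_minimal[of _ S] assms(4-6) by blast
qed

text \<open>The rule for products is available for homogeneous elements only. Since \<open>f\<close>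
  preserves degrees, its kernel contains the components of its elements, and expanding both factors
  shows that the kernel is an ideal.\<close>

lemma genideal_antikernel:
  assumes "superalgebra M" "f \<in> superalg_antihom A M"
    "S \<subseteq> carrier A" "\<And>s. s \<in> S \<Longrightarrow> f s = \<zero>\<^bsub>M\<^esub>" "x \<in> genideal A S"
  shows "f x = \<zero>\<^bsub>M\<^esub>"
proof -
  interpret M: superalgebra M by fact
  note f = superalg_antihomD[OF assms(2)] and fl = klinD[OF superalg_antihomD(1)[OF assms(2)]]
  have hz: "f (hpart A \<alpha> x) = \<zero>\<^bsub>M\<^esub>" if x: "x \<in> carrier A" "f x = \<zero>\<^bsub>M\<^esub>" for x \<alpha>
  proof -
    have "f (hpart A \<alpha> x) \<oplus>\<^bsub>M\<^esub> f (hpart A (\<alpha> + 1) x) = \<zero>\<^bsub>M\<^esub> \<oplus>\<^bsub>M\<^esub> \<zero>\<^bsub>M\<^esub>"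
      using x hpart_decomp[OF x(1), of \<alpha>] fl(2) by (metis M.l_zero M.zero_closed hpart_closed)
    then show ?thesis
      using M.homog_unique(1)[OF f(4)[OF hpart_homog[OF x(1)]] f(4)[OF hpart_homog[OF x(1)]] M.homog_sub(2) M.homog_sub(2)]
      by blast
  qed
  have z: "f (x \<otimes> y) = \<zero>\<^bsub>M\<^esub> \<and> f (y \<otimes> x) = \<zero>\<^bsub>M\<^esub>" if x: "x \<in> carrier A" "f x = \<zero>\<^bsub>M\<^esub>" and y: "y \<in> carrier A" for x y
  proof -
    have hh: "f (hpart A \<alpha> x \<otimes> hpart A \<beta> y) = \<zero>\<^bsub>M\<^esub>" "f (hpart A \<beta> y \<otimes> hpart A \<alpha> x) = \<zero>\<^bsub>M\<^esub>" for \<alpha> \<beta>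
      unfolding f(3)[OF hpart_homog[OF x(1)] hpart_homog[OF y]] f(3)[OF hpart_homog[OF y] hpart_homog[OF x(1)]]
        hz[OF x] using fl(1)[OF hpart_closed[OF y]] by (simp_all add: M.mult_zero)
    have e: "x \<otimes> y = (hpart A 0 x \<otimes> hpart A 0 y \<oplus> hpart A 1 x \<otimes> hpart A 0 y) \<oplus>
        (hpart A 0 x \<otimes> hpart A 1 y \<oplus> hpart A 1 x \<otimes> hpart A 1 y)"
      using hpart_decomp[OF x(1), of 0] hpart_decomp[OF y, of 0] x(1) y
      by (metis add_0 distr_left distr_right hpart_closed a_closed)
    have e': "y \<otimes> x = (hpart A 0 y \<otimes> hpart A 0 x \<oplus> hpart A 1 y \<otimes> hpart A 0 x) \<oplus>
        (hpart A 0 y \<otimes> hpart A 1 x \<oplus> hpart A 1 y \<otimes> hpart A 1 x)"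
      using hpart_decomp[OF x(1), of 0] hpart_decomp[OF y, of 0] x(1) y
      by (metis add_0 distr_left distr_right hpart_closed a_closed)
    show ?thesis
      unfolding e e' using x y by (simp add: fl mult_closed hh)
  qed
  have "ideal {x \<in> carrier A. f x = \<zero>\<^bsub>M\<^esub>} A"
    by (rule idealI'[OF kernel_submodule[OF M.kspace_axioms f(1)]]) (auto simp: z mult_closed)
  then show ?thesis using genideal_minimal[of _ S] assms(3-5) by blast
qed

end

section \<open>Matrices over an algebra\<close>

context superalgebra
begin

definition mmul :: "'i set \<Rightarrow> ('i \<Rightarrow> 'i \<Rightarrow> 'a) \<Rightarrow> ('i \<Rightarrow> 'i \<Rightarrow> 'a) \<Rightarrow> 'i \<Rightarrow> 'i \<Rightarrow> 'a"
  where "mmul S V W i k = (\<Oplus>j\<in>S. V i j \<otimes> W j k)"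

definition mats :: "'i set \<Rightarrow> ('i \<Rightarrow> 'i \<Rightarrow> 'a) set"
  where "mats S = {V. \<forall>i\<in>S. \<forall>j\<in>S. V i j \<in> carrier A}"

definition scal :: "('i \<Rightarrow> 'i \<Rightarrow> 'k) \<Rightarrow> 'i \<Rightarrow> 'i \<Rightarrow> 'a"
  where "scal R i j = R i j \<odot> \<one>"

text \<open>Matrices are total functions whose values outside the index set mean nothing, so
  equality is restricted to \<open>S\<close>.\<close>

definition meq :: "'i set \<Rightarrow> ('i \<Rightarrow> 'i \<Rightarrow> 'a) \<Rightarrow> ('i \<Rightarrow> 'i \<Rightarrow> 'a) \<Rightarrow> bool"
  where "meq S V W \<longleftrightarrow> (\<forall>i\<in>S. \<forall>k\<in>S. V i k = W i k)"

lemma matsD: "V \<in> mats S \<Longrightarrow> i \<in> S \<Longrightarrow> j \<in> S \<Longrightarrow> V i j \<in> carrier A"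
  by (simp add: mats_def)

lemma scal_mats: "scal R \<in> mats S"
  by (simp add: mats_def scal_def)

lemma mmul_mats: "V \<in> mats S \<Longrightarrow> W \<in> mats S \<Longrightarrow> mmul S V W \<in> mats S"
  by (auto simp: mats_def mmul_def intro!: finsum_closed)

lemma mmul_assoc:
  assumes "finite S" "V \<in> mats S" "W \<in> mats S" "Z \<in> mats S"
  shows "meq S (mmul S (mmul S V W) Z) (mmul S V (mmul S W Z))"
  unfolding meq_def
proof (intro ballI)
  fix i k assume ik: "i \<in> S" "k \<in> S"
  note c = matsD[OF assms(2)] matsD[OF assms(3)] matsD[OF assms(4)]
  have "mmul S (mmul S V W) Z i k = (\<Oplus>j\<in>S. \<Oplus>l\<in>S. V i l \<otimes> W l j \<otimes> Z j k)"
    unfolding mmul_def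
    by (rule finsum_cong'[OF refl]) (use ik c in \<open>auto intro!: finsum_mult_left finsum_closed\<close>)
  also have "\<dots> = (\<Oplus>l\<in>S. \<Oplus>j\<in>S. V i l \<otimes> W l j \<otimes> Z j k)"
    by (rule finsum_swap) (use assms(1) ik c in auto)
  also have "\<dots> = (\<Oplus>l\<in>S. \<Oplus>j\<in>S. V i l \<otimes> (W l j \<otimes> Z j k))"
    by (rule finsum_cong2) (use ik c in \<open>auto simp: m_assoc\<close>)
  also have "\<dots> = mmul S V (mmul S W Z) i k"
    unfolding mmul_def
    by (rule finsum_cong'[OF refl]) (use ik c in \<open>auto intro!: finsum_mult_right[symmetric] finsum_closed\<close>)
  finally show "mmul S (mmul S V W) Z i k = mmul S V (mmul S W Z) i k" .
qed

lemma meq_refl: "meq S V V" and meq_sym: "meq S V W \<Longrightarrow> meq S W V"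
  and meq_trans [trans]: "meq S V W \<Longrightarrow> meq S W Z \<Longrightarrow> meq S V Z"
  by (auto simp: meq_def)

lemma mmul_cong:
  assumes "meq S V V'" "meq S W W'" "V' \<in> mats S" "W' \<in> mats S"
  shows "meq S (mmul S V W) (mmul S V' W')"
  using assms unfolding meq_def mmul_def
  by (auto intro!: finsum_cong' mult_closed simp: mats_def)

lemma mmul_one:
  assumes "finite S" "V \<in> mats S"
  shows "meq S (mmul S (scal (\<lambda>i j. of_bool (i = j))) V) V" "meq S (mmul S V (scal (\<lambda>i j. of_bool (i = j)))) V"
proof -
  have "(\<Oplus>j\<in>S. scal (\<lambda>i j. of_bool (i = j)) i j \<otimes> V j k) = V i k" if "i \<in> S" "k \<in> S" for i k
    by (subst finsum_delta[of S i]) (use that assms in \<open>auto simp: scal_def mats_def mult_zero\<close>)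
  moreover have "(\<Oplus>j\<in>S. V i j \<otimes> scal (\<lambda>i j. of_bool (i = j)) j k) = V i k" if "i \<in> S" "k \<in> S" for i k
    by (subst finsum_delta[of S k]) (use that assms in \<open>auto simp: scal_def mats_def mult_zero\<close>)
  ultimately show "meq S (mmul S (scal (\<lambda>i j. of_bool (i = j))) V) V" "meq S (mmul S V (scal (\<lambda>i j. of_bool (i = j)))) V"
    by (auto simp: meq_def mmul_def)
qed

lemma mmul_scal_left: 
  assumes "V \<in> mats S" "i \<in> S" "k \<in> S"
  shows "mmul S (scal R) V i k = (\<Oplus>j\<in>S. R i j \<odot> V j k)"
  unfolding mmul_def scal_def
  by (rule finsum_cong'[OF refl]) (use assms in \<open>auto simp: mats_def smult_left\<close>)

lemma mmul_scal_right:
  assumes "V \<in> mats S" "i \<in> S" "k \<in> S"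
  shows "mmul S V (scal R) i k = (\<Oplus>j\<in>S. R j k \<odot> V i j)"
  unfolding mmul_def scal_def
  by (rule finsum_cong'[OF refl]) (use assms in \<open>auto simp: mats_def smult_right\<close>)

text \<open>\<open>R V = V W R V = V R W V = V R\<close>.\<close>

lemma inverse_intertwines:
  assumes "finite S" "V \<in> mats S" "W \<in> mats S"
    and VW: "meq S (mmul S V W) (scal (\<lambda>i j. of_bool (i = j)))" and WV: "meq S (mmul S W V) (scal (\<lambda>i j. of_bool (i = j)))"
    and RW: "meq S (mmul S (scal R) W) (mmul S W (scal R))"
  shows "meq S (mmul S (scal R) V) (mmul S V (scal R))"
proof -
  note m = mmul_mats scal_mats assms(2,3)
  note [trans] = meq_trans
  have "meq S (mmul S (scal R) V) (mmul S (scal (\<lambda>i j. of_bool (i = j))) (mmul S (scal R) V))"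
    by (rule meq_sym) (intro mmul_one m assms)
  also have "meq S \<dots> (mmul S (mmul S V W) (mmul S (scal R) V))"
    by (intro mmul_cong meq_sym[OF VW] meq_refl m)
  also have "meq S \<dots> (mmul S V (mmul S W (mmul S (scal R) V)))"
    by (intro mmul_assoc m assms)
  also have "meq S \<dots> (mmul S V (mmul S (mmul S W (scal R)) V))"
    by (intro mmul_cong meq_refl m meq_sym[OF mmul_assoc] assms)
  also have "meq S \<dots> (mmul S V (mmul S (mmul S (scal R) W) V))"
    by (intro mmul_cong meq_refl m meq_sym[OF RW])
  also have "meq S \<dots> (mmul S V (mmul S (scal R) (mmul S W V)))"
    by (intro mmul_cong meq_refl m mmul_assoc assms)
  also have "meq S \<dots> (mmul S V (mmul S (scal R) (scal (\<lambda>i j. of_bool (i = j)))))"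
    by (intro mmul_cong meq_refl m WV)
  also have "meq S \<dots> (mmul S V (scal R))"
    by (intro mmul_cong meq_refl m mmul_one assms)
  finally show ?thesis .
qed

text \<open>\<open>V = V (W V') = (V W) V' = V'\<close>: a left inverse and a right inverse of the
  same matrix agree.\<close>

lemma inverse_unique:
  assumes "finite S" "V \<in> mats S" "W \<in> mats S" "V' \<in> mats S"
    and VW: "meq S (mmul S V W) (scal (\<lambda>i j. of_bool (i = j)))" and WV: "meq S (mmul S W V') (scal (\<lambda>i j. of_bool (i = j)))"
  shows "meq S V V'"
proof -
  note m = mmul_mats scal_mats assms(2,3,4)
  have "meq S V (mmul S V (scal (\<lambda>i j. of_bool (i = j))))"
    by (rule meq_sym) (intro mmul_one m assms)
  also have "meq S \<dots> (mmul S V (mmul S W V'))"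
    by (intro mmul_cong meq_refl m meq_sym[OF WV])
  also have "meq S \<dots> (mmul S (mmul S V W) V')"
    by (rule meq_sym) (intro mmul_assoc m assms)
  also have "meq S \<dots> (mmul S (scal (\<lambda>i j. of_bool (i = j))) V')"
    by (intro mmul_cong meq_refl m VW)
  also have "meq S \<dots> V'"
    by (intro mmul_one m assms)
  finally show ?thesis .
qed

lemma scal_mult: "finite S \<Longrightarrow> mmul S (scal R) (scal R') i k = scal (\<lambda>i k. \<Sum>j\<in>S. R i j * R' j k) i k"
  by (simp add: mmul_def scal_def finsum_sum_smult smult_left)

lemma square_intertwines:
  assumes "finite S" "W \<in> mats S" and RW: "meq S (mmul S (scal R) W) (mmul S W (scal R))"
  shows "meq S (mmul S (scal (\<lambda>i k. \<Sum>j\<in>S. R i j * R j k)) W) (mmul S W (scal (\<lambda>i k. \<Sum>j\<in>S. R i j * R j k)))"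
proof -
  let ?R2 = "\<lambda>i k. \<Sum>j\<in>S. R i j * R j k"
  note m = mmul_mats scal_mats assms(2)
  have R2: "meq S (scal ?R2) (mmul S (scal R) (scal R))" using scal_mult[OF assms(1)] by (simp add: meq_def)
  have "meq S (mmul S (scal ?R2) W) (mmul S (mmul S (scal R) (scal R)) W)"
    by (intro mmul_cong meq_refl m R2)
  also have "meq S \<dots> (mmul S (scal R) (mmul S (scal R) W))"
    by (intro mmul_assoc m assms)
  also have "meq S \<dots> (mmul S (scal R) (mmul S W (scal R)))"
    by (intro mmul_cong meq_refl m RW)
  also have "meq S \<dots> (mmul S (mmul S (scal R) W) (scal R))"
    by (rule meq_sym) (intro mmul_assoc m assms)
  also have "meq S \<dots> (mmul S (mmul S W (scal R)) (scal R))"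
    by (intro mmul_cong meq_refl m RW)
  also have "meq S \<dots> (mmul S W (mmul S (scal R) (scal R)))"
    by (intro mmul_assoc m assms)
  also have "meq S \<dots> (mmul S W (scal ?R2))"
    by (intro mmul_cong meq_refl m meq_sym[OF R2])
  finally show ?thesis .
qed

end

lemma quot_matalg:
  assumes "matalg A I d w" "graded_quot A J"
  shows "matalg (quot_superalg A J) I d (\<lambda>M K. J +>\<^bsub>A\<^esub> w M K)"
proof -
  interpret A: matalg A I d w by fact
  interpret Q: graded_quot A J by fact
  have app: "M @ M' \<in> mwords I (l + l')" if "M \<in> mwords I l" "M' \<in> mwords I l'" for M M' l l'
    using that by (auto simp: mwords_def)
  have "carrier (quot_superalg A J) = lspan (quot_superalg A J) ((\<lambda>x. J +>\<^bsub>A\<^esub> x) ` A.wset)"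
    by (rule Q.lspan_quot[OF A.w_span])
  also have "(\<lambda>x. J +>\<^bsub>A\<^esub> x) ` A.wset = {J +>\<^bsub>A\<^esub> w M K | M K l. M \<in> mwords I l \<and> K \<in> mwords I l}"
    by blast
  finally have span: "carrier (quot_superalg A J) =
    lspan (quot_superalg A J) {J +>\<^bsub>A\<^esub> w M K | M K l. M \<in> mwords I l \<and> K \<in> mwords I l}" .
  show ?thesis
  proof (intro matalg.intro matalg_axioms.intro Q.quot_superalgebra A.finite_I span)
    fix M K l assume MK: "M \<in> mwords I l" "K \<in> mwords I l"
    show "J +>\<^bsub>A\<^esub> w M K \<in> homog (quot_superalg A J) (mdeg d M + mdeg d K)"
      unfolding Q.quot_homog by (rule imageI[OF A.w_homog[OF MK]])
    fix M' K' l' assume MK': "M' \<in> mwords I l'" "K' \<in> mwords I l'"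
    show "(J +>\<^bsub>A\<^esub> w M K) \<otimes>\<^bsub>quot_superalg A J\<^esub> (J +>\<^bsub>A\<^esub> w M' K') =
      sgn2 (mdeg d M + mdeg d K) (mdeg d M') \<odot>\<^bsub>quot_superalg A J\<^esub> (J +>\<^bsub>A\<^esub> w (M @ M') (K @ K'))"
      unfolding Q.quot_mult[OF A.w_closed[OF MK] A.w_closed[OF MK']]
        Q.quot_smult[OF A.w_closed[OF app[OF MK(1) MK'(1)] app[OF MK(2) MK'(2)]]] A.w_mult[OF MK MK'] ..
  next
    show "J +>\<^bsub>A\<^esub> w [] [] = \<one>\<^bsub>quot_superalg A J\<^esub>" by (simp add: A.w_Nil Q.quot_one)
  qed
qed

section \<open>The free superalgebra on matrix entries\<close>

text \<open>The normalising sign of a monomial. For each letter the first factor is the sign change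
  from \<open>t\<close> to \<open>u\<close>; the second is the sign with which \<open>w_mult\<close>
  splits the first letter off.\<close>

fun wsgn :: "('i \<Rightarrow> bit) \<Rightarrow> ('i \<times> 'i) list \<Rightarrow> 'k::ring_1"
  where "wsgn d [] = 1"
  | "wsgn d (p # ps) = sgn2 (d (fst p)) (d (fst p) + d (snd p))
      * sgn2 (d (fst p) + d (snd p)) (mdeg d (map fst ps)) * wsgn d ps"

definition wfree :: "('i \<Rightarrow> bit) \<Rightarrow> 'i list \<Rightarrow> 'i list \<Rightarrow> (('i \<times> 'i) word \<Rightarrow>\<^sub>0 'k::field)"
  where "wfree d J K = Poly_Mapping.single (Word (zip J K)) (wsgn d (zip J K))"

lemma wsgn_append:
  "wsgn d (ps @ qs) = (sgn2 (mdeg d (map fst ps) + mdeg d (map snd ps)) (mdeg d (map fst qs)) * wsgn d ps * wsgn d qs :: 'k::field)"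
  by (induction ps) (simp_all add: sgn2_def[of 0] sgn2_add mult_ac)

lemma wsgn_square: "wsgn d ps * wsgn d ps = (1 :: 'k::field)"
proof (induction ps)
  case (Cons p ps)
  have "wsgn d (p # ps) * wsgn d (p # ps) = (sgn2 (d (fst p)) (d (fst p) + d (snd p)) * sgn2 (d (fst p)) (d (fst p) + d (snd p)))
    * (sgn2 (d (fst p) + d (snd p)) (mdeg d (map fst ps)) * sgn2 (d (fst p) + d (snd p)) (mdeg d (map fst ps)))
    * (wsgn d ps * wsgn d ps :: 'k)"
    by (simp only: wsgn.simps mult_ac)
  then show ?case using Cons by (simp only: sgn2_mult_self) simp
qed simp

lemma free_matalg:
  fixes I :: "'i set" and d :: "'i \<Rightarrow> bit"
  assumes "finite I"
  shows "matalg (free_superalg (I \<times> I) (\<lambda>g. d (snd g) - d (fst g)) :: ('k::field, _) superalg) I d (wfree d)"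
proof -
  let ?F = "free_superalg (I \<times> I) (\<lambda>g. d (snd g) - d (fst g)) :: ('k, _) superalg"
  interpret F: superalgebra ?F by (rule free_superalgebra)
  have deg: "word_degree (\<lambda>g. d (snd g) - d (fst g)) (Word ps) = mdeg d (map fst ps) + mdeg d (map snd ps)"
    for ps
  proof (induction ps)
    case (Cons p ps)
    have [simp]: "a - b = a + b" for a b :: bit by (cases a; cases b) auto
    show ?case using Cons by (simp add: word_degree_def add_ac)
  qed (simp add: word_degree_def)
  have z: "set (zip J K) \<subseteq> I \<times> I" if "J \<in> mwords I l" "K \<in> mwords I l" for J K l
    using that by (auto simp: mwords_def dest: set_zip_leftD set_zip_rightD)
  have mz: "map fst (zip J K) = J" "map snd (zip J K) = K" if "J \<in> mwords I l" "K \<in> mwords I l" for J K l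
    using that by (auto simp: mwords_def)
  have cl: "wfree d J K \<in> carrier ?F" if "J \<in> mwords I l" "K \<in> mwords I l" for J K l
    using z[OF that] by (simp add: wfree_def)
  show ?thesis
  proof (intro matalg.intro matalg_axioms.intro F.superalgebra_axioms assms)
    fix J K l assume JK: "J \<in> mwords I l" "K \<in> mwords I l"
    show "wfree d J K \<in> homog ?F (mdeg d J + mdeg d K)"
      using z[OF JK] deg[of "zip J K"] mz[OF JK] by (simp add: wfree_def)
    fix J' K' l' assume JK': "J' \<in> mwords I l'" "K' \<in> mwords I l'"
    have "zip (J @ J') (K @ K') = zip J K @ zip J' K'"
      using JK JK' by (intro zip_append) (auto simp: mwords_def)
    then show "wfree d J K \<otimes>\<^bsub>?F\<^esub> wfree d J' K'
        = sgn2 (mdeg d J + mdeg d K) (mdeg d J') \<odot>\<^bsub>?F\<^esub> wfree d (J @ J') (K @ K')"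
      using mz[OF JK] mz[OF JK']
      by (simp add: wfree_def mult_single plus_word_def wsgn_append mult.assoc[symmetric])
  next
    show "wfree d [] [] = \<one>\<^bsub>?F\<^esub>" by (simp add: wfree_def zero_word_def[symmetric])
  next
    let ?V = "{wfree d J K | J K l. J \<in> mwords I l \<and> K \<in> mwords I l} :: (('i \<times> 'i) word \<Rightarrow>\<^sub>0 'k) set"
    show "carrier ?F = lspan ?F ?V"
    proof
      show "lspan ?F ?V \<subseteq> carrier ?F" by (rule F.lspan_closed) (use cl in blast)
      show "carrier ?F \<subseteq> lspan ?F ?V"
      proof
        fix p assume "p \<in> carrier ?F"
        then have "Poly_Mapping.keys p \<subseteq> {w. set (letters w) \<subseteq> I \<times> I}" by auto
        then show "p \<in> lspan ?F ?V"
        proof (induction rule: pm_induct)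
          case zero
          then show ?case using lspan.zero[of ?F ?V] by simp
        next
          case (single b c)
          obtain ps where b: "b = Word ps" by (cases b)
          have ps: "set ps \<subseteq> I \<times> I" using single b by simp
          have m: "map fst ps \<in> mwords I (length ps)" "map snd ps \<in> mwords I (length ps)"
            using ps by (auto simp: mwords_def)
          have e: "Poly_Mapping.single b c = (c * wsgn d ps) \<odot>\<^bsub>?F\<^esub> wfree d (map fst ps) (map snd ps)"
            using wsgn_square[of d ps, where 'k = 'k] by (simp add: wfree_def b zip_map_fst_snd mult.assoc)
          have "wfree d (map fst ps) (map snd ps) \<in> ?V" using m by blast
          then show ?case unfolding e by (rule lspan.smult[OF lspan.base])
        next
          case (add p p')
          then show ?case using lspan.add[of p ?F ?V p'] by simp
        qed
      qed
    qed
  qed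
qed

text \<open>Words form a basis and each \<open>wfree d J K\<close> is a word up to sign, so its
  image may be prescribed freely. Freeness is used in this linear form because it yields
  homomorphisms and antihomomorphisms alike; \<open>matalg_comult_hom\<close>,
  \<open>matalg_counit_hom\<close> and \<open>matalg_antihom\<close> recover the multiplicative
  behaviour from the values.\<close>

lemma free_matalg_extend:
  fixes M :: "('k::field, 'c, 'z) superalg_scheme" and v :: "'i list \<Rightarrow> 'i list \<Rightarrow> 'c"
  assumes "kspace M" "\<And>J K l. J \<in> mwords I l \<Longrightarrow> K \<in> mwords I l \<Longrightarrow> v J K \<in> carrier M"
  obtains f where "f \<in> klin (free_superalg (I \<times> I) e) M"
    "\<And>J K l. J \<in> mwords I l \<Longrightarrow> K \<in> mwords I l \<Longrightarrow> f (wfree d J K) = v J K"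
proof
  interpret M: kspace M by fact
  let ?U = "{w :: ('i \<times> 'i) word. set (letters w) \<subseteq> I \<times> I}"
  define \<phi> where "\<phi> w = (wsgn d (letters w) :: 'k) \<odot>\<^bsub>M\<^esub> v (map fst (letters w)) (map snd (letters w))" for w
  have \<phi>: "\<phi> w \<in> carrier M" if "w \<in> ?U" for w
  proof -
    have "map fst (letters w) \<in> mwords I (length (letters w))" "map snd (letters w) \<in> mwords I (length (letters w))"
      using that by (auto simp: mwords_def)
    then show ?thesis using assms(2) by (auto simp: \<phi>_def)
  qed
  have keys: "Poly_Mapping.keys p \<subseteq> ?U" if "p \<in> carrier (free_superalg (I \<times> I) e)" for p :: "_ \<Rightarrow>\<^sub>0 'k"
    using that by auto
  show "linext M \<phi> \<in> klin (free_superalg (I \<times> I) e) M"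
  proof (rule klinI)
    fix p q c assume p: "p \<in> carrier (free_superalg (I \<times> I) e :: ('k, _) superalg)"
    show "linext M \<phi> p \<in> carrier M" using keys[OF p] \<phi> by (intro M.linext_closed) blast
    show "linext M \<phi> (c \<odot>\<^bsub>free_superalg (I \<times> I) e\<^esub> p) = c \<odot>\<^bsub>M\<^esub> linext M \<phi> p"
      unfolding free_superalg_simps by (rule M.linext_scale[OF keys[OF p] \<phi>])
    assume q: "q \<in> carrier (free_superalg (I \<times> I) e :: ('k, _) superalg)"
    show "linext M \<phi> (p \<oplus>\<^bsub>free_superalg (I \<times> I) e\<^esub> q) = linext M \<phi> p \<oplus>\<^bsub>M\<^esub> linext M \<phi> q"
      unfolding free_superalg_simps by (rule M.linext_add[OF keys[OF p] keys[OF q] \<phi>])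
  qed
  fix J K l assume JK: "J \<in> mwords I l" "K \<in> mwords I l"
  then have z: "set (zip J K) \<subseteq> I \<times> I" "map fst (zip J K) = J" "map snd (zip J K) = K"
    by (auto simp: mwords_def dest: set_zip_leftD set_zip_rightD)
  have "linext M \<phi> (wfree d J K) = wsgn d (zip J K) \<odot>\<^bsub>M\<^esub> \<phi> (Word (zip J K))"
    unfolding wfree_def by (rule M.linext_single, rule \<phi>) (use z in simp)
  also have "\<dots> = v J K"
    using z assms(2)[OF JK] by (simp add: \<phi>_def wsgn_square)
  finally show "linext M \<phi> (wfree d J K) = v J K" .
qed

section \<open>Inverting the matrices of monomials\<close>

text \<open>The value at \<open>w J K\<close> of the antihomomorphism that takes the values
  \<open>v\<close> on the generators. Reversing the factors costs the sign of |i|+|k| against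
  |J|+|K|; combined with the sign of \<open>w_Cons\<close> only K is left. For words of equal length
  the second equation is reached with two empty lists only.\<close>

fun anti_ext :: "('k::field, 'a, 'x) superalg_scheme \<Rightarrow> ('i \<Rightarrow> bit) \<Rightarrow> ('i \<Rightarrow> 'i \<Rightarrow> 'a) \<Rightarrow> 'i list \<Rightarrow> 'i list \<Rightarrow> 'a"
  where "anti_ext A d v (i # J) (k # K) =
      sgn2 (d i + d k) (mdeg d K) \<odot>\<^bsub>A\<^esub> (anti_ext A d v J K \<otimes>\<^bsub>A\<^esub> v i k)"
  | "anti_ext A d v _ _ = \<one>\<^bsub>A\<^esub>"

lemma mwords_SucE:
  assumes "J \<in> mwords I (Suc l)"
  obtains i J' where "J = i # J'" "i \<in> I" "J' \<in> mwords I l"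
  using assms by (auto simp: mwords_def length_Suc_conv)

lemma mwords_SucI: "i \<in> I \<Longrightarrow> J \<in> mwords I l \<Longrightarrow> i # J \<in> mwords I (Suc l)"
  by (auto simp: mwords_def)

lemma (in abelian_monoid) finsum_mwords_Suc:
  assumes "finite I" "\<And>i J. i \<in> I \<Longrightarrow> J \<in> mwords I l \<Longrightarrow> f (i # J) \<in> carrier G"
  shows "(\<Oplus>J\<in>mwords I (Suc l). f J) = (\<Oplus>i\<in>I. \<Oplus>J\<in>mwords I l. f (i # J))"
proof -
  have m1: "\<exists>i\<in>I. J = [i]" if "J \<in> mwords I 1" for J
    using that by (auto simp: mwords_def length_Suc_conv)
  have "(\<Oplus>J\<in>mwords I (1 + l). f J) = (\<Oplus>M\<in>mwords I 1. \<Oplus>J\<in>mwords I l. f (M @ J))"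
    by (rule finsum_mwords_add[OF assms(1)]) (use assms(2) m1 in fastforce)
  also have "\<dots> = (\<Oplus>i\<in>I. \<Oplus>J\<in>mwords I l. f ([i] @ J))"
    by (rule finsum_mwords_1) (use assms(2) in \<open>auto intro!: finsum_closed\<close>)
  finally show ?thesis by simp
qed

context matalg
begin

context
  fixes v :: "'i \<Rightarrow> 'i \<Rightarrow> 'a"
  assumes v_homog: "\<And>i k. i \<in> I \<Longrightarrow> k \<in> I \<Longrightarrow> v i k \<in> homog A (d i + d k)"
    and v_left: "\<And>i k. i \<in> I \<Longrightarrow> k \<in> I \<Longrightarrow> (\<Oplus>j\<in>I. v i j \<otimes> w [j] [k]) = of_bool (i = k) \<odot> \<one>"
    and v_right: "\<And>i k. i \<in> I \<Longrightarrow> k \<in> I \<Longrightarrow> (\<Oplus>j\<in>I. w [i] [j] \<otimes> v j k) = of_bool (i = k) \<odot> \<one>"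
begin

lemma v_closed: "i \<in> I \<Longrightarrow> k \<in> I \<Longrightarrow> v i k \<in> carrier A"
  using v_homog homog_carrier by blast

lemma w1_closed: "i \<in> I \<Longrightarrow> k \<in> I \<Longrightarrow> w [i] [k] \<in> carrier A"
  by (rule w_closed[of _ 1]) (auto simp: mwords_def)

lemma anti_ext_homog: "\<lbrakk>J \<in> mwords I l; K \<in> mwords I l\<rbrakk> \<Longrightarrow> anti_ext A d v J K \<in> homog A (mdeg d J + mdeg d K)"
proof (induction l arbitrary: J K)
  case 0
  then show ?case by (simp add: homog_one)
next
  case (Suc l)
  obtain i J' k K' where J: "J = i # J'" "i \<in> I" "J' \<in> mwords I l" "K = k # K'" "k \<in> I" "K' \<in> mwords I l"
    using Suc(2,3) by (elim mwords_SucE) blast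
  have e: "mdeg d J + mdeg d K = (mdeg d J' + mdeg d K') + (d i + d k)" using J by (simp add: add_ac)
  show ?case
    unfolding e unfolding J(1,4) anti_ext.simps
    by (rule homog_sub(4)[OF homog_mult[OF Suc.IH[OF J(3,6)] v_homog[OF J(2,5)]]])
qed

lemma anti_ext_closed: "\<lbrakk>J \<in> mwords I l; K \<in> mwords I l\<rbrakk> \<Longrightarrow> anti_ext A d v J K \<in> carrier A"
  using anti_ext_homog homog_carrier by blast

lemma anti_ext_mult:
  "\<lbrakk>J \<in> mwords I l; K \<in> mwords I l; J' \<in> mwords I l'; K' \<in> mwords I l'\<rbrakk> \<Longrightarrow>
    anti_ext A d v (J @ J') (K @ K')
      = sgn2 (mdeg d J + mdeg d K) (mdeg d K') \<odot> (anti_ext A d v J' K' \<otimes> anti_ext A d v J K)"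
proof (induction l arbitrary: J K)
  case 0
  then show ?case using anti_ext_closed[of J' l' K'] by (simp add: sgn2_def)
next
  case (Suc l)
  obtain i J1 k K1 where J: "J = i # J1" "i \<in> I" "J1 \<in> mwords I l" "K = k # K1" "k \<in> I" "K1 \<in> mwords I l"
    using Suc(2,3) by (elim mwords_SucE) blast
  note c = anti_ext_closed[OF J(3,6)] anti_ext_closed[OF Suc(4,5)] v_closed[OF J(2,5)]
  show ?case
    using c by (simp add: J Suc.IH[OF J(3,6) Suc(4,5)] smult_left smult_right m_assoc sgn2_add mult_ac)
qed

text \<open>Because \<open>anti_ext\<close> reverses the order, the factors \<open>v i j\<close> and
  \<open>w [j] [k]\<close> meet in the middle of the product. Summing over \<open>j\<close> cancels
  them, and the shorter words are left to the induction hypothesis.\<close>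

lemma anti_ext_left:
  "\<lbrakk>J \<in> mwords I l; K \<in> mwords I l\<rbrakk> \<Longrightarrow>
    (\<Oplus>M\<in>mwords I l. anti_ext A d v J M \<otimes> w M K) = of_bool (J = K) \<odot> \<one>"
proof (induction l arbitrary: J K)
  case 0
  then show ?case by (simp add: w_Nil)
next
  case (Suc l)
  obtain i J1 k K1 where J: "J = i # J1" "i \<in> I" "J1 \<in> mwords I l" "K = k # K1" "k \<in> I" "K1 \<in> mwords I l"
    using Suc(2,3) by (elim mwords_SucE) blast
  let ?u = "\<lambda>M. anti_ext A d v J1 M" and ?s = "\<lambda>M. sgn2 (d i + d k) (mdeg d M) :: 'k"
  note uc = anti_ext_closed[OF J(3)] and wc = w_closed[OF _ J(6)] and vc = v_closed[OF J(2)] and w1 = w1_closed[OF _ J(5)]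
  have "(\<Oplus>M\<in>mwords I (Suc l). anti_ext A d v J M \<otimes> w M K)
      = (\<Oplus>j\<in>I. \<Oplus>M\<in>mwords I l. anti_ext A d v J (j # M) \<otimes> w (j # M) K)"
    by (rule finsum_mwords_Suc[OF finite_I])
      (intro mult_closed anti_ext_closed[of _ "Suc l"] w_closed[of _ "Suc l"] Suc.prems mwords_SucI)
  also have "\<dots> = (\<Oplus>j\<in>I. \<Oplus>M\<in>mwords I l. ?s M \<odot> (?u M \<otimes> ((v i j \<otimes> w [j] [k]) \<otimes> w M K1)))"
  proof (rule finsum_cong2)
    fix j M assume jM: "j \<in> I" "M \<in> mwords I l"
    \<comment> \<open>The combined sign does not depend on \<open>j\<close>, so the sum over
      \<open>j\<close> can be carried out with \<open>M\<close> fixed.\<close>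
    have "sgn2 (d i + d j) (mdeg d M) * sgn2 (d j + d k) (mdeg d M) = ?s M"
      by (cases "d i"; cases "d j"; cases "d k"; cases "mdeg d M") (simp_all add: sgn2_def)
    then show "anti_ext A d v J (j # M) \<otimes> w (j # M) K = ?s M \<odot> (?u M \<otimes> ((v i j \<otimes> w [j] [k]) \<otimes> w M K1))"
      using uc[OF jM(2)] wc[OF jM(2)] vc[OF jM(1)] w1[OF jM(1)]
      by (simp add: J(1,4) w_Cons[OF jM(2) J(6) jM(1) J(5)] smult_left smult_right m_assoc mult.commute)
    show "?s M \<odot> (?u M \<otimes> ((v i j \<otimes> w [j] [k]) \<otimes> w M K1)) \<in> carrier A"
      using uc[OF jM(2)] wc[OF jM(2)] vc[OF jM(1)] w1[OF jM(1)] by simp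
  qed
  also have "\<dots> = (\<Oplus>M\<in>mwords I l. \<Oplus>j\<in>I. ?s M \<odot> (?u M \<otimes> ((v i j \<otimes> w [j] [k]) \<otimes> w M K1)))"
    by (rule finsum_swap[OF finite_I finite_mw]) (use uc wc vc w1 in simp)
  also have "\<dots> = (\<Oplus>M\<in>mwords I l. of_bool (i = k) \<odot> (?u M \<otimes> w M K1))"
  proof (rule finsum_cong'[OF refl])
    show "(\<lambda>M. of_bool (i = k) \<odot> (?u M \<otimes> w M K1)) \<in> mwords I l \<rightarrow> carrier A"
      using uc wc by auto
    fix M assume M: "M \<in> mwords I l"
    have f: "(\<lambda>x. ?s M \<odot> (?u M \<otimes> (x \<otimes> w M K1))) \<in> klin A A"
      by (intro klin_smult kspace_axioms klin_comp[OF klin_mult_left[OF wc[OF M]] klin_mult_right[OF uc[OF M]]])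
    have "(\<Oplus>j\<in>I. ?s M \<odot> (?u M \<otimes> ((v i j \<otimes> w [j] [k]) \<otimes> w M K1)))
      = ?s M \<odot> (?u M \<otimes> ((\<Oplus>j\<in>I. v i j \<otimes> w [j] [k]) \<otimes> w M K1))"
      using klin_finsum[OF kspace_axioms kspace_axioms f, of I "\<lambda>j. v i j \<otimes> w [j] [k]"] vc w1 by simp
    moreover have "d k + d k = 0" by (cases "d k") auto
    ultimately show "(\<Oplus>j\<in>I. ?s M \<odot> (?u M \<otimes> ((v i j \<otimes> w [j] [k]) \<otimes> w M K1))) = of_bool (i = k) \<odot> (?u M \<otimes> w M K1)"
      using v_left[OF J(2,5)] uc[OF M] wc[OF M] by (auto simp: smult_left sgn2_def mult_zero)
  qed
  also have "\<dots> = of_bool (i = k) \<odot> (of_bool (J1 = K1) \<odot> \<one>)"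
    unfolding Suc.IH[OF J(3,6), symmetric]
    by (rule smult_finsum[symmetric, OF finite_mw]) (use uc wc in auto)
  also have "\<dots> = of_bool (J = K) \<odot> \<one>" using J by simp
  finally show ?case .
qed

text \<open>Here the long factors \<open>w J1 M\<close> and \<open>anti_ext A d v M K1\<close> meet
  in the middle. The induction hypothesis removes them first, and the outer sum over
  \<open>j\<close> is the given right inverse.\<close>

lemma anti_ext_right:
  "\<lbrakk>J \<in> mwords I l; K \<in> mwords I l\<rbrakk> \<Longrightarrow>
    (\<Oplus>M\<in>mwords I l. w J M \<otimes> anti_ext A d v M K) = of_bool (J = K) \<odot> \<one>"
proof (induction l arbitrary: J K)
  case 0
  then show ?case by (simp add: w_Nil)
next
  case (Suc l)
  obtain i J1 k K1 where J: "J = i # J1" "i \<in> I" "J1 \<in> mwords I l" "K = k # K1" "k \<in> I" "K1 \<in> mwords I l"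
    using Suc(2,3) by (elim mwords_SucE) blast
  let ?u = "\<lambda>M. anti_ext A d v M K1" and ?s = "\<lambda>j. sgn2 (d i + d j) (mdeg d J1) * sgn2 (d j + d k) (mdeg d K1) :: 'k"
  note uc = anti_ext_closed[OF _ J(6)] and wc = w_closed[OF J(3)] and vc = v_closed[OF _ J(5)] and w1 = w1_closed[OF J(2)]
  have "(\<Oplus>M\<in>mwords I (Suc l). w J M \<otimes> anti_ext A d v M K)
      = (\<Oplus>j\<in>I. \<Oplus>M\<in>mwords I l. w J (j # M) \<otimes> anti_ext A d v (j # M) K)"
    by (rule finsum_mwords_Suc[OF finite_I])
      (intro mult_closed anti_ext_closed[of _ "Suc l"] w_closed[of _ "Suc l"] Suc.prems mwords_SucI)
  also have "\<dots> = (\<Oplus>j\<in>I. \<Oplus>M\<in>mwords I l. ?s j \<odot> (w [i] [j] \<otimes> ((w J1 M \<otimes> ?u M) \<otimes> v j k)))"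
  proof (rule finsum_cong2)
    fix j M assume jM: "j \<in> I" "M \<in> mwords I l"
    show "w J (j # M) \<otimes> anti_ext A d v (j # M) K = ?s j \<odot> (w [i] [j] \<otimes> ((w J1 M \<otimes> ?u M) \<otimes> v j k))"
      using uc[OF jM(2)] wc[OF jM(2)] vc[OF jM(1)] w1[OF jM(1)]
      by (simp add: J(1,4) w_Cons[OF J(3) jM(2) J(2) jM(1)] smult_left smult_right m_assoc mult.commute)
    show "?s j \<odot> (w [i] [j] \<otimes> ((w J1 M \<otimes> ?u M) \<otimes> v j k)) \<in> carrier A"
      using uc[OF jM(2)] wc[OF jM(2)] vc[OF jM(1)] w1[OF jM(1)] by simp
  qed
  also have "\<dots> = (\<Oplus>j\<in>I. of_bool (J1 = K1) \<odot> (sgn2 (d i + d k) (mdeg d K1) \<odot> (w [i] [j] \<otimes> v j k)))"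
  proof (rule finsum_cong'[OF refl])
    show "(\<lambda>j. of_bool (J1 = K1) \<odot> (sgn2 (d i + d k) (mdeg d K1) \<odot> (w [i] [j] \<otimes> v j k))) \<in> I \<rightarrow> carrier A"
      using vc w1 by auto
    fix j assume j: "j \<in> I"
    have f: "(\<lambda>x. ?s j \<odot> (w [i] [j] \<otimes> (x \<otimes> v j k))) \<in> klin A A"
      by (intro klin_smult kspace_axioms klin_comp[OF klin_mult_left[OF vc[OF j]] klin_mult_right[OF w1[OF j]]])
    have "(\<Oplus>M\<in>mwords I l. ?s j \<odot> (w [i] [j] \<otimes> ((w J1 M \<otimes> ?u M) \<otimes> v j k)))
      = ?s j \<odot> (w [i] [j] \<otimes> ((\<Oplus>M\<in>mwords I l. w J1 M \<otimes> ?u M) \<otimes> v j k))"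
      using klin_finsum[OF kspace_axioms kspace_axioms f, of "mwords I l" "\<lambda>M. w J1 M \<otimes> ?u M"] uc wc by simp
    \<comment> \<open>The sign becomes independent of \<open>j\<close> only when J1 = K1; the sum
      over \<open>M\<close>, already carried out, is zero in all other cases.\<close>
    moreover have "J1 = K1 \<Longrightarrow> ?s j = sgn2 (d i + d k) (mdeg d K1)"
      by (cases "d i"; cases "d j"; cases "d k"; cases "mdeg d K1") (simp_all add: sgn2_def)
    ultimately show "(\<Oplus>M\<in>mwords I l. ?s j \<odot> (w [i] [j] \<otimes> ((w J1 M \<otimes> ?u M) \<otimes> v j k)))
        = of_bool (J1 = K1) \<odot> (sgn2 (d i + d k) (mdeg d K1) \<odot> (w [i] [j] \<otimes> v j k))"
      using Suc.IH[OF J(3,6)] vc[OF j] w1[OF j] by (auto simp: smult_left smult_right mult_zero)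
  qed
  also have "\<dots> = of_bool (J1 = K1) \<odot> (sgn2 (d i + d k) (mdeg d K1) \<odot> (of_bool (i = k) \<odot> \<one>))"
    unfolding v_right[OF J(2,5), symmetric]
    by (subst smult_finsum[OF finite_I], use w1 vc in force)+ simp
  also have "\<dots> = of_bool (J = K) \<odot> \<one>"
  proof -
    have "d k + d k = 0" by (cases "d k") auto
    then show ?thesis using J by (auto simp: sgn2_def)
  qed
  finally show ?case .
qed

end

end

section \<open>A quadratic relation for the braid operator\<close>

lemma eta_minus [simp]: "eta n (- i) = eta n i"
  by (simp add: eta_def)

lemma sg2_minus [simp]: "sg2 n (- i) j = sg2 n i j" "sg2 n i (- j) = sg2 n i j"
  by (simp_all add: sg2_def)

lemma idx_minus [simp]: "- i \<in> idx n m \<longleftrightarrow> i \<in> idx n m"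
  by (auto simp: idx_def)

lemma idx_nz: "i \<in> idx n m \<Longrightarrow> i \<noteq> 0"
  by (auto simp: idx_def)

lemma idx_neq_minus: "i \<in> idx n m \<Longrightarrow> i \<noteq> - i" "i \<in> idx n m \<Longrightarrow> - i \<noteq> i"
  by (auto simp: idx_def)

text \<open>The sign occurs as a scalar and, as an integer, in exponents of q; a case distinction
  has to fix both values together.\<close>

lemma sg_cases: "((sg n i :: int) = 1 \<and> (sg n i :: 'k::field) = 1) \<or> ((sg n i :: int) = - 1 \<and> (sg n i :: 'k) = - 1)"
  by (simp add: sg2_def sgn2_def)

locale spo_scalars =
  fixes q :: "'k::field" and n m :: nat
  assumes q_nz: "q \<noteq> 0"
begin

definition lam :: 'k where "lam = q - inverse q"

definition cq :: "int \<Rightarrow> 'k" where "cq a = Cq n q a (- a)"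

text \<open>The entry of \<open>Rhat\<close> in row \<open>[- a, a]\<close> and column
  \<open>[a, - a]\<close>. It is the root q^(-1) or -q of \<open>x^2 + \<lambda> x - 1\<close>,
  according to the parity of \<open>a\<close> (\<open>adiag_square\<close>).\<close>

definition adiag :: "int \<Rightarrow> 'k" where "adiag a = sg n a * q powi (- sg n a)"

definition sgn_sum :: "int \<Rightarrow> int" where "sgn_sum j = (\<Sum>k = 1..j. sg n k)"

text \<open>The signs add up to n - m, so this is the power of q with exponent -1 - 2(n - m). Its
  negative is the eigenvalue of \<open>Rhat\<close> on the vector \<open>emat\<close>.\<close>

definition mu :: 'k where "mu = inverse q * q powi (- 2 * sgn_sum (int (n + m)))"

lemma sgn_sum_step: "j \<ge> 1 \<Longrightarrow> sgn_sum j = sgn_sum (j - 1) + sg n j"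
proof -
  assume "j \<ge> 1"
  then have "{1..j} = insert j {1..j - 1}" by auto
  then show ?thesis by (simp add: sgn_sum_def)
qed

lemma sgn_sum_0 [simp]: "sgn_sum 0 = 0" by (simp add: sgn_sum_def)

lemma cq_pos: "j > 0 \<Longrightarrow> cq j = q powi sgn_sum j"
  by (simp add: cq_def Cq_def sgn_sum_def)

lemma cq_neg: "j > 0 \<Longrightarrow> cq (- j) = - sg n j * q powi (- 1 - sgn_sum (j - 1))"
  by (simp add: cq_def Cq_def sgn_sum_def)

lemma cq_nz [simp]: "cq a \<noteq> 0"
  using sg_cases[of n a, where 'k = 'k] q_nz by (auto simp: cq_def Cq_def)

lemma adiag_minus [simp]: "adiag (- a) = adiag a"
  by (simp add: adiag_def)

lemma adiag_nz [simp]: "adiag a \<noteq> 0"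
  using sg_cases[of n a, where 'k = 'k] q_nz by (auto simp: adiag_def)

lemma adiag_square: "adiag a * adiag a = 1 - lam * adiag a"
  using sg_cases[of n a, where 'k = 'k] q_nz by (auto simp: adiag_def lam_def field_simps)

text \<open>The diagonal entries q and -q^(-1) of \<open>Rhat\<close> at pairs \<open>[a, a]\<close>
  are the roots of \<open>x^2 - \<lambda> x - 1\<close>.\<close>

lemma sg_q_square: "(sg n a * q powi sg n a) * (sg n a * q powi sg n a) = 1 + lam * (sg n a * q powi sg n a)"
  using sg_cases[of n a, where 'k = 'k] q_nz by (auto simp: lam_def field_simps)

text \<open>The factor behind the telescoping of \<open>ratio_sum\<close>. A summand is
  \<open>- lam / adiag j\<close> times a power of q, and subtracting that power as well multiplies
  it by this factor, which shifts the sum of signs in its exponent by one index.\<close>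

lemma lam_dd: "1 + lam / adiag a = q powi (2 * sg n a)"
  using sg_cases[of n a, where 'k = 'k] q_nz
  by (auto simp: adiag_def lam_def field_simps power2_eq_square power_int_minus)

lemma cq_ratio_pos: assumes "j > 0" shows "adiag j * cq (- j) / cq j = - (q powi (- 1 - 2 * sgn_sum j))"
proof -
  have e: "sgn_sum (j - 1) = sgn_sum j - sg n j" using sgn_sum_step[of j] assms by simp
  have "sg n j * sg n j = (1 :: 'k)" by (simp add: sg2_def)
  then have "adiag j * cq (- j) / cq j = - (q powi (- sg n j) * q powi (- 1 - sgn_sum (j - 1)) / q powi sgn_sum j)"
    using assms by (simp add: adiag_def cq_pos cq_neg)
  also have "\<dots> = - (q powi (- sg n j + (- 1 - sgn_sum (j - 1)) - sgn_sum j))"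
    using q_nz by (simp only: power_int_add power_int_diff simp_thms)
  also have "- sg n j + (- 1 - sgn_sum (j - 1)) - sgn_sum j = - 1 - 2 * sgn_sum j" using e by simp
  finally show ?thesis .
qed

lemma cq_ratio_neg: assumes "j > 0" shows "adiag j * cq j / cq (- j) = - (q powi (1 + 2 * sgn_sum (j - 1)))"
proof -
  have e: "sgn_sum j = sgn_sum (j - 1) + sg n j" using sgn_sum_step[of j] assms by simp
  have "sg n j * sg n j = (1 :: 'k)" "sg n j \<noteq> (0 :: 'k)" by (auto simp: sg2_def sgn2_def)
  then have "adiag j * cq j / cq (- j) = - (q powi (- sg n j) * q powi sgn_sum j / q powi (- 1 - sgn_sum (j - 1)))"
    using assms by (simp add: adiag_def cq_pos cq_neg)
  also have "\<dots> = - (q powi (- sg n j + sgn_sum j - (- 1 - sgn_sum (j - 1))))"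
    using q_nz by (simp only: power_int_add power_int_diff simp_thms)
  also have "- sg n j + sgn_sum j - (- 1 - sgn_sum (j - 1)) = 1 + 2 * sgn_sum (j - 1)" using e by simp
  finally show ?thesis .
qed

text \<open>\<open>cq b / cq (- b)\<close> is the product of the entries of \<open>fmat\<close> and
  \<open>emat\<close> at \<open>[b, - b]\<close>, so this is \<open>lam\<close> times a partial
  contraction of \<open>f\<close> with \<open>e\<close>.\<close>

definition ratio_sum :: "int \<Rightarrow> 'k" where "ratio_sum z = lam * (\<Sum>b\<in>{b \<in> idx n m. b < z}. cq b / cq (- b))"

lemma ratio_sum_step: assumes "b \<in> idx n m" "\<And>b'. b' \<in> idx n m \<Longrightarrow> b' < z' \<longleftrightarrow> b' < z \<or> b' = b" "\<not> b < z"
  shows "ratio_sum z' = ratio_sum z + lam * (cq b / cq (- b))"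
proof -
  have "{b' \<in> idx n m. b' < z'} = insert b {b' \<in> idx n m. b' < z}" using assms(1,2) by blast
  then show ?thesis
    using assms(3) finite_idx[of n m] by (simp add: ratio_sum_def algebra_simps)
qed

text \<open>The sum \<open>ratio_sum\<close> telescopes, with different closed forms on the two halves of the index set.\<close>

lemma ratio_sum_neg: "t < n + m \<Longrightarrow> ratio_sum (int t - int (n + m)) = mu - q powi (- 1 - 2 * sgn_sum (int (n + m) - int t))"
proof (induction t)
  case 0
  have "{b \<in> idx n m. b < - int (n + m)} = {}" by (auto simp: idx_def)
  moreover have "mu = q powi (- 1 - 2 * sgn_sum (int (n + m)))"
    using q_nz power_int_add[of q "- 1" "- 2 * sgn_sum (int (n + m))"] by (simp add: mu_def)
  moreover have "int 0 - int (n + m) = - int (n + m)" "int (n + m) - int 0 = int (n + m)" by simp_all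
  ultimately show ?case unfolding ratio_sum_def by (simp only: sum.empty mult_zero_right) simp
next
  case (Suc t)
  let ?j = "int (n + m) - int t"
  have j: "?j > 0" "- ?j \<in> idx n m" using Suc by (auto simp: idx_def)
  have s: "ratio_sum (int (Suc t) - int (n + m)) = ratio_sum (int t - int (n + m)) + lam * (cq (- ?j) / cq (- (- ?j)))"
    by (rule ratio_sum_step[OF j(2)]) auto
  have "lam * (cq (- ?j) / cq ?j) = (lam / adiag ?j) * (adiag ?j * cq (- ?j) / cq ?j)" by simp
  also have "\<dots> = - (lam / adiag ?j) * q powi (- 1 - 2 * sgn_sum ?j)" unfolding cq_ratio_pos[OF j(1)] by simp
  finally have "lam * (cq (- ?j) / cq ?j) = - (lam / adiag ?j) * q powi (- 1 - 2 * sgn_sum ?j)" .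
  moreover have "ratio_sum (int t - int (n + m)) = mu - q powi (- 1 - 2 * sgn_sum ?j)" using Suc by simp
  \<comment> \<open>The new summand joins the power that is already subtracted; by
    \<open>lam_dd\<close> the result is the power for the next index.\<close>
  ultimately have "ratio_sum (int (Suc t) - int (n + m)) = mu - (1 + lam / adiag ?j) * q powi (- 1 - 2 * sgn_sum ?j)"
    unfolding s minus_minus by (simp only:) (simp add: algebra_simps)
  also have "(1 + lam / adiag ?j) * q powi (- 1 - 2 * sgn_sum ?j) = q powi (2 * sg n ?j + (- 1 - 2 * sgn_sum ?j))"
    unfolding lam_dd using q_nz by (simp only: power_int_add simp_thms)
  also have "2 * sg n ?j + (- 1 - 2 * sgn_sum ?j) = - 1 - 2 * sgn_sum (int (n + m) - int (Suc t))"
    using sgn_sum_step[of ?j] j(1) by (simp add: algebra_simps)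
  finally show ?case .
qed

lemma ratio_sum_pos: "t < n + m \<Longrightarrow> ratio_sum (int t + 1) = mu - q powi (1 + 2 * sgn_sum (int t)) + lam"
proof (induction t)
  case 0
  have i: "- 1 \<in> idx n m" using 0 by (auto simp: idx_def)
  \<comment> \<open>Zero is not an index: passing from the bound -1 to the bound 1 adds just the
    summand at -1.\<close>
  have s: "ratio_sum 1 = ratio_sum (- 1) + lam * (cq (- 1) / cq (- (- 1)))"
    by (rule ratio_sum_step[OF i]) (auto simp: idx_def)
  have g1: "ratio_sum (- 1) = mu - q powi (- 1 - 2 * sgn_sum 1)"
  proof -
    obtain r where r: "n + m = Suc r" using 0 by (cases "n + m") auto
    then show ?thesis using ratio_sum_neg[of r] by (simp add: r)
  qed
  have "lam * (cq (- 1) / cq 1) = (lam / adiag 1) * (adiag 1 * cq (- 1) / cq 1)" by simp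
  also have "\<dots> = - (lam / adiag 1) * q powi (- 1 - 2 * sgn_sum 1)" unfolding cq_ratio_pos[of 1, simplified] by simp
  finally have "ratio_sum 1 = mu - (1 + lam / adiag 1) * q powi (- 1 - 2 * sgn_sum 1)"
    using s g1 by (simp add: algebra_simps)
  also have "(1 + lam / adiag 1) * q powi (- 1 - 2 * sgn_sum 1) = q powi (2 * sg n 1 + (- 1 - 2 * sgn_sum 1))"
    unfolding lam_dd using q_nz by (simp only: power_int_add simp_thms)
  also have "2 * sg n 1 + (- 1 - 2 * sgn_sum 1) = - 1" using sgn_sum_step[of 1] by simp
  \<comment> \<open>The additional \<open>lam\<close> on the positive half comes from
    \<open>- q^(-1) = - q + lam\<close>, which rewrites the last power of the negative half as the
    first one of the positive half.\<close>
  finally show ?case by (simp add: lam_def)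
next
  case (Suc t)
  let ?j = "int t + 1"
  have j: "?j > 0" "?j \<in> idx n m" using Suc by (auto simp: idx_def)
  have s: "ratio_sum (int (Suc t) + 1) = ratio_sum (int t + 1) + lam * (cq ?j / cq (- ?j))"
    by (rule ratio_sum_step[OF j(2)]) auto
  have "lam * (cq ?j / cq (- ?j)) = (lam / adiag ?j) * (adiag ?j * cq ?j / cq (- ?j))" by simp
  also have "\<dots> = - (lam / adiag ?j) * q powi (1 + 2 * sgn_sum (?j - 1))" unfolding cq_ratio_neg[OF j(1)] by simp
  finally have "lam * (cq ?j / cq (- ?j)) = - (lam / adiag ?j) * q powi (1 + 2 * sgn_sum (?j - 1))" .
  moreover have "ratio_sum ?j = mu - q powi (1 + 2 * sgn_sum (?j - 1)) + lam" using Suc by simp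
  ultimately have "ratio_sum (int (Suc t) + 1) = mu - (1 + lam / adiag ?j) * q powi (1 + 2 * sgn_sum (?j - 1)) + lam"
    unfolding s by (simp only:) (simp add: algebra_simps)
  also have "(1 + lam / adiag ?j) * q powi (1 + 2 * sgn_sum (?j - 1)) = q powi (2 * sg n ?j + (1 + 2 * sgn_sum (?j - 1)))"
    unfolding lam_dd using q_nz by (simp only: power_int_add simp_thms)
  also have "2 * sg n ?j + (1 + 2 * sgn_sum (?j - 1)) = 1 + 2 * sgn_sum (int (Suc t))"
    using sgn_sum_step[of ?j] j(1) by (simp add: algebra_simps)
  finally show ?case .
qed

text \<open>Divided by \<open>cq (- b)\<close>, this is row \<open>[b, - b]\<close> of the
  eigenvalue equation \<open>Rhat e = - mu e\<close>: the terms with \<open>adiag\<close> and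
  \<open>lam\<close> are the antidiagonal and diagonal entries of that row, and
  \<open>ratio_sum\<close> comes from its triangular part.\<close>

lemma ratio_sum_eq: assumes "b \<in> idx n m" shows "ratio_sum (- b) = mu + adiag b * cq (- b) / cq b + (if b < 0 then lam else 0)"
proof (cases "b > 0")
  case True
  then obtain t where "b = int (n + m) - int t" "t < n + m"
    using assms that[of "nat (int (n + m) - b)"] by (auto simp: idx_def)
  then show ?thesis using ratio_sum_neg[of t] cq_ratio_pos[OF True] True by simp
next
  case False
  then have b: "b < 0" using assms by (auto simp: idx_def)
  define j where "j = - b"
  obtain t where t: "j = int t + 1" "t < n + m"
    using b assms that[of "nat (- b - 1)"] by (auto simp: idx_def j_def)
  have "ratio_sum j = mu - q powi (1 + 2 * sgn_sum (j - 1)) + lam" using ratio_sum_pos[OF t(2)] t(1) by simp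
  then show ?thesis using cq_ratio_neg[of j] b adiag_minus[of b] by (simp add: j_def)
qed

subsection \<open>The matrix of the braid operator\<close>

text \<open>\<open>Rhat\<close> is the ordinary matrix of \<open>P R\<close>, where \<open>P\<close> is the graded flip; its row index
  \<open>[j, i]\<close> carries the exchanged indices.\<close>

definition Rhat :: "int list \<Rightarrow> int list \<Rightarrow> 'k"
  where "Rhat J K = sg2 n (J ! 1) (J ! 0) * sgn2 (eta n (J ! 0) + eta n (K ! 1)) (eta n (K ! 0))
    * Rmat n m q (J ! 1) (J ! 0) (K ! 0) (K ! 1)"

lemma Rmat_eq:
  assumes "i \<in> idx n m" "j \<in> idx n m" "k \<in> idx n m" "l \<in> idx n m"
  shows "Rmat n m q i j k l =
    (if i = k \<and> j = l then if i = j then q powi sg n i else if j = - i then q powi (- sg n i) else 1 else 0)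
    + (if i = l \<and> j = k \<and> k < i then lam * sg n k else 0)
    - (if j = - i \<and> l = - k \<and> k < i then lam * (sg n k * sg n i * sg2 n k i * (cq k / cq i)) else 0)"
proof -
  have nz: "i \<noteq> - i" using assms(1) idx_neq_minus by blast
  have 1: "(\<Sum>a \<in> idx n m. q powi sg n a * EE (a, a) (a, a) i j k l)
    = (if i = k \<and> j = l \<and> i = j then q powi sg n i else 0)"
  proof -
    have "(\<Sum>a \<in> idx n m. q powi sg n a * EE (a, a) (a, a) i j k l)
      = (\<Sum>a \<in> idx n m. if a = i then (if i = k \<and> j = l \<and> i = j then q powi sg n i else 0) else 0)"
      by (intro sum.cong) (auto simp: EE_def)
    then show ?thesis using assms finite_idx by (simp add: sum.delta)
  qed
  have 2: "(\<Sum>a \<in> idx n m. q powi (- sg n a) * EE (a, a) (- a, - a) i j k l)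
    = (if i = k \<and> j = l \<and> j = - i then q powi (- sg n i) else 0)"
  proof -
    have "(\<Sum>a \<in> idx n m. q powi (- sg n a) * EE (a, a) (- a, - a) i j k l)
      = (\<Sum>a \<in> idx n m. if a = i then (if i = k \<and> j = l \<and> j = - i then q powi (- sg n i) else 0) else 0)"
      by (intro sum.cong) (auto simp: EE_def)
    then show ?thesis using assms finite_idx by (simp add: sum.delta)
  qed
  have 3: "(\<Sum>a \<in> idx n m. \<Sum>b \<in> idx n m - {a, - a}. EE (a, a) (b, b) i j k l)
    = (if i = k \<and> j = l \<and> j \<noteq> i \<and> j \<noteq> - i then 1 else 0 :: 'k)"
  proof -
    have "(\<Sum>a \<in> idx n m. \<Sum>b \<in> idx n m - {a, - a}. EE (a, a) (b, b) i j k l)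
      = (\<Sum>a \<in> idx n m. if a = i then (if i = k \<and> j = l \<and> j \<noteq> i \<and> j \<noteq> - i then 1 else 0 :: 'k) else 0)"
    proof (intro sum.cong refl)
      fix a assume a: "a \<in> idx n m"
      have "(\<Sum>b \<in> idx n m - {a, - a}. EE (a, a) (b, b) i j k l)
        = (\<Sum>b \<in> idx n m - {a, - a}. if b = j then (if i = k \<and> j = l \<and> a = i then 1 else 0 :: 'k) else 0)"
        by (intro sum.cong) (auto simp: EE_def)
      also have "\<dots> = (if a = i then (if i = k \<and> j = l \<and> j \<noteq> i \<and> j \<noteq> - i then 1 else 0 :: 'k) else 0)"
        using assms finite_idx[of n m] by (simp add: sum.delta)
      finally show "(\<Sum>b \<in> idx n m - {a, - a}. EE (a, a) (b, b) i j k l)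
        = (if a = i then (if i = k \<and> j = l \<and> j \<noteq> i \<and> j \<noteq> - i then 1 else 0 :: 'k) else 0)" .
    qed
    then show ?thesis using assms finite_idx by (simp add: sum.delta)
  qed
  have 4: "(\<Sum>b \<in> idx n m. \<Sum>a \<in> {a \<in> idx n m. a < b}. sg n a * EE (b, a) (a, b) i j k l)
    = (if i = l \<and> j = k \<and> k < i then sg n k else 0 :: 'k)"
  proof -
    have "(\<Sum>b \<in> idx n m. \<Sum>a \<in> {a \<in> idx n m. a < b}. sg n a * EE (b, a) (a, b) i j k l)
      = (\<Sum>b \<in> idx n m. if b = i then (if i = l \<and> j = k \<and> k < i then sg n k else 0 :: 'k) else 0)"
    proof (intro sum.cong refl)
      fix b assume b: "b \<in> idx n m"
      have "(\<Sum>a \<in> {a \<in> idx n m. a < b}. sg n a * EE (b, a) (a, b) i j k l)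
        = (\<Sum>a \<in> {a \<in> idx n m. a < b}. if a = k then (if i = l \<and> j = k \<and> b = i then sg n k else 0 :: 'k) else 0)"
        by (intro sum.cong) (auto simp: EE_def)
      also have "\<dots> = (if b = i then (if i = l \<and> j = k \<and> k < i then sg n k else 0 :: 'k) else 0)"
        using assms finite_idx[of n m] by (simp add: sum.delta)
      finally show "(\<Sum>a \<in> {a \<in> idx n m. a < b}. sg n a * EE (b, a) (a, b) i j k l)
        = (if b = i then (if i = l \<and> j = k \<and> k < i then sg n k else 0 :: 'k) else 0)" .
    qed
    then show ?thesis using assms finite_idx by (simp add: sum.delta)
  qed
  let ?c = "sg n k * sg n i * sg2 n k i * (cq k / cq i) :: 'k"
  have 5: "(\<Sum>b \<in> idx n m. \<Sum>a \<in> {a \<in> idx n m. a < b}.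
         sg n a * sg n b * sg2 n a b * Cq_inv n m q (- b) b * Cq n q a (- a) * EE (b, a) (- b, - a) i j k l)
    = (if j = - i \<and> l = - k \<and> k < i then ?c else 0)"
  proof -
    have "(\<Sum>b \<in> idx n m. \<Sum>a \<in> {a \<in> idx n m. a < b}.
         sg n a * sg n b * sg2 n a b * Cq_inv n m q (- b) b * Cq n q a (- a) * EE (b, a) (- b, - a) i j k l)
      = (\<Sum>b \<in> idx n m. if b = i then (if j = - i \<and> l = - k \<and> k < i then ?c else 0) else 0)"
    proof (intro sum.cong refl)
      fix b assume b: "b \<in> idx n m"
      have ci: "Cq_inv n m q (- b) b = inverse (cq b)"
        using Cq_inv_eq[OF q_nz, of "- b" n m b] b by (simp add: cq_def)
      have "(\<Sum>a \<in> {a \<in> idx n m. a < b}. sg n a * sg n b * sg2 n a b * Cq_inv n m q (- b) b * Cq n q a (- a) * EE (b, a) (- b, - a) i j k l)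
        = (\<Sum>a \<in> {a \<in> idx n m. a < b}. if a = k then (if j = - i \<and> l = - k \<and> b = i then ?c else 0) else 0)"
        unfolding ci cq_def[symmetric] by (intro sum.cong) (auto simp: EE_def divide_inverse)
      also have "\<dots> = (if b = i then (if j = - i \<and> l = - k \<and> k < i then ?c else 0) else 0)"
        using assms finite_idx[of n m] by (simp add: sum.delta)
      finally show "(\<Sum>a \<in> {a \<in> idx n m. a < b}. sg n a * sg n b * sg2 n a b * Cq_inv n m q (- b) b * Cq n q a (- a) * EE (b, a) (- b, - a) i j k l)
        = (if b = i then (if j = - i \<and> l = - k \<and> k < i then ?c else 0) else 0)" .
    qed
    then show ?thesis using assms finite_idx by (simp add: sum.delta)
  qed
  show ?thesis
  proof -
    have "(if i = k \<and> j = l \<and> i = j then q powi sg n i else 0) + (if i = k \<and> j = l \<and> j = - i then q powi (- sg n i) else 0)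
      + (if i = k \<and> j = l \<and> j \<noteq> i \<and> j \<noteq> - i then 1 else 0 :: 'k)
      = (if i = k \<and> j = l then if i = j then q powi sg n i else if j = - i then q powi (- sg n i) else 1 else 0)"
    proof -
      have h: "(if A \<and> A' \<and> B then a else 0) + (if A \<and> A' \<and> C then b else 0) + (if A \<and> A' \<and> B' \<and> \<not> C then 1 else 0)
        = (if A \<and> A' then if B then a else if C then b else 1 else 0 :: 'k)"
        if "B' \<longleftrightarrow> \<not> B" "\<not> (B \<and> C)" for A A' B B' C a b
        using that by auto
      show ?thesis by (rule h) (use nz in auto)
    qed
    moreover have "lam * (if b then c else 0) = (if b then lam * c else 0)" for b c by simp
    ultimately show ?thesis
      unfolding Rmat_def 1 2 3 4 5 lam_def[symmetric] by (simp only:)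
  qed
qed

text \<open>The sign of the flip and the sign of the graded tensor product of matrix units cancel
  all signs of the two triangular parts of R. Only the diagonal part keeps the sign of the pair
  \<open>k\<close>, \<open>l\<close>.\<close>

lemma Rhat_eq:
  assumes "x \<in> idx n m" "y \<in> idx n m" "k \<in> idx n m" "l \<in> idx n m"
  shows "Rhat [x, y] [k, l] =
    (if y = k \<and> x = l then sg2 n k l * (if k = l then q powi sg n k else if l = - k then q powi (- sg n k) else 1) else 0)
    + (if y = l \<and> x = k \<and> k < l then lam else 0)
    - (if y = - x \<and> l = - k \<and> k < - x then lam * (cq k / cq (- x)) else 0)"
proof -
  have s: "sgn2 (b :: bit) b' * sgn2 (b' + b) b' * sgn2 b' b' = (1 :: 'k)"
    "sgn2 (b :: bit) b * sgn2 (b + b') b' * (sgn2 b' b' * sgn2 b b * sgn2 b' b) = (1 :: 'k)" 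
    "sgn2 (b + b) b' = (1 :: 'k)" for b b' :: bit
    by (cases b; cases b'; simp add: sgn2_def)+
  show ?thesis
  proof -
    let ?S = "sg2 n y x * sgn2 (eta n x + eta n l) (eta n k) :: 'k"
    have "?S * (if y = k \<and> x = l then if y = x then q powi sg n y else if x = - y then q powi (- sg n y) else 1 else 0)
      = (if y = k \<and> x = l then sg2 n k l * (if k = l then q powi sg n k else if l = - k then q powi (- sg n k) else 1) else 0)"
    proof (cases "y = k \<and> x = l")
      case True
      then have "?S = sg2 n k l" using s(3)[of "eta n l" "eta n k"] by simp
      then show ?thesis using True by auto
    qed auto
    moreover have "?S * (if y = l \<and> x = k \<and> k < y then lam * sg n k else 0) = (if y = l \<and> x = k \<and> k < l then lam else 0)"
      using s(1)[of "eta n l" "eta n k", unfolded mult.assoc] by (auto simp: sg2_def mult.assoc)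
    moreover have "?S * (if x = - y \<and> l = - k \<and> k < y then lam * (sg n k * sg n y * sg2 n k y * (cq k / cq y)) else 0)
      = (if y = - x \<and> l = - k \<and> k < - x then lam * (cq k / cq (- x)) else 0)"
    proof (cases "y = - x \<and> l = - k \<and> k < - x")
      case True
      then have "?S * (lam * (sg n k * sg n y * sg2 n k y * (cq k / cq y)))
        = (sgn2 (eta n x) (eta n x) * sgn2 (eta n x + eta n k) (eta n k)
            * (sgn2 (eta n k) (eta n k) * sgn2 (eta n x) (eta n x) * sgn2 (eta n k) (eta n x))) * (lam * (cq k / cq (- x)))"
        by (simp only: sg2_def eta_minus mult_ac)
      then show ?thesis using True s(2)[of "eta n x" "eta n k"] by simp
    qed auto
    ultimately show ?thesis
      unfolding Rhat_def using Rmat_eq[OF assms(2,1,3,4)] by (simp add: distrib_left right_diff_distrib)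
  qed
qed

text \<open>The vector \<open>e\<close> and the linear form \<open>f\<close> on \<open>V \<otimes> V\<close>, as functions of index pairs \<open>[a, b]\<close>.\<close>

definition emat :: "int list \<Rightarrow> 'k" where "emat J = (if J ! 1 = - (J ! 0) then inverse (cq (- (J ! 0))) else 0)"
definition fmat :: "int list \<Rightarrow> 'k" where "fmat J = (if J ! 1 = - (J ! 0) then cq (J ! 0) else 0)"

lemma sum_mwords2: "(\<Sum>J\<in>mwords I 2. f J) = (\<Sum>a\<in>I. \<Sum>b\<in>I. f [a, b])" if "finite I" for I :: "'i set"
proof -
  have "mwords I 2 = (\<lambda>p. [fst p, snd p]) ` (I \<times> I)"
  proof (intro equalityI subsetI)
    fix J assume "J \<in> mwords I 2"
    then obtain a b where "J = [a, b]" "a \<in> I" "b \<in> I"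
      by (auto simp: mwords_def numeral_2_eq_2 length_Suc_conv)
    then show "J \<in> (\<lambda>p. [fst p, snd p]) ` (I \<times> I)" by (intro image_eqI[of _ _ "(a, b)"]) auto
  qed (auto simp: mwords_def)
  then have "(\<Sum>J\<in>mwords I 2. f J) = (\<Sum>p\<in>I \<times> I. f [fst p, snd p])"
    by (simp add: sum.reindex inj_on_def prod_eq_iff)
  then show ?thesis by (simp add: sum.cartesian_product case_prod_unfold)
qed

text \<open>For a pair that is neither equal nor opposite, \<open>Rhat\<close> acts on the span of
  \<open>[k, l]\<close> and \<open>[l, k]\<close> as in a Hecke algebra; these blocks contribute
  nothing to the rank-one term.\<close>

lemma Rhat_off:
  assumes "x \<in> idx n m" "y \<in> idx n m" "k \<in> idx n m" "l \<in> idx n m" "l \<noteq> - k" "l \<noteq> k"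
  shows "Rhat [x, y] [k, l] = (if x = l \<and> y = k then sg2 n k l else 0) + (if x = k \<and> y = l \<and> k < l then lam else 0)"
  unfolding Rhat_eq[OF assms(1-4)] using assms by auto

lemma Rhat_diag:
  assumes "x \<in> idx n m" "y \<in> idx n m" "k \<in> idx n m"
  shows "Rhat [x, y] [k, k] = (if x = k \<and> y = k then sg n k * q powi sg n k else 0)"
  unfolding Rhat_eq[OF assms assms(3)] using idx_neq_minus[OF assms(3)] by auto

text \<open>\<open>Rhat\<close> on the span of the pairs \<open>[a, - a]\<close>: row
  \<open>[b, - b]\<close>, column \<open>[a, - a]\<close>. Beside the antidiagonal and a diagonal
  part it has a triangular part of rank-one shape, whose square produces the ratio sums.\<close>

definition zero_block :: "int \<Rightarrow> int \<Rightarrow> 'k"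
  where "zero_block b a = (if b = - a then adiag a else 0) + (if b = a \<and> a < 0 then lam else 0)
    - (if a < - b then lam * (cq a / cq (- b)) else 0)"

lemma Rhat_zero_weight:
  assumes "x \<in> idx n m" "y \<in> idx n m" "k \<in> idx n m"
  shows "Rhat [x, y] [k, - k] = (if y = - x then zero_block x k else 0)"
proof -
  have k: "- k \<in> idx n m" "k \<noteq> - k" using assms idx_neq_minus by auto
  show ?thesis
    unfolding Rhat_eq[OF assms k(1)] zero_block_def adiag_def using k by auto
qed

text \<open>Row \<open>x\<close> of the block is split into its antidiagonal, diagonal and
  triangular part, and the last one is summed against column \<open>k\<close>. What remains is one
  truncated sum of ratios, and its closed form supplies the term with \<open>mu\<close>.\<close>

lemma zero_block_square:
  assumes x: "x \<in> idx n m" and k: "k \<in> idx n m"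
  shows "(\<Sum>b\<in>idx n m. zero_block x b * zero_block b k) = lam * zero_block x k + of_bool (x = k) + lam * mu * (cq k / cq (- x))"
proof -
  have nz: "x \<noteq> - x" "k \<noteq> - k" "x \<noteq> 0" "k \<noteq> 0" using assms idx_neq_minus idx_nz by blast+
  have fin: "finite (idx n m)" by (rule finite_idx)
  have xm: "- x \<in> idx n m" "- k \<in> idx n m" using assms by auto
  have "(\<Sum>b\<in>idx n m. zero_block x b * zero_block b k) = (\<Sum>b\<in>idx n m. (if b = - x then adiag x * zero_block (- x) k else 0)
      + (if b = x then (if x < 0 then lam else 0) * zero_block x k else 0)
      - (if b < - x then lam / cq (- x) * (cq b * zero_block b k) else 0))"
    by (intro sum.cong refl) (auto simp: zero_block_def[of x] algebra_simps)
  also have "\<dots> = adiag x * zero_block (- x) k + (if x < 0 then lam else 0) * zero_block x k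
      - lam / cq (- x) * (\<Sum>b\<in>{b \<in> idx n m. b < - x}. cq b * zero_block b k)"
    using x xm fin by (simp add: sum.distrib sum_subtractf sum.delta sum.inter_filter[symmetric] sum_distrib_left)
  also have "(\<Sum>b\<in>{b \<in> idx n m. b < - x}. cq b * zero_block b k)
    = (\<Sum>b\<in>{b \<in> idx n m. b < - x}. (if b = - k then cq (- k) * adiag k else 0) + (if b = k then (if k < 0 then lam else 0) * cq k else 0)
        - (if b < - k then lam * cq k * (cq b / cq (- b)) else 0))"
    by (intro sum.cong refl) (auto simp: zero_block_def algebra_simps)
  also have "\<dots> = (if - k < - x then cq (- k) * adiag k else 0) + (if k < - x \<and> k < 0 then lam * cq k else 0)
        - cq k * ratio_sum (min (- x) (- k))"
  proof -
    \<comment> \<open>The row restricts to \<open>b < - x\<close> and the column to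
      \<open>b < - k\<close>. The sum is cut at the smaller bound, which is why the order of
      \<open>x\<close> and \<open>k\<close> decides at which index \<open>ratio_sum_eq\<close> is
      applied below.\<close>
    have "{b \<in> {b \<in> idx n m. b < - x}. b < - k} = {b \<in> idx n m. b < min (- x) (- k)}" by auto
    then have "(\<Sum>b\<in>{b \<in> idx n m. b < - x}. if b < - k then lam * cq k * (cq b / cq (- b)) else 0) = cq k * ratio_sum (min (- x) (- k))"
      using fin by (simp add: sum.inter_filter[symmetric] ratio_sum_def sum_distrib_left mult_ac)
    then show ?thesis
      using x k xm fin by (simp add: sum.distrib sum_subtractf sum.delta)
  qed
  finally have eq: "(\<Sum>b\<in>idx n m. zero_block x b * zero_block b k) = adiag x * zero_block (- x) k + (if x < 0 then lam else 0) * zero_block x k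
      - lam / cq (- x) * ((if - k < - x then cq (- k) * adiag k else 0) + (if k < - x \<and> k < 0 then lam * cq k else 0)
        - cq k * ratio_sum (min (- x) (- k)))" .
  show ?thesis
  proof (rule linorder_cases[of x k])
    assume "x = k"
    \<comment> \<open>On the diagonal two antidiagonal entries meet; their quadratic equation
      produces the identity term.\<close>
    moreover have "adiag k * (adiag k * cq (- k)) = cq (- k) - lam * (adiag k * cq (- k))"
      unfolding mult.assoc[symmetric] adiag_square by (simp add: algebra_simps)
    ultimately show ?thesis
      unfolding eq using ratio_sum_eq[OF k] nz by (auto simp: zero_block_def field_simps)
  next
    assume xk: "x < k"
    then have "min (- x) (- k) = - k" by simp
    then show ?thesis
      unfolding eq using ratio_sum_eq[OF k] nz xk by (auto simp: zero_block_def field_simps)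
  next
    assume xk: "k < x"
    then have "min (- x) (- k) = - x" by simp
    then show ?thesis
      unfolding eq using ratio_sum_eq[OF x] nz xk by (auto simp: zero_block_def field_simps)
  qed
qed

text \<open>\<open>Rhat\<close> preserves weights, so columns of three kinds are treated: opposite
  pairs (\<open>zero_block\<close>), equal pairs (one eigenvalue) and all others (blocks of size
  two). The rank-one term occurs in the first kind alone.\<close>

lemma Rhat_square:
  assumes P: "P \<in> mwords (idx n m) 2" and K: "K \<in> mwords (idx n m) 2"
  shows "(\<Sum>J\<in>mwords (idx n m) 2. Rhat P J * Rhat J K) = lam * Rhat P K + of_bool (P = K) + lam * mu * (emat P * fmat K)"
proof -
  let ?I = "idx n m"
  have fin: "finite ?I" by (rule finite_idx)
  obtain x y where xy: "P = [x, y]" "x \<in> ?I" "y \<in> ?I"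
    using P by (auto simp: mwords_def numeral_2_eq_2 length_Suc_conv)
  obtain k l where kl: "K = [k, l]" "k \<in> ?I" "l \<in> ?I"
    using K by (auto simp: mwords_def numeral_2_eq_2 length_Suc_conv)
  have sum: "(\<Sum>J\<in>mwords ?I 2. Rhat P J * Rhat J K) = (\<Sum>a\<in>?I. \<Sum>b\<in>?I. Rhat [x, y] [a, b] * Rhat [a, b] [k, l])"
    unfolding sum_mwords2[OF fin] xy(1) kl(1) ..
  consider "l = - k" | "l \<noteq> - k" "l = k" | "l \<noteq> - k" "l \<noteq> k" by blast
  then show ?thesis
  proof cases
    case 1
    have "(\<Sum>a\<in>?I. \<Sum>b\<in>?I. Rhat [x, y] [a, b] * Rhat [a, b] [k, l])
      = (\<Sum>a\<in>?I. \<Sum>b\<in>?I. if b = - a then Rhat [x, y] [a, - a] * zero_block a k else 0)"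
      using kl(2) by (intro sum.cong refl) (simp add: 1 Rhat_zero_weight)
    also have "\<dots> = (\<Sum>a\<in>?I. (if y = - x then zero_block x a else 0) * zero_block a k)"
      using fin xy by (intro sum.cong refl) (simp add: sum.delta Rhat_zero_weight)
    also have "\<dots> = (if y = - x then (\<Sum>a\<in>?I. zero_block x a * zero_block a k) else 0)" by simp
    also have "\<dots> = lam * Rhat P K + of_bool (P = K) + lam * mu * (emat P * fmat K)"
      using zero_block_square[OF xy(2) kl(2)] xy kl 1
      by (auto simp: Rhat_zero_weight emat_def fmat_def divide_inverse mult_ac)
    finally show ?thesis unfolding sum .
  next
    case 2
    have "(\<Sum>a\<in>?I. \<Sum>b\<in>?I. Rhat [x, y] [a, b] * Rhat [a, b] [k, l])
      = (\<Sum>a\<in>?I. \<Sum>b\<in>?I. if b = k then (if a = k then Rhat [x, y] [k, k] * (sg n k * q powi sg n k) else 0) else 0)"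
      using kl(2) by (intro sum.cong refl) (simp add: 2 Rhat_diag)
    also have "\<dots> = Rhat [x, y] [k, k] * (sg n k * q powi sg n k)"
      using fin kl by (simp add: sum.delta)
    also have "\<dots> = lam * Rhat P K + of_bool (P = K) + lam * mu * (emat P * fmat K)"
      using sg_q_square[of k] xy kl 2 by (auto simp: Rhat_diag fmat_def)
    finally show ?thesis unfolding sum .
  next
    case 3
    have "(\<Sum>a\<in>?I. \<Sum>b\<in>?I. Rhat [x, y] [a, b] * Rhat [a, b] [k, l])
      = (\<Sum>a\<in>?I. \<Sum>b\<in>?I. (if b = k then (if a = l then Rhat [x, y] [l, k] * sg2 n k l else 0) else 0)
          + (if b = l then (if a = k then (if k < l then Rhat [x, y] [k, l] * lam else 0) else 0) else 0))"
      using kl 3 by (intro sum.cong refl) (simp add: Rhat_off distrib_left)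
    also have "\<dots> = Rhat [x, y] [l, k] * sg2 n k l + (if k < l then Rhat [x, y] [k, l] * lam else 0)"
      using fin kl by (simp add: sum.delta sum.distrib)
    also have "\<dots> = lam * Rhat P K + of_bool (P = K) + lam * mu * (emat P * fmat K)"
    proof -
      have s: "sg2 n k l * sg2 n k l = (1 :: 'k)" "sg2 n l k = (sg2 n k l :: 'k)"
        by (simp_all add: sg2_def sgn2_commute)
      have "k \<noteq> - l" using 3 by auto
      then have R: "Rhat [x, y] [l, k] = (if x = k \<and> y = l then sg2 n k l else 0) + (if x = l \<and> y = k \<and> l < k then lam else 0)"
        using Rhat_off[OF xy(2,3) kl(3,2)] 3 s(2) by simp
      show ?thesis
        using 3 by (auto simp: R Rhat_off[OF xy(2,3) kl(2,3)] xy(1) kl(1) fmat_def s algebra_simps)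
    qed
    finally show ?thesis unfolding sum .
  qed
qed

end

section \<open>The relations in terms of matrix coefficients\<close>

lemma mwords2E:
  assumes "J \<in> mwords I 2"
  obtains a b where "J = [a, b]" "a \<in> I" "b \<in> I"
  using assms by (auto simp: mwords_def numeral_2_eq_2 length_Suc_conv)

lemma mwords2I: "a \<in> I \<Longrightarrow> b \<in> I \<Longrightarrow> [a, b] \<in> mwords I 2"
  by (auto simp: mwords_def)

lemma klin_lincomb:
  assumes "kspace A" "kspace M" "f \<in> klin A M" "finite S" "\<And>J. J \<in> S \<Longrightarrow> x J \<in> carrier A"
  shows "f (\<Oplus>\<^bsub>A\<^esub>J\<in>S. r J \<odot>\<^bsub>A\<^esub> x J) = (\<Oplus>\<^bsub>M\<^esub>J\<in>S. r J \<odot>\<^bsub>M\<^esub> f (x J))"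
proof -
  interpret A: kspace A by fact
  interpret M: kspace M by fact
  have "f (\<Oplus>\<^bsub>A\<^esub>J\<in>S. r J \<odot>\<^bsub>A\<^esub> x J) = (\<Oplus>\<^bsub>M\<^esub>J\<in>S. f (r J \<odot>\<^bsub>A\<^esub> x J))"
    using assms(5) by (intro klin_finsum[OF assms(1-3)]) auto
  also have "\<dots> = (\<Oplus>\<^bsub>M\<^esub>J\<in>S. r J \<odot>\<^bsub>M\<^esub> f (x J))"
    using klinD[OF assms(3)] assms(5) by (intro M.finsum_cong') auto
  finally show ?thesis .
qed

text \<open>\<open>R v = v R\<close> with a scalar matrix R, written with scalar multiplication
  instead of products. It thus makes sense in any vector space, in particular in a tensor
  square.\<close>

definition (in kspace) intertwines :: "'j set \<Rightarrow> ('j \<Rightarrow> 'j \<Rightarrow> 'k) \<Rightarrow> ('j \<Rightarrow> 'j \<Rightarrow> 'a) \<Rightarrow> bool"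
  where "intertwines S R v \<longleftrightarrow> (\<forall>P\<in>S. \<forall>K\<in>S. (\<Oplus>J\<in>S. R P J \<odot> v J K) = (\<Oplus>J\<in>S. R J K \<odot> v P J))"

lemma (in superalgebra) intertwines_meq:
  assumes "v \<in> mats S"
  shows "intertwines S R v \<longleftrightarrow> meq S (mmul S (scal R) v) (mmul S v (scal R))"
  unfolding intertwines_def meq_def
  by (simp add: mmul_scal_left[OF assms] mmul_scal_right[OF assms])

text \<open>With the entries multiplied by tensors, R is moved through the two factors in turn:
  \<open>(R w) w = (w R) w = w (R w) = w (w R)\<close>.\<close>

lemma (in matalg) intertwines_comat:
  assumes "intertwines (mwords I l) R w"
  shows "kspace.intertwines (tensor A A) (mwords I l) R (comat A I w)"
proof -
  interpret AA: ktensor A A by (intro ktensor.intro kspace_axioms)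
  interpret T: kspace "tensor A A" by (rule AA.tensor_kspace)
  let ?S = "mwords I l" and ?T = "tensor A A"
  note p1 = bilinD(1)[OF AA.bilin_pure] and p2 = bilinD(2)[OF AA.bilin_pure]
  note fin = finite_mw[of l]
  have len: "length P = l" if "P \<in> ?S" for P using that by (simp add: mwords_def)
  show ?thesis
    unfolding T.intertwines_def
  proof (intro ballI)
    fix P K assume P: "P \<in> ?S" and K: "K \<in> ?S"
    have c: "pure_tensor A A (w J M) (w M' K') \<in> carrier ?T"
      if "J \<in> ?S" "M \<in> ?S" "M' \<in> ?S" "K' \<in> ?S" for J M M' K'
      using that by (intro AA.pure_closed w_closed[of _ l])
    have "(\<Oplus>\<^bsub>?T\<^esub>J\<in>?S. R P J \<odot>\<^bsub>?T\<^esub> comat A I w J K)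
        = (\<Oplus>\<^bsub>?T\<^esub>J\<in>?S. \<Oplus>\<^bsub>?T\<^esub>M\<in>?S. R P J \<odot>\<^bsub>?T\<^esub> pure_tensor A A (w J M) (w M K))"
    proof (rule T.finsum_cong'[OF refl])
      show "(\<lambda>J. \<Oplus>\<^bsub>?T\<^esub>M\<in>?S. R P J \<odot>\<^bsub>?T\<^esub> pure_tensor A A (w J M) (w M K)) \<in> ?S \<rightarrow> carrier ?T"
        using c K by (intro funcsetI T.finsum_closed) auto
      show "R P J \<odot>\<^bsub>?T\<^esub> comat A I w J K = (\<Oplus>\<^bsub>?T\<^esub>M\<in>?S. R P J \<odot>\<^bsub>?T\<^esub> pure_tensor A A (w J M) (w M K))"
        if "J \<in> ?S" for J
        unfolding comat_def len[OF that] by (rule T.smult_finsum[OF fin]) (use c that K in auto)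
    qed
    also have "\<dots> = (\<Oplus>\<^bsub>?T\<^esub>M\<in>?S. \<Oplus>\<^bsub>?T\<^esub>J\<in>?S. R P J \<odot>\<^bsub>?T\<^esub> pure_tensor A A (w J M) (w M K))"
      by (rule T.finsum_swap[OF fin fin]) (use c K in auto)
    also have "\<dots> = (\<Oplus>\<^bsub>?T\<^esub>M\<in>?S. \<Oplus>\<^bsub>?T\<^esub>J\<in>?S. R J M \<odot>\<^bsub>?T\<^esub> pure_tensor A A (w P J) (w M K))"
    proof (rule T.finsum_cong'[OF refl])
      show "(\<lambda>M. \<Oplus>\<^bsub>?T\<^esub>J\<in>?S. R J M \<odot>\<^bsub>?T\<^esub> pure_tensor A A (w P J) (w M K)) \<in> ?S \<rightarrow> carrier ?T"
        using c P K by (intro funcsetI T.finsum_closed) auto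
      fix M assume M: "M \<in> ?S"
      have pull: "(\<Oplus>\<^bsub>?T\<^esub>J\<in>?S. r J \<odot>\<^bsub>?T\<^esub> pure_tensor A A (x J) (w M K)) = pure_tensor A A (\<Oplus>J\<in>?S. r J \<odot> x J) (w M K)"
        if "\<And>J. J \<in> ?S \<Longrightarrow> x J \<in> carrier A" for r x
        by (rule klin_lincomb[OF kspace_axioms T.kspace_axioms p1[OF w_closed[OF M K]] fin that, symmetric])
      show "(\<Oplus>\<^bsub>?T\<^esub>J\<in>?S. R P J \<odot>\<^bsub>?T\<^esub> pure_tensor A A (w J M) (w M K))
          = (\<Oplus>\<^bsub>?T\<^esub>J\<in>?S. R J M \<odot>\<^bsub>?T\<^esub> pure_tensor A A (w P J) (w M K))"
        using pull[of "\<lambda>J. w J M" "R P", OF w_closed[OF _ M]] pull[of "w P" "\<lambda>J. R J M", OF w_closed[OF P]]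
          assms P M by (simp add: intertwines_def)
    qed
    also have "\<dots> = (\<Oplus>\<^bsub>?T\<^esub>J\<in>?S. \<Oplus>\<^bsub>?T\<^esub>M\<in>?S. R J M \<odot>\<^bsub>?T\<^esub> pure_tensor A A (w P J) (w M K))"
      by (rule T.finsum_swap[OF fin fin]) (use c P K in auto)
    also have "\<dots> = (\<Oplus>\<^bsub>?T\<^esub>J\<in>?S. \<Oplus>\<^bsub>?T\<^esub>M\<in>?S. R M K \<odot>\<^bsub>?T\<^esub> pure_tensor A A (w P J) (w J M))"
    proof (rule T.finsum_cong'[OF refl])
      show "(\<lambda>J. \<Oplus>\<^bsub>?T\<^esub>M\<in>?S. R M K \<odot>\<^bsub>?T\<^esub> pure_tensor A A (w P J) (w J M)) \<in> ?S \<rightarrow> carrier ?T"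
        using c P K by (intro funcsetI T.finsum_closed) auto
      fix J assume J: "J \<in> ?S"
      have pull: "(\<Oplus>\<^bsub>?T\<^esub>M\<in>?S. r M \<odot>\<^bsub>?T\<^esub> pure_tensor A A (w P J) (x M)) = pure_tensor A A (w P J) (\<Oplus>M\<in>?S. r M \<odot> x M)"
        if "\<And>M. M \<in> ?S \<Longrightarrow> x M \<in> carrier A" for r x
        by (rule klin_lincomb[OF kspace_axioms T.kspace_axioms p2[OF w_closed[OF P J]] fin that, symmetric])
      show "(\<Oplus>\<^bsub>?T\<^esub>M\<in>?S. R J M \<odot>\<^bsub>?T\<^esub> pure_tensor A A (w P J) (w M K))
          = (\<Oplus>\<^bsub>?T\<^esub>M\<in>?S. R M K \<odot>\<^bsub>?T\<^esub> pure_tensor A A (w P J) (w J M))"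
        using pull[of "\<lambda>M. w M K" "R J", OF w_closed[OF _ K]] pull[of "w J" "\<lambda>M. R M K", OF w_closed[OF J]]
          assms J K by (simp add: intertwines_def)
    qed
    also have "\<dots> = (\<Oplus>\<^bsub>?T\<^esub>M\<in>?S. \<Oplus>\<^bsub>?T\<^esub>J\<in>?S. R M K \<odot>\<^bsub>?T\<^esub> pure_tensor A A (w P J) (w J M))"
      by (rule T.finsum_swap[OF fin fin]) (use c P K in auto)
    also have "\<dots> = (\<Oplus>\<^bsub>?T\<^esub>M\<in>?S. R M K \<odot>\<^bsub>?T\<^esub> comat A I w P M)"
    proof (rule T.finsum_cong'[OF refl])
      show "(\<lambda>M. R M K \<odot>\<^bsub>?T\<^esub> comat A I w P M) \<in> ?S \<rightarrow> carrier ?T"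
        unfolding comat_def len[OF P] using c P by (intro funcsetI T.smult_closed' T.finsum_closed) auto
      show "(\<Oplus>\<^bsub>?T\<^esub>J\<in>?S. R M K \<odot>\<^bsub>?T\<^esub> pure_tensor A A (w P J) (w J M)) = R M K \<odot>\<^bsub>?T\<^esub> comat A I w P M"
        if "M \<in> ?S" for M
        unfolding comat_def len[OF P] by (rule T.smult_finsum[OF fin, symmetric]) (use c that P in auto)
    qed
    finally show "(\<Oplus>\<^bsub>?T\<^esub>J\<in>?S. R P J \<odot>\<^bsub>?T\<^esub> comat A I w J K) = (\<Oplus>\<^bsub>?T\<^esub>J\<in>?S. R J K \<odot>\<^bsub>?T\<^esub> comat A I w P J)" .
  qed
qed

context spo_scalars
begin

abbreviation "I \<equiv> idx n m"
abbreviation "d \<equiv> eta n"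
abbreviation "F \<equiv> rtt_free n m :: ('k, (int \<times> int) word \<Rightarrow>\<^sub>0 'k) superalg"

lemma F_matalg: "matalg F I d (wfree d)"
proof -
  have "gdeg n = (\<lambda>g. eta n (snd g) - eta n (fst g))" by (simp add: gdeg_def fun_eq_iff)
  then show ?thesis
    using free_matalg[OF finite_idx, of n m "eta n", where 'k = 'k] by (simp add: rtt_free_def gens_def)
qed

lemma Rmat_parity:
  assumes "i \<in> I" "j \<in> I" "k \<in> I" "l \<in> I" "Rmat n m q i j k l \<noteq> 0"
  shows "d i + d j = d k + d l"
proof -
  have "b + b = 0" for b :: bit by (cases b) auto
  then show ?thesis
    using assms(5) unfolding Rmat_eq[OF assms(1-4)]
    by (auto split: if_splits simp: add.commute)
qed

lemma Rhat_parity: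
  assumes "J \<in> mwords I 2" "K \<in> mwords I 2" "Rhat J K \<noteq> 0"
  shows "mdeg d J = mdeg d K"
proof -
  obtain x y where J: "J = [x, y]" "x \<in> I" "y \<in> I" using mwords2E[OF assms(1)] .
  obtain k l where K: "K = [k, l]" "k \<in> I" "l \<in> I" using mwords2E[OF assms(2)] .
  show ?thesis
    using Rmat_parity[OF J(3,2) K(2,3)] assms(3) by (auto simp: Rhat_def J K add.commute)
qed

text \<open>The sign between a defining relation and the corresponding entry of
  \<open>Rhat W - W Rhat\<close>. That one sign depending on the outer indices alone fits every
  summand relies on R being even (\<open>Rmat_parity\<close>).\<close>

definition rtt_sgn :: "int \<Rightarrow> int \<Rightarrow> int \<Rightarrow> int \<Rightarrow> 'k"
  where "rtt_sgn i j k l = sgn2 (d i) (d j) * sgn2 (d i) (d i) * sgn2 (d j) (d j) * sgn2 (d l) (d k)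
    * sgn2 (d i) (d k) * sgn2 (d i) (d l) * sgn2 (d j) (d l)"

lemma rtt_sgn_square: "rtt_sgn i j k l * rtt_sgn i j k l = 1"
  by (cases "d i"; cases "d j"; cases "d k"; cases "d l") (simp_all add: rtt_sgn_def sgn2_def)

lemma wfree2: "wfree d [a, b] [k, l] = pm_scale (wsgn d [(a, k), (b, l)]) (free_t a k * free_t b l)"
  by (simp add: wfree_def free_gen_def mult_single plus_word_def)

lemma rtt_rel_eq:
  assumes "i \<in> I" "j \<in> I" "k \<in> I" "l \<in> I"
  shows "rtt_rel n m q i j k l = pm_scale (rtt_sgn i j k l)
    ((\<Sum>J\<in>mwords I 2. pm_scale (Rhat [j, i] J) (wfree d J [k, l]))
    - (\<Sum>J\<in>mwords I 2. pm_scale (Rhat J [k, l]) (wfree d [j, i] J)))"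
proof -
  have 1: "pm_scale (sgn2 (d j - d l) (d a - d k) * Rmat n m q i j a b) (free_t a k * free_t b l)
    = pm_scale (rtt_sgn i j k l * Rhat [j, i] [a, b]) (wfree d [a, b] [k, l])" if "a \<in> I" "b \<in> I" for a b
  proof (cases "Rmat n m q i j a b = 0")
    case True
    then show ?thesis by (simp add: Rhat_def)
  next
    case False
    then have p: "d i + d j = d a + d b" using Rmat_parity[OF assms(1,2) that] by simp
    then have "sgn2 (d j - d l) (d a - d k) = (rtt_sgn i j k l * (sg2 n i j * sgn2 (d j + d b) (d a)) * wsgn d [(a, k), (b, l)] :: 'k)"
      by (cases "d i"; cases "d j"; cases "d k"; cases "d l"; cases "d a"; cases "d b")
        (simp_all add: rtt_sgn_def sgn2_def sg2_def)
    then show ?thesis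
      by (simp add: wfree2 Rhat_def mult_ac del: wsgn.simps)
  qed
  have 2: "pm_scale (sgn2 (d j - d b) (d a - d k) * Rmat n m q a b k l) (free_t j b * free_t i a)
    = pm_scale (rtt_sgn i j k l * Rhat [b, a] [k, l]) (wfree d [j, i] [b, a])" if "a \<in> I" "b \<in> I" for a b
  proof (cases "Rmat n m q a b k l = 0")
    case True
    then show ?thesis by (simp add: Rhat_def)
  next
    case False
    then have p: "d a + d b = d k + d l" using Rmat_parity[OF that assms(3,4)] by simp
    then have "sgn2 (d j - d b) (d a - d k) = (rtt_sgn i j k l * (sg2 n a b * sgn2 (d b + d l) (d k)) * wsgn d [(j, b), (i, a)] :: 'k)"
      by (cases "d i"; cases "d j"; cases "d k"; cases "d l"; cases "d a"; cases "d b")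
        (simp_all add: rtt_sgn_def sgn2_def sg2_def)
    then show ?thesis
      by (simp add: wfree2 Rhat_def mult_ac del: wsgn.simps)
  qed
  have "rtt_rel n m q i j k l =
    (\<Sum>a\<in>I. \<Sum>b\<in>I. pm_scale (rtt_sgn i j k l * Rhat [j, i] [a, b]) (wfree d [a, b] [k, l]))
    - (\<Sum>a\<in>I. \<Sum>b\<in>I. pm_scale (rtt_sgn i j k l * Rhat [b, a] [k, l]) (wfree d [j, i] [b, a]))"
    unfolding rtt_rel_def by (intro arg_cong2[where f = "(-)"] sum.cong refl 1 2)
  also have "(\<Sum>a\<in>I. \<Sum>b\<in>I. pm_scale (rtt_sgn i j k l * Rhat [b, a] [k, l]) (wfree d [j, i] [b, a]))
    = (\<Sum>b\<in>I. \<Sum>a\<in>I. pm_scale (rtt_sgn i j k l * Rhat [b, a] [k, l]) (wfree d [j, i] [b, a]))"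
    by (rule sum.swap)
  finally show ?thesis
    by (simp add: sum_mwords2[OF finite_idx] pm_scale_diff pm_scale_sum)
qed

lemma F_simps: "add F = (+)" "zero F = 0" "module.smult F = pm_scale" "monoid.mult F = (*)" "one F = 1"
  by (simp_all add: rtt_free_def)

lemma F_finsum: "(\<And>J. J \<in> S \<Longrightarrow> f J \<in> carrier F) \<Longrightarrow> (\<Oplus>\<^bsub>F\<^esub>J\<in>S. f J) = sum f S"
proof -
  interpret F: matalg F I d "wfree d" by (rule F_matalg)
  show "(\<And>J. J \<in> S \<Longrightarrow> f J \<in> carrier F) \<Longrightarrow> (\<Oplus>\<^bsub>F\<^esub>J\<in>S. f J) = sum f S"
  proof (induction S rule: infinite_finite_induct)
    case (insert x A)
    then show ?case by (subst F.finsum_insert) (auto simp: F_simps)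
  qed (simp_all add: F.finsum_infinite F_simps)
qed

lemma F_minus: "x \<in> carrier F \<Longrightarrow> y \<in> carrier F \<Longrightarrow> x \<ominus>\<^bsub>F\<^esub> y = x - y"
proof -
  interpret F: matalg F I d "wfree d" by (rule F_matalg)
  assume "x \<in> carrier F" "y \<in> carrier F"
  then show ?thesis using F.minus_one_smult[of y] by (simp add: a_minus_def F_simps pm_scale_neg)
qed

definition rtt_core :: "int list \<Rightarrow> int list \<Rightarrow> ((int \<times> int) word \<Rightarrow>\<^sub>0 'k)"
  where "rtt_core P K = (\<Oplus>\<^bsub>F\<^esub>J\<in>mwords I 2. Rhat P J \<odot>\<^bsub>F\<^esub> wfree d J K) \<ominus>\<^bsub>F\<^esub> (\<Oplus>\<^bsub>F\<^esub>J\<in>mwords I 2. Rhat J K \<odot>\<^bsub>F\<^esub> wfree d P J)"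

lemma rtt_core_rel:
  assumes "i \<in> I" "j \<in> I" "k \<in> I" "l \<in> I"
  shows "rtt_rel n m q i j k l = rtt_sgn i j k l \<odot>\<^bsub>F\<^esub> rtt_core [j, i] [k, l]"
    "rtt_core [j, i] [k, l] = rtt_sgn i j k l \<odot>\<^bsub>F\<^esub> rtt_rel n m q i j k l"
proof -
  interpret F: matalg F I d "wfree d" by (rule F_matalg)
  have c1: "Rhat [j, i] J \<odot>\<^bsub>F\<^esub> wfree d J [k, l] \<in> carrier F" if "J \<in> mwords I 2" for J
    by (intro F.smult_closed' F.w_closed[OF that mwords2I] assms)
  have c2: "Rhat J [k, l] \<odot>\<^bsub>F\<^esub> wfree d [j, i] J \<in> carrier F" if "J \<in> mwords I 2" for J
    by (intro F.smult_closed' F.w_closed[OF mwords2I that] assms)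
  have "rtt_core [j, i] [k, l] = (\<Sum>J\<in>mwords I 2. pm_scale (Rhat [j, i] J) (wfree d J [k, l]))
    - (\<Sum>J\<in>mwords I 2. pm_scale (Rhat J [k, l]) (wfree d [j, i] J))"
  proof -
    have "(\<Oplus>\<^bsub>F\<^esub>J\<in>mwords I 2. Rhat [j, i] J \<odot>\<^bsub>F\<^esub> wfree d J [k, l]) \<in> carrier F"
      "(\<Oplus>\<^bsub>F\<^esub>J\<in>mwords I 2. Rhat J [k, l] \<odot>\<^bsub>F\<^esub> wfree d [j, i] J) \<in> carrier F"
      using c1 c2 by (auto intro!: F.finsum_closed)
    then show ?thesis
      unfolding rtt_core_def by (simp only: F_minus F_finsum[OF c1] F_finsum[OF c2]) (simp only: F_simps)
  qed
  then show 1: "rtt_rel n m q i j k l = rtt_sgn i j k l \<odot>\<^bsub>F\<^esub> rtt_core [j, i] [k, l]"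
    using rtt_rel_eq[OF assms] by (simp add: F_simps)
  show "rtt_core [j, i] [k, l] = rtt_sgn i j k l \<odot>\<^bsub>F\<^esub> rtt_rel n m q i j k l"
    unfolding 1 by (simp add: F_simps rtt_sgn_square)
qed

abbreviation "rels \<equiv> {rtt_rel n m q i j k l | i j k l. i \<in> I \<and> j \<in> I \<and> k \<in> I \<and> l \<in> I}"

lemma rtt_core_homog:
  assumes "P \<in> mwords I 2" "K \<in> mwords I 2"
  shows "rtt_core P K \<in> homog F (mdeg d P + mdeg d K)"
proof -
  interpret F: matalg F I d "wfree d" by (rule F_matalg)
  have 1: "Rhat P J \<odot>\<^bsub>F\<^esub> wfree d J K \<in> homog F (mdeg d P + mdeg d K)" if J: "J \<in> mwords I 2" for J
  proof (cases "Rhat P J = 0")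
    case True
    then show ?thesis using F.w_closed[OF J assms(2)] F.homog_sub(2) by simp
  next
    case False
    then show ?thesis using Rhat_parity[OF assms(1) J] F.homog_sub(4)[OF F.w_homog[OF J assms(2)]] by simp
  qed
  have 2: "Rhat J K \<odot>\<^bsub>F\<^esub> wfree d P J \<in> homog F (mdeg d P + mdeg d K)" if J: "J \<in> mwords I 2" for J
  proof (cases "Rhat J K = 0")
    case True
    then show ?thesis using F.w_closed[OF assms(1) J] F.homog_sub(2) by simp
  next
    case False
    then show ?thesis using Rhat_parity[OF J assms(2)] F.homog_sub(4)[OF F.w_homog[OF assms(1) J]] by simp
  qed
  show ?thesis
    unfolding rtt_core_def
    by (intro F.homog_sub(6) F.finsum_in_submodule[OF F.homog_submodule] 1 2)
qed

lemma rels_homog: "rels \<subseteq> (\<Union>\<alpha>. homog F \<alpha>)"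
proof -
  interpret F: matalg F I d "wfree d" by (rule F_matalg)
  show ?thesis
  proof
    fix r assume "r \<in> rels"
    then obtain i j k l where r: "r = rtt_rel n m q i j k l" "i \<in> I" "j \<in> I" "k \<in> I" "l \<in> I" by blast
    have "r \<in> homog F (mdeg d [j, i] + mdeg d [k, l])"
      unfolding r(1) rtt_core_rel(1)[OF r(2-5)]
      by (rule F.homog_sub(4)[OF rtt_core_homog[OF mwords2I[OF r(3,2)] mwords2I[OF r(4,5)]]])
    then show "r \<in> (\<Union>\<alpha>. homog F \<alpha>)" by blast
  qed
qed

text \<open>Up to signs the defining relations are the entries of \<open>Rhat W - W Rhat\<close>, so
  it suffices that the images of the entries of W are intertwined.\<close>

lemma rels_killed:
  assumes M: "kspace M" and f: "f \<in> klin F M"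
    and v: "kspace.intertwines M (mwords I 2) Rhat (\<lambda>J K. f (wfree d J K))" and r: "r \<in> rels"
  shows "f r = \<zero>\<^bsub>M\<^esub>"
proof -
  interpret F: matalg F I d "wfree d" by (rule F_matalg)
  interpret M: kspace M by fact
  obtain i j k l where ijkl: "r = rtt_rel n m q i j k l" "i \<in> I" "j \<in> I" "k \<in> I" "l \<in> I" using r by blast
  have P: "[j, i] \<in> mwords I 2" "[k, l] \<in> mwords I 2" using ijkl by (auto intro: mwords2I)
  have s1: "(\<Oplus>\<^bsub>F\<^esub>J\<in>mwords I 2. Rhat [j, i] J \<odot>\<^bsub>F\<^esub> wfree d J [k, l]) \<in> carrier F"
    "(\<Oplus>\<^bsub>F\<^esub>J\<in>mwords I 2. Rhat J [k, l] \<odot>\<^bsub>F\<^esub> wfree d [j, i] J) \<in> carrier F"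
    using P by (intro F.finsum_closed funcsetI F.smult_closed' F.w_closed[of _ 2]; simp)+
  have "f (rtt_core [j, i] [k, l]) = \<zero>\<^bsub>M\<^esub>"
  proof -
    have a: "f (\<Oplus>\<^bsub>F\<^esub>J\<in>mwords I 2. Rhat [j, i] J \<odot>\<^bsub>F\<^esub> wfree d J [k, l])
        = f (\<Oplus>\<^bsub>F\<^esub>J\<in>mwords I 2. Rhat J [k, l] \<odot>\<^bsub>F\<^esub> wfree d [j, i] J)"
    proof -
      have "f (\<Oplus>\<^bsub>F\<^esub>J\<in>mwords I 2. Rhat [j, i] J \<odot>\<^bsub>F\<^esub> wfree d J [k, l])
          = (\<Oplus>\<^bsub>M\<^esub>J\<in>mwords I 2. Rhat [j, i] J \<odot>\<^bsub>M\<^esub> f (wfree d J [k, l]))"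
        by (rule klin_lincomb[OF F.kspace_axioms M f F.finite_mw F.w_closed[OF _ P(2)]])
      moreover have "f (\<Oplus>\<^bsub>F\<^esub>J\<in>mwords I 2. Rhat J [k, l] \<odot>\<^bsub>F\<^esub> wfree d [j, i] J)
          = (\<Oplus>\<^bsub>M\<^esub>J\<in>mwords I 2. Rhat J [k, l] \<odot>\<^bsub>M\<^esub> f (wfree d [j, i] J))"
        by (rule klin_lincomb[OF F.kspace_axioms M f F.finite_mw F.w_closed[OF P(1)]])
      ultimately show ?thesis using v P by (simp add: M.intertwines_def)
    qed
    show ?thesis
      unfolding rtt_core_def klin_minus[OF F.kspace_axioms M f s1] a
      using klinD(1)[OF f s1(2)] by (simp add: a_minus_def M.r_neg)
  qed
  then show ?thesis
    unfolding ijkl(1) rtt_core_rel(1)[OF ijkl(2-5)]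
    using klinD(3)[OF f F.homog_carrier[OF rtt_core_homog[OF P]]] by simp
qed

end

section \<open>Extended records\<close>

text \<open>\<open>AR\<close> and \<open>SPO\<close> carry a comultiplication and a counit as
  additional fields. The constructions treated here depend on the superalgebra fields alone, so they
  can be computed in the underlying superalgebra.\<close>

lemma ext_simps [simp]:
  "carrier (superalg.extend A e) = carrier A" "monoid.mult (superalg.extend A e) = monoid.mult A"
  "one (superalg.extend A e) = one A" "zero (superalg.extend A e) = zero A"
  "add (superalg.extend A e) = add A" "module.smult (superalg.extend A e) = module.smult A"
  "homog (superalg.extend A e) = homog A"
  by (simp_all add: superalg.extend_def)

lemma finsum_ext [simp]: "finsum (superalg.extend A e) = finsum A"
  by (simp add: finsum_def finprod_def fun_eq_iff)

lemma coset_ext [simp]: "a_r_coset (superalg.extend A e) = a_r_coset A"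
  by (simp add: a_r_coset_def fun_eq_iff r_coset_def)

lemma a_minus_ext [simp]: "a_minus (superalg.extend A e) = a_minus A"
  by (simp add: a_minus_def a_inv_def m_inv_def fun_eq_iff)

lemma ring_ext [simp]: "ring (superalg.extend A e) \<longleftrightarrow> ring A"
  unfolding ring_def abelian_group_def abelian_monoid_def abelian_group_axioms_def comm_group_def
    comm_monoid_def group_def monoid_def comm_monoid_axioms_def group_axioms_def ring_axioms_def Units_def
  by simp

lemma ideal_ext [simp]: "ideal J (superalg.extend A e) \<longleftrightarrow> ideal J A"
  unfolding ideal_def ideal_axioms_def additive_subgroup_def subgroup_def ring_ext m_inv_def
  by simp

lemma genideal_ext [simp]: "genideal (superalg.extend A e) = genideal A"
  by (simp add: genideal_def fun_eq_iff)

lemma quot_ext [simp]: "quot_superalg (superalg.extend A e) J = quot_superalg A J"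
proof -
  have "rcoset_mult (superalg.extend A e) = rcoset_mult A"
    by (simp add: rcoset_mult_def fun_eq_iff)
  moreover have "a_rcosets\<^bsub>superalg.extend A e\<^esub> J = a_rcosets\<^bsub>A\<^esub> J"
    by (simp add: A_RCOSETS_def RCOSETS_def r_coset_def)
  moreover have "set_add (superalg.extend A e) = set_add A"
    by (simp add: set_add_def set_mult_def fun_eq_iff)
  ultimately show ?thesis
    by (simp add: quot_superalg_def FactRing_def)
qed

lemma superalgebra_ext: "superalgebra (superalg.extend A e) \<longleftrightarrow> superalgebra A"
  unfolding superalgebra_def superalgebra_axioms_def ring_ext submodule_def submodule_axioms_def subgroup_def
    module_def module_axioms_def abelian_group_def abelian_monoid_def abelian_group_axioms_def comm_group_def
    comm_monoid_def group_def monoid_def comm_monoid_axioms_def group_axioms_def Units_def m_inv_def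
  by simp

lemma tensor_rel_cong:
  assumes "p \<in> tensor_rel A B"
    and "carrier A = carrier A'" "add A = add A'" "module.smult A = module.smult A'"
    and "carrier B = carrier B'" "add B = add B'" "module.smult B = module.smult B'"
  shows "p \<in> tensor_rel A' B'"
  using assms(1)
proof induction
  case (add_left a a' b)
  then show ?case using tensor_rel.add_left[of a A' a' b B'] assms(2-) by simp
next
  case (add_right a b b')
  then show ?case using tensor_rel.add_right[of a A' b B' b'] assms(2-) by simp
next
  case (smult_left a b c)
  then show ?case using tensor_rel.smult_left[of a A' b B' c] assms(2-) by simp
next
  case (smult_right a b c)
  then show ?case using tensor_rel.smult_right[of a A' b B' c] assms(2-) by simp
qed (auto intro: tensor_rel.intros)

lemma tensor_rel_ext:
  "tensor_rel (superalg.extend A e) B = tensor_rel A B" "tensor_rel C (superalg.extend D e') = tensor_rel C D"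
  by (intro equalityI subsetI; erule tensor_rel_cong; simp)+

lemma pretensor_ext:
  "pretensor (superalg.extend A e) B = pretensor A B" "pretensor C (superalg.extend D e') = pretensor C D"
  by (simp_all add: pretensor_def hpart_def)

lemma tensor_ext [simp]:
  "tensor (superalg.extend A e) B = tensor A B" "tensor C (superalg.extend D e') = tensor C D"
  by (simp_all add: tensor_def tensor_rel_ext pretensor_ext)

lemma pure_tensor_ext [simp]:
  "pure_tensor (superalg.extend A e) B = pure_tensor A B" "pure_tensor C (superalg.extend D e') = pure_tensor C D"
  by (simp_all add: pure_tensor_def tensor_rel_ext pretensor_ext fun_eq_iff)

lemma tensor_lift_ext [simp]: "tensor_lift (superalg.extend A e) = tensor_lift A"
  by (simp add: tensor_lift_def fun_eq_iff)

lemma tensor_map_ext [simp]: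
  "tensor_map (superalg.extend A e) B = tensor_map A B" "tensor_map C (superalg.extend D e') = tensor_map C D"
  by (simp_all add: tensor_map_def fun_eq_iff)

lemma tensor_assoc_ext [simp]:
  "tensor_assoc (superalg.extend A e) (superalg.extend A e) (superalg.extend A e) = tensor_assoc A A A"
  by (simp add: tensor_assoc_def fun_eq_iff)

lemma superlinear_ext [simp]:
  "superlinear (superalg.extend A e) B = superlinear A B" "superlinear C (superalg.extend D e') = superlinear C D"
  by (simp_all add: superlinear_def)

lemma superalg_hom_ext [simp]: "superalg_hom (superalg.extend A e) B = superalg_hom A B"
  by (simp add: superalg_hom_def ring_hom_def)

lemma superalg_antihom_ext [simp]:
  "superalg_antihom (superalg.extend A e) (superalg.extend A e) = superalg_antihom A A"
  by (simp add: superalg_antihom_def)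

section \<open>The bi-superalgebra \<open>A(R)\<close>\<close>

lemma (in kquot) coset_lincomb:
  assumes "finite S" "\<And>i. i \<in> S \<Longrightarrow> x i \<in> carrier A"
  shows "J +> (\<Oplus>i\<in>S. r i \<odot> x i) = (\<Oplus>\<^bsub>quot_superalg A J\<^esub>i\<in>S. r i \<odot>\<^bsub>quot_superalg A J\<^esub> (J +> x i))"
  by (rule klin_lincomb[OF kspace_axioms quot_kspace coset_klin assms])

lemma (in matalg) comat_closed:
  "J \<in> mwords I l \<Longrightarrow> K \<in> mwords I l \<Longrightarrow> comat A I w J K \<in> carrier (tensor A A)"
proof -
  interpret AA: ktensor A A by (intro ktensor.intro kspace_axioms)
  interpret T: kspace "tensor A A" by (rule AA.tensor_kspace)
  assume JK: "J \<in> mwords I l" "K \<in> mwords I l"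
  then have "length J = l" by (simp add: mwords_def)
  then show ?thesis unfolding comat_def using w_pure_closed[OF JK] by (auto intro!: T.finsum_closed)
qed

lemma (in matalg) mult_maps_eq_hom:
  assumes "kspace M" "f \<in> klin A M" "g \<in> klin A M" "f \<one> = g \<one>"
    "\<And>i k. i \<in> I \<Longrightarrow> k \<in> I \<Longrightarrow> f (w [i] [k]) = g (w [i] [k])"
    "\<And>x y. x \<in> carrier A \<Longrightarrow> y \<in> carrier A \<Longrightarrow> f (x \<otimes> y) = f x \<otimes>\<^bsub>M\<^esub> f y"
    "\<And>x y. x \<in> carrier A \<Longrightarrow> y \<in> carrier A \<Longrightarrow> g (x \<otimes> y) = g x \<otimes>\<^bsub>M\<^esub> g y"
    "x \<in> carrier A"
  shows "f x = g x"
proof (rule mult_maps_eq[OF assms(1-5) _ assms(8)])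
  fix i k J K l assume *: "i \<in> I" "k \<in> I" "J \<in> mwords I l" "K \<in> mwords I l" "f (w J K) = g (w J K)"
  have c: "w [i] [k] \<in> carrier A" "w J K \<in> carrier A"
    using *(1,2) w_closed[of "[i]" 1 "[k]"] w_closed[OF *(3,4)] by (auto simp: mwords_def)
  show "f (w [i] [k] \<otimes> w J K) = g (w [i] [k] \<otimes> w J K)"
    unfolding assms(6)[OF c] assms(7)[OF c] using * assms(5) by simp
qed

lemma superalg_hom_restrict:
  assumes "superalgebra A" "f \<in> superalg_hom A B"
  shows "restrict f (carrier A) \<in> superalg_hom A B"
proof -
  interpret A: superalgebra A by fact
  note f = superalg_homD[OF assms(2)]
  show ?thesis
    by (rule superalg_homI[OF klin_cong[OF f(1) A.kspace_axioms]])
      (auto simp: f A.homog_carrier)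
qed

lemma (in kspace) intertwines_cong:
  assumes "\<And>J K. J \<in> S \<Longrightarrow> K \<in> S \<Longrightarrow> v J K = v' J K" "\<And>J K. J \<in> S \<Longrightarrow> K \<in> S \<Longrightarrow> v' J K \<in> carrier A"
  shows "intertwines S R v \<longleftrightarrow> intertwines S R v'"
proof -
  have "(\<Oplus>J\<in>S. R P J \<odot> v J K) = (\<Oplus>J\<in>S. R P J \<odot> v' J K)"
    "(\<Oplus>J\<in>S. R J K \<odot> v P J) = (\<Oplus>J\<in>S. R J K \<odot> v' P J)" if "P \<in> S" "K \<in> S" for P K
    by (rule finsum_cong'[OF refl]; use that assms in auto)+
  then show ?thesis by (simp add: intertwines_def)
qed

context spo_scalars
begin

abbreviation "rtti \<equiv> rtt_ideal n m q"
abbreviation "A \<equiv> AR_alg n m q"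
definition wA :: "int list \<Rightarrow> int list \<Rightarrow> 'k rtt" where "wA J K = rtti +>\<^bsub>F\<^esub> wfree d J K"

lemma F_graded_quot: "graded_quot F rtti"
proof -
  interpret F: matalg F I d "wfree d" by (rule F_matalg)
  have "rels \<subseteq> carrier F" using rels_homog F.homog_carrier by blast
  then show ?thesis
    unfolding rtt_ideal_def
    by (intro graded_quot.intro graded_quot_axioms.intro F.superalgebra_axioms F.genideal_ideal
        F.genideal_graded rels_homog)
qed

lemma A_matalg: "matalg A I d wA"
  using quot_matalg[OF F_matalg F_graded_quot] by (simp add: wA_def[abs_def] AR_alg_def)

lemma A_intertwines: "kspace.intertwines A (mwords I 2) Rhat wA"
proof -
  interpret F: matalg F I d "wfree d" by (rule F_matalg)
  interpret Q: graded_quot F rtti by (rule F_graded_quot)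
  interpret A: matalg A I d wA by (rule A_matalg)
  have relc: "rels \<subseteq> carrier F" using rels_homog F.homog_carrier by blast
  show ?thesis
    unfolding A.intertwines_def
  proof (intro ballI)
    fix P K assume P: "P \<in> mwords I 2" and K: "K \<in> mwords I 2"
    obtain j i where ji: "P = [j, i]" "j \<in> I" "i \<in> I" using mwords2E[OF P] .
    obtain k l where kl: "K = [k, l]" "k \<in> I" "l \<in> I" using mwords2E[OF K] .
    have "rtt_rel n m q i j k l \<in> rtti"
      unfolding rtt_ideal_def using F.genideal_self[OF relc] ji kl by blast
    then have core: "rtt_core P K \<in> rtti"
      unfolding ji(1) kl(1) rtt_core_rel(2)[OF ji(3,2) kl(2,3)] by (rule Q.J_sub(4))
    have c: "(\<Oplus>\<^bsub>F\<^esub>J\<in>mwords I 2. Rhat P J \<odot>\<^bsub>F\<^esub> wfree d J K) \<in> carrier F"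
      "(\<Oplus>\<^bsub>F\<^esub>J\<in>mwords I 2. Rhat J K \<odot>\<^bsub>F\<^esub> wfree d P J) \<in> carrier F"
      using P K by (intro F.finsum_closed funcsetI F.smult_closed' F.w_closed[of _ 2]; simp)+
    have "rtti +>\<^bsub>F\<^esub> (\<Oplus>\<^bsub>F\<^esub>J\<in>mwords I 2. Rhat P J \<odot>\<^bsub>F\<^esub> wfree d J K)
        = rtti +>\<^bsub>F\<^esub> (\<Oplus>\<^bsub>F\<^esub>J\<in>mwords I 2. Rhat J K \<odot>\<^bsub>F\<^esub> wfree d P J)"
      using core unfolding rtt_core_def Q.coset_eq_iff[OF c] .
    then show "(\<Oplus>\<^bsub>A\<^esub>J\<in>mwords I 2. Rhat P J \<odot>\<^bsub>A\<^esub> wA J K) = (\<Oplus>\<^bsub>A\<^esub>J\<in>mwords I 2. Rhat J K \<odot>\<^bsub>A\<^esub> wA P J)"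
      using Q.coset_lincomb[OF F.finite_mw, of 2 "\<lambda>J. wfree d J K" "Rhat P", OF F.w_closed[OF _ K]]
        Q.coset_lincomb[OF F.finite_mw, of 2 "wfree d P" "\<lambda>J. Rhat J K", OF F.w_closed[OF P]]
      by (simp add: wA_def AR_alg_def)
  qed
qed

text \<open>The lift \<open>f\<close> to the free superalgebra is chosen inside the proof, so the
  premise speaks of every lift with the given values. It asks for vanishing on the whole ideal,
  because passing there from the relations needs \<open>f\<close> to be a homomorphism or an
  antihomomorphism, and both occur.\<close>

lemma A_extend:
  assumes "kspace M" "\<And>J K l. J \<in> mwords I l \<Longrightarrow> K \<in> mwords I l \<Longrightarrow> v J K \<in> carrier M"
    and kill: "\<And>f x. \<lbrakk>f \<in> klin F M; \<And>J K l. J \<in> mwords I l \<Longrightarrow> K \<in> mwords I l \<Longrightarrow> f (wfree d J K) = v J K;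
      x \<in> rtti\<rbrakk> \<Longrightarrow> f x = \<zero>\<^bsub>M\<^esub>"
  obtains g where "g \<in> klin A M" "\<And>J K l. J \<in> mwords I l \<Longrightarrow> K \<in> mwords I l \<Longrightarrow> g (wA J K) = v J K"
proof -
  interpret F: matalg F I d "wfree d" by (rule F_matalg)
  interpret Q: graded_quot F rtti by (rule F_graded_quot)
  have F: "F = free_superalg (I \<times> I) (gdeg n)" by (simp add: rtt_free_def gens_def)
  obtain f where f: "f \<in> klin F M" "\<And>J K l. J \<in> mwords I l \<Longrightarrow> K \<in> mwords I l \<Longrightarrow> f (wfree d J K) = v J K"
  proof (rule free_matalg_extend[where I = I and v = v and M = M and d = d and e = "gdeg n", OF assms(1,2), folded F])
  qed (auto intro: that)
  note k = kill[OF f]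
  show thesis
  proof
    show "(\<lambda>U. THE z. \<forall>y\<in>U. z = f y) \<in> klin A M"
      using Q.the_coset_klin[OF assms(1) f(1) k] by (simp add: AR_alg_def)
    show "(THE z. \<forall>y\<in>wA J K. z = f y) = v J K" if "J \<in> mwords I l" "K \<in> mwords I l" for J K l
      unfolding wA_def using Q.the_coset[OF assms(1) f(1) k F.w_closed[OF that]] f(2)[OF that] by simp
  qed
qed

text \<open>\<open>intertwines_comat\<close> lets the prescribed values satisfy the relations, and
  \<open>matalg_comult_hom\<close> makes the kernel of the lift an ideal.\<close>

lemma AR_comult_exists:
  obtains D where "D \<in> klin A (tensor A A)" "\<And>J K l. J \<in> mwords I l \<Longrightarrow> K \<in> mwords I l \<Longrightarrow> D (wA J K) = comat A I wA J K"
proof -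
  interpret F: matalg F I d "wfree d" by (rule F_matalg)
  interpret A: matalg A I d wA by (rule A_matalg)
  interpret T: graded_tensor A A by (intro graded_tensor.intro A.superalgebra_axioms)
  show thesis
  proof (rule A_extend[OF T.tensor_kspace A.comat_closed])
    fix f x assume f: "f \<in> klin F (tensor A A)"
      and fw: "\<And>J K l. J \<in> mwords I l \<Longrightarrow> K \<in> mwords I l \<Longrightarrow> f (wfree d J K) = comat A I wA J K"
      and x: "x \<in> rtti"
    note hom = matalg_comult_hom[OF F_matalg A_matalg f fw]
    have "kspace.intertwines (tensor A A) (mwords I 2) Rhat (\<lambda>J K. f (wfree d J K))"
      by (subst kspace.intertwines_cong[OF T.tensor_kspace fw A.comat_closed])
        (assumption | rule A.intertwines_comat[OF A_intertwines])+
    from rels_killed[OF T.tensor_kspace f this]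
    show "f x = \<zero>\<^bsub>tensor A A\<^esub>"
      by (intro F.genideal_kernel[OF T.tensor_kalg f superalg_homD(3)[OF hom] _ _ x[unfolded rtt_ideal_def]])
        (use rels_homog F.homog_carrier in blast)+
  qed (use that in blast)+
qed

end

lemma base_kalg: "kalg (base_superalg :: ('k::field, 'k) superalg)"
  by (intro kalg.intro kalg_axioms.intro base_kspace) (simp_all add: algebra_simps)

context spo_scalars
begin

text \<open>The counit sends the matrix \<open>w\<close> to the identity matrix, which commutes with
  \<open>Rhat\<close>.\<close>

lemma AR_counit_exists:
  obtains e where "e \<in> klin A base_superalg" "\<And>J K l. J \<in> mwords I l \<Longrightarrow> K \<in> mwords I l \<Longrightarrow> e (wA J K) = of_bool (J = K)"
proof -
  interpret F: matalg F I d "wfree d" by (rule F_matalg)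
  interpret B: kalg "base_superalg :: ('k, 'k) superalg" by (rule base_kalg)
  show thesis
  proof (rule A_extend[OF B.kspace_axioms, of "\<lambda>J K. of_bool (J = K)"])
    fix f x assume f: "f \<in> klin F base_superalg"
      and fw: "\<And>J K l. J \<in> mwords I l \<Longrightarrow> K \<in> mwords I l \<Longrightarrow> f (wfree d J K) = of_bool (J = K)"
      and x: "x \<in> rtti"
    note hom = matalg_counit_hom[OF F_matalg f fw]
    have "(\<Oplus>\<^bsub>base_superalg\<^esub>J\<in>mwords I 2. Rhat P J * f (wfree d J K)) = Rhat P K"
      "(\<Oplus>\<^bsub>base_superalg\<^esub>J\<in>mwords I 2. Rhat J K * f (wfree d P J)) = Rhat P K"
      if "P \<in> mwords I 2" "K \<in> mwords I 2" for P K
      by (subst B.finsum_delta[of _ K], use that fw F.finite_mw in auto)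
        (subst B.finsum_delta[of _ P], use that fw F.finite_mw in auto)
    then have "B.intertwines (mwords I 2) Rhat (\<lambda>J K. f (wfree d J K))"
      by (simp add: B.intertwines_def)
    from rels_killed[OF B.kspace_axioms f this]
    show "f x = \<zero>\<^bsub>base_superalg\<^esub>"
      by (intro F.genideal_kernel[OF B.kalg_axioms f superalg_homD(3)[OF hom] _ _ x[unfolded rtt_ideal_def]])
        (use rels_homog F.homog_carrier in blast)+
  qed (use that in auto)
qed

definition usgn :: "int \<Rightarrow> int \<Rightarrow> 'k" where "usgn i j = sgn2 (d i) (d i + d j)"

lemma usgn_square [simp]: "usgn i j * usgn i j = 1"
  by (simp add: usgn_def)

lemma AR_t_eq:
  assumes "i \<in> I" "j \<in> I"
  shows "AR_t n m q i j = usgn i j \<odot>\<^bsub>A\<^esub> wA [i] [j]" "wA [i] [j] = usgn i j \<odot>\<^bsub>A\<^esub> AR_t n m q i j"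
    "AR_t n m q i j \<in> carrier A"
proof -
  interpret F: matalg F I d "wfree d" by (rule F_matalg)
  interpret Q: graded_quot F rtti by (rule F_graded_quot)
  interpret A: matalg A I d wA by (rule A_matalg)
  have c: "wfree d [i] [j] \<in> carrier F" by (rule F.w_closed[of _ 1]) (use assms in \<open>auto simp: mwords_def\<close>)
  have "sgn2 b 0 = (1 :: 'k)" for b by (simp add: sgn2_def)
  then have "wfree d [i] [j] = pm_scale (usgn i j) (free_t i j)"
    by (simp add: wfree_def free_gen_def usgn_def)
  then have "free_t i j = usgn i j \<odot>\<^bsub>F\<^esub> wfree d [i] [j]" by (simp add: F_simps)
  then show 1: "AR_t n m q i j = usgn i j \<odot>\<^bsub>A\<^esub> wA [i] [j]"
    using Q.quot_smult[OF c] by (simp add: AR_t_def wA_def AR_alg_def)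
  have w: "wA [i] [j] \<in> carrier A" by (rule A.w_closed[of _ 1]) (use assms in \<open>auto simp: mwords_def\<close>)
  show "wA [i] [j] = usgn i j \<odot>\<^bsub>A\<^esub> AR_t n m q i j" "AR_t n m q i j \<in> carrier A"
    unfolding 1 using w by simp_all
qed

lemma comult_t:
  assumes "D \<in> klin A (tensor A A)" "\<And>J K l. J \<in> mwords I l \<Longrightarrow> K \<in> mwords I l \<Longrightarrow> D (wA J K) = comat A I wA J K"
    and ij: "i \<in> I" "j \<in> I"
  shows "D (AR_t n m q i j) = (\<Oplus>\<^bsub>tensor A A\<^esub>k \<in> I. sgn2 (d k - d i) (d k - d j)
    \<odot>\<^bsub>tensor A A\<^esub> pure_tensor A A (AR_t n m q i k) (AR_t n m q k j))"
proof -
  interpret A: matalg A I d wA by (rule A_matalg)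
  interpret T: ktensor A A by (intro ktensor.intro A.kspace_axioms)
  interpret T': kspace "tensor A A" by (rule T.tensor_kspace)
  have m: "[i] \<in> mwords I 1" if "i \<in> I" for i using that by (simp add: mwords_def)
  have c: "pure_tensor A A (wA [i] [k]) (wA [k] [j]) \<in> carrier (tensor A A)" if "k \<in> I" for k
    by (rule A.w_pure_closed[OF m[OF ij(1)] m[OF ij(2)] m[OF that]])
  have "D (AR_t n m q i j) = usgn i j \<odot>\<^bsub>tensor A A\<^esub> comat A I wA [i] [j]"
    unfolding AR_t_eq(1)[OF ij] klinD(3)[OF assms(1) A.w_closed[OF m[OF ij(1)] m[OF ij(2)]]]
      assms(2)[OF m[OF ij(1)] m[OF ij(2)]] ..
  also have "comat A I wA [i] [j] = (\<Oplus>\<^bsub>tensor A A\<^esub>k\<in>I. pure_tensor A A (wA [i] [k]) (wA [k] [j]))"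
    unfolding comat_def using T'.finsum_mwords_1[of I "\<lambda>M. pure_tensor A A (wA [i] M) (wA M [j])", OF c] by simp
  also have "usgn i j \<odot>\<^bsub>tensor A A\<^esub> \<dots> = (\<Oplus>\<^bsub>tensor A A\<^esub>k\<in>I. usgn i j \<odot>\<^bsub>tensor A A\<^esub> pure_tensor A A (wA [i] [k]) (wA [k] [j]))"
    using c finite_idx by (intro T'.smult_finsum) auto
  also have "\<dots> = (\<Oplus>\<^bsub>tensor A A\<^esub>k \<in> I. sgn2 (d k - d i) (d k - d j)
    \<odot>\<^bsub>tensor A A\<^esub> pure_tensor A A (AR_t n m q i k) (AR_t n m q k j))"
  proof (rule T'.finsum_cong'[OF refl])
    fix k assume k: "k \<in> I"
    note p = klinD(3)[OF bilinD(1)[OF T.bilin_pure]] klinD(3)[OF bilinD(2)[OF T.bilin_pure]]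
    \<comment> \<open>This sign identity is the reason for passing from \<open>t\<close> to
      \<open>w\<close>: it absorbs the signs in the comultiplication of the
      \<open>t\<close>.\<close>
    have s: "usgn i j = sgn2 (d k - d i) (d k - d j) * (usgn k j * usgn i k)"
      by (cases "d i"; cases "d j"; cases "d k") (simp_all add: usgn_def sgn2_def)
    show "usgn i j \<odot>\<^bsub>tensor A A\<^esub> pure_tensor A A (wA [i] [k]) (wA [k] [j])
      = sgn2 (d k - d i) (d k - d j) \<odot>\<^bsub>tensor A A\<^esub> pure_tensor A A (AR_t n m q i k) (AR_t n m q k j)"
      unfolding AR_t_eq(1)[OF ij(1) k] AR_t_eq(1)[OF k ij(2)]
      using A.w_closed[OF m m] ij k c[OF k] by (simp add: p s)
  qed (use AR_t_eq(3) ij in \<open>auto intro!: T.pure_closed\<close>)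
  finally show ?thesis .
qed

text \<open>The description in \<open>AR_comult\<close> asks for an extensional homomorphism with
  given values on the generators. The restriction of the constructed map is one, and a homomorphism
  is fixed on the carrier by these values.\<close>

lemma AR_comult:
  shows "AR_comult n m q \<in> klin A (tensor A A)"
    and "\<And>J K l. J \<in> mwords I l \<Longrightarrow> K \<in> mwords I l \<Longrightarrow> AR_comult n m q (wA J K) = comat A I wA J K"
proof -
  interpret A: matalg A I d wA by (rule A_matalg)
  interpret T: ktensor A A by (intro ktensor.intro A.kspace_axioms)
  obtain D where D: "D \<in> klin A (tensor A A)"
    "\<And>J K l. J \<in> mwords I l \<Longrightarrow> K \<in> mwords I l \<Longrightarrow> D (wA J K) = comat A I wA J K"
    using AR_comult_exists by metis
  note hom = matalg_comult_hom[OF A_matalg A_matalg D]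
  have eq: "AR_comult n m q = restrict D (carrier A)"
    unfolding AR_comult_def Let_def
  proof (rule the_equality)
    show "restrict D (carrier A) \<in> superalg_hom A (tensor A A) \<inter> extensional (carrier A) \<and>
      (\<forall>i\<in>I. \<forall>j\<in>I. restrict D (carrier A) (AR_t n m q i j) =
        (\<Oplus>\<^bsub>tensor A A\<^esub>k \<in> I. sgn2 (d k - d i) (d k - d j)
           \<odot>\<^bsub>tensor A A\<^esub> pure_tensor A A (AR_t n m q i k) (AR_t n m q k j)))"
      using superalg_hom_restrict[OF A.superalgebra_axioms hom] comult_t[OF D] AR_t_eq(3) by simp
    fix D' assume D': "D' \<in> superalg_hom A (tensor A A) \<inter> extensional (carrier A) \<and>
      (\<forall>i\<in>I. \<forall>j\<in>I. D' (AR_t n m q i j) =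
        (\<Oplus>\<^bsub>tensor A A\<^esub>k \<in> I. sgn2 (d k - d i) (d k - d j)
           \<odot>\<^bsub>tensor A A\<^esub> pure_tensor A A (AR_t n m q i k) (AR_t n m q k j)))"
    then have h': "D' \<in> superalg_hom A (tensor A A)" by blast
    have t: "D' (AR_t n m q i j) = D (AR_t n m q i j)" if "i \<in> I" "j \<in> I" for i j
      using D' comult_t[OF D that] that by simp
    have "D' x = D x" if x: "x \<in> carrier A" for x
    proof (rule A.mult_maps_eq_hom[OF T.tensor_kspace superalg_homD(1)[OF h'] D(1) _ _ superalg_homD(3)[OF h'] superalg_homD(3)[OF hom] x])
      show "D' \<one>\<^bsub>A\<^esub> = D \<one>\<^bsub>A\<^esub>" using superalg_homD(2)[OF h'] superalg_homD(2)[OF hom] by simp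
      show "D' (wA [i] [k]) = D (wA [i] [k])" if "i \<in> I" "k \<in> I" for i k
        unfolding AR_t_eq(2)[OF that] klinD(3)[OF superalg_homD(1)[OF h'] AR_t_eq(3)[OF that]]
          klinD(3)[OF D(1) AR_t_eq(3)[OF that]] t[OF that] ..
    qed
    then show "D' = restrict D (carrier A)"
      using D' by (intro extensionalityI[of _ "carrier A"]) auto
  qed
  show "AR_comult n m q \<in> klin A (tensor A A)"
    unfolding eq by (rule klin_cong[OF D(1) A.kspace_axioms]) simp
  show "AR_comult n m q (wA J K) = comat A I wA J K" if "J \<in> mwords I l" "K \<in> mwords I l" for J K l
    unfolding eq using A.w_closed[OF that] D(2)[OF that] by simp
qed

lemma AR_counit:
  shows "AR_counit n m q \<in> klin A base_superalg"
    and "\<And>J K l. J \<in> mwords I l \<Longrightarrow> K \<in> mwords I l \<Longrightarrow> AR_counit n m q (wA J K) = of_bool (J = K)"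
proof -
  interpret A: matalg A I d wA by (rule A_matalg)
  interpret B: kalg "base_superalg :: ('k, 'k) superalg" by (rule base_kalg)
  obtain D where D: "D \<in> klin A base_superalg"
    "\<And>J K l. J \<in> mwords I l \<Longrightarrow> K \<in> mwords I l \<Longrightarrow> D (wA J K) = of_bool (J = K)"
    using AR_counit_exists by metis
  note hom = matalg_counit_hom[OF A_matalg D]
  have m: "[i] \<in> mwords I 1" if "i \<in> I" for i using that by (simp add: mwords_def)
  have Dt: "D (AR_t n m q i j) = of_bool (i = j)" if "i \<in> I" "j \<in> I" for i j
  proof -
    have "usgn j j = 1" by (cases "d j") (simp_all add: usgn_def sgn2_def)
    then show ?thesis
      unfolding AR_t_eq(1)[OF that] klinD(3)[OF D(1) A.w_closed[OF m[OF that(1)] m[OF that(2)]]]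
        D(2)[OF m[OF that(1)] m[OF that(2)]] by auto
  qed
  have eq: "AR_counit n m q = restrict D (carrier A)"
    unfolding AR_counit_def Let_def
  proof (rule the_equality)
    show "restrict D (carrier A) \<in> superalg_hom A base_superalg \<inter> extensional (carrier A) \<and>
      (\<forall>i\<in>I. \<forall>j\<in>I. restrict D (carrier A) (AR_t n m q i j) = of_bool (i = j))"
      using superalg_hom_restrict[OF A.superalgebra_axioms hom] Dt AR_t_eq(3) by simp
    fix D' assume D': "D' \<in> superalg_hom A base_superalg \<inter> extensional (carrier A) \<and>
      (\<forall>i\<in>I. \<forall>j\<in>I. D' (AR_t n m q i j) = of_bool (i = j))"
    then have h': "D' \<in> superalg_hom A base_superalg" by blast
    have t: "D' (AR_t n m q i j) = D (AR_t n m q i j)" if "i \<in> I" "j \<in> I" for i j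
      using D' Dt[OF that] that by simp
    have "D' x = D x" if x: "x \<in> carrier A" for x
    proof (rule A.mult_maps_eq_hom[OF B.kspace_axioms superalg_homD(1)[OF h'] D(1) _ _ superalg_homD(3)[OF h'] superalg_homD(3)[OF hom] x])
      show "D' \<one>\<^bsub>A\<^esub> = D \<one>\<^bsub>A\<^esub>" using superalg_homD(2)[OF h'] superalg_homD(2)[OF hom] by simp
      show "D' (wA [i] [k]) = D (wA [i] [k])" if "i \<in> I" "k \<in> I" for i k
        unfolding AR_t_eq(2)[OF that] klinD(3)[OF superalg_homD(1)[OF h'] AR_t_eq(3)[OF that]]
          klinD(3)[OF D(1) AR_t_eq(3)[OF that]] t[OF that] ..
    qed
    then show "D' = restrict D (carrier A)"
      using D' by (intro extensionalityI[of _ "carrier A"]) auto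
  qed
  show "AR_counit n m q \<in> klin A base_superalg"
    unfolding eq by (rule klin_cong[OF D(1) A.kspace_axioms]) simp
  show "AR_counit n m q (wA J K) = of_bool (J = K)" if "J \<in> mwords I l" "K \<in> mwords I l" for J K l
    unfolding eq using A.w_closed[OF that] D(2)[OF that] by simp
qed

end

section \<open>The quotient by \<open>Q - 1\<close>\<close>

text \<open>If \<open>f w = f\<close>, then contracting \<open>f\<close> with \<open>comat\<close>
  absorbs the left tensor factors first and the right ones afterwards. Applied in the quotient, it
  shows that the image of \<open>Q - 1\<close> under the comultiplication vanishes there.\<close>

lemma (in matalg) invariant_comat:
  assumes "\<And>K. K \<in> mwords I l \<Longrightarrow> (\<Oplus>J\<in>mwords I l. f J \<odot> w J K) = f K \<odot> \<one>" and K: "K \<in> mwords I l"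
  shows "(\<Oplus>\<^bsub>tensor A A\<^esub>J\<in>mwords I l. f J \<odot>\<^bsub>tensor A A\<^esub> comat A I w J K) = f K \<odot>\<^bsub>tensor A A\<^esub> pure_tensor A A \<one> \<one>"
proof -
  interpret AA: ktensor A A by (intro ktensor.intro kspace_axioms)
  interpret T: kspace "tensor A A" by (rule AA.tensor_kspace)
  let ?S = "mwords I l" and ?T = "tensor A A"
  note p1 = bilinD(1)[OF AA.bilin_pure] and p2 = bilinD(2)[OF AA.bilin_pure]
  note fin = finite_mw[of l]
  have len: "length P = l" if "P \<in> ?S" for P using that by (simp add: mwords_def)
  have c: "pure_tensor A A (w J M) (w M K) \<in> carrier ?T" if "J \<in> ?S" "M \<in> ?S" for J M
    using that K by (intro AA.pure_closed w_closed[of _ l])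
  have "(\<Oplus>\<^bsub>?T\<^esub>J\<in>?S. f J \<odot>\<^bsub>?T\<^esub> comat A I w J K) = (\<Oplus>\<^bsub>?T\<^esub>J\<in>?S. \<Oplus>\<^bsub>?T\<^esub>M\<in>?S. f J \<odot>\<^bsub>?T\<^esub> pure_tensor A A (w J M) (w M K))"
  proof (rule T.finsum_cong'[OF refl])
    show "(\<lambda>J. \<Oplus>\<^bsub>?T\<^esub>M\<in>?S. f J \<odot>\<^bsub>?T\<^esub> pure_tensor A A (w J M) (w M K)) \<in> ?S \<rightarrow> carrier ?T"
      using c by (intro funcsetI T.finsum_closed) auto
    show "f J \<odot>\<^bsub>?T\<^esub> comat A I w J K = (\<Oplus>\<^bsub>?T\<^esub>M\<in>?S. f J \<odot>\<^bsub>?T\<^esub> pure_tensor A A (w J M) (w M K))"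
      if "J \<in> ?S" for J
      unfolding comat_def len[OF that] by (rule T.smult_finsum[OF fin]) (use c that in auto)
  qed
  also have "\<dots> = (\<Oplus>\<^bsub>?T\<^esub>M\<in>?S. \<Oplus>\<^bsub>?T\<^esub>J\<in>?S. f J \<odot>\<^bsub>?T\<^esub> pure_tensor A A (w J M) (w M K))"
    by (rule T.finsum_swap[OF fin fin]) (use c in auto)
  also have "\<dots> = (\<Oplus>\<^bsub>?T\<^esub>M\<in>?S. f M \<odot>\<^bsub>?T\<^esub> pure_tensor A A \<one> (w M K))"
  proof (rule T.finsum_cong'[OF refl])
    show "(\<lambda>M. f M \<odot>\<^bsub>?T\<^esub> pure_tensor A A \<one> (w M K)) \<in> ?S \<rightarrow> carrier ?T"
      using w_closed[OF _ K] by (auto intro!: AA.pure_closed)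
    fix M assume M: "M \<in> ?S"
    show "(\<Oplus>\<^bsub>?T\<^esub>J\<in>?S. f J \<odot>\<^bsub>?T\<^esub> pure_tensor A A (w J M) (w M K)) = f M \<odot>\<^bsub>?T\<^esub> pure_tensor A A \<one> (w M K)"
      using klin_lincomb[OF kspace_axioms T.kspace_axioms p1[OF w_closed[OF M K]] fin, of "\<lambda>J. w J M" f, OF w_closed[OF _ M]]
        assms(1)[OF M] klinD(3)[OF p1[OF w_closed[OF M K]]] by simp
  qed
  also have "\<dots> = pure_tensor A A \<one> (\<Oplus>M\<in>?S. f M \<odot> w M K)"
    by (rule klin_lincomb[OF kspace_axioms T.kspace_axioms p2[OF one_closed] fin w_closed[OF _ K], symmetric])
  also have "\<dots> = f K \<odot>\<^bsub>?T\<^esub> pure_tensor A A \<one> \<one>"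
    unfolding assms(1)[OF K] using klinD(3)[OF p2[OF one_closed]] by simp
  finally show ?thesis .
qed

lemma (in kspace) finsum_mwords_zero_weight:
  fixes g :: "int list \<Rightarrow> 'a"
  assumes "finite I" "\<And>a. a \<in> I \<Longrightarrow> - a \<in> I" "\<And>a. a \<in> I \<Longrightarrow> g [a, - a] \<in> carrier A"
    "\<And>a b. a \<in> I \<Longrightarrow> b \<in> I \<Longrightarrow> b \<noteq> - a \<Longrightarrow> g [a, b] = \<zero>"
  shows "(\<Oplus>J\<in>mwords I 2. g J) = (\<Oplus>a\<in>I. g [a, - a])"
proof -
  have sub: "(\<lambda>a. [a, - a]) ` I \<subseteq> mwords I 2" using assms(2) by (auto intro: mwords2I)
  have z: "g J = \<zero>" if "J \<in> mwords I 2 - (\<lambda>a. [a, - a]) ` I" for J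
    using that assms(4) by (auto elim!: mwords2E)
  have "(\<Oplus>J\<in>mwords I 2. g J) = (\<Oplus>J\<in>(\<lambda>a. [a, - a]) ` I. g J)"
  proof (rule add.finprod_mono_neutral_cong_right[OF finite_mwords[OF assms(1)] sub])
    show "g \<in> mwords I 2 \<rightarrow> carrier A"
    proof
      fix J assume "J \<in> mwords I 2"
      then show "g J \<in> carrier A" using z assms(3) by (cases "J \<in> (\<lambda>a. [a, - a]) ` I") auto
    qed
  qed (use z in auto)
  also have "\<dots> = (\<Oplus>a\<in>I. g [a, - a])"
    by (rule finsum_reindex) (use assms(3) in \<open>auto simp: inj_on_def\<close>)
  finally show ?thesis .
qed

locale spo = spo_scalars q n m for q :: "'k::field" and n m +
  fixes k0 :: int
  assumes q_square: "q * q \<noteq> 1" and k0: "k0 \<in> idx n m"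
begin

section \<open>The central element Q and the quotient in which it becomes the unit\<close>

lemma lam_nz: "lam \<noteq> 0"
  using q_square q_nz by (simp add: lam_def field_simps)

lemma mu_nz: "mu \<noteq> 0"
  using q_nz by (simp add: mu_def)

text \<open>Since \<open>Rhat\<close> intertwines \<open>v\<close>, so do its square and the
  identity. By \<open>Rhat_square\<close> their combination is \<open>lam * mu\<close> times the
  rank-one matrix, and the nonzero scalar can be divided out.\<close>

lemma rank_one_intertwines:
  assumes "matalg M I d v" "kspace.intertwines M (mwords I 2) Rhat v"
    and P: "P \<in> mwords I 2" and K: "K \<in> mwords I 2"
  shows "emat P \<odot>\<^bsub>M\<^esub> (\<Oplus>\<^bsub>M\<^esub>J\<in>mwords I 2. fmat J \<odot>\<^bsub>M\<^esub> v J K) = fmat K \<odot>\<^bsub>M\<^esub> (\<Oplus>\<^bsub>M\<^esub>J\<in>mwords I 2. emat J \<odot>\<^bsub>M\<^esub> v P J)"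
proof -
  interpret M: matalg M I d v by fact
  let ?S = "mwords I 2" and ?R2 = "\<lambda>P K. \<Sum>J\<in>mwords I 2. Rhat P J * Rhat J K"
  have v: "v \<in> M.mats ?S" using M.w_closed by (auto simp: M.mats_def)
  note fin = M.finite_mw[of 2]
  have c1: "v J K \<in> carrier M" if "J \<in> ?S" for J using M.w_closed[OF that K] .
  have c2: "v P J \<in> carrier M" if "J \<in> ?S" for J using M.w_closed[OF P that] .
  let ?FV = "\<Oplus>\<^bsub>M\<^esub>J\<in>?S. fmat J \<odot>\<^bsub>M\<^esub> v J K" and ?EV = "\<Oplus>\<^bsub>M\<^esub>J\<in>?S. emat J \<odot>\<^bsub>M\<^esub> v P J"
  let ?X = "\<Oplus>\<^bsub>M\<^esub>J\<in>?S. Rhat P J \<odot>\<^bsub>M\<^esub> v J K"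
  have X: "?X = (\<Oplus>\<^bsub>M\<^esub>J\<in>?S. Rhat J K \<odot>\<^bsub>M\<^esub> v P J)"
    using assms(2) P K by (simp add: M.intertwines_def)
  have cl: "?X \<in> carrier M" "?FV \<in> carrier M" "?EV \<in> carrier M"
    using c1 c2 by (auto intro!: M.finsum_closed)
  have "M.meq ?S (M.mmul ?S (M.scal Rhat) v) (M.mmul ?S v (M.scal Rhat))"
    using assms(2) M.intertwines_meq[OF v] by blast
  then have "M.meq ?S (M.mmul ?S (M.scal ?R2) v) (M.mmul ?S v (M.scal ?R2))"
    by (rule M.square_intertwines[OF fin v])
  then have eq: "(\<Oplus>\<^bsub>M\<^esub>J\<in>?S. ?R2 P J \<odot>\<^bsub>M\<^esub> v J K) = (\<Oplus>\<^bsub>M\<^esub>J\<in>?S. ?R2 J K \<odot>\<^bsub>M\<^esub> v P J)"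
    using P K M.mmul_scal_left[OF v P K, of ?R2] M.mmul_scal_right[OF v P K, of ?R2] by (simp add: M.meq_def)
  have split: "(\<Oplus>\<^bsub>M\<^esub>J\<in>?S. (lam * a J + b J + e * f J) \<odot>\<^bsub>M\<^esub> x J)
      = (lam \<odot>\<^bsub>M\<^esub> (\<Oplus>\<^bsub>M\<^esub>J\<in>?S. a J \<odot>\<^bsub>M\<^esub> x J) \<oplus>\<^bsub>M\<^esub> (\<Oplus>\<^bsub>M\<^esub>J\<in>?S. b J \<odot>\<^bsub>M\<^esub> x J)) \<oplus>\<^bsub>M\<^esub> e \<odot>\<^bsub>M\<^esub> (\<Oplus>\<^bsub>M\<^esub>J\<in>?S. f J \<odot>\<^bsub>M\<^esub> x J)"
    if x: "\<And>J. J \<in> ?S \<Longrightarrow> x J \<in> carrier M" for a b f :: "int list \<Rightarrow> 'k" and e x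
  proof -
    have "(\<Oplus>\<^bsub>M\<^esub>J\<in>?S. (lam * a J + b J + e * f J) \<odot>\<^bsub>M\<^esub> x J)
      = (\<Oplus>\<^bsub>M\<^esub>J\<in>?S. (lam \<odot>\<^bsub>M\<^esub> (a J \<odot>\<^bsub>M\<^esub> x J) \<oplus>\<^bsub>M\<^esub> b J \<odot>\<^bsub>M\<^esub> x J) \<oplus>\<^bsub>M\<^esub> e \<odot>\<^bsub>M\<^esub> (f J \<odot>\<^bsub>M\<^esub> x J))"
      using x by (intro M.finsum_cong'[OF refl]) (auto simp: M.smult_add_left)
    also have "\<dots> = ((\<Oplus>\<^bsub>M\<^esub>J\<in>?S. lam \<odot>\<^bsub>M\<^esub> (a J \<odot>\<^bsub>M\<^esub> x J)) \<oplus>\<^bsub>M\<^esub> (\<Oplus>\<^bsub>M\<^esub>J\<in>?S. b J \<odot>\<^bsub>M\<^esub> x J)) \<oplus>\<^bsub>M\<^esub> (\<Oplus>\<^bsub>M\<^esub>J\<in>?S. e \<odot>\<^bsub>M\<^esub> (f J \<odot>\<^bsub>M\<^esub> x J))"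
      using x by (subst M.finsum_addf, auto)+
    also have "(\<Oplus>\<^bsub>M\<^esub>J\<in>?S. lam \<odot>\<^bsub>M\<^esub> (a J \<odot>\<^bsub>M\<^esub> x J)) = lam \<odot>\<^bsub>M\<^esub> (\<Oplus>\<^bsub>M\<^esub>J\<in>?S. a J \<odot>\<^bsub>M\<^esub> x J)"
      by (rule M.smult_finsum[OF fin, symmetric]) (use x in auto)
    also have "(\<Oplus>\<^bsub>M\<^esub>J\<in>?S. e \<odot>\<^bsub>M\<^esub> (f J \<odot>\<^bsub>M\<^esub> x J)) = e \<odot>\<^bsub>M\<^esub> (\<Oplus>\<^bsub>M\<^esub>J\<in>?S. f J \<odot>\<^bsub>M\<^esub> x J)"
      by (rule M.smult_finsum[OF fin, symmetric]) (use x in auto)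
    finally show ?thesis .
  qed
  have "(\<Oplus>\<^bsub>M\<^esub>J\<in>?S. ?R2 P J \<odot>\<^bsub>M\<^esub> v J K)
      = (\<Oplus>\<^bsub>M\<^esub>J\<in>?S. (lam * Rhat P J + of_bool (P = J) + (lam * mu * emat P) * fmat J) \<odot>\<^bsub>M\<^esub> v J K)"
    using c1 by (intro M.finsum_cong'[OF refl]) (auto simp: Rhat_square[OF P] mult.assoc)
  also have "\<dots> = (lam \<odot>\<^bsub>M\<^esub> ?X \<oplus>\<^bsub>M\<^esub> (\<Oplus>\<^bsub>M\<^esub>J\<in>?S. of_bool (P = J) \<odot>\<^bsub>M\<^esub> v J K)) \<oplus>\<^bsub>M\<^esub> (lam * mu * emat P) \<odot>\<^bsub>M\<^esub> ?FV"
    by (rule split[OF c1])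
  also have "(\<Oplus>\<^bsub>M\<^esub>J\<in>?S. of_bool (P = J) \<odot>\<^bsub>M\<^esub> v J K) = v P K"
    by (subst M.finsum_delta[of _ P]) (use P fin c1 in auto)
  finally have l: "(\<Oplus>\<^bsub>M\<^esub>J\<in>?S. ?R2 P J \<odot>\<^bsub>M\<^esub> v J K) = (lam \<odot>\<^bsub>M\<^esub> ?X \<oplus>\<^bsub>M\<^esub> v P K) \<oplus>\<^bsub>M\<^esub> (lam * mu * emat P) \<odot>\<^bsub>M\<^esub> ?FV" .
  have "(\<Oplus>\<^bsub>M\<^esub>J\<in>?S. ?R2 J K \<odot>\<^bsub>M\<^esub> v P J)
      = (\<Oplus>\<^bsub>M\<^esub>J\<in>?S. (lam * Rhat J K + of_bool (J = K) + (lam * mu * fmat K) * emat J) \<odot>\<^bsub>M\<^esub> v P J)"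
    using c2 by (intro M.finsum_cong'[OF refl]) (auto simp: Rhat_square[OF _ K] mult_ac)
  also have "\<dots> = (lam \<odot>\<^bsub>M\<^esub> ?X \<oplus>\<^bsub>M\<^esub> (\<Oplus>\<^bsub>M\<^esub>J\<in>?S. of_bool (J = K) \<odot>\<^bsub>M\<^esub> v P J)) \<oplus>\<^bsub>M\<^esub> (lam * mu * fmat K) \<odot>\<^bsub>M\<^esub> ?EV"
    unfolding X by (rule split[OF c2])
  also have "(\<Oplus>\<^bsub>M\<^esub>J\<in>?S. of_bool (J = K) \<odot>\<^bsub>M\<^esub> v P J) = v P K"
    by (subst M.finsum_delta[of _ K]) (use K fin c2 in auto)
  finally have r: "(\<Oplus>\<^bsub>M\<^esub>J\<in>?S. ?R2 J K \<odot>\<^bsub>M\<^esub> v P J) = (lam \<odot>\<^bsub>M\<^esub> ?X \<oplus>\<^bsub>M\<^esub> v P K) \<oplus>\<^bsub>M\<^esub> (lam * mu * fmat K) \<odot>\<^bsub>M\<^esub> ?EV" .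
  \<comment> \<open>The terms from \<open>lam * Rhat\<close> and from the identity are the same on
    both sides and cancel.\<close>
  have "(lam * mu * emat P) \<odot>\<^bsub>M\<^esub> ?FV = (lam * mu * fmat K) \<odot>\<^bsub>M\<^esub> ?EV"
    using eq cl c1[OF P] unfolding l r by simp
  then have "inverse (lam * mu) \<odot>\<^bsub>M\<^esub> ((lam * mu * emat P) \<odot>\<^bsub>M\<^esub> ?FV) = inverse (lam * mu) \<odot>\<^bsub>M\<^esub> ((lam * mu * fmat K) \<odot>\<^bsub>M\<^esub> ?EV)"
    by simp
  moreover have "inverse (lam * mu) * (lam * mu * e) = e" for e
    using lam_nz mu_nz by (simp add: field_simps)
  ultimately show ?thesis by (simp only: M.smult_smult[OF cl(2)] M.smult_smult[OF cl(3)])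
qed

text \<open>Q read off from \<open>f W = Q f\<close> at the column \<open>[k0, - k0]\<close>, where
  \<open>f\<close> has the nonzero entry \<open>cq k0\<close>.\<close>

definition QA :: "'k rtt" where "QA = inverse (cq k0) \<odot>\<^bsub>A\<^esub> (\<Oplus>\<^bsub>A\<^esub>J\<in>mwords I 2. fmat J \<odot>\<^bsub>A\<^esub> wA J [k0, - k0])"

lemma k0_pair: "[k0, - k0] \<in> mwords I 2"
  using k0 by (auto intro: mwords2I)

lemma QA_closed: "QA \<in> carrier A"
proof -
  interpret A: matalg A I d wA by (rule A_matalg)
  show ?thesis unfolding QA_def using A.w_closed[OF _ k0_pair] by (auto intro!: A.finsum_closed)
qed

lemma fmat_fold: "fmat [k0, - k0] = cq k0" by (simp add: fmat_def)

text \<open>In \<open>e_P (f W)_K = f_K (W e)_P\<close>, the column K = \<open>[k0, - k0]\<close>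
  first yields \<open>W e = Q e\<close>; then the row P = \<open>[k0, - k0]\<close> yields
  \<open>f W = Q f\<close> with the same Q. In particular the choice of the index in the definition
  of Q does not matter.\<close>

lemma QA_f:
  shows "K \<in> mwords I 2 \<Longrightarrow> (\<Oplus>\<^bsub>A\<^esub>J\<in>mwords I 2. fmat J \<odot>\<^bsub>A\<^esub> wA J K) = fmat K \<odot>\<^bsub>A\<^esub> QA"
    and "P \<in> mwords I 2 \<Longrightarrow> (\<Oplus>\<^bsub>A\<^esub>J\<in>mwords I 2. emat J \<odot>\<^bsub>A\<^esub> wA P J) = emat P \<odot>\<^bsub>A\<^esub> QA"
proof -
  interpret A: matalg A I d wA by (rule A_matalg)
  let ?S = "mwords I 2"
  note r = rank_one_intertwines[OF A_matalg A_intertwines]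
  have FVc: "(\<Oplus>\<^bsub>A\<^esub>J\<in>?S. fmat J \<odot>\<^bsub>A\<^esub> wA J K) \<in> carrier A" if "K \<in> ?S" for K
    using A.w_closed[OF _ that] by (auto intro!: A.finsum_closed)
  have EVc: "(\<Oplus>\<^bsub>A\<^esub>J\<in>?S. emat J \<odot>\<^bsub>A\<^esub> wA P J) \<in> carrier A" if "P \<in> ?S" for P
    using A.w_closed[OF that] by (auto intro!: A.finsum_closed)
  have QF: "cq k0 \<odot>\<^bsub>A\<^esub> QA = (\<Oplus>\<^bsub>A\<^esub>J\<in>?S. fmat J \<odot>\<^bsub>A\<^esub> wA J [k0, - k0])"
    using FVc[OF k0_pair] by (simp add: QA_def)
  show E: "(\<Oplus>\<^bsub>A\<^esub>J\<in>?S. emat J \<odot>\<^bsub>A\<^esub> wA P J) = emat P \<odot>\<^bsub>A\<^esub> QA" if "P \<in> ?S" for P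
  proof -
    have "inverse (cq k0) \<odot>\<^bsub>A\<^esub> (emat P \<odot>\<^bsub>A\<^esub> (cq k0 \<odot>\<^bsub>A\<^esub> QA)) = inverse (cq k0) \<odot>\<^bsub>A\<^esub> (cq k0 \<odot>\<^bsub>A\<^esub> (\<Oplus>\<^bsub>A\<^esub>J\<in>?S. emat J \<odot>\<^bsub>A\<^esub> wA P J))"
      using r[OF that k0_pair] unfolding QF fmat_fold by simp
    moreover have "inverse (cq k0) * (emat P * cq k0) = emat P" by (simp add: field_simps)
    ultimately show ?thesis using EVc[OF that] QA_closed by simp
  qed
  show "(\<Oplus>\<^bsub>A\<^esub>J\<in>?S. fmat J \<odot>\<^bsub>A\<^esub> wA J K) = fmat K \<odot>\<^bsub>A\<^esub> QA" if "K \<in> ?S" for K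
  proof -
    let ?e = "inverse (cq (- k0))"
    have e: "emat [k0, - k0] = ?e" by (simp add: emat_def)
    have "cq (- k0) \<odot>\<^bsub>A\<^esub> (?e \<odot>\<^bsub>A\<^esub> (\<Oplus>\<^bsub>A\<^esub>J\<in>?S. fmat J \<odot>\<^bsub>A\<^esub> wA J K)) = cq (- k0) \<odot>\<^bsub>A\<^esub> (fmat K \<odot>\<^bsub>A\<^esub> (?e \<odot>\<^bsub>A\<^esub> QA))"
      using r[OF k0_pair that] unfolding E[OF k0_pair] e by simp
    then show ?thesis using FVc[OF that] QA_closed by (simp add: mult.left_commute)
  qed
qed

lemma QA_homog: "QA \<in> homog A 0"
proof -
  interpret A: matalg A I d wA by (rule A_matalg)
  have bb: "b + b = 0" for b :: bit by (cases b) auto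
  have "fmat J \<odot>\<^bsub>A\<^esub> wA J [k0, - k0] \<in> homog A 0" if J: "J \<in> mwords I 2" for J
  proof (cases "fmat J = 0")
    case True
    then show ?thesis using A.w_closed[OF J k0_pair] A.homog_sub(2) by simp
  next
    case False
    obtain a b where "J = [a, b]" using mwords2E[OF J] by metis
    then have "mdeg d J = 0" "mdeg d [k0, - k0] = 0" using False bb by (auto simp: fmat_def split: if_splits)
    then show ?thesis using A.homog_sub(4)[OF A.w_homog[OF J k0_pair]] by simp
  qed
  then show ?thesis
    unfolding QA_def by (rule A.homog_sub(4)[OF A.finsum_in_submodule[OF A.homog_submodule]])
qed

text \<open>The form is antidiagonal, so the inner sum has a single term. The signs in the
  definition of Q are those that turn the product of two generators into an entry of
  \<open>wA\<close>.\<close>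

lemma Q_elem_eq: "Q_elem n m q k0 = QA"
proof -
  interpret A: matalg A I d wA by (rule A_matalg)
  have m: "[i] \<in> mwords I 1" if "i \<in> I" for i using that by (simp add: mwords_def)
  have t: "AR_t n m q a b \<in> carrier A" if "a \<in> I" "b \<in> I" for a b using AR_t_eq(3)[OF that] .
  have k0m: "- k0 \<in> I" using k0 by simp
  have off: "Cq n q a b = 0" if "b \<noteq> - a" for a b using that by (simp add: Cq_def)
  have inner: "(\<Oplus>\<^bsub>A\<^esub>b\<in>I. (sg2 n a k0 * sg2 n b a * Cq n q a b) \<odot>\<^bsub>A\<^esub> (AR_t n m q a k0 \<otimes>\<^bsub>A\<^esub> AR_t n m q b (- k0)))
    = fmat [a, - a] \<odot>\<^bsub>A\<^esub> wA [a, - a] [k0, - k0]" if a: "a \<in> I" for a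
  proof -
    have am: "- a \<in> I" using a by simp
    have "(\<Oplus>\<^bsub>A\<^esub>b\<in>I. (sg2 n a k0 * sg2 n b a * Cq n q a b) \<odot>\<^bsub>A\<^esub> (AR_t n m q a k0 \<otimes>\<^bsub>A\<^esub> AR_t n m q b (- k0)))
      = (sg2 n a k0 * sg2 n (- a) a * Cq n q a (- a)) \<odot>\<^bsub>A\<^esub> (AR_t n m q a k0 \<otimes>\<^bsub>A\<^esub> AR_t n m q (- a) (- k0))"
      by (rule A.finsum_delta) (use finite_idx am a k0 k0m t off in auto)
    also have "\<dots> = (sg2 n a k0 * sg2 n (- a) a * cq a * (usgn a k0 * usgn (- a) (- k0))) \<odot>\<^bsub>A\<^esub> (wA [a] [k0] \<otimes>\<^bsub>A\<^esub> wA [- a] [- k0])"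
      unfolding AR_t_eq(1)[OF a k0] AR_t_eq(1)[OF am k0m]
      using A.w_closed[OF m[OF a] m[OF k0]] A.w_closed[OF m[OF am] m[OF k0m]]
      by (simp add: A.smult_left A.smult_right cq_def[symmetric] mult_ac)
    also have "wA [a] [k0] \<otimes>\<^bsub>A\<^esub> wA [- a] [- k0] = sgn2 (d a + d k0) (d a) \<odot>\<^bsub>A\<^esub> wA [a, - a] [k0, - k0]"
      using A.w_mult[OF m[OF a] m[OF k0] m[OF am] m[OF k0m]] by simp
    also have "(sg2 n a k0 * sg2 n (- a) a * cq a * (usgn a k0 * usgn (- a) (- k0))) \<odot>\<^bsub>A\<^esub> (sgn2 (d a + d k0) (d a) \<odot>\<^bsub>A\<^esub> wA [a, - a] [k0, - k0])
      = cq a \<odot>\<^bsub>A\<^esub> wA [a, - a] [k0, - k0]"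
    proof -
      have "sg2 n a k0 * sg2 n (- a) a * cq a * (usgn a k0 * usgn (- a) (- k0)) * sgn2 (d a + d k0) (d a) = cq a"
        by (cases "d a"; cases "d k0") (simp_all add: usgn_def sg2_def sgn2_def)
      then show ?thesis unfolding A.smult_smult[OF A.w_closed[OF mwords2I[OF a am] k0_pair]] by (simp only:)
    qed
    finally show ?thesis by (simp add: fmat_def)
  qed
  have "Q_elem n m q k0 = inverse (cq k0) \<odot>\<^bsub>A\<^esub> (\<Oplus>\<^bsub>A\<^esub>a\<in>I. \<Oplus>\<^bsub>A\<^esub>b\<in>I.
    (sg2 n a k0 * sg2 n b a * Cq n q a b) \<odot>\<^bsub>A\<^esub> (AR_t n m q a k0 \<otimes>\<^bsub>A\<^esub> AR_t n m q b (- k0)))"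
    unfolding Q_elem_def Let_def AR_def by (simp add: cq_def)
  also have "(\<Oplus>\<^bsub>A\<^esub>a\<in>I. \<Oplus>\<^bsub>A\<^esub>b\<in>I.
    (sg2 n a k0 * sg2 n b a * Cq n q a b) \<odot>\<^bsub>A\<^esub> (AR_t n m q a k0 \<otimes>\<^bsub>A\<^esub> AR_t n m q b (- k0)))
    = (\<Oplus>\<^bsub>A\<^esub>a\<in>I. fmat [a, - a] \<odot>\<^bsub>A\<^esub> wA [a, - a] [k0, - k0])"
    by (rule A.finsum_cong'[OF refl]) (use inner A.w_closed[OF mwords2I k0_pair] in auto)
  also have "\<dots> = (\<Oplus>\<^bsub>A\<^esub>J\<in>mwords I 2. fmat J \<odot>\<^bsub>A\<^esub> wA J [k0, - k0])"
    by (rule A.finsum_mwords_zero_weight[symmetric])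
      (use finite_idx A.w_closed[OF mwords2I k0_pair] in \<open>auto simp: fmat_def\<close>)
  finally show ?thesis by (simp add: QA_def)
qed

abbreviation "JQ \<equiv> J_Q n m q k0"
abbreviation "B \<equiv> quot_superalg A JQ"
definition wB :: "int list \<Rightarrow> int list \<Rightarrow> 'k rtt set" where "wB J K = JQ +>\<^bsub>A\<^esub> wA J K"

lemma JQ_eq: "JQ = genideal A {QA \<ominus>\<^bsub>A\<^esub> \<one>\<^bsub>A\<^esub>}"
  by (simp add: J_Q_def Q_elem_eq AR_def)

lemma QA_minus_one: "{QA \<ominus>\<^bsub>A\<^esub> \<one>\<^bsub>A\<^esub>} \<subseteq> homog A 0" "{QA \<ominus>\<^bsub>A\<^esub> \<one>\<^bsub>A\<^esub>} \<subseteq> carrier A"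
proof -
  interpret A: matalg A I d wA by (rule A_matalg)
  show 1: "{QA \<ominus>\<^bsub>A\<^esub> \<one>\<^bsub>A\<^esub>} \<subseteq> homog A 0" using A.homog_sub(6)[OF QA_homog A.homog_one] by simp
  then show "{QA \<ominus>\<^bsub>A\<^esub> \<one>\<^bsub>A\<^esub>} \<subseteq> carrier A" using A.homog_carrier by blast
qed

lemma A_graded_quot: "graded_quot A JQ"
proof -
  interpret A: matalg A I d wA by (rule A_matalg)
  show ?thesis
    unfolding JQ_eq using QA_minus_one
    by (intro graded_quot.intro graded_quot_axioms.intro A.superalgebra_axioms A.genideal_ideal A.genideal_graded) auto
qed

lemma B_matalg: "matalg B I d wB"
  using quot_matalg[OF A_matalg A_graded_quot] by (simp add: wB_def[abs_def])

lemma coset_QA: "JQ +>\<^bsub>A\<^esub> QA = \<one>\<^bsub>B\<^esub>"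
proof -
  interpret A: matalg A I d wA by (rule A_matalg)
  interpret Q: graded_quot A JQ by (rule A_graded_quot)
  have "QA \<ominus>\<^bsub>A\<^esub> \<one>\<^bsub>A\<^esub> \<in> JQ" unfolding JQ_eq using A.genideal_self[OF QA_minus_one(2)] by simp
  then show ?thesis using Q.coset_eq_iff[OF QA_closed A.one_closed] by (simp add: Q.quot_one)
qed

lemma B_f:
  shows "K \<in> mwords I 2 \<Longrightarrow> (\<Oplus>\<^bsub>B\<^esub>J\<in>mwords I 2. fmat J \<odot>\<^bsub>B\<^esub> wB J K) = fmat K \<odot>\<^bsub>B\<^esub> \<one>\<^bsub>B\<^esub>"
    and "P \<in> mwords I 2 \<Longrightarrow> (\<Oplus>\<^bsub>B\<^esub>J\<in>mwords I 2. emat J \<odot>\<^bsub>B\<^esub> wB P J) = emat P \<odot>\<^bsub>B\<^esub> \<one>\<^bsub>B\<^esub>"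
proof -
  interpret A: matalg A I d wA by (rule A_matalg)
  interpret Q: graded_quot A JQ by (rule A_graded_quot)
  show "(\<Oplus>\<^bsub>B\<^esub>J\<in>mwords I 2. fmat J \<odot>\<^bsub>B\<^esub> wB J K) = fmat K \<odot>\<^bsub>B\<^esub> \<one>\<^bsub>B\<^esub>" if "K \<in> mwords I 2"
    using Q.coset_lincomb[OF A.finite_mw, of 2 "\<lambda>J. wA J K" fmat, OF A.w_closed[OF _ that]]
    unfolding wB_def QA_f(1)[OF that] Q.quot_smult[OF QA_closed, symmetric] coset_QA by simp
  show "(\<Oplus>\<^bsub>B\<^esub>J\<in>mwords I 2. emat J \<odot>\<^bsub>B\<^esub> wB P J) = emat P \<odot>\<^bsub>B\<^esub> \<one>\<^bsub>B\<^esub>" if "P \<in> mwords I 2"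
    using Q.coset_lincomb[OF A.finite_mw, of 2 "wA P" emat, OF A.w_closed[OF that]]
    unfolding wB_def QA_f(2)[OF that] Q.quot_smult[OF QA_closed, symmetric] coset_QA by simp
qed

lemma B_intertwines: "kspace.intertwines B (mwords I 2) Rhat wB"
proof -
  interpret A: matalg A I d wA by (rule A_matalg)
  interpret Q: graded_quot A JQ by (rule A_graded_quot)
  interpret B: matalg B I d wB by (rule B_matalg)
  show ?thesis
    unfolding B.intertwines_def
  proof (intro ballI)
    fix P K assume P: "P \<in> mwords I 2" and K: "K \<in> mwords I 2"
    show "(\<Oplus>\<^bsub>B\<^esub>J\<in>mwords I 2. Rhat P J \<odot>\<^bsub>B\<^esub> wB J K) = (\<Oplus>\<^bsub>B\<^esub>J\<in>mwords I 2. Rhat J K \<odot>\<^bsub>B\<^esub> wB P J)"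
      using Q.coset_lincomb[OF A.finite_mw, of 2 "\<lambda>J. wA J K" "Rhat P", OF A.w_closed[OF _ K]]
        Q.coset_lincomb[OF A.finite_mw, of 2 "wA P" "\<lambda>J. Rhat J K", OF A.w_closed[OF P]]
        A_intertwines P K by (simp add: wB_def A.intertwines_def)
  qed
qed

text \<open>\<open>v [] []\<close> is the image of the unit. The values \<open>v\<close> are left
  abstract because the lemma serves the comultiplication, the counit and the antipode.\<close>

lemma QA_image:
  assumes M: "kspace M" and f: "f \<in> klin A M" and fw: "\<And>J K l. J \<in> mwords I l \<Longrightarrow> K \<in> mwords I l \<Longrightarrow> f (wA J K) = v J K"
    and v: "(\<Oplus>\<^bsub>M\<^esub>J\<in>mwords I 2. fmat J \<odot>\<^bsub>M\<^esub> v J [k0, - k0]) = fmat [k0, - k0] \<odot>\<^bsub>M\<^esub> v [] []"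
    and vc: "v [] [] \<in> carrier M" "\<And>J. J \<in> mwords I 2 \<Longrightarrow> v J [k0, - k0] \<in> carrier M"
    and s: "s \<in> {QA \<ominus>\<^bsub>A\<^esub> \<one>\<^bsub>A\<^esub>}"
  shows "f s = \<zero>\<^bsub>M\<^esub>"
proof -
  interpret A: matalg A I d wA by (rule A_matalg)
  interpret M: kspace M by fact
  have c: "(\<Oplus>\<^bsub>A\<^esub>J\<in>mwords I 2. fmat J \<odot>\<^bsub>A\<^esub> wA J [k0, - k0]) \<in> carrier A"
    using A.w_closed[OF _ k0_pair] by (auto intro!: A.finsum_closed)
  have "f (\<Oplus>\<^bsub>A\<^esub>J\<in>mwords I 2. fmat J \<odot>\<^bsub>A\<^esub> wA J [k0, - k0]) = (\<Oplus>\<^bsub>M\<^esub>J\<in>mwords I 2. fmat J \<odot>\<^bsub>M\<^esub> f (wA J [k0, - k0]))"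
    by (rule klin_lincomb[OF A.kspace_axioms M f A.finite_mw A.w_closed[OF _ k0_pair]])
  also have "\<dots> = (\<Oplus>\<^bsub>M\<^esub>J\<in>mwords I 2. fmat J \<odot>\<^bsub>M\<^esub> v J [k0, - k0])"
    by (rule M.finsum_cong'[OF refl]) (use fw[OF _ k0_pair] vc in auto)
  finally have "f QA = v [] []"
    unfolding QA_def klinD(3)[OF f c] v fmat_fold using vc(1) by simp
  moreover have "f \<one>\<^bsub>A\<^esub> = v [] []" using fw[of "[]" 0 "[]"] by (simp add: A.w_Nil)
  moreover have "s = QA \<ominus>\<^bsub>A\<^esub> \<one>\<^bsub>A\<^esub>" using s by simp
  ultimately show ?thesis
    using klin_minus[OF A.kspace_axioms M f QA_closed A.one_closed] vc(1) by (simp add: a_minus_def M.r_neg)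
qed

end

section \<open>The antipode\<close>

context spo
begin

text \<open>The formula for the antipode in terms of \<open>wB\<close> instead of \<open>t\<close>.
  The two sign changes replace the factor for \<open>i\<close> by the one for
  \<open>j\<close>.\<close>

definition tS :: "int \<Rightarrow> int \<Rightarrow> 'k rtt set"
  where "tS i j = (sg n j * sg2 n i j * (cq (- j) / cq (- i))) \<odot>\<^bsub>B\<^esub> wB [- j] [- i]"

lemma singleton_mwords: "i \<in> I \<Longrightarrow> [i] \<in> mwords I 1"
  by (simp add: mwords_def)

lemma wB1_closed: "i \<in> I \<Longrightarrow> j \<in> I \<Longrightarrow> wB [i] [j] \<in> carrier B"
  using matalg.w_closed[OF B_matalg singleton_mwords singleton_mwords] .

lemma tS_homog: "i \<in> I \<Longrightarrow> j \<in> I \<Longrightarrow> tS i j \<in> homog B (d i + d j)"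
proof -
  interpret B: matalg B I d wB by (rule B_matalg)
  assume ij: "i \<in> I" "j \<in> I"
  have "wB [- j] [- i] \<in> homog B (mdeg d [- j] + mdeg d [- i])"
    using ij by (intro B.w_homog[OF singleton_mwords singleton_mwords]) auto
  then show ?thesis unfolding tS_def by (intro B.homog_sub(4)) (simp add: add.commute)
qed

lemma wB_pair:
  assumes "a \<in> I" "b \<in> I" "k \<in> I" "l \<in> I"
  shows "wB [a, b] [k, l] = sgn2 (d a + d k) (d b) \<odot>\<^bsub>B\<^esub> (wB [a] [k] \<otimes>\<^bsub>B\<^esub> wB [b] [l])"
proof -
  interpret B: matalg B I d wB by (rule B_matalg)
  show ?thesis using B.w_Cons[OF singleton_mwords[OF assms(2)] singleton_mwords[OF assms(4)] assms(1,3)] by simp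
qed

text \<open>Substituting j = -a turns the sum into column \<open>[- i, k]\<close> of
  \<open>f W\<close>, divided by \<open>cq (- i)\<close>. By \<open>f W = f\<close> it is the entry
  of \<open>f\<close> there, which vanishes unless i = k.\<close>

lemma tS_left:
  assumes i: "i \<in> I" and k: "k \<in> I"
  shows "(\<Oplus>\<^bsub>B\<^esub>j\<in>I. tS i j \<otimes>\<^bsub>B\<^esub> wB [j] [k]) = of_bool (i = k) \<odot>\<^bsub>B\<^esub> \<one>\<^bsub>B\<^esub>"
proof -
  interpret B: matalg B I d wB by (rule B_matalg)
  have im: "- i \<in> I" using i by simp
  let ?t = "\<lambda>a. wB [a] [- i] \<otimes>\<^bsub>B\<^esub> wB [- a] [k]"
  have tc: "?t a \<in> carrier B" if "a \<in> I" for a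
    using that im k by (intro B.mult_closed wB1_closed) auto
  have vc: "tS i j \<otimes>\<^bsub>B\<^esub> wB [j] [k] \<in> carrier B" if "j \<in> I" for j
    using tS_homog[OF i that] B.homog_carrier wB1_closed[OF that k] by (intro B.mult_closed) auto
  have "(\<Oplus>\<^bsub>B\<^esub>j\<in>I. tS i j \<otimes>\<^bsub>B\<^esub> wB [j] [k]) = (\<Oplus>\<^bsub>B\<^esub>j\<in>uminus ` I. tS i j \<otimes>\<^bsub>B\<^esub> wB [j] [k])"
  proof -
    have "uminus ` I = I" by (auto intro!: image_eqI[of _ _ "- _"])
    then show ?thesis by simp
  qed
  also have "\<dots> = (\<Oplus>\<^bsub>B\<^esub>a\<in>I. tS i (- a) \<otimes>\<^bsub>B\<^esub> wB [- a] [k])"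
    by (rule B.finsum_reindex) (use vc in auto)
  also have "\<dots> = (\<Oplus>\<^bsub>B\<^esub>a\<in>I. inverse (cq (- i)) \<odot>\<^bsub>B\<^esub> (fmat [a, - a] \<odot>\<^bsub>B\<^esub> wB [a, - a] [- i, k]))"
  proof (rule B.finsum_cong'[OF refl])
    show "(\<lambda>a. inverse (cq (- i)) \<odot>\<^bsub>B\<^esub> (fmat [a, - a] \<odot>\<^bsub>B\<^esub> wB [a, - a] [- i, k])) \<in> I \<rightarrow> carrier B"
      using im k by (intro funcsetI B.smult_closed' B.w_closed[of _ 2] mwords2I) auto
    fix a assume a: "a \<in> I"
    have s: "sg n a * sg2 n i a = (sgn2 (d a + d i) (d a) :: 'k)"
      by (cases "d a"; cases "d i") (simp_all add: sg2_def sgn2_def)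
    show "tS i (- a) \<otimes>\<^bsub>B\<^esub> wB [- a] [k] = inverse (cq (- i)) \<odot>\<^bsub>B\<^esub> (fmat [a, - a] \<odot>\<^bsub>B\<^esub> wB [a, - a] [- i, k])"
      using a im k wB1_closed[OF a im] wB1_closed[of "- a" k] tc[OF a]
      by (simp add: tS_def wB_pair B.smult_left fmat_def s divide_inverse mult_ac)
  qed
  also have "\<dots> = inverse (cq (- i)) \<odot>\<^bsub>B\<^esub> (\<Oplus>\<^bsub>B\<^esub>a\<in>I. fmat [a, - a] \<odot>\<^bsub>B\<^esub> wB [a, - a] [- i, k])"
    by (rule B.smult_finsum[symmetric, OF finite_idx])
      (use im k in \<open>intro funcsetI B.smult_closed' B.w_closed[of _ 2] mwords2I; auto\<close>)
  also have "(\<Oplus>\<^bsub>B\<^esub>a\<in>I. fmat [a, - a] \<odot>\<^bsub>B\<^esub> wB [a, - a] [- i, k]) = (\<Oplus>\<^bsub>B\<^esub>J\<in>mwords I 2. fmat J \<odot>\<^bsub>B\<^esub> wB J [- i, k])"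
    by (rule B.finsum_mwords_zero_weight[symmetric])
      (use finite_idx B.w_closed[OF mwords2I mwords2I[OF im k]] in \<open>auto simp: fmat_def\<close>)
  also have "\<dots> = fmat [- i, k] \<odot>\<^bsub>B\<^esub> \<one>\<^bsub>B\<^esub>" by (rule B_f(1)[OF mwords2I[OF im k]])
  finally show ?thesis by (auto simp: fmat_def)
qed

text \<open>The sum is a multiple of row \<open>[i, - k]\<close> of \<open>W e\<close>, and
  \<open>W e = e\<close>.\<close>

lemma tS_right:
  assumes i: "i \<in> I" and k: "k \<in> I"
  shows "(\<Oplus>\<^bsub>B\<^esub>j\<in>I. wB [i] [j] \<otimes>\<^bsub>B\<^esub> tS j k) = of_bool (i = k) \<odot>\<^bsub>B\<^esub> \<one>\<^bsub>B\<^esub>"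
proof -
  interpret B: matalg B I d wB by (rule B_matalg)
  have km: "- k \<in> I" using k by simp
  let ?c = "sg n k * cq (- k) * sg2 n i k :: 'k"
  have tc: "wB [i] [j] \<otimes>\<^bsub>B\<^esub> wB [- k] [- j] \<in> carrier B" if "j \<in> I" for j
    using that km i by (intro B.mult_closed wB1_closed) auto
  have "(\<Oplus>\<^bsub>B\<^esub>j\<in>I. wB [i] [j] \<otimes>\<^bsub>B\<^esub> tS j k) = (\<Oplus>\<^bsub>B\<^esub>j\<in>I. ?c \<odot>\<^bsub>B\<^esub> (emat [j, - j] \<odot>\<^bsub>B\<^esub> wB [i, - k] [j, - j]))"
  proof (rule B.finsum_cong'[OF refl])
    show "(\<lambda>j. ?c \<odot>\<^bsub>B\<^esub> (emat [j, - j] \<odot>\<^bsub>B\<^esub> wB [i, - k] [j, - j])) \<in> I \<rightarrow> carrier B"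
      using km i by (intro funcsetI B.smult_closed' B.w_closed[of _ 2] mwords2I) auto
    fix j assume j: "j \<in> I"
    have s: "sg n k * sg2 n j k * (cq (- k) / cq (- j)) = ?c * (inverse (cq (- j)) * sgn2 (d i + d j) (d k))"
      by (cases "d i"; cases "d j"; cases "d k") (simp_all add: sg2_def sgn2_def divide_inverse)
    show "wB [i] [j] \<otimes>\<^bsub>B\<^esub> tS j k = ?c \<odot>\<^bsub>B\<^esub> (emat [j, - j] \<odot>\<^bsub>B\<^esub> wB [i, - k] [j, - j])"
      unfolding tS_def s using j km i wB1_closed[OF i j] wB1_closed[of "- k" "- j"] tc[OF j]
      by (simp add: wB_pair B.smult_right emat_def)
  qed
  also have "\<dots> = ?c \<odot>\<^bsub>B\<^esub> (\<Oplus>\<^bsub>B\<^esub>j\<in>I. emat [j, - j] \<odot>\<^bsub>B\<^esub> wB [i, - k] [j, - j])"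
    by (rule B.smult_finsum[symmetric, OF finite_idx])
      (use km i in \<open>intro funcsetI B.smult_closed' B.w_closed[of _ 2] mwords2I; auto\<close>)
  also have "(\<Oplus>\<^bsub>B\<^esub>j\<in>I. emat [j, - j] \<odot>\<^bsub>B\<^esub> wB [i, - k] [j, - j]) = (\<Oplus>\<^bsub>B\<^esub>J\<in>mwords I 2. emat J \<odot>\<^bsub>B\<^esub> wB [i, - k] J)"
    by (rule B.finsum_mwords_zero_weight[symmetric])
      (use finite_idx B.w_closed[OF mwords2I[OF i km] mwords2I] in \<open>auto simp: emat_def\<close>)
  also have "\<dots> = emat [i, - k] \<odot>\<^bsub>B\<^esub> \<one>\<^bsub>B\<^esub>" by (rule B_f(2)[OF mwords2I[OF i km]])
  also have "?c \<odot>\<^bsub>B\<^esub> \<dots> = of_bool (i = k) \<odot>\<^bsub>B\<^esub> \<one>\<^bsub>B\<^esub>"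
  proof -
    have "?c * emat [i, - k] = of_bool (i = k)" by (auto simp: emat_def sg2_def sgn2_def)
    then show ?thesis by simp
  qed
  finally show ?thesis .
qed

definition wS :: "int list \<Rightarrow> int list \<Rightarrow> 'k rtt set" where "wS = anti_ext B d tS"

lemma wS_props:
  shows "\<lbrakk>J \<in> mwords I l; K \<in> mwords I l\<rbrakk> \<Longrightarrow> wS J K \<in> homog B (mdeg d J + mdeg d K)"
    and "\<lbrakk>J \<in> mwords I l; K \<in> mwords I l\<rbrakk> \<Longrightarrow> wS J K \<in> carrier B"
    and "\<lbrakk>J \<in> mwords I l; K \<in> mwords I l; J' \<in> mwords I l'; K' \<in> mwords I l'\<rbrakk> \<Longrightarrow>
      wS (J @ J') (K @ K') = sgn2 (mdeg d J + mdeg d K) (mdeg d K') \<odot>\<^bsub>B\<^esub> (wS J' K' \<otimes>\<^bsub>B\<^esub> wS J K)"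
    and "\<lbrakk>J \<in> mwords I l; K \<in> mwords I l\<rbrakk> \<Longrightarrow> (\<Oplus>\<^bsub>B\<^esub>M\<in>mwords I l. wS J M \<otimes>\<^bsub>B\<^esub> wB M K) = of_bool (J = K) \<odot>\<^bsub>B\<^esub> \<one>\<^bsub>B\<^esub>"
    and "\<lbrakk>J \<in> mwords I l; K \<in> mwords I l\<rbrakk> \<Longrightarrow> (\<Oplus>\<^bsub>B\<^esub>M\<in>mwords I l. wB J M \<otimes>\<^bsub>B\<^esub> wS M K) = of_bool (J = K) \<odot>\<^bsub>B\<^esub> \<one>\<^bsub>B\<^esub>"
    and "wS [] [] = \<one>\<^bsub>B\<^esub>"
proof -
  interpret B: matalg B I d wB by (rule B_matalg)
  note p = tS_homog tS_left tS_right
  show "\<lbrakk>J \<in> mwords I l; K \<in> mwords I l\<rbrakk> \<Longrightarrow> wS J K \<in> homog B (mdeg d J + mdeg d K)"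
    unfolding wS_def by (rule B.anti_ext_homog[OF p])
  show "\<lbrakk>J \<in> mwords I l; K \<in> mwords I l\<rbrakk> \<Longrightarrow> wS J K \<in> carrier B"
    unfolding wS_def by (rule B.anti_ext_closed[OF p])
  show "\<lbrakk>J \<in> mwords I l; K \<in> mwords I l; J' \<in> mwords I l'; K' \<in> mwords I l'\<rbrakk> \<Longrightarrow>
      wS (J @ J') (K @ K') = sgn2 (mdeg d J + mdeg d K) (mdeg d K') \<odot>\<^bsub>B\<^esub> (wS J' K' \<otimes>\<^bsub>B\<^esub> wS J K)"
    unfolding wS_def by (rule B.anti_ext_mult[OF p])
  show "\<lbrakk>J \<in> mwords I l; K \<in> mwords I l\<rbrakk> \<Longrightarrow> (\<Oplus>\<^bsub>B\<^esub>M\<in>mwords I l. wS J M \<otimes>\<^bsub>B\<^esub> wB M K) = of_bool (J = K) \<odot>\<^bsub>B\<^esub> \<one>\<^bsub>B\<^esub>"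
    unfolding wS_def by (rule B.anti_ext_left[OF p])
  show "\<lbrakk>J \<in> mwords I l; K \<in> mwords I l\<rbrakk> \<Longrightarrow> (\<Oplus>\<^bsub>B\<^esub>M\<in>mwords I l. wB J M \<otimes>\<^bsub>B\<^esub> wS M K) = of_bool (J = K) \<odot>\<^bsub>B\<^esub> \<one>\<^bsub>B\<^esub>"
    unfolding wS_def by (rule B.anti_ext_right[OF p])
  show "wS [] [] = \<one>\<^bsub>B\<^esub>" by (simp add: wS_def)
qed

lemma inverse_mats:
  shows "wS \<in> superalgebra.mats B (mwords I l)" "wB \<in> superalgebra.mats B (mwords I l)"
    "superalgebra.meq (mwords I l) (superalgebra.mmul B (mwords I l) wS wB) (superalgebra.scal B (\<lambda>i j. of_bool (i = j)))"
    "superalgebra.meq (mwords I l) (superalgebra.mmul B (mwords I l) wB wS) (superalgebra.scal B (\<lambda>i j. of_bool (i = j)))"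
proof -
  interpret B: matalg B I d wB by (rule B_matalg)
  show "wS \<in> B.mats (mwords I l)" "wB \<in> B.mats (mwords I l)"
    using wS_props(2) B.w_closed by (auto simp: B.mats_def)
  show "B.meq (mwords I l) (B.mmul (mwords I l) wS wB) (B.scal (\<lambda>i j. of_bool (i = j)))"
    "B.meq (mwords I l) (B.mmul (mwords I l) wB wS) (B.scal (\<lambda>i j. of_bool (i = j)))"
    using wS_props(4,5) by (simp_all add: B.meq_def B.mmul_def B.scal_def)
qed

lemma wS_intertwines: "kspace.intertwines B (mwords I 2) Rhat wS"
proof -
  interpret B: matalg B I d wB by (rule B_matalg)
  show ?thesis
    unfolding B.intertwines_meq[OF inverse_mats(1)]
    by (rule B.inverse_intertwines[OF B.finite_mw inverse_mats])
      (use B_intertwines B.intertwines_meq[OF inverse_mats(2)] in blast)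
qed

text \<open>\<open>f V = (f W) V = f (W V) = f\<close> for the inverse V of W.\<close>

lemma wS_f: assumes K: "K \<in> mwords I 2"
  shows "(\<Oplus>\<^bsub>B\<^esub>J\<in>mwords I 2. fmat J \<odot>\<^bsub>B\<^esub> wS J K) = fmat K \<odot>\<^bsub>B\<^esub> \<one>\<^bsub>B\<^esub>"
proof -
  interpret B: matalg B I d wB by (rule B_matalg)
  let ?S = "mwords I 2"
  note fin = B.finite_mw[of 2]
  have vc: "wS J K \<in> carrier B" if "J \<in> ?S" for J using wS_props(2)[OF that K] .
  have wc: "wB M J \<in> carrier B" if "M \<in> ?S" "J \<in> ?S" for M J using B.w_closed[OF that] .
  have "(\<Oplus>\<^bsub>B\<^esub>J\<in>?S. fmat J \<odot>\<^bsub>B\<^esub> wS J K) = (\<Oplus>\<^bsub>B\<^esub>J\<in>?S. \<Oplus>\<^bsub>B\<^esub>M\<in>?S. fmat M \<odot>\<^bsub>B\<^esub> (wB M J \<otimes>\<^bsub>B\<^esub> wS J K))"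
  proof (rule B.finsum_cong'[OF refl])
    show "(\<lambda>J. \<Oplus>\<^bsub>B\<^esub>M\<in>?S. fmat M \<odot>\<^bsub>B\<^esub> (wB M J \<otimes>\<^bsub>B\<^esub> wS J K)) \<in> ?S \<rightarrow> carrier B"
      using vc wc by (intro funcsetI B.finsum_closed) auto
    fix J assume J: "J \<in> ?S"
    have "fmat J \<odot>\<^bsub>B\<^esub> wS J K = (fmat J \<odot>\<^bsub>B\<^esub> \<one>\<^bsub>B\<^esub>) \<otimes>\<^bsub>B\<^esub> wS J K"
      using vc[OF J] by (simp add: B.smult_left)
    also have "\<dots> = (\<Oplus>\<^bsub>B\<^esub>M\<in>?S. fmat M \<odot>\<^bsub>B\<^esub> wB M J) \<otimes>\<^bsub>B\<^esub> wS J K" unfolding B_f(1)[OF J] ..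
    also have "\<dots> = (\<Oplus>\<^bsub>B\<^esub>M\<in>?S. fmat M \<odot>\<^bsub>B\<^esub> (wB M J \<otimes>\<^bsub>B\<^esub> wS J K))"
      by (rule klin_lincomb[OF B.kspace_axioms B.kspace_axioms B.klin_mult_left[OF vc[OF J]] fin wc[OF _ J]])
    finally show "fmat J \<odot>\<^bsub>B\<^esub> wS J K = (\<Oplus>\<^bsub>B\<^esub>M\<in>?S. fmat M \<odot>\<^bsub>B\<^esub> (wB M J \<otimes>\<^bsub>B\<^esub> wS J K))" .
  qed
  also have "\<dots> = (\<Oplus>\<^bsub>B\<^esub>M\<in>?S. \<Oplus>\<^bsub>B\<^esub>J\<in>?S. fmat M \<odot>\<^bsub>B\<^esub> (wB M J \<otimes>\<^bsub>B\<^esub> wS J K))"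
    by (rule B.finsum_swap[OF fin fin]) (use vc wc in auto)
  also have "\<dots> = (\<Oplus>\<^bsub>B\<^esub>M\<in>?S. fmat M \<odot>\<^bsub>B\<^esub> (of_bool (M = K) \<odot>\<^bsub>B\<^esub> \<one>\<^bsub>B\<^esub>))"
  proof (rule B.finsum_cong'[OF refl])
    fix M assume M: "M \<in> ?S"
    show "(\<Oplus>\<^bsub>B\<^esub>J\<in>?S. fmat M \<odot>\<^bsub>B\<^esub> (wB M J \<otimes>\<^bsub>B\<^esub> wS J K)) = fmat M \<odot>\<^bsub>B\<^esub> (of_bool (M = K) \<odot>\<^bsub>B\<^esub> \<one>\<^bsub>B\<^esub>)"
      unfolding wS_props(5)[OF M K, symmetric]
      by (rule B.smult_finsum[OF fin, symmetric]) (use vc wc[OF M] in auto)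
  qed auto
  also have "\<dots> = fmat K \<odot>\<^bsub>B\<^esub> \<one>\<^bsub>B\<^esub>"
    by (subst B.finsum_delta[of _ K]) (use K fin in auto)
  finally show ?thesis .
qed

text \<open>The antihomomorphism takes its values in the final quotient from the start, because
  \<open>tS\<close> is shown to invert the generating matrix after Q has become 1. It descends
  twice: through the relations by \<open>wS_intertwines\<close>, and through \<open>Q - 1\<close> by
  \<open>wS_f\<close>.\<close>

lemma antipode_exists:
  obtains S where "S \<in> superalg_antihom B B" "\<And>J K l. J \<in> mwords I l \<Longrightarrow> K \<in> mwords I l \<Longrightarrow> S (wB J K) = wS J K"
proof -
  interpret F: matalg F I d "wfree d" by (rule F_matalg)
  interpret A: matalg A I d wA by (rule A_matalg)
  interpret B: matalg B I d wB by (rule B_matalg)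
  interpret Q: graded_quot A JQ by (rule A_graded_quot)
  note anti = matalg_antihom[OF _ B.superalgebra_axioms _ _ wS_props(1,3,6)]
  obtain S1 where S1: "S1 \<in> klin A B" "\<And>J K l. J \<in> mwords I l \<Longrightarrow> K \<in> mwords I l \<Longrightarrow> S1 (wA J K) = wS J K"
  proof (rule A_extend[OF B.kspace_axioms, of wS])
    show "wS J K \<in> carrier B" if "J \<in> mwords I l" "K \<in> mwords I l" for J K l using wS_props(2)[OF that] .
    fix f x assume f: "f \<in> klin F B" and fw: "\<And>J K l. J \<in> mwords I l \<Longrightarrow> K \<in> mwords I l \<Longrightarrow> f (wfree d J K) = wS J K"
      and x: "x \<in> rtti"
    have "B.intertwines (mwords I 2) Rhat (\<lambda>J K. f (wfree d J K))"
      by (subst B.intertwines_cong[OF fw wS_props(2)]) (assumption | rule wS_intertwines)+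
    note kill = rels_killed[OF B.kspace_axioms f this]
    have "f \<in> superalg_antihom F B" by (rule anti[OF F_matalg f fw])
    then show "f x = \<zero>\<^bsub>B\<^esub>"
      by (rule F.genideal_antikernel[OF B.superalgebra_axioms _ _ _ x[unfolded rtt_ideal_def]])
        (use rels_homog F.homog_carrier kill in blast)+
  qed blast
  have S1a: "S1 \<in> superalg_antihom A B" by (rule anti[OF A_matalg S1])
  have kill: "S1 s = \<zero>\<^bsub>B\<^esub>" if "s \<in> {QA \<ominus>\<^bsub>A\<^esub> \<one>\<^bsub>A\<^esub>}" for s
    by (rule QA_image[OF B.kspace_axioms S1 _ _ _ that]) (use wS_f[OF k0_pair] wS_props(2)[OF _ k0_pair] wS_props(6) in auto)
  have zero: "S1 x = \<zero>\<^bsub>B\<^esub>" if "x \<in> JQ" for x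
    by (rule A.genideal_antikernel[OF B.superalgebra_axioms S1a QA_minus_one(2) kill that[unfolded JQ_eq]])
  let ?S = "\<lambda>U. THE z. \<forall>x\<in>U. z = S1 x"
  have S: "?S \<in> klin B B" by (rule Q.the_coset_klin[OF B.kspace_axioms S1(1) zero])
  have Sw: "?S (wB J K) = wS J K" if "J \<in> mwords I l" "K \<in> mwords I l" for J K l
  proof -
    have "?S (wB J K) = S1 (wA J K)"
      unfolding wB_def by (rule Q.the_coset[OF B.kspace_axioms S1(1) zero A.w_closed[OF that]])
    then show ?thesis using S1(2)[OF that] by simp
  qed
  show thesis by (rule that[OF anti[OF B_matalg S Sw] Sw])
qed

section \<open>The Hopf superalgebra \<open>SPO\<^sub>q(2n|2m)\<close>\<close>

abbreviation "SPOq \<equiv> SPO n m q k0"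
abbreviation "\<Delta>B \<equiv> (\<lambda>U. THE z. \<forall>x \<in> U. z = tensor_map B B (\<lambda>y. JQ +>\<^bsub>A\<^esub> y) (\<lambda>y. JQ +>\<^bsub>A\<^esub> y) (AR_comult n m q x))"
abbreviation "\<epsilon>B \<equiv> (\<lambda>U. THE c. \<forall>x \<in> U. c = AR_counit n m q x)"

lemma SPO_eq: "SPOq = superalg.extend B (bisuperalg.fields \<Delta>B \<epsilon>B)"
proof -
  have "comult (AR n m q) = AR_comult n m q" "counit (AR n m q) = AR_counit n m q"
    by (simp_all add: AR_def superalg.extend_def bisuperalg.fields_def)
  moreover have "quot_superalg (AR n m q) JQ = B" "a_r_coset (AR n m q) = a_r_coset A" by (simp_all add: AR_def)
  ultimately show ?thesis by (simp add: SPO_def quot_bisuperalg_def)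
qed

lemma SPO_comult: "comult SPOq = \<Delta>B" "counit SPOq = \<epsilon>B"
  unfolding SPO_eq by (simp_all add: superalg.extend_def bisuperalg.fields_def)

text \<open>The composite of the comultiplication of \<open>A(R)\<close> with the projection of the
  tensor square again has the form \<open>comat\<close>. It is therefore a homomorphism, and only
  the single generator of the ideal has to be sent to zero.\<close>

lemma \<Delta>B:
  shows "\<Delta>B \<in> klin B (tensor B B)"
    and "\<And>J K l. J \<in> mwords I l \<Longrightarrow> K \<in> mwords I l \<Longrightarrow> \<Delta>B (wB J K) = comat B I wB J K"
proof -
  interpret A: matalg A I d wA by (rule A_matalg)
  interpret B: matalg B I d wB by (rule B_matalg)
  interpret Q: graded_quot A JQ by (rule A_graded_quot)
  interpret AA: ktensor A A by (intro ktensor.intro A.kspace_axioms)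
  interpret T: graded_tensor B B by (intro graded_tensor.intro B.superalgebra_axioms)
  interpret T': kspace "tensor B B" by (rule T.tensor_kspace)
  let ?g = "\<lambda>x. tensor_map B B (\<lambda>y. JQ +>\<^bsub>A\<^esub> y) (\<lambda>y. JQ +>\<^bsub>A\<^esub> y) (AR_comult n m q x)"
  note tm = tensor_map_props[OF AA.ktensor_axioms T.ktensor_axioms Q.coset_klin Q.coset_klin]
  have g: "?g \<in> klin A (tensor B B)" by (rule klin_comp[OF AR_comult(1) tm(1)])
  have gw: "?g (wA J K) = comat B I wB J K" if JK: "J \<in> mwords I l" "K \<in> mwords I l" for J K l
  proof -
    have l: "length J = l" using JK by (simp add: mwords_def)
    have "?g (wA J K) = (\<Oplus>\<^bsub>tensor B B\<^esub>M\<in>mwords I l. tensor_map B B (\<lambda>y. JQ +>\<^bsub>A\<^esub> y) (\<lambda>y. JQ +>\<^bsub>A\<^esub> y) (pure_tensor A A (wA J M) (wA M K)))"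
      by (rule A.klin_comat[OF AR_comult T.tensor_kspace tm(1) JK])
    also have "\<dots> = comat B I wB J K"
      unfolding comat_def l
    proof (rule T'.finsum_cong'[OF refl])
      show "(\<lambda>M. pure_tensor B B (wB J M) (wB M K)) \<in> mwords I l \<rightarrow> carrier (tensor B B)"
        using B.w_pure_closed[OF JK] by auto
      show "tensor_map B B (\<lambda>y. JQ +>\<^bsub>A\<^esub> y) (\<lambda>y. JQ +>\<^bsub>A\<^esub> y) (pure_tensor A A (wA J M) (wA M K)) = pure_tensor B B (wB J M) (wB M K)"
        if "M \<in> mwords I l" for M
        unfolding wB_def by (rule tm(2)[OF A.w_closed[OF JK(1) that] A.w_closed[OF that JK(2)]])
    qed
    finally show ?thesis .
  qed
  have hom: "?g \<in> superalg_hom A (tensor B B)" by (rule matalg_comult_hom[OF A_matalg B_matalg g gw])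
  have one: "comat B I wB [] [] = pure_tensor B B \<one>\<^bsub>B\<^esub> \<one>\<^bsub>B\<^esub>"
    using B.w_pure_closed[of "[]" 0 "[]" "[]"] by (simp add: comat_def B.w_Nil)
  have kill: "?g s = \<zero>\<^bsub>tensor B B\<^esub>" if "s \<in> {QA \<ominus>\<^bsub>A\<^esub> \<one>\<^bsub>A\<^esub>}" for s
  proof (rule QA_image[OF T.tensor_kspace g gw _ _ _ that])
    show "(\<Oplus>\<^bsub>tensor B B\<^esub>J\<in>mwords I 2. fmat J \<odot>\<^bsub>tensor B B\<^esub> comat B I wB J [k0, - k0]) = fmat [k0, - k0] \<odot>\<^bsub>tensor B B\<^esub> comat B I wB [] []"
      unfolding one by (rule B.invariant_comat[OF B_f(1) k0_pair])
    show "comat B I wB [] [] \<in> carrier (tensor B B)" by (rule B.comat_closed[of _ 0]) auto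
    show "comat B I wB J [k0, - k0] \<in> carrier (tensor B B)" if "J \<in> mwords I 2" for J
      by (rule B.comat_closed[OF that k0_pair])
  qed
  have zero: "?g x = \<zero>\<^bsub>tensor B B\<^esub>" if "x \<in> JQ" for x
    by (rule A.genideal_kernel[OF T.tensor_kalg g superalg_homD(3)[OF hom] QA_minus_one(2) kill that[unfolded JQ_eq]])
  show "\<Delta>B \<in> klin B (tensor B B)" by (rule Q.the_coset_klin[OF T.tensor_kspace g zero])
  show "\<Delta>B (wB J K) = comat B I wB J K" if "J \<in> mwords I l" "K \<in> mwords I l" for J K l
  proof -
    have "\<Delta>B (JQ +>\<^bsub>A\<^esub> wA J K) = ?g (wA J K)"
      by (rule Q.the_coset[OF T.tensor_kspace g zero A.w_closed[OF that]])
    then show ?thesis using gw[OF that] by (simp only: wB_def)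
  qed
qed

lemma \<epsilon>B:
  shows "\<epsilon>B \<in> klin B base_superalg"
    and "\<And>J K l. J \<in> mwords I l \<Longrightarrow> K \<in> mwords I l \<Longrightarrow> \<epsilon>B (wB J K) = of_bool (J = K)"
proof -
  interpret A: matalg A I d wA by (rule A_matalg)
  interpret Q: graded_quot A JQ by (rule A_graded_quot)
  interpret K: kalg "base_superalg :: ('k, 'k) superalg" by (rule base_kalg)
  have hom: "AR_counit n m q \<in> superalg_hom A base_superalg" by (rule matalg_counit_hom[OF A_matalg AR_counit])
  have kill: "AR_counit n m q s = \<zero>\<^bsub>base_superalg\<^esub>" if "s \<in> {QA \<ominus>\<^bsub>A\<^esub> \<one>\<^bsub>A\<^esub>}" for s
  proof (rule QA_image[OF K.kspace_axioms AR_counit _ _ _ that])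
    show "(\<Oplus>\<^bsub>base_superalg\<^esub>J\<in>mwords I 2. fmat J \<odot>\<^bsub>base_superalg\<^esub> of_bool (J = [k0, - k0])) = fmat [k0, - k0] \<odot>\<^bsub>base_superalg\<^esub> of_bool ([] = ([] :: int list))"
      by (subst K.finsum_delta[of _ "[k0, - k0]"]) (use k0_pair A.finite_mw in auto)
  qed auto
  have zero: "AR_counit n m q x = \<zero>\<^bsub>base_superalg\<^esub>" if "x \<in> JQ" for x
    by (rule A.genideal_kernel[OF K.kalg_axioms AR_counit(1) superalg_homD(3)[OF hom] QA_minus_one(2) kill that[unfolded JQ_eq]])
  show "\<epsilon>B \<in> klin B base_superalg" by (rule Q.the_coset_klin[OF K.kspace_axioms AR_counit(1) zero])
  show "\<epsilon>B (wB J K) = of_bool (J = K)" if "J \<in> mwords I l" "K \<in> mwords I l" for J K l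
  proof -
    have "\<epsilon>B (JQ +>\<^bsub>A\<^esub> wA J K) = AR_counit n m q (wA J K)"
      by (rule Q.the_coset[OF K.kspace_axioms AR_counit(1) zero A.w_closed[OF that]])
    then show ?thesis using AR_counit(2)[OF that] by (simp only: wB_def)
  qed
qed

lemma SPO_bi_superalgebra: "bi_superalgebra SPOq"
proof -
  interpret B: matalg B I d wB by (rule B_matalg)
  note D = \<Delta>B and e = \<epsilon>B
  show ?thesis
  proof (intro bi_superalgebra.intro bi_superalgebra_axioms.intro)
    show "superalgebra SPOq" unfolding SPO_eq superalgebra_ext by (rule B.superalgebra_axioms)
    show "comult SPOq \<in> superalg_hom SPOq (tensor SPOq SPOq)"
      unfolding SPO_comult unfolding SPO_eq superalg_hom_ext tensor_ext by (rule matalg_comult_hom[OF B_matalg B_matalg D])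
    show "counit SPOq \<in> superalg_hom SPOq base_superalg"
      unfolding SPO_comult unfolding SPO_eq superalg_hom_ext by (rule matalg_counit_hom[OF B_matalg e])
    fix x assume "x \<in> carrier SPOq"
    then have x: "x \<in> carrier B" unfolding SPO_eq by simp
    show "tensor_assoc SPOq SPOq SPOq (tensor_map (tensor SPOq SPOq) SPOq (comult SPOq) (\<lambda>y. y) (comult SPOq x))
      = tensor_map SPOq (tensor SPOq SPOq) (\<lambda>y. y) (comult SPOq) (comult SPOq x)"
      unfolding SPO_comult unfolding SPO_eq tensor_ext tensor_map_ext tensor_assoc_ext by (rule B.matalg_coassoc[OF D x])
    show "tensor_lift SPOq (\<lambda>c y. c \<odot>\<^bsub>SPOq\<^esub> y) (tensor_map base_superalg SPOq (counit SPOq) (\<lambda>y. y) (comult SPOq x)) = x"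
      unfolding SPO_comult unfolding SPO_eq tensor_map_ext tensor_lift_ext ext_simps
      by (rule B.matalg_counit(1)[OF D e x])
    show "tensor_lift SPOq (\<lambda>y c. c \<odot>\<^bsub>SPOq\<^esub> y) (tensor_map SPOq base_superalg (\<lambda>y. y) (counit SPOq) (comult SPOq x)) = x"
      unfolding SPO_comult unfolding SPO_eq tensor_map_ext tensor_lift_ext ext_simps
      by (rule B.matalg_counit(2)[OF D e x])
  qed
qed

text \<open>All three maps in the antipode axioms are linear, so the axioms may be tested on the
  spanning family, where convolution is matrix multiplication.\<close>

lemma antipode_iff:
  "is_antipode SPOq S \<longleftrightarrow> S \<in> superlinear B B \<and> (\<forall>J K l. J \<in> mwords I l \<longrightarrow> K \<in> mwords I l \<longrightarrow>
    (\<Oplus>\<^bsub>B\<^esub>M\<in>mwords I l. S (wB J M) \<otimes>\<^bsub>B\<^esub> wB M K) = of_bool (J = K) \<odot>\<^bsub>B\<^esub> \<one>\<^bsub>B\<^esub> \<and>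
    (\<Oplus>\<^bsub>B\<^esub>M\<in>mwords I l. wB J M \<otimes>\<^bsub>B\<^esub> S (wB M K)) = of_bool (J = K) \<odot>\<^bsub>B\<^esub> \<one>\<^bsub>B\<^esub>)" (is "_ \<longleftrightarrow> _ \<and> ?R")
proof -
  interpret B: matalg B I d wB by (rule B_matalg)
  note D = \<Delta>B and e = \<epsilon>B
  let ?l = "\<lambda>x. tensor_lift B (monoid.mult B) (tensor_map B B S (\<lambda>y. y) (\<Delta>B x))"
  let ?r = "\<lambda>x. tensor_lift B (monoid.mult B) (tensor_map B B (\<lambda>y. y) S (\<Delta>B x))"
  let ?c = "\<lambda>x. \<epsilon>B x \<odot>\<^bsub>B\<^esub> \<one>\<^bsub>B\<^esub>"
  have 1: "is_antipode SPOq S \<longleftrightarrow> S \<in> superlinear B B \<and> (\<forall>x\<in>carrier B. ?l x = ?c x \<and> ?r x = ?c x)"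
    unfolding is_antipode_def SPO_comult unfolding SPO_eq by simp
  have "(\<forall>x\<in>carrier B. ?l x = ?c x \<and> ?r x = ?c x) \<longleftrightarrow> ?R" if S: "S \<in> superlinear B B"
  proof -
    have Sk: "S \<in> klin B B" using S by (simp add: superlinear_iff)
    have l1: "?l \<in> klin B B" by (rule B.convolution_klin(1)[OF D Sk klin_id])
    have r1: "?r \<in> klin B B" by (rule B.convolution_klin(1)[OF D klin_id Sk])
    have l2: "?l (wB J K) = (\<Oplus>\<^bsub>B\<^esub>M\<in>mwords I l. S (wB J M) \<otimes>\<^bsub>B\<^esub> wB M K)"
      if "J \<in> mwords I l" "K \<in> mwords I l" for J K l
      using D Sk klin_id that by (rule B.convolution_klin(2))
    have r2: "?r (wB J K) = (\<Oplus>\<^bsub>B\<^esub>M\<in>mwords I l. wB J M \<otimes>\<^bsub>B\<^esub> S (wB M K))"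
      if "J \<in> mwords I l" "K \<in> mwords I l" for J K l
      using D klin_id Sk that by (rule B.convolution_klin(2))
    have c: "?c \<in> klin B B"
      by (rule klin_comp[OF e(1)]) (auto intro!: klinI simp: B.smult_add_left)
    have cw: "?c (wB J K) = of_bool (J = K) \<odot>\<^bsub>B\<^esub> \<one>\<^bsub>B\<^esub>" if "J \<in> mwords I l" "K \<in> mwords I l" for J K l
      unfolding e(2)[OF that] ..
    show ?thesis
    proof
      assume h: "\<forall>x\<in>carrier B. ?l x = ?c x \<and> ?r x = ?c x"
      show ?R
      proof (intro allI impI)
        fix J K l assume JK: "J \<in> mwords I l" "K \<in> mwords I l"
        show "(\<Oplus>\<^bsub>B\<^esub>M\<in>mwords I l. S (wB J M) \<otimes>\<^bsub>B\<^esub> wB M K) = of_bool (J = K) \<odot>\<^bsub>B\<^esub> \<one>\<^bsub>B\<^esub> \<and>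
          (\<Oplus>\<^bsub>B\<^esub>M\<in>mwords I l. wB J M \<otimes>\<^bsub>B\<^esub> S (wB M K)) = of_bool (J = K) \<odot>\<^bsub>B\<^esub> \<one>\<^bsub>B\<^esub>"
          using bspec[OF h B.w_closed[OF JK]] unfolding l2[OF JK] r2[OF JK] cw[OF JK] .
      qed
    next
      assume R: ?R
      show "\<forall>x\<in>carrier B. ?l x = ?c x \<and> ?r x = ?c x"
      proof (intro ballI conjI)
        fix x assume x: "x \<in> carrier B"
        show "?l x = ?c x"
        proof (rule B.klin_eq_w[OF B.kspace_axioms l1 c _ x])
          fix J K l assume JK: "J \<in> mwords I l" "K \<in> mwords I l"
          show "?l (wB J K) = ?c (wB J K)" unfolding l2[OF JK] cw[OF JK] using R JK by blast
        qed
        show "?r x = ?c x"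
        proof (rule B.klin_eq_w[OF B.kspace_axioms r1 c _ x])
          fix J K l assume JK: "J \<in> mwords I l" "K \<in> mwords I l"
          show "?r (wB J K) = ?c (wB J K)" unfolding r2[OF JK] cw[OF JK] using R JK by blast
        qed
      qed
    qed
  qed
  then show ?thesis unfolding 1 by blast
qed

text \<open>No multiplicativity of S is available at this point. For each length the values of S
  form a left inverse of \<open>wB\<close>, which agrees with the right inverse \<open>wS\<close>;
  in this way S is known on all monomials and not just on the generators.\<close>

lemma antipode_vv:
  assumes "is_antipode SPOq S"
  shows "S \<in> klin B B" "\<And>J K l. J \<in> mwords I l \<Longrightarrow> K \<in> mwords I l \<Longrightarrow> S (wB J K) = wS J K"
proof -
  interpret B: matalg B I d wB by (rule B_matalg)
  show S: "S \<in> klin B B" using assms unfolding antipode_iff by (simp add: superlinear_iff)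
  fix J K l assume JK: "J \<in> mwords I l" "K \<in> mwords I l"
  have m: "(\<lambda>J K. S (wB J K)) \<in> B.mats (mwords I l)"
    using klinD(1)[OF S B.w_closed] by (auto simp: B.mats_def)
  have "B.meq (mwords I l) (B.mmul (mwords I l) (\<lambda>J K. S (wB J K)) wB) (B.scal (\<lambda>i j. of_bool (i = j)))"
    using assms unfolding antipode_iff by (simp add: B.meq_def B.mmul_def B.scal_def)
  from B.inverse_unique[OF B.finite_mw m inverse_mats(2,1) this inverse_mats(4)]
  show "S (wB J K) = wS J K" using JK by (simp add: B.meq_def)
qed

lemma SPO_t_eq:
  assumes "i \<in> I" "j \<in> I"
  shows "SPO_t n m q k0 i j = usgn i j \<odot>\<^bsub>B\<^esub> wB [i] [j]" "wB [i] [j] = usgn i j \<odot>\<^bsub>B\<^esub> SPO_t n m q k0 i j"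
    "SPO_t n m q k0 i j \<in> carrier B"
proof -
  interpret A: matalg A I d wA by (rule A_matalg)
  interpret Q: graded_quot A JQ by (rule A_graded_quot)
  interpret B: matalg B I d wB by (rule B_matalg)
  have w: "wA [i] [j] \<in> carrier A" by (rule A.w_closed[OF singleton_mwords singleton_mwords]) (use assms in auto)
  show 1: "SPO_t n m q k0 i j = usgn i j \<odot>\<^bsub>B\<^esub> wB [i] [j]"
    using Q.quot_smult[OF w] AR_t_eq(1)[OF assms] by (simp add: SPO_t_def AR_def wB_def)
  show "wB [i] [j] = usgn i j \<odot>\<^bsub>B\<^esub> SPO_t n m q k0 i j" "SPO_t n m q k0 i j \<in> carrier B"
    unfolding 1 using wB1_closed[OF assms] by simp_all
qed

lemma wS_single: "i \<in> I \<Longrightarrow> j \<in> I \<Longrightarrow> wS [i] [j] = tS i j"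
proof -
  interpret B: matalg B I d wB by (rule B_matalg)
  assume "i \<in> I" "j \<in> I"
  then have "tS i j \<in> carrier B" using tS_homog B.homog_carrier by blast
  then show ?thesis by (simp add: wS_def sgn2_def)
qed

text \<open>Both sides carry the sign \<open>usgn i j\<close> when rewritten in the normalised
  generators, and this sign is its own inverse.\<close>

lemma formula_iff:
  assumes S: "S \<in> klin B B" and ij: "i \<in> I" "j \<in> I"
  shows "S (SPO_t n m q k0 i j) = (sg n i * sg2 n i j * Cq_inv n m q i (- i) * Cq n q (- j) j) \<odot>\<^bsub>B\<^esub> SPO_t n m q k0 (- j) (- i)
    \<longleftrightarrow> S (wB [i] [j]) = wS [i] [j]"
proof -
  interpret B: matalg B I d wB by (rule B_matalg)
  have mm: "- i \<in> I" "- j \<in> I" using ij by auto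
  note wc = wB1_closed[OF ij] wB1_closed[OF mm(2,1)]
  have ci: "Cq_inv n m q i (- i) = inverse (cq (- i))"
    using Cq_inv_eq[OF q_nz, of i n m "- i"] ij by (simp add: cq_def)
  have cj: "Cq n q (- j) j = cq (- j)" by (simp add: cq_def)
  have s: "sg n i * sg2 n i j * inverse (cq (- i)) * cq (- j) * usgn (- j) (- i)
      = usgn i j * (sg n j * sg2 n i j * (cq (- j) / cq (- i)))"
    by (cases "d i"; cases "d j") (simp_all add: usgn_def sg2_def sgn2_def divide_inverse)
  have "(sg n i * sg2 n i j * Cq_inv n m q i (- i) * Cq n q (- j) j) \<odot>\<^bsub>B\<^esub> SPO_t n m q k0 (- j) (- i)
      = usgn i j \<odot>\<^bsub>B\<^esub> wS [i] [j]"
    unfolding wS_single[OF ij] tS_def SPO_t_eq(1)[OF mm(2,1)] ci cj B.smult_smult[OF wc(2)] s ..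
  moreover have "S (SPO_t n m q k0 i j) = usgn i j \<odot>\<^bsub>B\<^esub> S (wB [i] [j])"
    unfolding SPO_t_eq(1)[OF ij] by (rule klinD(3)[OF S wc(1)])
  moreover have "usgn i j \<odot>\<^bsub>B\<^esub> x = usgn i j \<odot>\<^bsub>B\<^esub> y \<longleftrightarrow> x = y" if "x \<in> carrier B" "y \<in> carrier B" for x y
  proof
    assume "usgn i j \<odot>\<^bsub>B\<^esub> x = usgn i j \<odot>\<^bsub>B\<^esub> y"
    then have "usgn i j \<odot>\<^bsub>B\<^esub> (usgn i j \<odot>\<^bsub>B\<^esub> x) = usgn i j \<odot>\<^bsub>B\<^esub> (usgn i j \<odot>\<^bsub>B\<^esub> y)" by simp
    then show "x = y" using that by simp
  qed simp
  ultimately show ?thesis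
    using klinD(1)[OF S wc(1)] wS_props(2)[OF singleton_mwords[OF ij(1)] singleton_mwords[OF ij(2)]] by simp
qed

text \<open>The generators and the shorter monomials are homogeneous, so the value of an
  antihomomorphism on their product is determined by its values on the factors.\<close>

lemma antihom_unique:
  assumes T: "T \<in> superalg_antihom B B" "\<And>i j. i \<in> I \<Longrightarrow> j \<in> I \<Longrightarrow> T (wB [i] [j]) = wS [i] [j]"
    and S: "S \<in> superalg_antihom B B" "\<And>i j. i \<in> I \<Longrightarrow> j \<in> I \<Longrightarrow> S (wB [i] [j]) = wS [i] [j]"
    and x: "x \<in> carrier B"
  shows "T x = S x"
proof -
  interpret B: matalg B I d wB by (rule B_matalg)
  note t = superalg_antihomD[OF T(1)] and s = superalg_antihomD[OF S(1)]
  show ?thesis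
  proof (rule B.mult_maps_eq[OF B.kspace_axioms t(1) s(1) _ _ _ x])
    fix i k J K l assume *: "i \<in> I" "k \<in> I" "J \<in> mwords I l" "K \<in> mwords I l" "T (wB J K) = S (wB J K)"
    note h = B.w_homog[OF singleton_mwords[OF *(1)] singleton_mwords[OF *(2)]] B.w_homog[OF *(3,4)]
    show "T (wB [i] [k] \<otimes>\<^bsub>B\<^esub> wB J K) = S (wB [i] [k] \<otimes>\<^bsub>B\<^esub> wB J K)"
      unfolding t(3)[OF h] s(3)[OF h] using *(5) T(2)[OF *(1,2)] S(2)[OF *(1,2)] by simp
  qed (use t(2) s(2) T(2) S(2) in simp_all)
qed

lemma SPO_hopf: "hopf_superalgebra SPOq"
proof -
  obtain S where S: "S \<in> superalg_antihom B B" "\<And>J K l. J \<in> mwords I l \<Longrightarrow> K \<in> mwords I l \<Longrightarrow> S (wB J K) = wS J K"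
    using antipode_exists by metis
  interpret B: matalg B I d wB by (rule B_matalg)
  have "is_antipode SPOq S"
    unfolding antipode_iff
  proof (intro conjI allI impI)
    show "S \<in> superlinear B B" using S(1) by (simp add: superalg_antihom_def)
    fix J K l assume JK: "J \<in> mwords I l" "K \<in> mwords I l"
    have 1: "(\<Oplus>\<^bsub>B\<^esub>M\<in>mwords I l. S (wB J M) \<otimes>\<^bsub>B\<^esub> wB M K) = (\<Oplus>\<^bsub>B\<^esub>M\<in>mwords I l. wS J M \<otimes>\<^bsub>B\<^esub> wB M K)"
      by (rule B.finsum_cong'[OF refl]) (use S(2)[OF JK(1)] wS_props(2)[OF JK(1)] B.w_closed[OF _ JK(2)] in auto)
    show "(\<Oplus>\<^bsub>B\<^esub>M\<in>mwords I l. S (wB J M) \<otimes>\<^bsub>B\<^esub> wB M K) = of_bool (J = K) \<odot>\<^bsub>B\<^esub> \<one>\<^bsub>B\<^esub>"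
      unfolding 1 by (rule wS_props(4)[OF JK])
    have 2: "(\<Oplus>\<^bsub>B\<^esub>M\<in>mwords I l. wB J M \<otimes>\<^bsub>B\<^esub> S (wB M K)) = (\<Oplus>\<^bsub>B\<^esub>M\<in>mwords I l. wB J M \<otimes>\<^bsub>B\<^esub> wS M K)"
      by (rule B.finsum_cong'[OF refl]) (use S(2)[OF _ JK(2)] wS_props(2)[OF _ JK(2)] B.w_closed[OF JK(1)] in auto)
    show "(\<Oplus>\<^bsub>B\<^esub>M\<in>mwords I l. wB J M \<otimes>\<^bsub>B\<^esub> S (wB M K)) = of_bool (J = K) \<odot>\<^bsub>B\<^esub> \<one>\<^bsub>B\<^esub>"
      unfolding 2 by (rule wS_props(5)[OF JK])
  qed
  then show ?thesis
    by (intro hopf_superalgebra.intro hopf_superalgebra_axioms.intro SPO_bi_superalgebra exI)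
qed

text \<open>The values \<open>wS\<close> of S on the spanning family obey the sign rule of an
  antihomomorphism, since \<open>anti_ext\<close> was built to do so.\<close>

lemma antipode_antihom:
  assumes "is_antipode SPOq S"
  shows "S \<in> superalg_antihom B B"
proof -
  interpret B: matalg B I d wB by (rule B_matalg)
  show ?thesis
    by (rule matalg_antihom[OF B_matalg B.superalgebra_axioms antipode_vv[OF assms] wS_props(1,3,6)])
qed

end

text \<open>Existence of an antipode is contained in \<open>hopf_superalgebra\<close>. An antipode
  is by definition a superlinear map, so the conclusion also records that it is an antihomomorphism:
  for these maps the values on the generators fix everything. Agreement is asserted on the carrier,
  because maps are total functions.\<close>

theorem mainTheorem2:
  fixes q :: "'k::field_char_0" and n m :: nat and k :: int
  assumes "n \<ge> 1" and "m \<ge> 1"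
    and "q \<noteq> 0" and "\<forall>N>0. q ^ N \<noteq> 1"
    and "k \<in> idx n m"
  defines "A \<equiv> SPO n m q k"
    and "t \<equiv> SPO_t n m q k"
  defines "formula \<equiv> \<lambda>S. \<forall>i \<in> idx n m. \<forall>j \<in> idx n m. S (t i j) =
      (sg n i * sg2 n i j * Cq_inv n m q i (- i) * Cq n q (- j) j) \<odot>\<^bsub>A\<^esub> t (- j) (- i)"
  shows "hopf_superalgebra A \<and>
    (\<forall>S. is_antipode A S \<longrightarrow>
      formula S \<and>
      S \<in> superalg_antihom A A \<and>
      (\<forall>T \<in> superalg_antihom A A. formula T \<longrightarrow> (\<forall>x \<in> carrier A. T x = S x)))"
proof -
  \<comment> \<open>The hypothesis on roots of unity at exponent 2: it makes \<open>lam\<close>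
    invertible, as needed to isolate the rank-one matrix.\<close>
  have "q ^ 2 \<noteq> 1" using assms(4) by (metis zero_less_numeral)
  then interpret spo q n m k
    by unfold_locales (use assms(3,5) in \<open>simp_all add: power2_eq_square\<close>)
  have form: "formula S \<longleftrightarrow> (\<forall>i \<in> idx n m. \<forall>j \<in> idx n m. S (wB [i] [j]) = wS [i] [j])"
    if "S \<in> klin B B" for S
    unfolding formula_def t_def A_def SPO_eq using formula_iff[OF that] by simp
  have anti: "superalg_antihom A A = superalg_antihom B B" and car: "carrier A = carrier B"
    unfolding A_def SPO_eq by simp_all
  show ?thesis
  proof (intro conjI allI impI ballI)
    show "hopf_superalgebra A" unfolding A_def by (rule SPO_hopf)
    fix S assume S: "is_antipode A S"
    note S' = S[unfolded A_def]
    have f: "S (wB [i] [j]) = wS [i] [j]" if "i \<in> idx n m" "j \<in> idx n m" for i j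
      using antipode_vv(2)[OF S' singleton_mwords singleton_mwords] that by blast
    show "formula S" using form[OF antipode_vv(1)[OF S']] f by blast
    show Sa: "S \<in> superalg_antihom A A" unfolding anti by (rule antipode_antihom[OF S'])
    fix T x assume T: "T \<in> superalg_antihom A A" "formula T" "x \<in> carrier A"
    note Tk = superalg_antihomD(1)[OF T(1)[unfolded anti]]
    show "T x = S x"
      using antihom_unique[OF T(1)[unfolded anti] _ Sa[unfolded anti] f T(3)[unfolded car]] form[OF Tk] T(2) by blast
  qed
qed

end
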